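(* Let $3\le r\le n$ and $k$ be integers and let $s_{\max}=\lfloor\frac{r-1}{2}\rfloor$. The Fano scheme $\mathbf{F}_k(\mathrm{SD}_n^r)$ is irreducible if and only if $$\max\{\kappa(1),\kappa(s_{\max})\}<k\le\kappa(0)$$ or $$\max\{\kappa(0),\kappa(s_{\max}-1)\}<k\le\kappa(s_{\max}).$$
   Context: $\mathbb{K}$ is an algebraically closed field of characteristic $\ne2$. $\mathcal{S}_n$ is the $\mathbb{K}$-vector space of symmetric $n\times n$ matrices over $\mathbb{K}$. $\mathrm{SD}_n^r\subseteq\mathbb{P}(\mathcal S_n)=\mathbb{P}^{\binom{n+1}{2}-1}$ is the closed subscheme cut out by the $r\times r$ minors of the generic symmetric $n\times n$ matrix. $\mathbf{F}_k(\mathrm{SD}_n^r)\subseteq\mathrm{Gr}(k+1,\mathcal{S}_n)$ is the Fano scheme of $k$-planes contained in $\mathrm{SD}_n^r$; its closed points are the $(k+1)$-dimensional linear subspaces of $\mathcal{S}_n$ all of whose matrices have rank less than $r$. For $0\le s\le\lfloor\frac{r-1}{2}\rfloor$, $\kappa(s)=s(s+1+n-r)+\binom{r-s}{2}-1$.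
   Formalization: Stated for k ≥ 1 only: for k = 0 the claim is false, since F_0(SD_n^r) = SD_n^r is irreducible while both conditions fail because κ(0), κ(1) ≥ 2; k = −1 fails likewise (a single point). *)

theory Defs
  imports
    "HOL-Analysis.Analysis"
    "Jordan_Normal_Form.Determinant"
begin

no_notation Matrix.vec_index (infixl \<open>$\<close> 100)
unbundle no fps_syntax
hide_const (open) Matrix.rows Matrix.row Matrix.col Matrix.vec

definition mscale :: "'a::field \<Rightarrow> 'a^'n^'m \<Rightarrow> 'a^'n^'m" where
  "mscale c A = (\<chi> i j. c * A $ i $ j)"

definition matrix_unit :: "'m \<times> 'n \<Rightarrow> 'a::field^'n^'m" where
  "matrix_unit p = (\<chi> i j. if p = (i, j) then 1 else 0)"

lemma mscale_nth [simp]: "mscale c A $ i $ j = c * A $ i $ j"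
  by (simp add: mscale_def)

lemma matrix_unit_nth [simp]: "matrix_unit p $ i $ j = (if p = (i, j) then 1 else 0)"
  by (simp add: matrix_unit_def)

lemma sum_nth_nth: "(\<Sum>x\<in>X. f x) $ i $ j = (\<Sum>x\<in>X. f x $ i $ j)"
  by (simp add: sum_component)

lemma inj_matrix_unit: "inj (matrix_unit :: 'm \<times> 'n \<Rightarrow> 'a::field^'n^'m)"
proof (rule injI)
  fix p q :: "'m \<times> 'n"
  assume "(matrix_unit p :: 'a^'n^'m) = matrix_unit q"
  then have "(matrix_unit p :: 'a^'n^'m) $ fst p $ snd p = matrix_unit q $ fst p $ snd p"
    by simp
  then show "p = q" by (simp split: if_splits)
qed

interpretation mspace: vector_space "mscale :: 'a::field \<Rightarrow> 'a^'n^'m \<Rightarrow> 'a^'n^'m"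
  by unfold_locales (auto simp: Finite_Cartesian_Product.vec_eq_iff algebra_simps)

lemma sum_matrix_units:
  "(\<Sum>v\<in>range (matrix_unit :: 'm::finite \<times> 'n::finite \<Rightarrow> 'a::field^'n^'m). mscale (u v) v) $ i $ j
     = u (matrix_unit (i, j))"
proof -
  have "(\<Sum>v\<in>range (matrix_unit :: 'm \<times> 'n \<Rightarrow> 'a^'n^'m). mscale (u v) v)
      = (\<Sum>p\<in>UNIV. mscale (u (matrix_unit p)) (matrix_unit p))"
    by (subst sum.reindex) (simp_all add: inj_matrix_unit)
  then show ?thesis by (simp add: sum_nth_nth if_distrib[of "(*) _"] cong: if_cong)
qed

interpretation mspace: finite_dimensional_vector_space
  "mscale :: 'a::field \<Rightarrow> 'a^'n^'m \<Rightarrow> 'a^'n^'m" "range matrix_unit"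
proof
  show fin: "finite (range (matrix_unit :: 'm \<times> 'n \<Rightarrow> 'a^'n^'m))" by simp
  show "mspace.independent (range (matrix_unit :: 'm \<times> 'n \<Rightarrow> 'a^'n^'m))"
    unfolding mspace.independent_explicit_finite_subsets
  proof (intro allI impI ballI)
    fix S :: "('a^'n^'m) set" and u v
    assume S: "S \<subseteq> range matrix_unit" "finite S" "(\<Sum>v\<in>S. mscale (u v) v) = 0" and v: "v \<in> S"
    let ?u = "\<lambda>v. if v \<in> S then u v else 0"
    have "(\<Sum>v\<in>range matrix_unit. mscale (?u v) v) = (\<Sum>v\<in>S. mscale (u v) v)"
      using S(1) fin by (intro sum.mono_neutral_cong_right) auto
    then have z: "(\<Sum>v\<in>range matrix_unit. mscale (?u v) v) = 0" using S by simp
    obtain i j where ij: "v = matrix_unit (i, j)" using v S(1) by auto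
    have "?u (matrix_unit (i, j)) = 0"
      using sum_matrix_units[of ?u i j] unfolding z by simp
    then show "u v = 0" using v ij by simp
  qed
  show "mspace.span (range (matrix_unit :: 'm \<times> 'n \<Rightarrow> 'a^'n^'m)) = UNIV"
  proof -
    have "A \<in> mspace.span (range matrix_unit)" for A :: "'a^'n^'m"
    proof -
      define u where "u v = (case the_inv matrix_unit v of (i, j) \<Rightarrow> A $ i $ j)" for v :: "'a^'n^'m"
      have u: "u (matrix_unit (i, j)) = A $ i $ j" for i j
        by (simp add: u_def the_inv_f_f[OF inj_matrix_unit])
      have "A = (\<Sum>v\<in>range matrix_unit. mscale (u v) v)"
        unfolding Finite_Cartesian_Product.vec_eq_iff sum_matrix_units u by simp
      then show ?thesis
        using mspace.span_finite[OF fin] by auto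
    qed
    then show ?thesis by auto
  qed
qed

definition symmetric_matrices :: "('a::field^'n^'n) set" where
  "symmetric_matrices = {A. transpose A = A}"

text \<open>The affine cone over the determinantal locus: \<open>0\<close> is included, so that a linear subspace
  \<open>L\<close> satisfies \<open>\<P>(L) \<subseteq> SD\<close> iff \<open>L\<close> is contained in this set.\<close>

definition sym_det_cone :: "nat \<Rightarrow> ('a::field^'n^'n) set" where
  "sym_det_cone r = {A \<in> symmetric_matrices. rank A < r}"

definition grassmannian :: "nat \<Rightarrow> ('a::field^'n^'m) set \<Rightarrow> ('a^'n^'m) set set" where
  "grassmannian d V = {L. mspace.subspace L \<and> L \<subseteq> V \<and> mspace.dim L = d}"

definition ordered_basis :: "('a::field^'n^'m) set \<Rightarrow> ('a^'n^'m) list \<Rightarrow> bool" where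
  "ordered_basis L vs \<longleftrightarrow>
     distinct vs \<and> mspace.independent (set vs) \<and> mspace.span (set vs) = L"

text \<open>The coordinate matrix of \<open>vs\<close> has one row per member of \<open>vs\<close> and one column per matrix
  position. Its maximal minors, indexed by lists of positions, are the Pluecker coordinates of the
  span of \<open>vs\<close>. Repeated positions, and the positions \<open>(i, j)\<close> and \<open>(j, i)\<close> when all members of
  \<open>vs\<close> are symmetric, only contribute coordinates that are zero or equal to others up to sign, so
  the topology below is not affected by this redundancy.\<close>

definition pluecker :: "('a::field^'n^'m) list \<Rightarrow> ('m \<times> 'n) list \<Rightarrow> 'a" where
  "pluecker vs I =
     (if length I = length vs
      then Determinant.det (Matrix.mat (length vs) (length vs)
             (\<lambda>(a, b). (vs ! a) $ fst (I ! b) $ snd (I ! b)))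
      else 0)"

text \<open>Functions of a coordinate family \<open>x\<close> that are given by a homogeneous polynomial of
  degree \<open>e\<close> in finitely many of the coordinates.\<close>

inductive homogeneous_poly :: "nat \<Rightarrow> (('i \<Rightarrow> 'a::comm_ring_1) \<Rightarrow> 'a) \<Rightarrow> bool" where
  const: "homogeneous_poly 0 (\<lambda>x. c)"
| coord: "homogeneous_poly 1 (\<lambda>x. x i)"
| add: "homogeneous_poly e p \<Longrightarrow> homogeneous_poly e q \<Longrightarrow> homogeneous_poly e (\<lambda>x. p x + q x)"
| mult: "homogeneous_poly e p \<Longrightarrow> homogeneous_poly e' q \<Longrightarrow>
    homogeneous_poly (e + e') (\<lambda>x. p x * q x)"

definition vanishes_at ::
    "((('m \<times> 'n) list \<Rightarrow> 'a::field) \<Rightarrow> 'a) \<Rightarrow> ('a^'n^'m) set \<Rightarrow> bool" where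
  "vanishes_at p L \<longleftrightarrow> (\<forall>vs. ordered_basis L vs \<longrightarrow> p (pluecker vs) = 0)"

text \<open>The Zariski closed subsets for the Pluecker embedding of the Grassmannian.\<close>

definition zariski_closed :: "nat \<Rightarrow> ('a::field^'n^'m) set \<Rightarrow> ('a^'n^'m) set set \<Rightarrow> bool" where
  "zariski_closed d V Z \<longleftrightarrow>
     (\<exists>P. (\<forall>p\<in>P. \<exists>e. homogeneous_poly e p) \<and>
          Z = {L \<in> grassmannian d V. \<forall>p\<in>P. vanishes_at p L})"

definition zariski_grassmannian ::
    "nat \<Rightarrow> ('a::field^'n^'m) set \<Rightarrow> ('a^'n^'m) set topology" where
  "zariski_grassmannian d V =
     topology (\<lambda>U. U \<subseteq> grassmannian d V \<and> zariski_closed d V (grassmannian d V - U))"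

text \<open>The argument of \<^const>\<open>topology\<close> really is a topology, see
  \<open>closedin_zariski_grassmannian\<close> below for the resulting closed sets.\<close>

lemma homogeneous_poly_scale:
  assumes "homogeneous_poly e p"
  shows "p (\<lambda>i. c * x i) = c ^ e * p x"
  using assms by induction (auto simp: algebra_simps power_add)

lemma pluecker_change_basis:
  fixes vs ws :: "('a::field^'n^'m) list"
  assumes vs: "ordered_basis L vs" and ws: "ordered_basis L ws"
  shows "\<exists>c. pluecker vs = (\<lambda>I. c * pluecker ws I)"
proof -
  define d where "d = length ws"
  have "length us = mspace.dim L" if "ordered_basis L us" for us
    using that distinct_card[of us] mspace.dim_span_eq_card_independent[of "set us"]
    unfolding ordered_basis_def by simp
  with vs ws have len: "length vs = d" "length ws = d" by (auto simp: d_def)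
  have "\<exists>u. vs ! a = (\<Sum>b<d. mscale (u b) (ws ! b))" if "a < d" for a
  proof -
    have "vs ! a \<in> mspace.span (set ws)"
      using that vs ws len unfolding ordered_basis_def
      by (metis mspace.span_base nth_mem)
    then obtain u where u: "vs ! a = (\<Sum>v\<in>set ws. mscale (u v) v)"
      using mspace.span_finite[of "set ws"] by auto
    have "bij_betw ((!) ws) {..<d} (set ws)"
      using ws len by (intro bij_betw_nth) (auto simp: ordered_basis_def)
    from sum.reindex_bij_betw[OF this, of "\<lambda>v. mscale (u v) v"] u
    have "vs ! a = (\<Sum>b<d. mscale (u (ws ! b)) (ws ! b))" by simp
    then show ?thesis by (rule exI[where x = "\<lambda>b. u (ws ! b)"])
  qed
  then have "\<forall>a\<in>{..<d}. \<exists>u. vs ! a = (\<Sum>b<d. mscale (u b) (ws ! b))" by simp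
  from bchoice[OF this]
  obtain M where M: "\<And>a. a < d \<Longrightarrow> vs ! a = (\<Sum>b<d. mscale (M a b) (ws ! b))"
    by auto
  let ?M = "Matrix.mat d d (\<lambda>(a, b). M a b)"
  have "pluecker vs I = Determinant.det ?M * pluecker ws I" for I
  proof (cases "length I = d")
    case True
    let ?W = "Matrix.mat d d (\<lambda>(a, b). (ws ! a) $ fst (I ! b) $ snd (I ! b))"
    have "Matrix.mat d d (\<lambda>(a, b). (vs ! a) $ fst (I ! b) $ snd (I ! b)) = ?M * ?W"
      by (rule eq_matI)
        (auto simp: M sum_nth_nth scalar_prod_def lessThan_atLeast0 intro!: sum.cong)
    then show ?thesis
      using True len by (simp add: pluecker_def det_mult[of _ d])
  next
    case False
    then show ?thesis using len by (simp add: pluecker_def)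
  qed
  then show ?thesis by blast
qed

lemma vanishes_at_iff:
  assumes "homogeneous_poly e p" "ordered_basis L vs"
  shows "vanishes_at p L \<longleftrightarrow> p (pluecker vs) = 0"
proof
  assume z: "p (pluecker vs) = 0"
  show "vanishes_at p L"
    unfolding vanishes_at_def
  proof (intro allI impI)
    fix ws assume "ordered_basis L ws"
    then obtain c where "pluecker ws = (\<lambda>I. c * pluecker vs I)"
      using pluecker_change_basis assms(2) by blast
    then show "p (pluecker ws) = 0"
      using homogeneous_poly_scale[OF assms(1)] z by simp
  qed
qed (use assms in \<open>auto simp: vanishes_at_def\<close>)

lemma ordered_basis_exists:
  assumes "mspace.subspace L"
  shows "\<exists>vs. ordered_basis L vs"
proof -
  obtain B where B: "B \<subseteq> L" "mspace.independent B" "L \<subseteq> mspace.span B"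
    using mspace.basis_exists by metis
  have "finite B" using B(2) by (rule mspace.finiteI_independent)
  then obtain vs where "set vs = B" "distinct vs" using finite_distinct_list by metis
  moreover have "mspace.span B = L"
    using B assms by (metis mspace.span_eq_iff mspace.span_mono subset_antisym)
  ultimately show ?thesis using B unfolding ordered_basis_def by metis
qed

lemma zariski_closed_Un:
  assumes "zariski_closed d V Y" "zariski_closed d V Z"
  shows "zariski_closed d V (Y \<union> Z)"
proof -
  obtain P where P: "\<And>p. p \<in> P \<Longrightarrow> \<exists>e. homogeneous_poly e p"
    and Y: "Y = {L \<in> grassmannian d V. \<forall>p\<in>P. vanishes_at p L}"
    using assms(1) unfolding zariski_closed_def by auto
  obtain Q where Q: "\<And>p. p \<in> Q \<Longrightarrow> \<exists>e. homogeneous_poly e p"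
    and Z: "Z = {L \<in> grassmannian d V. \<forall>p\<in>Q. vanishes_at p L}"
    using assms(2) unfolding zariski_closed_def by auto
  define R where "R = (\<lambda>(p, q) x. p x * q x) ` (P \<times> Q)"
  have R: "\<exists>e. homogeneous_poly e f" if "f \<in> R" for f
  proof -
    obtain p q where pq: "p \<in> P" "q \<in> Q" and f: "f = (\<lambda>x. p x * q x)"
      using \<open>f \<in> R\<close> unfolding R_def by auto
    obtain e e' where "homogeneous_poly e p" "homogeneous_poly e' q"
      using P[OF pq(1)] Q[OF pq(2)] by auto
    from homogeneous_poly.mult[OF this] show ?thesis unfolding f by (rule exI)
  qed
  have prod: "vanishes_at (\<lambda>x. p x * q x) L \<longleftrightarrow> vanishes_at p L \<or> vanishes_at q L"
    if pq: "p \<in> P" "q \<in> Q" and L: "L \<in> grassmannian d V" for p q L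
  proof -
    obtain vs where vs: "ordered_basis L vs"
      using L ordered_basis_exists unfolding grassmannian_def by blast
    obtain e e' where e: "homogeneous_poly e p" "homogeneous_poly e' q"
      using P[OF pq(1)] Q[OF pq(2)] by auto
    show ?thesis
      using vanishes_at_iff[OF e(1) vs] vanishes_at_iff[OF e(2) vs]
        vanishes_at_iff[OF homogeneous_poly.mult[OF e] vs] by simp
  qed
  have "Y \<union> Z = {L \<in> grassmannian d V. \<forall>f\<in>R. vanishes_at f L}"
    unfolding Y Z R_def by (auto simp: prod)
  with R show ?thesis
    unfolding zariski_closed_def by (intro exI[where x = R]) simp
qed

lemma zariski_closed_Inter:
  assumes "\<And>Z. Z \<in> K \<Longrightarrow> zariski_closed d V Z"
  shows "zariski_closed d V (grassmannian d V \<inter> \<Inter>K)"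
proof -
  from assms have "\<forall>Z\<in>K. \<exists>P. (\<forall>p\<in>P. \<exists>e. homogeneous_poly e p) \<and>
      Z = {L \<in> grassmannian d V. \<forall>p\<in>P. vanishes_at p L}"
    unfolding zariski_closed_def by simp
  then obtain P where P0: "\<forall>Z\<in>K. (\<forall>p\<in>P Z. \<exists>e. homogeneous_poly e p) \<and>
      Z = {L \<in> grassmannian d V. \<forall>p\<in>P Z. vanishes_at p L}"
    by (rule bchoice[THEN exE])
  have P: "\<And>Z p. Z \<in> K \<Longrightarrow> p \<in> P Z \<Longrightarrow> \<exists>e. homogeneous_poly e p"
    and Z: "\<And>Z. Z \<in> K \<Longrightarrow> Z = {L \<in> grassmannian d V. \<forall>p\<in>P Z. vanishes_at p L}"
    using bspec[OF P0] by simp_all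
  have mem: "L \<in> Z \<longleftrightarrow> (\<forall>p\<in>P Z. vanishes_at p L)" if "Z \<in> K" "L \<in> grassmannian d V" for L Z
    using that by (subst Z) simp_all
  show ?thesis
    unfolding zariski_closed_def
  proof (intro exI conjI)
    show "\<forall>p\<in>\<Union>(P ` K). \<exists>e. homogeneous_poly e p" using P by auto
    show "grassmannian d V \<inter> \<Inter>K =
        {L \<in> grassmannian d V. \<forall>p\<in>\<Union>(P ` K). vanishes_at p L}"
      by (auto simp: mem)
  qed
qed

lemma zariski_closed_empty: "zariski_closed d V {}"
  unfolding zariski_closed_def
proof (intro exI conjI)
  show "\<forall>p\<in>{\<lambda>x. 1}. \<exists>e. homogeneous_poly e p"
    using homogeneous_poly.const[of 1] by auto
  show "{} = {L \<in> grassmannian d V. \<forall>p\<in>{\<lambda>x. 1}. vanishes_at p L}"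
    by (auto simp: grassmannian_def vanishes_at_def dest!: ordered_basis_exists)
qed

lemma istopology_zariski_grassmannian:
  "istopology (\<lambda>U. U \<subseteq> grassmannian d V \<and> zariski_closed d V (grassmannian d V - U))"
  unfolding istopology_def
proof (intro conjI allI impI)
  fix S T
  assume S: "S \<subseteq> grassmannian d V \<and> zariski_closed d V (grassmannian d V - S)"
    and T: "T \<subseteq> grassmannian d V \<and> zariski_closed d V (grassmannian d V - T)"
  then show "S \<inter> T \<subseteq> grassmannian d V" by auto
  show "zariski_closed d V (grassmannian d V - S \<inter> T)"
    using S T zariski_closed_Un[of d V "grassmannian d V - S" "grassmannian d V - T"]
    by (simp add: Diff_Int)
next
  fix K
  assume K: "\<forall>S\<in>K. S \<subseteq> grassmannian d V \<and> zariski_closed d V (grassmannian d V - S)"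
  then show "\<Union>K \<subseteq> grassmannian d V" by auto
  have "zariski_closed d V
      (grassmannian d V \<inter> \<Inter>((\<lambda>S. grassmannian d V - S) ` K))"
    using K by (intro zariski_closed_Inter) auto
  moreover have "grassmannian d V \<inter> \<Inter>((\<lambda>S. grassmannian d V - S) ` K)
      = grassmannian d V - \<Union>K" by auto
  ultimately show "zariski_closed d V (grassmannian d V - \<Union>K)" by simp
qed

lemma topspace_zariski_grassmannian [simp]:
  "topspace (zariski_grassmannian d V) = grassmannian d V"
proof -
  have "openin (zariski_grassmannian d V) U \<longleftrightarrow>
      U \<subseteq> grassmannian d V \<and> zariski_closed d V (grassmannian d V - U)" for U
    unfolding zariski_grassmannian_def
    by (simp add: topology_inverse'[OF istopology_zariski_grassmannian])
  then have *: "openin (zariski_grassmannian d V) = (\<lambda>U. U \<subseteq> grassmannian d V \<and>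
      zariski_closed d V (grassmannian d V - U))" by (rule ext)
  show ?thesis
    unfolding topspace_def * using zariski_closed_empty[of d V] by auto
qed

lemma closedin_zariski_grassmannian:
  "closedin (zariski_grassmannian d V) Z \<longleftrightarrow> zariski_closed d V Z"
proof -
  have "Z \<subseteq> grassmannian d V" if "zariski_closed d V Z"
    using that unfolding zariski_closed_def by auto
  moreover have "grassmannian d V - (grassmannian d V - Z) = Z" if "Z \<subseteq> grassmannian d V"
    using that by auto
  ultimately show ?thesis
    unfolding closedin_def topspace_zariski_grassmannian
    unfolding zariski_grassmannian_def topology_inverse'[OF istopology_zariski_grassmannian]
    by auto
qed

definition irreducible_space :: "'b topology \<Rightarrow> bool" where
  "irreducible_space X \<longleftrightarrow>
     topspace X \<noteq> {} \<and>
     (\<forall>C D. closedin X C \<and> closedin X D \<and> topspace X = C \<union> D \<longrightarrow>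
        C = topspace X \<or> D = topspace X)"

text \<open>The space of closed points of the Fano scheme of projective \<open>k\<close>-planes, that is, of
  linear subspaces of dimension \<open>k + 1\<close>. A scheme of finite type over an algebraically closed field
  is irreducible iff its space of closed points is.\<close>

definition fano_space :: "nat \<Rightarrow> nat \<Rightarrow> ('a::alg_closed_field^'n^'n) set topology" where
  "fano_space k r =
     subtopology (zariski_grassmannian (k + 1) symmetric_matrices)
       {L. L \<subseteq> sym_det_cone r}"

definition kappa :: "nat \<Rightarrow> nat \<Rightarrow> nat \<Rightarrow> int" where
  "kappa n r s = int s * (int s + 1 + int n - int r) + int ((r - s) choose 2) - 1"

end

theory Submission
  imports Defs
begin

text \<open>Put \<open>\<rho> = r - 1\<close> and let \<open>C\<^sub>s\<close> be the set of members of the Fano variety that are congruent to a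
  subspace of the standard \<open>s\<close>-compression space, that is, for which some subspaces \<open>W \<subseteq> U\<close> of
  codimensions \<open>\<rho> - s\<close> and \<open>s\<close> satisfy \<open>w \<bullet> N u = 0\<close> for all members \<open>N\<close>. The standard
  \<open>s\<close>-compression space has dimension \<open>\<kappa>(s) + 1\<close>, and \<open>C\<^sub>s\<close> is irreducible because any two of its points are joined by a
  rational curve.

  A torus limit followed by transvections degenerates every member to a coordinate subspace whose
  set of weights is shifted; bounded rank forces that set into a standard compression space, so
  \<open>k \<le> \<kappa>(s)\<close> for some \<open>s\<close>, hence for \<open>s = 0\<close> or \<open>s = s\<^sub>m\<^sub>a\<^sub>x\<close> by convexity of \<open>\<kappa>\<close>. If only one such
  \<open>s\<close> exists and it is extremal, the limit is so large that an explicit open condition, implying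
  membership in \<open>C\<^sub>s\<close>, holds on it and therefore on a translate of the given member: for \<open>s = 0\<close> that a
  pencil has square-free determinant, for \<open>s = s\<^sub>m\<^sub>a\<^sub>x\<close> that two kernel vectors of a generic member have
  independent images of maximal isotropic dimension. Thus the variety equals \<open>C\<^sub>s\<close>. In the remaining
  nonempty cases this open condition and a second one, which excludes \<open>C\<^sub>s\<close>, both hold somewhere, so
  irreducibility would make them hold simultaneously.\<close>

hide_const (open) Determinant.det Matrix.mat

text \<open>No limit of subspaces and no dimension of a variety is ever formed. Geometric statements
  are rephrased as polynomial tests on tuples of members of a subspace (\<open>vanishes_on\<close>).
  Such a test is Zariski closed because a basis of a subspace is, chart by chart, linear in its
  Pluecker coordinates. A degeneration then only asserts that an open test true on the limit is true
  on some congruent copy.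

  The obstacle is that compressibility of the limit says nothing about the original space, since it
  is not an open property. Each extremal stratum therefore needs a certificate that is open and
  still forces compression, and the inequalities on \<open>k\<close> serve to place the weights of a
  test tuple for this certificate into the limit.

  Characteristic 2 is excluded for three reasons: quadratic relations have to be polarised, a
  transvection can produce the entry 2, and the test polynomial has derivative \<open>-2\<close>
  when the characteristic divides \<rho>.\<close>

lemma infinite_alg_closed: "infinite (UNIV :: 'a::alg_closed_field set)"
proof
  assume fin: "finite (UNIV :: 'a set)"
  define p :: "'a poly" where "p = (\<Prod>a\<in>UNIV. [:- a, 1:]) + 1"
  have "degree (\<Prod>a\<in>(UNIV::'a set). [:- a, 1:]) = (\<Sum>a\<in>(UNIV::'a set). 1)"
    by (subst degree_prod_eq_sum_degree) auto
  then have d: "degree (\<Prod>a\<in>(UNIV::'a set). [:- a, 1:]) > 0"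
    using fin finite_UNIV_card_ge_0 by auto
  then have "degree p > 0" unfolding p_def
    by (subst degree_add_eq_left) auto
  then obtain x where x: "poly p x = 0" using alg_closed_imp_poly_has_root by blast
  have "poly (\<Prod>a\<in>(UNIV::'a set). [:- a, 1:]) x = 0"
    unfolding poly_prod using fin by (intro prod_zero) auto
  then show False using x unfolding p_def by simp
qed

section \<open>Polynomial functions\<close>

text \<open>Inhomogeneous on purpose: tests such as \<open>det (layer 0 x + D)\<close> with a
  constant matrix \<open>D\<close> mix degrees. They become conditions on the Grassmannian after
  splitting into homogeneous parts.\<close>

inductive poly_fun :: "(('i \<Rightarrow> 'a::comm_ring_1) \<Rightarrow> 'a) \<Rightarrow> bool" where
  const: "poly_fun (\<lambda>x. c)"
| coord: "poly_fun (\<lambda>x. x i)"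
| add: "poly_fun p \<Longrightarrow> poly_fun q \<Longrightarrow> poly_fun (\<lambda>x. p x + q x)"
| mult: "poly_fun p \<Longrightarrow> poly_fun q \<Longrightarrow> poly_fun (\<lambda>x. p x * q x)"

lemma poly_fun_uminus: "poly_fun p \<Longrightarrow> poly_fun (\<lambda>x. - p x)"
  using poly_fun.mult[OF poly_fun.const[of "-1"]] by simp

lemma poly_fun_sum: "(\<And>i. i \<in> A \<Longrightarrow> poly_fun (p i)) \<Longrightarrow> poly_fun (\<lambda>x. \<Sum>i\<in>A. p i x)"
  by (induction A rule: infinite_finite_induct) (auto intro: poly_fun.intros)

lemma poly_fun_prod: "(\<And>i. i \<in> A \<Longrightarrow> poly_fun (p i)) \<Longrightarrow> poly_fun (\<lambda>x. \<Prod>i\<in>A. p i x)"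
  by (induction A rule: infinite_finite_induct) (auto intro: poly_fun.intros)

lemma poly_fun_det:
  assumes "\<And>i j. poly_fun (\<lambda>x. F x $ i $ j)"
  shows "poly_fun (\<lambda>x. det (F x))"
  unfolding Determinants.det_def by (intro poly_fun_sum poly_fun.mult poly_fun.const poly_fun_prod assms)

text \<open>Determinants indexed by numbers occur beside those indexed by types: the sizes of
  Pluecker minors and Sylvester matrices are not cardinalities of given types.\<close>

lemma poly_fun_det_mat:
  assumes "\<And>i j. i < N \<Longrightarrow> j < N \<Longrightarrow> poly_fun (\<lambda>x. F x i j)"
  shows "poly_fun (\<lambda>x. Determinant.det (Matrix.mat N N (\<lambda>(i, j). F x i j)))"
proof -
  have eq: "Determinant.det (Matrix.mat N N (\<lambda>(i, j). F x i j)) =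
    (\<Sum>p | p permutes {0..<N}. signof p * (\<Prod>i = 0..<N. F x i (p i)))" for x
    by (subst det_def') (auto intro!: sum.cong prod.cong dest: permutes_in_image)
  show ?thesis unfolding eq
    by (intro poly_fun_sum poly_fun.mult poly_fun.const poly_fun_prod assms)
      (auto dest: permutes_in_image)
qed

lemma poly_fun_subst:
  assumes "poly_fun f" "\<And>i. poly_fun (g i)"
  shows "poly_fun (\<lambda>x. f (\<lambda>i. g i x))"
  using assms(1) by induction (auto intro: poly_fun.intros assms(2))

text \<open>The source of all general-position arguments: along a polynomial curve a test becomes a
  polynomial in one variable, so being nonzero at one parameter makes it nonzero at all but finitely
  many.\<close>

lemma poly_fun_curve:
  assumes "poly_fun f"
  shows "\<exists>q. \<forall>t. f (\<lambda>i. poly (c i) t) = poly q t"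
  using assms
proof induction
  case (const a) show ?case by (rule exI[where x = "[:a:]"]) simp
next
  case (coord i) show ?case by (rule exI[where x = "c i"]) simp
next
  case (add p q)
  then obtain P Q where "\<forall>t. p (\<lambda>i. poly (c i) t) = poly P t" "\<forall>t. q (\<lambda>i. poly (c i) t) = poly Q t"
    by auto
  then show ?case by (intro exI[where x = "P + Q"]) simp
next
  case (mult p q)
  then obtain P Q where "\<forall>t. p (\<lambda>i. poly (c i) t) = poly P t" "\<forall>t. q (\<lambda>i. poly (c i) t) = poly Q t"
    by auto
  then show ?case by (intro exI[where x = "P * Q"]) simp
qed

lemma homogeneous_poly_zero: "homogeneous_poly e (\<lambda>x. 0)"
proof (induction e)
  case (Suc e)
  \<comment> \<open>The rule for constants yields zero only in degree 0; multiplication by an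
    arbitrary coordinate raises the degree.\<close>
  from homogeneous_poly.mult[OF Suc homogeneous_poly.coord[of undefined]]
  show ?case by simp
qed (rule homogeneous_poly.const)

lemma homogeneous_poly_sum:
  "(\<And>i. i \<in> A \<Longrightarrow> homogeneous_poly e (p i)) \<Longrightarrow> homogeneous_poly e (\<lambda>x. \<Sum>i\<in>A. p i x)"
  by (induction A rule: infinite_finite_induct)
    (auto intro: homogeneous_poly.add homogeneous_poly_zero)

lemma homogeneous_poly_subst:
  assumes "homogeneous_poly e f" "\<And>i. homogeneous_poly 1 (g i)"
  shows "homogeneous_poly e (\<lambda>x. f (\<lambda>i. g i x))"
  using assms(1) by induction (auto intro: homogeneous_poly.intros assms(2)[unfolded One_nat_def])

lemma homogeneous_poly_poly_fun: "homogeneous_poly e f \<Longrightarrow> poly_fun f"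
  by (induction rule: homogeneous_poly.induct) (auto intro: poly_fun.intros)

lemma poly_fun_homogeneous_parts:
  assumes "poly_fun f"
  shows "\<exists>N h. (\<forall>e. homogeneous_poly e (h e)) \<and> (\<forall>x. f x = (\<Sum>e<N. h e x))"
  using assms
proof induction
  case (const c)
  show ?case
    by (rule exI[where x = 1], rule exI[where x = "\<lambda>e. if e = 0 then (\<lambda>x. c) else (\<lambda>x. 0)"])
      (auto intro: homogeneous_poly.const homogeneous_poly_zero)
next
  case (coord i)
  show ?case
    by (rule exI[where x = 2], rule exI[where x = "\<lambda>e. if e = 1 then (\<lambda>x. x i) else (\<lambda>x. 0)"])
      (auto intro: homogeneous_poly.coord[unfolded One_nat_def] homogeneous_poly_zero simp: numeral_2_eq_2)
next
  case (add p q)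
  then obtain N h N' h' where h: "\<And>e. homogeneous_poly e (h e)" "\<And>x. p x = (\<Sum>e<N. h e x)"
    and h': "\<And>e. homogeneous_poly e (h' e)" "\<And>x. q x = (\<Sum>e<N'. h' e x)" by metis
  define k where "k e = (\<lambda>x. (if e < N then h e x else 0) + (if e < N' then h' e x else 0))" for e
  have "homogeneous_poly e (k e)" for e
    unfolding k_def
    by (intro homogeneous_poly.add; cases "e < N"; cases "e < N'")
      (auto simp: h(1) h'(1) homogeneous_poly_zero)
  moreover have "p x + q x = (\<Sum>e<N + N'. k e x)" for x
  proof -
    have "(\<Sum>e<N + N'. if e < N then h e x else 0) = (\<Sum>e<N. h e x)"
      by (rule sum.mono_neutral_cong_right) auto
    moreover have "(\<Sum>e<N + N'. if e < N' then h' e x else 0) = (\<Sum>e<N'. h' e x)"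
      by (rule sum.mono_neutral_cong_right) auto
    ultimately show ?thesis unfolding k_def h h' sum.distrib by simp
  qed
  ultimately show ?case by blast
next
  case (mult p q)
  then obtain N h N' h' where h: "\<And>e. homogeneous_poly e (h e)" "\<And>x. p x = (\<Sum>e<N. h e x)"
    and h': "\<And>e. homogeneous_poly e (h' e)" "\<And>x. q x = (\<Sum>e<N'. h' e x)" by metis
  define S where "S e = {(a, b). a < N \<and> b < N' \<and> a + b = e}" for e
  define k where "k e = (\<lambda>x. \<Sum>(a, b)\<in>S e. h a x * h' b x)" for e
  have "homogeneous_poly e (k e)" for e
    unfolding k_def
    by (intro homogeneous_poly_sum)
      (use homogeneous_poly.mult[OF h(1) h'(1)] in \<open>auto simp: S_def\<close>)
  moreover have "p x * q x = (\<Sum>e<N + N'. k e x)" for x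
  proof -
    have fin: "finite (S e)" for e
      by (rule finite_subset[of _ "{..<N} \<times> {..<N'}"]) (auto simp: S_def)
    have "(\<Sum>e<N + N'. k e x) = (\<Sum>(a, b)\<in>(\<Union>e<N + N'. S e). h a x * h' b x)"
      unfolding k_def using fin by (subst sum.UNION_disjoint) (auto simp: S_def)
    also have "(\<Union>e<N + N'. S e) = {..<N} \<times> {..<N'}" by (auto simp: S_def)
    finally show ?thesis unfolding h h' sum_product sum.cartesian_product by simp
  qed
  ultimately show ?case by blast
qed

lemma poly_zero_if_infinite_zeros:
  fixes p :: "'a::idom poly"
  assumes "infinite {t. poly p t = 0}"
  shows "p = 0"
  using assms poly_roots_finite by auto

lemma common_nonzero_point:
  fixes P :: "'a::alg_closed_field poly set"
  assumes "finite P" "0 \<notin> P" "finite X"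
  obtains t where "t \<notin> X" "\<And>p. p \<in> P \<Longrightarrow> poly p t \<noteq> 0"
proof -
  have "finite (X \<union> (\<Union>p\<in>P. {t. poly p t = 0}))"
    using assms by (auto intro!: poly_roots_finite)
  then obtain t where "t \<notin> X \<union> (\<Union>p\<in>P. {t. poly p t = 0})"
    using infinite_alg_closed ex_new_if_finite by metis
  then show thesis using that by auto
qed

text \<open>Along the line through \<open>x\<close>, \<open>f\<close> is a polynomial in
  \<open>c\<close> with coefficients \<open>h e x\<close>, and vanishing on an infinite field kills
  each of them. So vanishing on a subspace, which is stable under scaling, amounts to homogeneous
  conditions.\<close>

lemma poly_fun_homogeneous_parts_zero:
  fixes f :: "('i \<Rightarrow> 'a::alg_closed_field) \<Rightarrow> 'a"
  assumes h: "\<And>e. homogeneous_poly e (h e)" "\<And>x. f x = (\<Sum>e<N. h e x)"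
    and z: "\<And>c. f (\<lambda>i. c * x i) = 0" and e: "e < N"
  shows "h e x = 0"
proof -
  define p where "p = (\<Sum>e<N. monom (h e x) e)"
  have "poly p c = 0" for c
    using z[of c] unfolding h(2) p_def poly_sum poly_monom
    by (simp add: homogeneous_poly_scale[OF h(1)] mult.commute)
  then have "p = 0"
    using poly_zero_if_infinite_zeros[of p] infinite_alg_closed by simp
  then have "coeff p e = 0" by simp
  then show ?thesis using e unfolding p_def by (simp add: coeff_sum)
qed

section \<open>Closed conditions on tuples of members of a subspace\<close>

text \<open>Tuples are infinite sequences of matrices, so that tests with any number of arguments
  share one type; a polynomial function reads only finitely many entries.\<close>

definition entries :: "(nat \<Rightarrow> 'a^'n^'m) \<Rightarrow> nat \<times> 'm \<times> 'n \<Rightarrow> 'a" where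
  "entries M = (\<lambda>(l, i, j). M l $ i $ j)"

definition vanishes_on :: "((nat \<times> 'm \<times> 'n \<Rightarrow> 'a) \<Rightarrow> 'a::field) \<Rightarrow> ('a^'n^'m) set \<Rightarrow> bool" where
  "vanishes_on f L \<longleftrightarrow> (\<forall>M. range M \<subseteq> L \<longrightarrow> f (entries M) = 0)"

lemma entries_apply [simp]: "entries M (l, i, j) = M l $ i $ j"
  by (simp add: entries_def)

text \<open>Laplace expansion along column \<open>a\<close>: the cofactors do not involve that
  column, so for varying \<open>p\<close> these coordinates are the entries of one fixed linear
  combination of \<open>vs\<close>.\<close>

lemma pluecker_replace:
  fixes vs :: "('a::field^'n^'m) list"
  assumes I: "length I = length vs" and a: "a < length vs"
  defines "W \<equiv> Matrix.mat (length vs) (length vs) (\<lambda>(a, b). (vs ! a) $ fst (I ! b) $ snd (I ! b))"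
  shows "pluecker vs (I[a := p]) = (\<Sum>c<length vs. (vs ! c) $ fst p $ snd p * Determinant.cofactor W c a)"
proof -
  let ?d = "length vs"
  let ?V = "Matrix.mat ?d ?d (\<lambda>(b, c). (vs ! b) $ fst (I[a := p] ! c) $ snd (I[a := p] ! c))"
  have "pluecker vs (I[a := p]) = Determinant.det ?V"
    using I by (simp add: pluecker_def)
  also have "\<dots> = (\<Sum>c<?d. ?V $$ (c, a) * Determinant.cofactor ?V c a)"
    using a by (intro laplace_expansion_column) auto
  also have "\<dots> = (\<Sum>c<?d. (vs ! c) $ fst p $ snd p * Determinant.cofactor W c a)"
  proof (intro sum.cong refl arg_cong2[where f = "(*)"])
    fix c assume c: "c \<in> {..<?d}"
    then show "?V $$ (c, a) = (vs ! c) $ fst p $ snd p" using a I by simp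
    have "mat_delete ?V c a = mat_delete W c a"
      unfolding mat_delete_def W_def using a c I
      by (intro eq_matI) (auto simp: nth_list_update)
    then show "Determinant.cofactor ?V c a = Determinant.cofactor W c a"
      by (simp add: Determinant.cofactor_def)
  qed
  finally show ?thesis .
qed

lemma exists_pluecker_nonzero:
  fixes vs :: "('a::field^'n^'m) list"
  assumes "distinct vs" "mspace.independent (set vs)"
  shows "\<exists>I. length I = length vs \<and> pluecker vs I \<noteq> 0"
  using assms
proof (induction vs)
  case Nil
  then show ?case by (auto simp: pluecker_def)
next
  case (Cons v vs)
  have "mspace.independent (set vs)"
    using Cons.prems mspace.independent_mono[of "set (v # vs)" "set vs"] by auto
  then obtain I where I: "length I = length vs" "pluecker vs I \<noteq> 0"
    using Cons by auto
  show ?case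
  proof (rule ccontr)
    assume none: "\<not> ?thesis"
    define us where "us = v # vs"
    \<comment> \<open>The first position is a placeholder that \<open>pluecker_replace\<close>
      overwrites. If all minors vanished, the cofactors of this column would form a linear relation
      among \<open>us\<close> whose coefficient at \<open>v\<close> is the nonzero minor of
      \<open>vs\<close>.\<close>
    define J where "J = undefined # I"
    define W where "W = Matrix.mat (length us) (length us)
        (\<lambda>(a, b). (us ! a) $ fst (J ! b) $ snd (J ! b))"
    define c where "c a = Determinant.cofactor W a 0" for a
    have J: "length J = length us" by (simp add: J_def us_def I)
    have "(\<Sum>a<length us. (us ! a) $ i $ j * c a) = 0" for i j
      using pluecker_replace[OF J, of 0 "(i, j)"] none I
      by (auto simp: J_def us_def c_def W_def)
    then have "(\<Sum>a<length us. mscale (c a) (us ! a)) = 0"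
      by (simp add: Finite_Cartesian_Product.vec_eq_iff sum_nth_nth mult.commute)
    moreover have bij: "bij_betw ((!) us) {..<length us} (set us)"
      using Cons.prems by (intro bij_betw_nth) (auto simp: us_def)
    define u where "u x = c (the_inv_into {..<length us} ((!) us) x)" for x
    have u: "u (us ! a) = c a" if "a < length us" for a
      unfolding u_def using that bij by (subst the_inv_into_f_f) (auto simp: bij_betw_def)
    ultimately have "(\<Sum>x\<in>set us. mscale (u x) x) = 0"
      using sum.reindex_bij_betw[OF bij, of "\<lambda>x. mscale (u x) x"] u by simp
    then have "u v = 0"
      using Cons.prems(2) unfolding mspace.dependent_finite[OF finite_set] us_def by auto
    then have "c 0 = 0" using u[of 0] by (simp add: us_def)
    have "mat_delete W 0 0 = Matrix.mat (length vs) (length vs)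
        (\<lambda>(a, b). (vs ! a) $ fst (I ! b) $ snd (I ! b))"
      by (intro eq_matI) (auto simp: mat_delete_def W_def us_def J_def)
    then have "c 0 = pluecker vs I"
      using I by (simp add: c_def Determinant.cofactor_def pluecker_def)
    then show False using \<open>c 0 = 0\<close> I by simp
  qed
qed

text \<open>The affine chart of the Grassmannian at \<open>I\<close>: the matrices
  \<open>b a\<close> are linear in the Pluecker coordinates. Multiplying the coordinate matrix by
  its adjugate expresses \<open>det W\<close> times each member of \<open>vs\<close> through them,
  so they span once this coordinate is nonzero.\<close>

lemma pluecker_chart:
  fixes vs :: "('a::field^'n^'m) list"
  assumes I: "length I = length vs"
  defines "b \<equiv> \<lambda>a. (\<chi> i j. pluecker vs (I[a := (i, j)]))"
  shows "a < length vs \<Longrightarrow> b a \<in> mspace.span (set vs)"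
    and "pluecker vs I \<noteq> 0 \<Longrightarrow> c < length vs \<Longrightarrow>
      \<exists>u. vs ! c = (\<Sum>a<length vs. mscale (u a) (b a))"
proof -
  let ?d = "length vs"
  define W where "W = Matrix.mat ?d ?d (\<lambda>(a, b). (vs ! a) $ fst (I ! b) $ snd (I ! b))"
  have b: "b a = (\<Sum>c<?d. mscale (Determinant.cofactor W c a) (vs ! c))" if "a < ?d" for a
    using pluecker_replace[OF I that] unfolding b_def W_def
    by (simp add: Finite_Cartesian_Product.vec_eq_iff sum_nth_nth mult.commute)
  show "b a \<in> mspace.span (set vs)" if "a < ?d" for a
    unfolding b[OF that]
    by (intro mspace.span_sum mspace.span_scale mspace.span_base) auto
  assume nz: "pluecker vs I \<noteq> 0" and c: "c < ?d"
  have D: "Determinant.det W = pluecker vs I" using I by (simp add: pluecker_def W_def)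
  have WC: "W \<in> carrier_mat ?d ?d" by (simp add: W_def)
  have adj: "(\<Sum>a<?d. W $$ (c, a) * Determinant.cofactor W c' a) = (if c = c' then Determinant.det W else 0)"
    if "c' < ?d" for c'
  proof -
    have "(W * adj_mat W) $$ (c, c') = (\<Sum>a<?d. W $$ (c, a) * Determinant.cofactor W c' a)"
      using c that WC by (auto simp: scalar_prod_def adj_mat_def lessThan_atLeast0 intro!: sum.cong)
    then show ?thesis unfolding adj_mat(2)[OF WC] using c that by (simp split: if_splits)
  qed
  have "(\<Sum>a<?d. mscale (W $$ (c, a)) (b a)) $ i $ j = Determinant.det W * (vs ! c) $ i $ j" for i j
  proof -
    have "(\<Sum>a<?d. mscale (W $$ (c, a)) (b a)) $ i $ j
      = (\<Sum>a<?d. \<Sum>c'<?d. (vs ! c') $ i $ j * (W $$ (c, a) * Determinant.cofactor W c' a))"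
      by (simp add: b sum_nth_nth sum_distrib_left mult_ac)
    also have "\<dots> = (\<Sum>c'<?d. \<Sum>a<?d. (vs ! c') $ i $ j * (W $$ (c, a) * Determinant.cofactor W c' a))"
      by (rule sum.swap)
    also have "\<dots> = (\<Sum>c'<?d. (vs ! c') $ i $ j * (if c = c' then Determinant.det W else 0))"
      by (intro sum.cong refl) (simp add: sum_distrib_left[symmetric] adj)
    also have "\<dots> = Determinant.det W * (vs ! c) $ i $ j"
      using c by (simp add: if_distrib[of "(*) _"] mult.commute cong: if_cong)
    finally show ?thesis .
  qed
  then have "vs ! c = (\<Sum>a<?d. mscale (inverse (pluecker vs I) * W $$ (c, a)) (b a))"
    using nz unfolding D
    by (simp add: Finite_Cartesian_Product.vec_eq_iff sum_nth_nth sum_distrib_left[symmetric] mult.assoc)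
  then show "\<exists>u. vs ! c = (\<Sum>a<?d. mscale (u a) (b a))"
    by (rule exI[where x = "\<lambda>a. inverse (pluecker vs I) * W $$ (c, a)"])
qed

text \<open>In a chart where the matrices \<open>b I a\<close> span, their combinations exhaust all
  tuples of members, so letting \<open>I\<close> and the coefficients \<open>c\<close> run through
  everything tests \<open>f\<close> on every tuple.\<close>

lemma zariski_closed_vanishes_on:
  fixes f :: "(nat \<times> 'm::finite \<times> 'n::finite \<Rightarrow> 'a) \<Rightarrow> 'a::alg_closed_field"
  assumes "poly_fun f"
  shows "zariski_closed d V {L \<in> grassmannian d V. vanishes_on f L}"
proof -
  obtain N h where h: "\<And>e. homogeneous_poly e (h e)" "\<And>x. f x = (\<Sum>e<N. h e x)"
    using poly_fun_homogeneous_parts[OF assms] by metis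
  \<comment> \<open>The linear forms in the Pluecker coordinates that give the entries of the tuple
    with \<open>l\<close>-th matrix \<open>\<Sum>a<d. mscale (c l a) (b I a)\<close>. Below,
    \<open>F\<close> evaluates a homogeneous part of \<open>f\<close> at this tuple, multiplied by
    the chart coordinate \<open>x I\<close>.\<close>
  define g where "g I c = (\<lambda>(l, i, j) x. \<Sum>a<d. c l a * x (I[a := (i, j)]))"
    for I :: "('m \<times> 'n) list" and c :: "nat \<Rightarrow> nat \<Rightarrow> 'a"
  define F where "F I c e = (\<lambda>x. x I * h e (\<lambda>i. g I c i x))"
    for I :: "('m \<times> 'n) list" and c :: "nat \<Rightarrow> nat \<Rightarrow> 'a" and e
  define P where "P = {F I c e |I c e. length I = d \<and> e < N}"
  have g1: "homogeneous_poly 1 (g I c i)" for I c i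
    using homogeneous_poly.mult[OF homogeneous_poly.const homogeneous_poly.coord]
    unfolding g_def by (cases i) (auto intro!: homogeneous_poly_sum)
  have FP: "homogeneous_poly (1 + e) (F I c e)" for I c e
    unfolding F_def
    by (rule homogeneous_poly.mult[OF homogeneous_poly.coord homogeneous_poly_subst[OF h(1) g1]])
  have key: "vanishes_on f L \<longleftrightarrow> (\<forall>p\<in>P. vanishes_at p L)" if L: "L \<in> grassmannian d V" for L
  proof -
    have sub: "mspace.subspace L" using L by (simp add: grassmannian_def)
    then obtain vs where vs: "ordered_basis L vs" using ordered_basis_exists by blast
    have len: "length vs = d"
      using vs L distinct_card[of vs] mspace.dim_span_eq_card_independent[of "set vs"]
      by (simp add: ordered_basis_def grassmannian_def)
    define b where "b I a = (\<chi> i j. pluecker vs (I[a := (i, j)]))" for I a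
    have gb: "(\<lambda>i. g I c i (pluecker vs)) = entries (\<lambda>l. \<Sum>a<d. mscale (c l a) (b I a))" for I c
      by (auto simp: g_def b_def sum_nth_nth)
    have van: "(\<forall>p\<in>P. vanishes_at p L) \<longleftrightarrow>
        (\<forall>I c e. length I = d \<longrightarrow> e < N \<longrightarrow> F I c e (pluecker vs) = 0)"
      using vanishes_at_iff[OF FP vs] unfolding P_def by blast
    show ?thesis
    proof
      assume f: "vanishes_on f L"
      have "F I c e (pluecker vs) = 0" if I: "length I = d" and e: "e < N" for I c e
      proof -
        define M where "M l = (\<Sum>a<d. mscale (c l a) (b I a))" for l
        have "b I a \<in> L" if "a < d" for a
          using pluecker_chart(1)[of I vs a] vs that len I by (simp add: ordered_basis_def b_def)
        then have M: "M l \<in> L" for l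
          unfolding M_def using sub by (auto intro!: mspace.subspace_sum mspace.subspace_scale)
        have "f (\<lambda>i. t * entries M i) = 0" for t
        proof -
          have "(\<lambda>i. t * entries M i) = entries (\<lambda>l. mscale t (M l))"
            by auto
          moreover have "range (\<lambda>l. mscale t (M l)) \<subseteq> L"
            using M sub by (auto intro!: mspace.subspace_scale)
          ultimately show ?thesis using f unfolding vanishes_on_def by simp
        qed
        from poly_fun_homogeneous_parts_zero[OF h this e] show ?thesis
          unfolding F_def gb M_def by simp
      qed
      then show "\<forall>p\<in>P. vanishes_at p L" unfolding van by blast
    next
      assume P: "\<forall>p\<in>P. vanishes_at p L"
      obtain I where I: "length I = d" "pluecker vs I \<noteq> 0"
        using exists_pluecker_nonzero[of vs] vs len unfolding ordered_basis_def by auto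
      have span: "\<exists>u. v = (\<Sum>a<d. mscale (u a) (b I a))" if "v \<in> L" for v
      proof -
        have "v \<in> mspace.span (b I ` {..<d})"
        proof -
          have "set vs \<subseteq> mspace.span (b I ` {..<d})"
          proof
            fix x assume "x \<in> set vs"
            then obtain c where c: "c < d" "x = vs ! c" using len by (auto simp: in_set_conv_nth)
            then obtain u where "x = (\<Sum>a<d. mscale (u a) (b I a))"
              using pluecker_chart(2)[of I vs c] I len unfolding b_def by auto
            then show "x \<in> mspace.span (b I ` {..<d})"
              by (simp only:) (intro mspace.span_sum mspace.span_scale mspace.span_base, auto)
          qed
          then have "mspace.span (set vs) \<subseteq> mspace.span (b I ` {..<d})"
            by (simp add: mspace.span_minimal)
          then show ?thesis using that vs by (auto simp: ordered_basis_def)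
        qed
        then show ?thesis
        proof (induction rule: mspace.span_induct_alt)
          case base
          show ?case by (rule exI[where x = "\<lambda>_. 0"])
              (simp add: Finite_Cartesian_Product.vec_eq_iff sum_nth_nth)
        next
          case (step c x y)
          then obtain u a where u: "y = (\<Sum>a<d. mscale (u a) (b I a))" and a: "a < d" "x = b I a" by auto
          show ?case
          proof (rule exI[where x = "\<lambda>a'. (if a' = a then c else 0) + u a'"])
            have "(\<Sum>a'<d. mscale (if a' = a then c else 0) (b I a')) = mscale c (b I a)"
              using a by (subst sum.remove[of _ a]) (auto simp: Finite_Cartesian_Product.vec_eq_iff sum_nth_nth)
            then show "mscale c x + y = (\<Sum>a'<d. mscale ((if a' = a then c else 0) + u a') (b I a'))"
              using u a by (simp add: mspace.scale_left_distrib sum.distrib)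
          qed
        qed
      qed
      show "vanishes_on f L"
        unfolding vanishes_on_def
      proof (intro allI impI)
        fix M :: "nat \<Rightarrow> 'a^'n^'m" assume "range M \<subseteq> L"
        then have "\<forall>l. \<exists>u. M l = (\<Sum>a<d. mscale (u a) (b I a))" using span by blast
        then obtain c where c: "\<And>l. M l = (\<Sum>a<d. mscale (c l a) (b I a))" by metis
        have "M = (\<lambda>l. \<Sum>a<d. mscale (c l a) (b I a))" using c by auto
        then have "pluecker vs I * h e (entries M) = 0" if "e < N" for e
          using P[unfolded van, rule_format, of I e c] I that unfolding F_def gb by simp
        then show "f (entries M) = 0" unfolding h(2) using I by simp
      qed
    qed
  qed
  show ?thesis
    unfolding zariski_closed_def
  proof (intro exI[where x = P] conjI ballI)
    fix p assume "p \<in> P"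
    then show "\<exists>e. homogeneous_poly e p" using FP unfolding P_def by blast
  qed (use key in blast)
qed

section \<open>Irreducibility of the Fano variety\<close>

lemma independent_if_pluecker_nonzero:
  fixes vs :: "('a::field^'n^'m) list"
  assumes nz: "pluecker vs I \<noteq> 0"
  shows "distinct vs" "mspace.independent (set vs)"
proof -
  let ?d = "length vs"
  define W where "W = Matrix.mat ?d ?d (\<lambda>(a, b). (vs ! a) $ fst (I ! b) $ snd (I ! b))"
  have W: "Determinant.det W \<noteq> 0" "W \<in> carrier_mat ?d ?d"
    using nz by (auto simp: pluecker_def W_def split: if_splits)
  have ind: "u a = 0" if u: "(\<Sum>a<?d. mscale (u a) (vs ! a)) = 0" and a: "a < ?d" for u a
  proof (rule ccontr)
    assume ua: "u a \<noteq> 0"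
    let ?v = "Matrix.vec ?d u"
    have "transpose_mat W *\<^sub>v ?v = 0\<^sub>v ?d"
    proof (rule eq_vecI)
      fix b assume "b < dim_vec (0\<^sub>v ?d)"
      then have b: "b < ?d" by simp
      have "(\<Sum>a<?d. mscale (u a) (vs ! a)) $ fst (I ! b) $ snd (I ! b) = 0"
        unfolding u by simp
      then show "Matrix.vec_index (transpose_mat W *\<^sub>v ?v) b = Matrix.vec_index (0\<^sub>v ?d) b"
        using b by (simp add: W_def scalar_prod_def sum_nth_nth lessThan_atLeast0 mult.commute)
    qed (simp add: W_def)
    moreover have "?v \<noteq> 0\<^sub>v ?d"
    proof
      assume "?v = 0\<^sub>v ?d"
      then have "Matrix.vec_index ?v a = Matrix.vec_index (0\<^sub>v ?d) a" by simp
      then show False using a ua by simp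
    qed
    ultimately have "Determinant.det (transpose_mat W) = 0"
      using W(2) by (subst det_0_iff_vec_prod_zero[of _ ?d]) (auto intro!: exI[of _ ?v])
    then show False using W Determinant.det_transpose by metis
  qed
  show dist: "distinct vs"
  proof (rule ccontr)
    assume "\<not> distinct vs"
    then obtain a b where ab: "a < ?d" "b < ?d" "a \<noteq> b" "vs ! a = vs ! b"
      by (auto simp: distinct_conv_nth)
    define u where "u c = (if c = a then 1 else if c = b then -1 else 0 :: 'a)" for c
    have "(\<Sum>c<?d. mscale (u c) (vs ! c)) = mscale (u a) (vs ! a) + mscale (u b) (vs ! b)"
    proof -
      have "(\<Sum>c<?d. mscale (u c) (vs ! c)) = (\<Sum>c\<in>{a, b}. mscale (u c) (vs ! c))"
        using ab by (intro sum.mono_neutral_right) (auto simp: u_def)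
      then show ?thesis using ab by simp
    qed
    also have "\<dots> = 0" using ab by (simp add: u_def)
    finally show False using ind[of u a] ab by (simp add: u_def)
  qed
  show "mspace.independent (set vs)"
    unfolding mspace.dependent_finite[OF finite_set]
  proof (rule notI, elim exE conjE bexE)
    fix u v assume u: "(\<Sum>v\<in>set vs. mscale (u v) v) = 0" and v: "v \<in> set vs" "u v \<noteq> 0"
    have "bij_betw ((!) vs) {..<?d} (set vs)"
      using dist by (intro bij_betw_nth) auto
    from sum.reindex_bij_betw[OF this, of "\<lambda>v. mscale (u v) v"] u
    have "(\<Sum>a<?d. mscale (u (vs ! a)) (vs ! a)) = 0" by simp
    then show False using ind[of "\<lambda>a. u (vs ! a)"] v by (auto simp: in_set_conv_nth)
  qed
qed

lemma topspace_fano_space: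
  "topspace (fano_space k r :: ('a::alg_closed_field^'n^'n) set topology) =
     {L \<in> grassmannian (k + 1) symmetric_matrices. L \<subseteq> sym_det_cone r}"
  by (auto simp: fano_space_def topspace_subtopology)

text \<open>Nonempty open subsets of an irreducible space meet. This is how irreducibility is
  refuted later: two incompatible tests, each nonzero on some member.\<close>

lemma irreducible_fano_space_meet:
  fixes f g :: "(nat \<times> 'n::finite \<times> 'n \<Rightarrow> 'a::alg_closed_field) \<Rightarrow> 'a"
  assumes irr: "irreducible_space (fano_space k r :: ('a^'n^'n) set topology)"
    and f: "poly_fun f" and g: "poly_fun g"
    and L1: "L1 \<in> topspace (fano_space k r)" "\<not> vanishes_on f L1"
    and L2: "L2 \<in> topspace (fano_space k r)" "\<not> vanishes_on g L2"
  obtains L where "L \<in> topspace (fano_space k r)" "\<not> vanishes_on f L" "\<not> vanishes_on g L"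
proof -
  let ?X = "fano_space k r :: ('a^'n^'n) set topology"
  have cl: "closedin ?X {L \<in> topspace ?X. vanishes_on h L}" if "poly_fun h" for h
  proof -
    let ?T = "{L \<in> grassmannian (k + 1) symmetric_matrices. vanishes_on h L} :: ('a^'n^'n) set set"
    have "closedin (zariski_grassmannian (k + 1) symmetric_matrices) ?T"
      using zariski_closed_vanishes_on[OF that] by (simp only: closedin_zariski_grassmannian)
    moreover have "{L \<in> topspace ?X. vanishes_on h L} = ?T \<inter> {L. L \<subseteq> sym_det_cone r}"
      unfolding topspace_fano_space by blast
    ultimately show ?thesis unfolding fano_space_def closedin_subtopology by blast
  qed
  show ?thesis
  proof (rule ccontr)
    assume "\<not> thesis"
    then have "topspace ?X = {L \<in> topspace ?X. vanishes_on f L} \<union> {L \<in> topspace ?X. vanishes_on g L}"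
      using that by auto
    then have "{L \<in> topspace ?X. vanishes_on f L} = topspace ?X \<or>
        {L \<in> topspace ?X. vanishes_on g L} = topspace ?X"
      using irr cl[OF f] cl[OF g] unfolding irreducible_space_def by (simp only: conj_imp_eq_imp_imp)
    then show False using L1 L2 by auto
  qed
qed

lemma poly_fun_pluecker:
  "poly_fun (\<lambda>x. pluecker (map (\<lambda>a. \<chi> i j. x (a, i, j)) [0..<d]) I :: 'a::field)"
proof (cases "length I = d")
  case True
  have eq: "pluecker (map (\<lambda>a. \<chi> i j. x (a, i, j)) [0..<d]) I =
    Determinant.det (Matrix.mat d d (\<lambda>(a, b). x (a, fst (I ! b), snd (I ! b))))"
    for x :: "nat \<times> 'b \<times> 'c \<Rightarrow> 'a"
    unfolding pluecker_def using True
    by (auto intro!: arg_cong[where f = Determinant.det] eq_matI)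
  show ?thesis unfolding eq by (intro poly_fun_det_mat poly_fun.coord)
next
  case False
  then show ?thesis by (simp add: pluecker_def poly_fun.const)
qed

text \<open>Any two points are joined by a rational curve, so two proper closed subsets cannot cover.\<close>

lemma irreducible_fano_spaceI:
  fixes r k :: nat
  defines "F \<equiv> topspace (fano_space k r :: ('a::alg_closed_field^'n^'n) set topology)"
  assumes ne: "F \<noteq> {}"
    and curve: "\<And>L1 L2. L1 \<in> F \<Longrightarrow> L2 \<in> F \<Longrightarrow>
      \<exists>c D. ordered_basis L1 (map (\<lambda>a. \<chi> i j. poly (c (a, i, j)) 0) [0..<k + 1]) \<and>
        ordered_basis L2 (map (\<lambda>a. \<chi> i j. poly (c (a, i, j)) 1) [0..<k + 1]) \<and> D \<noteq> 0 \<and>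
        (\<forall>t. poly D t \<noteq> 0 \<longrightarrow>
          mspace.span (set (map (\<lambda>a. \<chi> i j. poly (c (a, i, j)) t) [0..<k + 1])) \<subseteq> sym_det_cone r)"
  shows "irreducible_space (fano_space k r :: ('a^'n^'n) set topology)"
  unfolding irreducible_space_def
proof (intro conjI allI impI)
  let ?X = "fano_space k r :: ('a^'n^'n) set topology"
  show "topspace ?X \<noteq> {}" using ne by (simp add: F_def)
  fix C D assume CD: "closedin ?X C \<and> closedin ?X D \<and> topspace ?X = C \<union> D"
  have sep: "\<exists>p e. homogeneous_poly e p \<and> \<not> vanishes_at p L \<and> (\<forall>L'\<in>C. vanishes_at p L')"
    if C: "closedin ?X C" and L: "L \<in> F" "L \<notin> C" for C L
  proof -
    obtain T where T: "zariski_closed (k + 1) symmetric_matrices T" "C = T \<inter> {L. L \<subseteq> sym_det_cone r}"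
      using C unfolding fano_space_def closedin_subtopology closedin_zariski_grassmannian by auto
    then obtain P where P: "\<forall>p\<in>P. \<exists>e. homogeneous_poly e p"
      "T = {L \<in> grassmannian (k + 1) symmetric_matrices. \<forall>p\<in>P. vanishes_at p L}"
      unfolding zariski_closed_def by auto
    show ?thesis using L T(2) P unfolding F_def topspace_fano_space by blast
  qed
  show "C = topspace ?X \<or> D = topspace ?X"
  proof (rule ccontr)
    assume "\<not> ?thesis"
    then obtain L1 L2 where L: "L1 \<in> F" "L1 \<notin> C" "L2 \<in> F" "L2 \<notin> D"
      using CD unfolding F_def by blast
    obtain p1 e1 where p1: "homogeneous_poly e1 p1" "\<not> vanishes_at p1 L1" "\<forall>L'\<in>C. vanishes_at p1 L'"
      using sep[of C L1] CD L by blast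
    obtain p2 e2 where p2: "homogeneous_poly e2 p2" "\<not> vanishes_at p2 L2" "\<forall>L'\<in>D. vanishes_at p2 L'"
      using sep[of D L2] CD L by blast
    obtain c Q where cQ: "ordered_basis L1 (map (\<lambda>a. \<chi> i j. poly (c (a, i, j)) 0) [0..<k + 1])"
      "ordered_basis L2 (map (\<lambda>a. \<chi> i j. poly (c (a, i, j)) 1) [0..<k + 1])" "Q \<noteq> 0"
      "\<And>t. poly Q t \<noteq> 0 \<Longrightarrow>
          mspace.span (set (map (\<lambda>a. \<chi> i j. poly (c (a, i, j)) t) [0..<k + 1])) \<subseteq> sym_det_cone r"
      using curve[OF L(1,3)] by metis
    define vs where "vs t = map (\<lambda>a. \<chi> i j. poly (c (a, i, j)) t) [0..<k + 1]" for t
    note cQ = cQ[folded vs_def]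
    have pc: "\<exists>q. \<forall>t. p (pluecker (vs t)) = poly q t" if "poly_fun p" for p :: "(('n \<times> 'n) list \<Rightarrow> 'a) \<Rightarrow> 'a"
      using poly_fun_curve[OF poly_fun_subst[OF that poly_fun_pluecker[where d = "k + 1"]], of c]
      by (simp add: vs_def)
    obtain q1 where q1: "\<And>t. p1 (pluecker (vs t)) = poly q1 t"
      using pc[OF homogeneous_poly_poly_fun[OF p1(1)]] by auto
    obtain q2 where q2: "\<And>t. p2 (pluecker (vs t)) = poly q2 t"
      using pc[OF homogeneous_poly_poly_fun[OF p2(1)]] by auto
    \<comment> \<open>A coordinate that is nonzero at parameter 0 stays nonzero at a general
      parameter. It keeps the matrices on the curve independent, so that their span is again a point
      of the space.\<close>
    obtain I where I: "pluecker (vs 0) I \<noteq> 0"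
      using exists_pluecker_nonzero cQ(1) unfolding ordered_basis_def by blast
    obtain q3 where q3: "\<And>t. pluecker (vs t) I = poly q3 t"
      using pc[OF poly_fun.coord[of I]] by auto
    have "poly q1 0 \<noteq> 0" using p1 cQ(1) q1[of 0] vanishes_at_iff by metis
    moreover have "poly q2 1 \<noteq> 0" using p2 cQ(2) q2[of 1] vanishes_at_iff by metis
    moreover have "poly q3 0 \<noteq> 0" using I q3 by metis
    ultimately have "0 \<notin> {q1, q2, q3, Q}" using cQ(3) by auto
    then obtain t where t: "\<And>p. p \<in> {q1, q2, q3, Q} \<Longrightarrow> poly p t \<noteq> 0"
      using common_nonzero_point[of "{q1, q2, q3, Q}" "{}"] by auto
    have nz: "pluecker (vs t) I \<noteq> 0" using t q3 by simp
    define L where "L = mspace.span (set (vs t))"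
    have ob: "ordered_basis L (vs t)"
      using independent_if_pluecker_nonzero[OF nz] by (simp add: ordered_basis_def L_def)
    have cone: "L \<subseteq> sym_det_cone r" using cQ(4) t by (simp add: L_def)
    have "mspace.dim L = k + 1"
      using independent_if_pluecker_nonzero[OF nz] distinct_card[of "vs t"]
        mspace.dim_span_eq_card_independent[of "set (vs t)"]
      by (simp add: L_def vs_def)
    then have LF: "L \<in> F"
      using cone unfolding F_def topspace_fano_space grassmannian_def
      by (auto simp: L_def sym_det_cone_def)
    then have "L \<in> C \<or> L \<in> D" using CD by (auto simp: F_def)
    then show False
      using p1(3) p2(3) vanishes_at_iff[OF p1(1) ob] vanishes_at_iff[OF p2(1) ob] q1 q2 t by auto
  qed
qed

section \<open>Linear algebra over a field\<close>

lemma (in finite_dimensional_vector_space_pair_1) dim_image_kernel: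
  assumes f: "Vector_Spaces.linear s1 s2 f" and S: "vs1.subspace S"
  shows "vs1.dim S = vs2.dim (f ` S) + vs1.dim {x \<in> S. f x = 0}"
proof -
  interpret lf: Vector_Spaces.linear s1 s2 f by fact
  let ?K = "{x \<in> S. f x = 0}"
  obtain B where B: "B \<subseteq> ?K" "vs1.independent B" "?K \<subseteq> vs1.span B" "card B = vs1.dim ?K"
    using vs1.basis_exists[of ?K] by auto
  obtain C where C: "B \<subseteq> C" "C \<subseteq> S" "vs1.independent C" "S \<subseteq> vs1.span C"
    using vs1.maximal_independent_subset_extend[of B S] B by blast
  have fin: "finite C" using C(3) by (rule vs1.finiteI_independent)
  have span: "vs1.span C = S"
    using C S by (metis vs1.span_minimal subset_antisym)
  have dimS: "vs1.dim S = card C"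
    using C vs1.dim_eq_card_independent[of C] vs1.dim_span[of C] span by simp
  have KS: "vs1.subspace ?K"
    using S by (auto simp: vs1.subspace_def lf.add lf.scale)
  have spanB: "vs1.span B = ?K"
    using B KS by (metis vs1.span_minimal subset_antisym)
  have indD: "vs1.independent (C - B)" "vs1.independent B"
    using vs1.independent_mono[OF C(3)] C(1) by auto
  have int0: "vs1.span (C - B) \<inter> vs1.span B \<subseteq> {0}"
  proof -
    have "{x + y |x y. x \<in> vs1.span (C - B) \<and> y \<in> vs1.span B} = vs1.span C"
      using vs1.span_Un[of "C - B" B] C(1) by (auto simp: Un_absorb2)
    then have "vs1.dim (vs1.span C) + vs1.dim (vs1.span (C - B) \<inter> vs1.span B)
        = vs1.dim (vs1.span (C - B)) + vs1.dim (vs1.span B)"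
      using vs1.dim_sums_Int[of "vs1.span (C - B)" "vs1.span B"] by simp
    then have "card C + vs1.dim (vs1.span (C - B) \<inter> vs1.span B) = card (C - B) + card B"
      using indD C(3) by (simp add: vs1.dim_span_eq_card_independent del: vs1.dim_span)
    then have "vs1.dim (vs1.span (C - B) \<inter> vs1.span B) = 0"
      using C(1) fin card_mono[OF fin C(1)] by (simp add: card_Diff_subset finite_subset)
    then show ?thesis by (simp only: vs1.dim_eq_0)
  qed
  have inj: "inj_on f (vs1.span (C - B))"
  proof (rule inj_onI)
    fix x y assume xy: "x \<in> vs1.span (C - B)" "y \<in> vs1.span (C - B)" "f x = f y"
    have d: "x - y \<in> vs1.span (C - B)" using xy by (simp add: vs1.span_diff)
    moreover have "x - y \<in> vs1.span C" using d vs1.span_mono[of "C - B" C] by auto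
    ultimately have "x - y \<in> vs1.span (C - B) \<inter> vs1.span B"
      using xy span spanB by (auto simp: lf.diff)
    then show "x = y" using int0 by auto
  qed
  have "vs2.dim (f ` S) = vs2.dim (f ` (C - B))"
  proof -
    have "f ` S = vs2.span (f ` C)" using span lf.span_image[of C] by simp
    also have "\<dots> = vs2.span (f ` (C - B))"
    proof (rule subset_antisym)
      have "f c \<in> vs2.span (f ` (C - B))" if "c \<in> C" for c
      proof (cases "c \<in> B")
        case True
        then have "f c = 0" using B by auto
        then show ?thesis by (simp add: vs2.span_zero)
      next
        case False
        then show ?thesis using that by (intro vs2.span_base) auto
      qed
      then have "f ` C \<subseteq> vs2.span (f ` (C - B))" by auto
      then show "vs2.span (f ` C) \<subseteq> vs2.span (f ` (C - B))"
        by (simp add: vs2.span_minimal)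
    qed (intro vs2.span_mono, auto)
    finally show ?thesis by simp
  qed
  also have "\<dots> = card (C - B)"
    using dim_image_eq[OF f inj] vs1.dim_eq_card_independent[OF indD(1)] by simp
  also have "\<dots> = card C - card B" using C fin by (simp add: card_Diff_subset finite_subset)
  finally show ?thesis
    using dimS B(4) card_mono[OF fin C(1)] by simp
qed

notation scalar_product (infixl \<open>\<odot>\<close> 68)

lemma dot_simps [simp]:
  fixes u v w :: "'a::field^'n"
  shows "(u + v) \<odot> w = u \<odot> w + v \<odot> w" "w \<odot> (u + v) = w \<odot> u + w \<odot> v"
    "(u - v) \<odot> w = u \<odot> w - v \<odot> w" "w \<odot> (u - v) = w \<odot> u - w \<odot> v"
    "(- u) \<odot> w = - (u \<odot> w)" "w \<odot> (- u) = - (w \<odot> u)"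
    "(c *s u) \<odot> w = c * (u \<odot> w)" "w \<odot> (c *s u) = c * (w \<odot> u)"
    "0 \<odot> w = 0" "w \<odot> 0 = 0" "axis i 1 \<odot> w = w $ i" "w \<odot> axis i 1 = w $ i"
  by (simp_all add: scalar_product_def algebra_simps sum.distrib sum_subtractf sum_negf
      sum_distrib_left axis_def if_distrib[of "\<lambda>x. x * _"] if_distrib[of "\<lambda>x. _ * x"] cong: if_cong)

lemma dot_commute: "u \<odot> v = v \<odot> (u :: 'a::field^'n)"
  by (simp add: scalar_product_def mult.commute)

lemma dot_matrix: "u \<odot> (A *v v) = (transpose A *v u) \<odot> (v :: 'a::field^'n)"
proof -
  have "u \<odot> (A *v v) = (\<Sum>i\<in>UNIV. \<Sum>j\<in>UNIV. u $ i * (A $ i $ j * v $ j))"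
    by (simp add: scalar_product_def matrix_vector_mult_def sum_distrib_left)
  also have "\<dots> = (\<Sum>j\<in>UNIV. \<Sum>i\<in>UNIV. u $ i * (A $ i $ j * v $ j))"
    by (rule sum.swap)
  also have "\<dots> = (\<chi> j. \<Sum>i\<in>UNIV. A $ i $ j * u $ i) \<odot> v"
    by (simp add: scalar_product_def sum_distrib_left sum_distrib_right mult_ac)
  also have "(\<chi> j. \<Sum>i\<in>UNIV. A $ i $ j * u $ i) = transpose A *v u"
    by (simp add: matrix_vector_mult_def transpose_def del: transpose_matrix_vector)
  finally show ?thesis .
qed

lemma dot_symmetric_matrix:
  "transpose A = A \<Longrightarrow> u \<odot> (A *v v) = (A *v u) \<odot> (v :: 'a::field^'n)"
  using dot_matrix[of u A v] by metis

lemma dot_symmetric_matrix_swap: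
  "transpose A = A \<Longrightarrow> u \<odot> (A *v v) = v \<odot> (A *v (u :: 'a::field^'n))"
  using dot_symmetric_matrix[of A u v] dot_commute by metis

definition perp :: "('a::field^'n) set \<Rightarrow> ('a^'n) set" where
  "perp S = {y. \<forall>x\<in>S. x \<odot> y = 0}"

lemma subspace_perp: "vec.subspace (perp S)"
  by (auto simp: perp_def vec.subspace_def)

lemma perp_span: "perp (vec.span S) = perp S"
proof
  show "perp (vec.span S) \<subseteq> perp S" by (auto simp: perp_def vec.span_base)
  show "perp S \<subseteq> perp (vec.span S)"
  proof (clarsimp simp: perp_def)
    fix y x assume y: "\<forall>x\<in>S. x \<odot> y = 0" and x: "x \<in> vec.span S"
    show "x \<odot> y = 0" using x
      by (induction rule: vec.span_induct_alt) (use y in auto)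
  qed
qed

text \<open>Over a general field \<open>perp S\<close> may meet the span of \<open>S\<close>, so
  only the dimensions are complementary. If the rows of \<open>P\<close> are a basis of the whole
  space extending one of the span of \<open>S\<close>, then \<open>P\<close> carries
  \<open>perp S\<close> onto a coordinate subspace.\<close>

lemma dim_perp: "vec.dim (perp S) + vec.dim S = CARD('n)" for S :: "('a::field^'n) set"
proof -
  obtain B where B: "B \<subseteq> S" "vec.independent B" "S \<subseteq> vec.span B" "card B = vec.dim S"
    using vec.basis_exists by metis
  obtain C where C: "B \<subseteq> C" "C \<subseteq> UNIV" "vec.independent C" "UNIV \<subseteq> vec.span C"
    using vec.maximal_independent_subset_extend[of B UNIV] B by blast
  have fin: "finite C" using C(3) by (rule vec.finiteI_independent)
  have card: "card C = CARD('n)"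
    using vec.dim_eq_card_independent[OF C(3)] vec.dim_span[of C] C(4) vec_dim_card
    by (metis top.extremum_unique)
  then obtain e where e: "bij_betw e (UNIV :: 'n set) C"
    using finite_same_card_bij[of "UNIV :: 'n set" C] fin by auto
  define P where "P = (\<chi> i j. e i $ j)"
  have P: "(P *v y) $ i = e i \<odot> y" for y i
    by (simp add: P_def matrix_vector_mult_def scalar_product_def)
  have inj: "inj ((*v) P)"
  proof (rule injI)
    fix x y assume "P *v x = P *v y"
    then have "e i \<odot> (x - y) = 0" for i using P[of x i] P[of y i] by simp
    then have "x - y \<in> perp C" using e by (auto simp: perp_def bij_betw_def)
    then have "x - y \<in> perp UNIV" using perp_span[of C] C(4) by (simp add: top.extremum_unique)
    then have "(x - y) $ i = 0" for i
      using dot_simps(11)[of i "x - y"] unfolding perp_def by auto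
    then show "x = y" by (simp add: Finite_Cartesian_Product.vec_eq_iff)
  qed
  have surj: "surj ((*v) P)"
    using vec.linear_inj_imp_surj[OF matrix_vector_mul_linear_gen inj] .
  have spanBS: "perp B = perp S"
    using B perp_span by (metis (no_types, lifting) vec.span_eq vec.span_superset order_trans)
  have "(*v) P ` perp S = {x. \<forall>i. i \<notin> {i. e i \<notin> B} \<longrightarrow> x $ i = 0}"
  proof -
    have mem: "y \<in> perp S \<longleftrightarrow> (\<forall>i. e i \<in> B \<longrightarrow> (P *v y) $ i = 0)" for y
    proof -
      have "y \<in> perp S \<longleftrightarrow> (\<forall>b\<in>B. b \<odot> y = 0)" using spanBS by (auto simp: perp_def)
      also have "\<dots> \<longleftrightarrow> (\<forall>i. e i \<in> B \<longrightarrow> e i \<odot> y = 0)"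
        using e C(1) unfolding bij_betw_def by blast
      finally show ?thesis by (simp only: P)
    qed
    show ?thesis
    proof (intro subset_antisym subsetI)
      fix x :: "'a^'n" assume x: "x \<in> {x. \<forall>i. i \<notin> {i. e i \<notin> B} \<longrightarrow> x $ i = 0}"
      obtain y where "x = P *v y" using surj by blast
      then show "x \<in> (*v) P ` perp S" using x mem[of y] by auto
    qed (use mem in auto)
  qed
  then have "vec.dim ((*v) P ` perp S) = card {i. e i \<notin> B}"
    by (simp only: dim_substandard_cart)
  moreover have "vec.dim ((*v) P ` perp S) = vec.dim (perp S)"
    by (rule vec.dim_image_eq) (use inj in \<open>auto intro: inj_on_subset\<close>)
  moreover have "card {i. e i \<notin> B} = CARD('n) - card B"
  proof -
    have "bij_betw e {i. e i \<notin> B} (C - B)"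
      using e by (auto simp: bij_betw_def inj_on_def)
    then show ?thesis
      using bij_betw_same_card card C(1) fin by (metis card_Diff_subset finite_subset)
  qed
  moreover have "card B \<le> CARD('n)" using card_mono[OF fin C(1)] card by simp
  ultimately show ?thesis using B(4) by simp
qed

lemma dim_kernel: "vec.dim {v. A *v v = 0} + rank A = CARD('n)" for A :: "'a::field^'n^'n"
proof -
  have "{v. A *v v = 0} = perp (Finite_Cartesian_Product.rows A)"
    by (auto simp: perp_def Finite_Cartesian_Product.rows_def Finite_Cartesian_Product.row_def
        scalar_product_def matrix_vector_mult_def Finite_Cartesian_Product.vec_eq_iff)
  then show ?thesis using dim_perp[of "Finite_Cartesian_Product.rows A"] by (simp add: row_rank_def_gen)
qed

lemma subspace_kernel: "vec.subspace {v. A *v v = 0}"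
  by (auto simp: vec.subspace_def matrix_vector_right_distrib vec.scale)

lemma rank_le_card: "rank A \<le> CARD('n)" for A :: "'a::field^'n^'n"
  using dim_kernel[of A] by simp

lemma dim_range: "vec.dim (range ((*v) A)) = rank A" for A :: "'a::field^'n^'n"
proof -
  have "CARD('n) = vec.dim (range ((*v) A)) + vec.dim {x. A *v x = 0}"
    using vec.dim_image_kernel[OF matrix_vector_mul_linear_gen vec.subspace_UNIV, of A]
    unfolding vec_dim_card by simp
  then show ?thesis using dim_kernel[of A] by linarith
qed

lemma det_nonzero_iff_inj: "det A \<noteq> 0 \<longleftrightarrow> (\<forall>v. A *v v = 0 \<longrightarrow> v = 0)" for A :: "'a::field^'n^'n"
  unfolding invertible_det_nz[symmetric] invertible_left_inverse matrix_left_invertible_ker ..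

lemma det_nonzero_surj: "det A \<noteq> 0 \<Longrightarrow> \<exists>v. A *v v = w" for A :: "'a::field^'n^'n"
  using cramer by blast

lemma det_nonzero_iff_rank: "det A \<noteq> 0 \<longleftrightarrow> rank A = CARD('n)" for A :: "'a::field^'n^'n"
proof -
  have "rank A = CARD('n) \<longleftrightarrow> vec.dim {v. A *v v = 0} = 0" using dim_kernel[of A] by linarith
  then show ?thesis unfolding det_nonzero_iff_inj vec.dim_eq_0 by auto
qed

lemma det_add_eq_0:
  fixes A X :: "'a::field^'n^'n"
  assumes "rank A + rank X < CARD('n)"
  shows "det (A + X) = 0"
proof (rule ccontr)
  assume "det (A + X) \<noteq> 0"
  then have inj: "inj ((*v) (A + X))"
    by (intro inj_matrix_vector_mult) (simp add: invertible_det_nz)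
  let ?K = "{v. A *v v = 0}"
  have "vec.dim ((*v) (A + X) ` ?K) = vec.dim ?K"
    by (rule vec.dim_image_eq) (use inj in \<open>auto intro: inj_on_subset\<close>)
  moreover have "(*v) (A + X) ` ?K \<subseteq> range ((*v) X)"
    by (auto simp: matrix_vector_mult_add_rdistrib)
  ultimately have "vec.dim ?K \<le> rank X"
    using vec.dim_subset[of "(*v) (A + X) ` ?K" "range ((*v) X)"] by (simp add: dim_range)
  then show False using dim_kernel[of A] assms by simp
qed

lemma rank_add_le: "rank (A + B) \<le> rank A + rank B" for A B :: "'a::field^'n^'n"
proof -
  let ?S = "{x + y |x y. x \<in> range ((*v) A) \<and> y \<in> range ((*v) B)}"
  have "range ((*v) (A + B)) \<subseteq> ?S" by (auto simp: matrix_vector_mult_add_rdistrib)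
  then have "rank (A + B) \<le> vec.dim ?S"
    unfolding dim_range[of "A + B", symmetric] by (rule vec.dim_subset)
  also have "\<dots> \<le> rank A + rank B"
    using vec.dim_sums_Int[of "range ((*v) A)" "range ((*v) B)"]
    by (simp add: dim_range vec.subspace_image)
  finally show ?thesis .
qed

text \<open>\<open>D\<close> maps a basis of the kernel onto a basis of a complement of the range.
  It encodes a rank bound in one polynomial: \<open>det (A + D)\<close> is nonzero, while
  \<open>det (N + D)\<close> is 0 for every \<open>N\<close> of smaller rank than \<open>A\<close>,
  by \<open>det_add_eq_0\<close>.\<close>

lemma exists_complementary_matrix:
  fixes A :: "'a::field^'n^'n"
  obtains D where "det (A + D) \<noteq> 0" "rank D = CARD('n) - rank A"
proof -
  let ?K = "{v. A *v v = 0}"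
  obtain B where B: "B \<subseteq> ?K" "vec.independent B" "?K \<subseteq> vec.span B" "card B = vec.dim ?K"
    using vec.basis_exists by metis
  obtain C where C: "B \<subseteq> C" "C \<subseteq> UNIV" "vec.independent C" "UNIV \<subseteq> vec.span C"
    using vec.maximal_independent_subset_extend[of B UNIV] B by blast
  obtain E where E: "E \<subseteq> range ((*v) A)" "vec.independent E" "range ((*v) A) \<subseteq> vec.span E" "card E = rank A"
    using vec.basis_exists[of "range ((*v) A)"] unfolding dim_range by metis
  obtain G where G: "E \<subseteq> G" "G \<subseteq> UNIV" "vec.independent G" "UNIV \<subseteq> vec.span G"
    using vec.maximal_independent_subset_extend[of E UNIV] E by blast
  have finG: "finite G" using G(3) by (rule vec.finiteI_independent)
  have finB: "finite B" using B(2) by (rule vec.finiteI_independent)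
  have cardG: "card G = CARD('n)"
    using vec.dim_eq_card_independent[OF G(3)] vec.dim_span[of G] G(4) vec_dim_card
    by (metis top.extremum_unique)
  have card: "card (G - E) = card B"
    using card_Diff_subset[OF finite_subset[OF G(1) finG] G(1)] cardG E(4) B(4) dim_kernel[of A] by simp
  then obtain e where e: "bij_betw e B (G - E)"
    using finite_same_card_bij[of B "G - E"] finB finG by auto
  define f where "f = vec.construct C (\<lambda>c. if c \<in> B then e c else 0)"
  have lf: "Vector_Spaces.linear (*s) (*s) f"
    unfolding f_def by (rule vec.linear_construct[OF C(3)])
  have fb: "f c = (if c \<in> B then e c else 0)" if "c \<in> C" for c
    unfolding f_def by (rule vec.construct_basis[OF C(3) that])
  define D where "D = matrix f"
  have D: "D *v v = f v" for v
    unfolding D_def by (rule matrix_works[OF lf])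
  have rangeD: "range ((*v) D) \<subseteq> vec.span (G - E)"
  proof -
    have "f v \<in> vec.span (f ` C)" for v
      using C(4) vec.linear_spans_image[OF lf, of "{v}" C] by auto
    moreover have "f ` C \<subseteq> insert 0 (G - E)" using fb e by (auto simp: bij_betw_def)
    ultimately have "f v \<in> vec.span (insert 0 (G - E))" for v
      using vec.span_mono by blast
    then show ?thesis unfolding D by (auto simp: vec.span_insert_0)
  qed
  have rankD: "rank D \<le> card B"
  proof -
    have "vec.dim (range ((*v) D)) \<le> card (G - E)"
      by (rule vec.dim_le_card[OF rangeD]) (use finG in simp)
    then show ?thesis using card by (simp add: dim_range)
  qed
  have surj: "w \<in> range ((*v) (A + D))" for w
  proof -
    have "G \<subseteq> range ((*v) (A + D))"
    proof -
      have 1: "g \<in> range ((*v) (A + D))" if "g \<in> G - E" for g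
      proof -
        have "g \<in> e ` B" using that e by (simp only: bij_betw_def)
        then obtain b where b: "b \<in> B" "e b = g" by (elim imageE) simp
        have "A *v b = 0" using b(1) B(1) by blast
        moreover have "f b = g" using b C(1) fb[of b] by auto
        ultimately have "(A + D) *v b = g"
          by (simp add: matrix_vector_mult_add_rdistrib D)
        then show ?thesis by auto
      qed
      then have sub: "vec.span (G - E) \<subseteq> range ((*v) (A + D))"
        by (intro vec.span_minimal vec.subspace_image) auto
      have "g \<in> range ((*v) (A + D))" if "g \<in> E" for g
      proof -
        have "g \<in> range ((*v) A)" using that E(1) by (rule rev_subsetD)
        then obtain v where v: "g = A *v v" by (elim rangeE)
        have "D *v v \<in> range ((*v) (A + D))" using rangeD sub by auto
        then obtain u where "(A + D) *v u = D *v v" by auto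
        then have "(A + D) *v (v - u) = g"
          by (simp add: v matrix_vector_mult_diff_distrib matrix_vector_mult_add_rdistrib)
        then show ?thesis by (metis rangeI)
      qed
      then show ?thesis using 1 by auto
    qed
    then have "vec.span G \<subseteq> range ((*v) (A + D))"
      by (intro vec.span_minimal vec.subspace_image) auto
    then show ?thesis using G(4) by auto
  qed
  then have "range ((*v) (A + D)) = UNIV" by auto
  then have full: "rank (A + D) = CARD('n)"
    using dim_range[of "A + D"] vec_dim_card by metis
  then have "rank D = CARD('n) - rank A"
    using rank_add_le[of A D] rankD B(4) dim_kernel[of A] by simp
  then show thesis using that full det_nonzero_iff_rank by blast
qed

lemma rank_congruence:
  fixes A g :: "'a::field^'n^'n"
  assumes "invertible g"
  shows "rank (g ** A ** transpose g) = rank A"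
proof -
  have le: "rank A \<le> rank (g ** A ** transpose g)" if "invertible g" for A g :: "'a^'n^'n"
  proof -
    let ?h = "transpose g"
    have h: "invertible ?h" using that by (simp add: invertible_det_nz)
    have injg: "g *v v = 0 \<longleftrightarrow> v = 0" for v
      using that invertible_det_nz det_nonzero_iff_inj matrix_vector_mult_0_right by metis
    have injh: "inj ((*v) ?h)" using h by (rule inj_matrix_vector_mult)
    have "(*v) ?h ` {v. (g ** A ** ?h) *v v = 0} \<subseteq> {v. A *v v = 0}"
      using injg by (auto simp: matrix_vector_mul_assoc[symmetric] simp del: transpose_matrix_vector)
    then have "vec.dim ((*v) ?h ` {v. (g ** A ** ?h) *v v = 0}) \<le> vec.dim {v. A *v v = 0}"
      by (rule vec.dim_subset)
    moreover have "vec.dim ((*v) ?h ` {v. (g ** A ** ?h) *v v = 0}) = vec.dim {v. (g ** A ** ?h) *v v = 0}"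
      by (rule vec.dim_image_eq[OF matrix_vector_mul_linear_gen]) (use injh in \<open>auto intro: inj_on_subset\<close>)
    ultimately show ?thesis
      using dim_kernel[of A] dim_kernel[of "g ** A ** ?h"] by simp
  qed
  obtain h where h: "g ** h = mat 1" "h ** g = mat 1"
    using assms unfolding invertible_def by auto
  then have "invertible h" unfolding invertible_def by auto
  from le[OF this, of "g ** A ** transpose g"]
  have "rank (g ** A ** transpose g) \<le> rank (h ** (g ** A ** transpose g) ** transpose h)" .
  also have "h ** (g ** A ** transpose g) ** transpose h = (h ** g) ** A ** transpose (h ** g)"
    by (simp add: matrix_mul_assoc matrix_transpose_mul)
  also have "\<dots> = A" by (simp add: h transpose_mat)
  finally show ?thesis using le[OF assms, of A] by simp
qed

section \<open>Kernel vectors of linear matrix pencils\<close>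

lemma poly_det: "poly (det P) t = det (\<chi> i j. poly (P $ i $ j) t)" for P :: "'a::comm_ring_1 poly^'n^'n"
  by (simp add: Determinants.det_def poly_sum poly_prod)

lemma poly_eq_if_eq_generically:
  fixes p q d :: "'a::alg_closed_field poly"
  assumes "d \<noteq> 0" "\<And>t. poly d t \<noteq> 0 \<Longrightarrow> poly p t = poly q t"
  shows "p = q"
proof -
  have "poly (d * (p - q)) t = 0" for t using assms(2)[of t] by auto
  then have "d * (p - q) = 0"
    using poly_zero_if_infinite_zeros[of "d * (p - q)"] infinite_alg_closed by simp
  then show ?thesis using assms(1) by simp
qed

text \<open>Cramer's rule holds at every parameter where \<open>det P\<close> is nonzero, which
  suffices for an identity of polynomials.\<close>

lemma poly_cramer:
  fixes P :: "'a::alg_closed_field poly^'n^'n"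
  obtains y where "P *v y = det P *s b"
proof (cases "det P = 0")
  case True
  then show thesis using that[of 0] by simp
next
  case nz: False
  define y where "y = (\<chi> k. det (\<chi> i j. if j = k then b $ i else P $ i $ j))"
  have "(P *v y) $ i = det P * b $ i" for i
  proof (rule poly_eq_if_eq_generically[OF nz])
    fix t assume t: "poly (det P) t \<noteq> 0"
    define Q where "Q = (\<chi> i j. poly (P $ i $ j) t)"
    define c where "c = (\<chi> i. poly (b $ i) t)"
    define x where "x = (\<chi> k. det (\<chi> i j. if j = k then c $ i else Q $ i $ j) / det Q)"
    have Q: "det Q \<noteq> 0" using t by (simp add: poly_det Q_def)
    then have "Q *v x = c" using cramer[OF Q, of x c] by (simp add: x_def)
    have "poly (y $ k) t = det Q * x $ k" for k
      unfolding y_def x_def using Q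
      by (simp add: poly_det c_def Q_def if_distrib[of "\<lambda>p. poly p t"] cong: if_cong)
    then have "poly ((P *v y) $ i) t = (\<Sum>j\<in>UNIV. det Q * (Q $ i $ j * x $ j))"
      by (simp add: matrix_vector_mult_def poly_sum Q_def mult.left_commute)
    also have "\<dots> = det Q * (Q *v x) $ i"
      by (simp add: matrix_vector_mult_def sum_distrib_left)
    finally have "poly ((P *v y) $ i) t = det Q * c $ i" using \<open>Q *v x = c\<close> by simp
    then show "poly ((P *v y) $ i) t = poly (det P * b $ i) t"
      by (simp add: poly_det Q_def c_def)
  qed
  then have "P *v y = det P *s b" by (simp add: Finite_Cartesian_Product.vec_eq_iff)
  then show thesis by (rule that)
qed

text \<open>A kernel vector of a member of maximal rank on the line \<open>x + t Z\<close> extends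
  to a kernel vector that is polynomial in \<open>t\<close>; the recursion compares coefficients.
  The extension solves \<open>(x + t Z + D) y = \<delta> D v\<close>. For general \<open>t\<close>
  the matrix \<open>D\<close> maps the kernel of \<open>x + t Z\<close> injectively into its range,
  hence onto it by the rank bound, so that the solution lies in this kernel.\<close>

lemma kernel_power_series:
  fixes x Z :: "'a::alg_closed_field^'n^'n"
  assumes rk: "\<And>t. rank (x + mscale t Z) \<le> rank x" and v: "x *v v = 0"
  obtains \<zeta> where "\<zeta> 0 = v" "\<And>i. x *v \<zeta> (Suc i) = - (Z *v \<zeta> i)"
proof -
  obtain D where D: "det (x + D) \<noteq> 0" "rank D = CARD('n) - rank x"
    using exists_complementary_matrix by blast
  define P where "P = (\<chi> i j. [:x $ i $ j + D $ i $ j, Z $ i $ j:])"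
  define b where "b = (\<chi> i. [:(D *v v) $ i:])"
  define \<delta> where "\<delta> = det P"
  have Pt: "(\<chi> i j. poly (P $ i $ j) t) = x + mscale t Z + D" for t
    by (simp add: P_def Finite_Cartesian_Product.vec_eq_iff algebra_simps)
  have \<delta>t: "poly \<delta> t = det (x + mscale t Z + D)" for t
    unfolding \<delta>_def poly_det Pt ..
  have \<delta>0: "poly \<delta> 0 \<noteq> 0"
  proof -
    have "x + mscale 0 Z + D = x + D" by (simp add: Finite_Cartesian_Product.vec_eq_iff)
    then show ?thesis using D \<delta>t[of 0] by simp
  qed
  then have \<delta>nz: "\<delta> \<noteq> 0" by auto
  obtain y where y: "P *v y = \<delta> *s b" unfolding \<delta>_def by (rule poly_cramer)
  define yt where "yt t = (\<chi> i. poly (y $ i) t)" for t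
  have yt: "(x + mscale t Z + D) *v yt t = poly \<delta> t *s (D *v v)" for t
  proof -
    have "poly ((P *v y) $ i) t = poly ((\<delta> *s b) $ i) t" for i using y by simp
    then show ?thesis
      by (simp add: Finite_Cartesian_Product.vec_eq_iff matrix_vector_mult_def poly_sum yt_def b_def
          P_def algebra_simps)
  qed
  have ker: "(x + mscale t Z) *v yt t = 0" if t: "poly \<delta> t \<noteq> 0" for t
  proof -
    let ?X = "x + mscale t Z"
    let ?K = "{v. ?X *v v = 0}"
    have inj: "inj ((*v) (?X + D))"
      using t unfolding \<delta>t by (intro inj_matrix_vector_mult) (simp add: invertible_det_nz)
    have DK: "(*v) D ` ?K = (*v) (?X + D) ` ?K"
      by (intro image_cong refl) (auto simp: matrix_vector_mult_add_rdistrib)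
    have "vec.dim ((*v) D ` ?K) = vec.dim ?K"
      unfolding DK by (rule vec.dim_image_eq[OF matrix_vector_mul_linear_gen])
        (use inj in \<open>auto intro: inj_on_subset\<close>)
    then have "vec.dim (range ((*v) D)) \<le> vec.dim ((*v) D ` ?K)"
      using dim_kernel[of ?X] rk[of t] D(2) by (simp add: dim_range)
    then have "(*v) D ` ?K = range ((*v) D)"
      by (intro vec.subspace_dim_equal) (auto intro!: vec.subspace_image simp: subspace_kernel)
    then have "D *v v \<in> (*v) D ` ?K" by (simp only: rangeI)
    then obtain u where u: "u \<in> ?K" "D *v v = D *v u" by (elim imageE)
    have Xu: "?X *v u = 0" using u(1) by (rule CollectD)
    have "(?X + D) *v (poly \<delta> t *s u) = poly \<delta> t *s ((?X + D) *v u)"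
      by (rule vec.scale)
    also have "(?X + D) *v u = D *v v"
      unfolding u(2) matrix_vector_mult_add_rdistrib[of ?X] Xu by simp
    finally have "(?X + D) *v (poly \<delta> t *s u) = poly \<delta> t *s (D *v v)" .
    then have yu: "poly \<delta> t *s u = yt t" unfolding yt[of t, symmetric] by (rule injD[OF inj])
    have "?X *v yt t = poly \<delta> t *s (?X *v u)" unfolding yu[symmetric] by (rule vec.scale)
    also have "\<dots> = 0" unfolding Xu by (rule vec.scale_zero_right)
    finally show ?thesis .
  qed
  have poly0: "(\<Sum>j\<in>UNIV. [:x $ i $ j, Z $ i $ j:] * y $ j) = 0" for i
  proof (rule poly_eq_if_eq_generically[OF \<delta>nz])
    fix t assume "poly \<delta> t \<noteq> 0"
    from arg_cong[OF ker[OF this], of "\<lambda>v. v $ i"]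
    show "poly (\<Sum>j\<in>UNIV. [:x $ i $ j, Z $ i $ j:] * y $ j) t = poly 0 t"
      by (simp add: matrix_vector_mult_def poly_sum yt_def algebra_simps)
  qed
  \<comment> \<open>Division by the nonzero value \<open>\<delta>(0) = det (x + D)\<close>
    normalises the constant term to \<open>v\<close>.\<close>
  define \<zeta> where "\<zeta> m = (\<chi> j. coeff (y $ j) m / poly \<delta> 0)" for m
  have z0: "\<zeta> 0 = v"
  proof -
    have inj: "inj ((*v) (x + D))"
      using D by (intro inj_matrix_vector_mult) (simp add: invertible_det_nz)
    have "x + mscale 0 Z + D = x + D" by (simp add: Finite_Cartesian_Product.vec_eq_iff)
    then have "(x + D) *v yt 0 = poly \<delta> 0 *s (D *v v)" using yt[of 0] by simp
    also have "\<dots> = (x + D) *v (poly \<delta> 0 *s v)"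
      using v by (simp add: matrix_vector_mult_add_rdistrib vec.scale)
    finally have "yt 0 = poly \<delta> 0 *s v" by (rule injD[OF inj])
    then show ?thesis
      using \<delta>0 by (simp add: \<zeta>_def yt_def Finite_Cartesian_Product.vec_eq_iff poly_0_coeff_0)
  qed
  have "x *v \<zeta> (Suc m) = - (Z *v \<zeta> m)" for m
  proof -
    have "(\<Sum>j\<in>UNIV. x $ i $ j * coeff (y $ j) (Suc m) + Z $ i $ j * coeff (y $ j) m) = 0" for i
      using arg_cong[OF poly0[of i], of "\<lambda>p. coeff p (Suc m)"]
      by (simp add: coeff_sum)
    then have "(\<Sum>j\<in>UNIV. x $ i $ j * coeff (y $ j) (Suc m)) = - (\<Sum>j\<in>UNIV. Z $ i $ j * coeff (y $ j) m)" for i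
      by (simp add: sum.distrib eq_neg_iff_add_eq_0)
    then show ?thesis
      by (simp add: Finite_Cartesian_Product.vec_eq_iff matrix_vector_mult_def \<zeta>_def
          flip: sum_divide_distrib)
  qed
  with z0 show thesis by (rule that)
qed

section \<open>Pencils with square-free determinant\<close>

lemma exists_nonzero_point:
  fixes q :: "'a::alg_closed_field poly"
  assumes "q \<noteq> 0" "finite X"
  shows "\<exists>t. t \<notin> X \<and> poly q t \<noteq> 0"
proof -
  have "finite (X \<union> {t. poly q t = 0})"
    using assms by (simp add: poly_roots_finite)
  then obtain t where "t \<notin> X \<union> {t. poly q t = 0}"
    using infinite_alg_closed ex_new_if_finite by metis
  then show ?thesis by auto
qed

text \<open>The Sylvester matrix of \<open>p\<close> and its derivative, with \<open>p\<close>
  treated as a polynomial of degree \<open>m\<close>: \<open>m - 1\<close> shifts of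
  \<open>p\<close>, then \<open>m\<close> shifts of the derivative. Its determinant is the
  discriminant up to sign and the leading coefficient.\<close>

definition sylvester :: "nat \<Rightarrow> 'a::idom poly \<Rightarrow> 'a Matrix.mat" where
  "sylvester m p = Matrix.mat (2 * m - 1) (2 * m - 1) (\<lambda>(i, j).
     if i < m - 1 then coeff (monom 1 i * p) j else coeff (monom 1 (i - (m - 1)) * pderiv p) j)"

lemma poly_eq_sum_coeff:
  fixes p :: "'a::comm_ring_1 poly"
  assumes "degree p < N"
  shows "poly p x = (\<Sum>j<N. coeff p j * x ^ j)"
proof -
  have "poly p x = (\<Sum>j\<le>degree p. coeff p j * x ^ j)" by (rule poly_altdef)
  also have "\<dots> = (\<Sum>j<N. coeff p j * x ^ j)"
    using assms by (intro sum.mono_neutral_left) (auto simp: coeff_eq_0)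
  finally show ?thesis .
qed

lemma pderiv_sum': "pderiv (\<Sum>i\<in>A. f i) = (\<Sum>i\<in>A. pderiv (f i))"
  by (induction A rule: infinite_finite_induct) (auto simp: pderiv_add)

lemma degree_pderiv_le: "degree (pderiv p) \<le> degree p - 1" for p :: "'a::idom poly"
  by (rule degree_le) (auto simp: coeff_pderiv coeff_eq_0)

text \<open>The powers of the common root form a nonzero kernel vector.\<close>

lemma det_sylvester_common_root:
  fixes p :: "'a::idom poly"
  assumes deg: "degree p \<le> m" and m: "0 < m" and root: "poly p c = 0" "poly (pderiv p) c = 0"
  shows "Determinant.det (sylvester m p) = 0"
proof -
  let ?N = "2 * m - 1"
  let ?v = "Matrix.vec ?N (\<lambda>j. c ^ j)"
  have "sylvester m p *\<^sub>v ?v = 0\<^sub>v ?N"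
  proof (rule eq_vecI)
    fix i assume "i < dim_vec (0\<^sub>v ?N)"
    then have i: "i < ?N" by simp
    define q where "q = (if i < m - 1 then monom 1 i * p else monom 1 (i - (m - 1)) * pderiv p)"
    have "degree q < ?N"
    proof (cases "i < m - 1")
      case True
      have "degree q \<le> i + degree p"
        unfolding q_def using True degree_mult_le[of "monom 1 i" p] degree_monom_le[of "1::'a" i] by auto
      then show ?thesis using True deg by linarith
    next
      case False
      have "degree q \<le> degree (monom (1::'a) (i - (m - 1))) + degree (pderiv p)"
        unfolding q_def using False by (simp add: degree_mult_le)
      also have "\<dots> \<le> (i - (m - 1)) + (degree p - 1)"
        by (intro add_mono degree_monom_le degree_pderiv_le)
      finally have "degree q \<le> (i - (m - 1)) + (degree p - 1)" .
      then show ?thesis using False deg i by linarith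
    qed
    then have "(\<Sum>j<?N. coeff q j * c ^ j) = poly q c" by (simp add: poly_eq_sum_coeff)
    also have "\<dots> = 0" using root by (simp add: q_def)
    finally show "Matrix.vec_index (sylvester m p *\<^sub>v ?v) i = Matrix.vec_index (0\<^sub>v ?N) i"
      using i by (simp add: sylvester_def scalar_product_def scalar_prod_def lessThan_atLeast0 q_def
          cong: if_cong split: if_splits)
  qed (simp add: sylvester_def)
  moreover have "?v \<noteq> 0\<^sub>v ?N"
  proof
    assume "?v = 0\<^sub>v ?N"
    then have "Matrix.vec_index ?v 0 = Matrix.vec_index (0\<^sub>v ?N) 0" by simp
    then show False using m by simp
  qed
  ultimately show ?thesis
    by (subst det_0_iff_vec_prod_zero[of _ ?N]) (auto simp: sylvester_def intro!: exI[of _ ?v])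
qed

text \<open>A left kernel vector reads \<open>a p + b p' = 0\<close> with
  \<open>degree b < m\<close>; coprimality makes \<open>p\<close> divide \<open>b\<close>, so both
  factors vanish. Only the degree of \<open>p\<close> is fixed, because that of the derivative may
  drop in positive characteristic.\<close>

lemma det_sylvester_nonzero:
  fixes p :: "'a::field poly"
  assumes deg: "degree p = m" and m: "0 < m" and bezout: "\<alpha> * p + \<beta> * pderiv p = 1"
  shows "Determinant.det (sylvester m p) \<noteq> 0"
proof
  let ?N = "2 * m - 1"
  obtain m' where m': "m = Suc m'" using m gr0_implies_Suc by blast
  assume "Determinant.det (sylvester m p) = 0"
  then have "Determinant.det (transpose_mat (sylvester m p)) = 0"
    using Determinant.det_transpose[of "sylvester m p" ?N] by (simp add: sylvester_def)
  then obtain u where u: "u \<in> carrier_vec ?N" "u \<noteq> 0\<^sub>v ?N"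
    "transpose_mat (sylvester m p) *\<^sub>v u = 0\<^sub>v ?N"
    by (subst (asm) det_0_iff_vec_prod_zero[of _ ?N]) (auto simp: sylvester_def)
  define a where "a = (\<Sum>i<m - 1. monom (Matrix.vec_index u i) i)"
  define b where "b = (\<Sum>i<m. monom (Matrix.vec_index u (m - 1 + i)) i)"
  have da: "degree a < m"
    unfolding a_def by (intro degree_sum_less) (use m in \<open>auto intro: le_less_trans[OF degree_monom_le]\<close>)
  have db: "degree b < m"
    unfolding b_def by (intro degree_sum_less) (use m in \<open>auto intro: le_less_trans[OF degree_monom_le]\<close>)
  have ca: "coeff a i = (if i < m - 1 then Matrix.vec_index u i else 0)" for i
    by (simp add: a_def coeff_sum)
  have cb: "coeff b i = (if i < m then Matrix.vec_index u (m - 1 + i) else 0)" for i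
    by (simp add: b_def coeff_sum)
  have small: "coeff (a * p + b * pderiv p) j = 0" if j: "j < ?N" for j
  proof -
    have "Matrix.vec_index (transpose_mat (sylvester m p) *\<^sub>v u) j = 0" using u(3) j by simp
    then have "(\<Sum>i<?N. sylvester m p $$ (i, j) * Matrix.vec_index u i) = 0"
      using j u(1) by (simp add: scalar_prod_def lessThan_atLeast0 sylvester_def)
    also have "(\<Sum>i<?N. sylvester m p $$ (i, j) * Matrix.vec_index u i)
      = (\<Sum>i<m - 1. sylvester m p $$ (i, j) * Matrix.vec_index u i)
        + (\<Sum>i<m. sylvester m p $$ (m - 1 + i, j) * Matrix.vec_index u (m - 1 + i))"
    proof -
      have N: "{..<?N} = {..<m - 1} \<union> (\<lambda>i. m - 1 + i) ` {..<m}"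
      proof (intro subset_antisym subsetI)
        fix i assume i: "i \<in> {..<?N}"
        show "i \<in> {..<m - 1} \<union> (\<lambda>i. m - 1 + i) ` {..<m}"
        proof (cases "i < m - 1")
          case False
          then have "i = m - 1 + (i - (m - 1))" "i - (m - 1) < m" using i m by auto
          then show ?thesis by blast
        qed simp
      qed (use m in auto)
      have "(\<Sum>i\<in>(\<lambda>i. m - 1 + i) ` {..<m}. f i) = (\<Sum>i<m. f (m - 1 + i))" for f :: "nat \<Rightarrow> 'a"
        by (subst sum.reindex) (auto simp: inj_on_def)
      then show ?thesis
        unfolding N by (subst sum.union_disjoint) auto
    qed
    also have "(\<Sum>i<m - 1. sylvester m p $$ (i, j) * Matrix.vec_index u i) = coeff (a * p) j"
    proof -
      have "a * p = (\<Sum>i<m - 1. Polynomial.smult (Matrix.vec_index u i) (monom 1 i * p))"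
        unfolding a_def sum_distrib_right by (simp add: smult_monom flip: mult_smult_left)
      then show ?thesis using j by (simp add: coeff_sum sylvester_def mult.commute)
    qed
    also have "(\<Sum>i<m. sylvester m p $$ (m - 1 + i, j) * Matrix.vec_index u (m - 1 + i)) = coeff (b * pderiv p) j"
    proof -
      have "b * pderiv p = (\<Sum>i<m. Polynomial.smult (Matrix.vec_index u (m - 1 + i)) (monom 1 i * pderiv p))"
        unfolding b_def sum_distrib_right by (simp add: smult_monom flip: mult_smult_left)
      then show ?thesis using j by (simp add: coeff_sum sylvester_def mult.commute m')
    qed
    finally show ?thesis by simp
  qed
  have "a * p + b * pderiv p = 0"
  proof (rule poly_eqI)
    fix j
    show "coeff (a * p + b * pderiv p) j = coeff 0 j"
    proof (cases "j < ?N")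
      case False
      have da': "a \<noteq> 0 \<Longrightarrow> degree a < m - 1"
      proof -
        assume "a \<noteq> 0"
        then have "coeff a (degree a) \<noteq> 0" by simp
        then show "degree a < m - 1" unfolding ca by (auto split: if_splits)
      qed
      have "degree (a * p) < ?N" using degree_mult_le[of a p] deg da' m by (cases "a = 0") auto
      moreover have "degree (b * pderiv p) < ?N"
        using degree_mult_le[of b "pderiv p"] degree_pderiv_le[of p] deg db m by linarith
      ultimately show ?thesis using False by (simp add: coeff_eq_0)
    qed (use small in simp)
  qed
  then have eq: "b * pderiv p = - (a * p)" by (simp add: eq_neg_iff_add_eq_0 add.commute)
  have "b = b * (\<alpha> * p + \<beta> * pderiv p)" using bezout by simp
  also have "\<dots> = p * (b * \<alpha>) + \<beta> * (b * pderiv p)" by (simp add: algebra_simps)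
  also have "\<dots> = p * (b * \<alpha> - \<beta> * a)" unfolding eq by (simp add: algebra_simps)
  finally have "p dvd b" by (metis dvd_triv_left)
  then have b0: "b = 0" using db deg by (metis dvd_imp_degree_le not_less)
  moreover have "p \<noteq> 0" using deg m by auto
  ultimately have "a = 0" using eq by simp
  have "Matrix.vec_index u i = 0" if "i < ?N" for i
  proof (cases "i < m - 1")
    case True
    then show ?thesis using ca[of i] \<open>a = 0\<close> by simp
  next
    case False
    then have i: "i - (m - 1) < m" "m - 1 + (i - (m - 1)) = i" using that by linarith+
    have "coeff b (i - (m - 1)) = Matrix.vec_index u i" unfolding cb i(2) using i(1) by (simp only: if_True)
    then show ?thesis using b0 by simp
  qed
  then have "u = 0\<^sub>v ?N" using u(1) by (intro eq_vecI) auto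
  then show False using u(2) by simp
qed

text \<open>Completing the block by the identity keeps the matrix type fixed, while the determinant
  is the principal minor on \<open>I\<close>.\<close>

definition principal_block :: "'n set \<Rightarrow> 'a::zero_neq_one^'n^'n \<Rightarrow> 'a^'n^'n" where
  "principal_block I Y = (\<chi> i j. if i \<in> I \<and> j \<in> I then Y $ i $ j else if i = j then 1 else 0)"

definition pencil :: "'a::comm_ring_1^'n^'n \<Rightarrow> 'a^'n^'n \<Rightarrow> 'a poly^'n^'n" where
  "pencil A B = (\<chi> i j. [:- B $ i $ j, A $ i $ j:])"

definition pencil_poly :: "'n::finite set \<Rightarrow> 'a::field^'n^'n \<Rightarrow> 'a^'n^'n \<Rightarrow> 'a poly" where
  "pencil_poly I A B = det (principal_block I (pencil A B))"

lemma degree_pencil_poly: "degree (pencil_poly I A B) \<le> card I"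
  unfolding pencil_poly_def Determinants.det_def
proof (intro degree_sum_le)
  fix p :: "'b \<Rightarrow> 'b" assume "p \<in> {p. p permutes UNIV}"
  have "degree (of_int (sign p) * (\<Prod>i\<in>UNIV. principal_block I (pencil A B) $ i $ p i))
      \<le> degree (of_int (sign p) :: 'a poly) + degree (\<Prod>i\<in>UNIV. principal_block I (pencil A B) $ i $ p i)"
    by (rule degree_mult_le)
  also have "\<dots> = degree (\<Prod>i\<in>UNIV. principal_block I (pencil A B) $ i $ p i)" by simp
  also have "\<dots> \<le> (\<Sum>i\<in>UNIV. degree (principal_block I (pencil A B) $ i $ p i))"
    using degree_prod_sum_le[of UNIV "\<lambda>i. principal_block I (pencil A B) $ i $ p i"] by (simp add: o_def)
  also have "\<dots> \<le> (\<Sum>i\<in>UNIV. if i \<in> I then 1 else 0)"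
    by (intro sum_mono) (auto simp: principal_block_def pencil_def)
  also have "\<dots> = card I" by (simp add: sum.If_cases)
  finally show "degree (of_int (sign p) * (\<Prod>i\<in>UNIV. principal_block I (pencil A B) $ i $ p i)) \<le> card I" .
qed simp

lemma principal_block_mult_eq_0:
  fixes Y :: "'a::field^'n^'n"
  assumes "\<And>i. i \<notin> I \<Longrightarrow> v $ i = 0" "\<And>i. i \<in> I \<Longrightarrow> (Y *v v) $ i = 0"
  shows "principal_block I Y *v v = 0"
proof -
  have "(principal_block I Y *v v) $ i = 0" for i
  proof (cases "i \<in> I")
    case True
    have "(principal_block I Y *v v) $ i = (Y *v v) $ i"
      unfolding matrix_vector_mult_def using True assms(1)
      by (auto simp: principal_block_def intro!: sum.cong)
    then show ?thesis using assms(2) True by simp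
  next
    case False
    then have "(principal_block I Y *v v) $ i = v $ i"
      by (simp add: matrix_vector_mult_def principal_block_def if_distrib[of "\<lambda>x. x * _"] cong: if_cong)
    then show ?thesis using assms(1) False by simp
  qed
  then show ?thesis by (simp add: Finite_Cartesian_Product.vec_eq_iff)
qed

text \<open>The rows in \<open>I\<close> are independent by the minor and span the row space by the
  rank bound, so they detect the kernel.\<close>

lemma kernel_if_kernel_on_block:
  fixes Y :: "'a::field^'n^'n"
  assumes rk: "rank Y \<le> card I" and nz: "det (principal_block I Y) \<noteq> 0"
    and v: "\<And>i. i \<in> I \<Longrightarrow> (Y *v v) $ i = 0"
  shows "Y *v v = 0"
proof -
  let ?N = "{v. \<forall>i\<in>I. (Y *v v) $ i = 0}"
  define R :: "'a^'n^'n" where "R = (\<chi> i j. if i = j \<and> i \<notin> I then 1 else 0)"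
  have R: "(R *v w) $ i = (if i \<in> I then 0 else w $ i)" for w i
    by (simp add: R_def matrix_vector_mult_def if_distrib[of "\<lambda>x. x * _"] cong: if_cong)
  have N: "vec.subspace ?N"
    by (auto simp: vec.subspace_def matrix_vector_right_distrib vec.scale)
  have inj: "inj_on ((*v) R) (vec.span ?N)"
  proof (rule inj_onI)
    fix a b assume ab: "a \<in> vec.span ?N" "b \<in> vec.span ?N" "R *v a = R *v b"
    have abN: "a \<in> ?N" "b \<in> ?N" using ab vec.span_eq_iff[THEN iffD2, OF N] by auto
    have "principal_block I Y *v (a - b) = 0"
    proof (rule principal_block_mult_eq_0)
      fix i assume "i \<notin> I"
      then show "(a - b) $ i = 0" using arg_cong[OF ab(3), of "\<lambda>v. v $ i"] by (simp add: R)
    next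
      fix i assume "i \<in> I"
      then show "(Y *v (a - b)) $ i = 0" using abN by (simp add: matrix_vector_mult_diff_distrib)
    qed
    then show "a = b" using nz unfolding det_nonzero_iff_inj by fastforce
  qed
  have "vec.dim ?N = vec.dim ((*v) R ` ?N)"
    by (rule vec.dim_image_eq[OF matrix_vector_mul_linear_gen inj, symmetric])
  also have "\<dots> \<le> vec.dim {x::'a^'n. \<forall>i. i \<notin> - I \<longrightarrow> x $ i = 0}"
    by (intro vec.dim_subset) (auto simp: R)
  also have "\<dots> = CARD('n) - card I"
    unfolding dim_substandard_cart by (simp add: Compl_eq_Diff_UNIV card_Diff_subset)
  finally have "vec.dim ?N \<le> vec.dim {v. Y *v v = 0}"
    using dim_kernel[of Y] rk by simp
  then have "{v. Y *v v = 0} = ?N"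
    by (intro vec.subspace_dim_equal subspace_kernel N) auto
  then show ?thesis using v by blast
qed

text \<open>Each term of the determinant contains either the zero diagonal entry or two different
  factors, one from row \<open>k\<close> and one from column \<open>k\<close>.\<close>

lemma square_dvd_det:
  fixes R :: "'a::comm_ring_1^'n^'n"
  assumes "R $ k $ k = 0" "\<And>i. d dvd R $ i $ k" "\<And>i. d dvd R $ k $ i"
  shows "d ^ 2 dvd det R"
  unfolding Determinants.det_def
proof (intro dvd_sum dvd_mult)
  fix p :: "'n \<Rightarrow> 'n" assume "p \<in> {p. p permutes UNIV}"
  then have p: "bij p" by (simp add: permutes_bij)
  show "d ^ 2 dvd (\<Prod>i\<in>UNIV. R $ i $ p i)"
  proof (cases "p k = k")
    case True
    have "(\<Prod>i\<in>UNIV. R $ i $ p i) = 0"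
    proof (rule prod_zero)
      show "\<exists>i\<in>UNIV. R $ i $ p i = 0" using True assms(1) by (intro bexI[of _ k]) auto
    qed simp
    then show ?thesis by simp
  next
    case False
    obtain l where l: "p l = k" using p by (metis bij_pointE)
    have lk: "l \<noteq> k" using l False by auto
    have "(\<Prod>i\<in>UNIV. R $ i $ p i) = R $ k $ p k * (\<Prod>i\<in>UNIV - {k}. R $ i $ p i)"
      by (rule prod.remove) auto
    also have "(\<Prod>i\<in>UNIV - {k}. R $ i $ p i) = R $ l $ p l * (\<Prod>i\<in>UNIV - {k} - {l}. R $ i $ p i)"
      using lk by (intro prod.remove) auto
    finally have "(\<Prod>i\<in>UNIV. R $ i $ p i)
        = (R $ k $ p k * R $ l $ p l) * (\<Prod>i\<in>UNIV - {k} - {l}. R $ i $ p i)"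
      by (simp only: mult.assoc)
    moreover have "d ^ 2 dvd R $ k $ p k * R $ l $ p l"
      unfolding power2_eq_square using assms(2)[of l] assms(3)[of "p k"] l by (intro mult_dvd_mono) auto
    ultimately show ?thesis by (simp only: dvd_mult2)
  qed
qed

text \<open>After a congruence that moves \<open>u\<close> into the basis, its row and column are
  divisible by \<open>t - c\<close>, and its diagonal entry is \<open>t - c\<close> times
  \<open>u \<odot> (A *v u)\<close>, which is 0 by isotropy. Then \<open>square_dvd_det\<close>
  applies.\<close>

lemma pencil_poly_double_root:
  fixes A B :: "'a::alg_closed_field^'n^'n"
  assumes sym: "transpose A = A" "transpose B = B"
    and u: "u \<noteq> 0" "\<And>i. i \<notin> I \<Longrightarrow> u $ i = 0"
    and ker: "\<And>i. i \<in> I \<Longrightarrow> (B *v u) $ i = c * (A *v u) $ i"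
    and iso: "u \<odot> (A *v u) = 0"
  shows "[:- c, 1:] ^ 2 dvd pencil_poly I A B"
proof -
  obtain k where k: "u $ k \<noteq> 0" using u(1) by (auto simp: Finite_Cartesian_Product.vec_eq_iff)
  define P where "P = principal_block I (pencil A B)"
  \<comment> \<open>The identity with column \<open>k\<close> replaced by \<open>u\<close>; its
    determinant \<open>u $ k\<close> is nonzero by the choice of \<open>k\<close>.\<close>
  define Q0 where "Q0 = (\<chi> i j. if j = k then u $ i else if i = j then 1 else 0)"
  define Q where "Q = (\<chi> i j. [:Q0 $ i $ j:])"
  define R where "R = transpose Q ** (P ** Q)"
  define e where "e = (\<chi> a. if a \<in> I then [:(A *v u) $ a:] else 0)"
  have detQ: "det Q = [:u $ k:]"
  proof (rule poly_eq_if_eq_generically[of 1])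
    fix t
    have "poly (det Q) t = det Q0" by (simp add: poly_det Q_def)
    also have "\<dots> = u $ k * det (Finite_Cartesian_Product.mat 1 :: 'a^'n^'n)"
      using cramer_lemma[where k = k and A = "Finite_Cartesian_Product.mat 1" and x = u]
      unfolding matrix_vector_mul_lid by (simp add: Q0_def Finite_Cartesian_Product.mat_def cong: if_cong)
    finally show "poly (det Q) t = poly [:u $ k:] t" by simp
  qed simp
  have symP: "P $ i $ j = P $ j $ i" for i j
    using sym by (auto simp: P_def principal_block_def pencil_def Finite_Cartesian_Product.vec_eq_iff
        Finite_Cartesian_Product.transpose_def)
  have Qk: "Q $ b $ k = [:u $ b:]" for b by (simp add: Q_def Q0_def)
  have PQ: "(P ** Q) $ a $ k = [:- c, 1:] * e $ a" for a
  proof -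
    have "(P ** Q) $ a $ k = (\<Sum>b\<in>UNIV. P $ a $ b * [:u $ b:])"
      by (simp add: matrix_matrix_mult_def Qk)
    also have "\<dots> = [:- c, 1:] * e $ a"
    proof (cases "a \<in> I")
      case True
      have "(\<Sum>b\<in>UNIV. P $ a $ b * [:u $ b:]) = (\<Sum>b\<in>UNIV. [:- (B $ a $ b * u $ b), A $ a $ b * u $ b:])"
        using True u(2) by (intro sum.cong) (auto simp: P_def principal_block_def pencil_def mult.commute)
      also have "\<dots> = [:- (B *v u) $ a, (A *v u) $ a:]"
      proof (rule poly_eqI)
        fix n
        show "coeff (\<Sum>b\<in>UNIV. [:- (B $ a $ b * u $ b), A $ a $ b * u $ b:]) n = coeff [:- (B *v u) $ a, (A *v u) $ a:] n"
          by (simp add: coeff_sum coeff_pCons matrix_vector_mult_def sum_negf split: nat.splits)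
      qed
      also have "\<dots> = [:- c, 1:] * e $ a" using ker[OF True] True by (simp add: e_def)
      finally show ?thesis .
    next
      case False
      then have "(\<Sum>b\<in>UNIV. P $ a $ b * [:u $ b:]) = (\<Sum>b\<in>UNIV. if a = b then [:u $ b:] else 0)"
        by (intro sum.cong) (auto simp: P_def principal_block_def)
      then show ?thesis using False u(2) by (simp add: e_def)
    qed
    finally show ?thesis .
  qed
  have Rk: "R $ i $ k = [:- c, 1:] * (\<Sum>a\<in>UNIV. Q $ a $ i * e $ a)" for i
  proof -
    have "R $ i $ k = (\<Sum>a\<in>UNIV. transpose Q $ i $ a * (P ** Q) $ a $ k)"
      by (simp only: R_def matrix_matrix_mult_def[of "transpose Q"] vec_lambda_beta)
    also have "\<dots> = (\<Sum>a\<in>UNIV. [:- c, 1:] * (Q $ a $ i * e $ a))"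
      by (simp only: PQ Finite_Cartesian_Product.transpose_def vec_lambda_beta mult.left_commute)
    finally show ?thesis by (simp only: sum_distrib_left)
  qed
  have symR: "R $ i $ j = R $ j $ i" for i j
  proof -
    have "transpose P = P" using symP by (simp add: Finite_Cartesian_Product.vec_eq_iff Finite_Cartesian_Product.transpose_def)
    then have "transpose R = R"
      by (simp add: R_def matrix_transpose_mul matrix_mul_assoc)
    then show ?thesis by (metis (no_types) Finite_Cartesian_Product.transpose_def vec_lambda_beta)
  qed
  have Rkk: "R $ k $ k = 0"
  proof -
    have "(\<Sum>a\<in>UNIV. Q $ a $ k * e $ a) = (\<Sum>a\<in>UNIV. [:u $ a * (A *v u) $ a:])"
      using u(2) by (intro sum.cong) (auto simp: Qk e_def mult.commute)
    also have "\<dots> = [:u \<odot> (A *v u):]"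
      by (rule poly_eqI) (simp add: coeff_sum coeff_pCons scalar_product_def split: nat.splits)
    finally show ?thesis unfolding Rk iso by simp
  qed
  have "[:- c, 1:] ^ 2 dvd det R"
  proof (rule square_dvd_det[OF Rkk])
    show dvd: "[:- c, 1:] dvd R $ i $ k" for i unfolding Rk by (rule dvd_triv_left)
    show "[:- c, 1:] dvd R $ k $ i" for i using dvd[of i] symR[of i k] by simp
  qed
  also have "det R = Polynomial.smult (u $ k * u $ k) (pencil_poly I A B)"
    by (simp add: R_def det_mul detQ P_def pencil_poly_def)
  finally show ?thesis using k by (simp add: dvd_smult_iff)
qed

text \<open>A kernel vector of the pencil with polynomial entries is normalised outside the block to a multiple
  \<open>q\<close> of a unit vector. If \<open>q\<close> of minimal degree had a root, the value there would be an
  isotropic kernel vector, producing a double root; so \<open>q\<close> is constant, and then the whole vector is.\<close>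

lemma pencil_constant_kernel_vector:
  fixes A B :: "'a::alg_closed_field^'n^'n"
  assumes sym: "transpose A = A" "transpose B = B"
    and rk: "\<And>t. rank (mscale t A - B) \<le> card I"
    and A: "det (principal_block I A) \<noteq> 0"
    and p: "\<And>c. poly (pencil_poly I A B) c = 0 \<Longrightarrow> poly (pderiv (pencil_poly I A B)) c \<noteq> 0"
    and j: "j \<notin> I"
  obtains z where "A *v z = 0" "B *v z = 0" "\<And>i. i \<notin> I \<Longrightarrow> z $ i = (if i = j then 1 else 0)"
proof -
  define p where "p = pencil_poly I A B"
  define Y where "Y = pencil A B"
  have nz: "p \<noteq> 0"
    using assms(5) by (auto simp: p_def)
  define good where "good q z \<longleftrightarrow> q \<noteq> 0 \<and> Y *v z = 0 \<and> (\<forall>i. i \<notin> I \<longrightarrow> z $ i = (if i = j then q else 0))"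
    for q :: "'a poly" and z
  have Yt: "(\<chi> a. poly ((Y *v z) $ a) t) = (mscale t A - B) *v (\<chi> a. poly (z $ a) t)" for t z
    by (simp add: Y_def pencil_def matrix_vector_mult_def poly_sum algebra_simps)
  have ex: "\<exists>q z. good q z"
  proof -
    \<comment> \<open>Solving the block for minus column \<open>j\<close> of the pencil and putting
      \<open>p\<close> at \<open>j\<close> cancels the rows in \<open>I\<close>; the rank bound
      extends this to all rows.\<close>
    define b where "b = (\<chi> i. if i \<in> I then - Y $ i $ j else 0)"
    obtain y where y: "principal_block I Y *v y = p *s b"
      unfolding p_def pencil_poly_def Y_def by (rule poly_cramer)
    have y0: "y $ i = 0" if "i \<notin> I" for i
    proof -
      have "(principal_block I Y *v y) $ i = y $ i"
        using that
        by (simp add: matrix_vector_mult_def principal_block_def if_distrib[of "\<lambda>x. x * _"] cong: if_cong)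
      then show ?thesis unfolding y using that by (simp add: b_def)
    qed
    define z where "z = (\<chi> i. y $ i + (if i = j then p else 0))"
    have zI: "(Y *v z) $ i = 0" if i: "i \<in> I" for i
    proof -
      have "(Y *v z) $ i = (\<Sum>k\<in>UNIV. Y $ i $ k * y $ k) + Y $ i $ j * p"
        by (simp add: matrix_vector_mult_def z_def distrib_left sum.distrib if_distrib[of "\<lambda>x. _ * x"] cong: if_cong)
      also have "(\<Sum>k\<in>UNIV. Y $ i $ k * y $ k) = (principal_block I Y *v y) $ i"
        unfolding matrix_vector_mult_def using y0 i by (auto simp: principal_block_def intro!: sum.cong)
      finally show ?thesis unfolding y using i by (simp add: b_def)
    qed
    have "(Y *v z) $ i = 0" for i
    proof (rule poly_eq_if_eq_generically[OF nz])
      fix t assume t: "poly p t \<noteq> 0"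
      have "(\<chi> a. poly ((Y *v z) $ a) t) = 0"
        unfolding Yt
      proof (rule kernel_if_kernel_on_block[OF rk])
        have "(\<chi> a b. poly (principal_block I Y $ a $ b) t) = principal_block I (mscale t A - B)"
          by (simp add: Finite_Cartesian_Product.vec_eq_iff principal_block_def Y_def pencil_def)
        then show "det (principal_block I (mscale t A - B)) \<noteq> 0"
          using t poly_det[of "principal_block I Y" t] by (simp add: p_def pencil_poly_def Y_def)
        show "((mscale t A - B) *v (\<chi> a. poly (z $ a) t)) $ i = 0" if "i \<in> I" for i
          unfolding Yt[symmetric] using zI[OF that] by simp
      qed
      then show "poly ((Y *v z) $ i) t = poly 0 t" by (simp add: Finite_Cartesian_Product.vec_eq_iff)
    qed
    then have "good p z"
      unfolding good_def using nz y0 by (auto simp: Finite_Cartesian_Product.vec_eq_iff z_def)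
    then show ?thesis by blast
  qed
  define d where "d = (LEAST d. \<exists>q z. good q z \<and> degree q = d)"
  have "\<exists>q z. good q z \<and> degree q = d"
    unfolding d_def by (rule LeastI_ex) (use ex in blast)
  then obtain q z where qz: "good q z" "degree q = d" by blast
  have least: "d \<le> degree q'" if "good q' z'" for q' z'
    unfolding d_def by (rule Least_le) (use that in blast)
  have Yz: "Y *v z = 0" and zout: "\<And>i. i \<notin> I \<Longrightarrow> z $ i = (if i = j then q else 0)" and q: "q \<noteq> 0"
    using qz(1) by (auto simp: good_def)
  have Yzi: "(\<Sum>k\<in>UNIV. [:- B $ i $ k, A $ i $ k:] * z $ k) = 0" for i
    using arg_cong[OF Yz, of "\<lambda>v. v $ i"] by (simp add: Y_def pencil_def matrix_vector_mult_def)
  have "d = 0"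
  proof (rule ccontr)
    assume "d \<noteq> 0"
    then obtain c where c: "poly q c = 0" using alg_closed_imp_poly_has_root[of q] qz(2) by auto
    define u where "u = (\<chi> i. poly (z $ i) c)"
    show False
    proof (cases "u = 0")
      case True
      \<comment> \<open>All entries vanish at \<open>c\<close>, so \<open>t - c\<close> can be
        cancelled from \<open>z\<close> and from \<open>q\<close>, against minimality of the
        degree.\<close>
      have "[:- c, 1:] dvd z $ i" for i
        using True by (simp add: u_def Finite_Cartesian_Product.vec_eq_iff poly_eq_0_iff_dvd)
      then obtain w where w: "\<And>i. z $ i = [:- c, 1:] * w i" unfolding dvd_def by metis
      obtain q' where q': "q = [:- c, 1:] * q'" using c by (auto simp: poly_eq_0_iff_dvd dvd_def)
      have "good q' (\<chi> i. w i)"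
        unfolding good_def
      proof (intro conjI allI impI)
        show "q' \<noteq> 0" using q q' by auto
        have "[:- c, 1:] * (Y *v (\<chi> i. w i)) $ i = (Y *v z) $ i" for i
          by (simp add: matrix_vector_mult_def sum_distrib_left w mult.left_commute del: mult_pCons_left)
        then have "[:- c, 1:] * (Y *v (\<chi> i. w i)) $ i = 0" for i unfolding Yz by simp
        then have "(Y *v (\<chi> i. w i)) $ i = 0" for i
          using mult_eq_0_iff[of "[:- c, 1:]"] by (metis pCons_eq_0_iff one_neq_zero)
        then show "Y *v (\<chi> i. w i) = 0" by (simp add: Finite_Cartesian_Product.vec_eq_iff)
        fix i assume "i \<notin> I"
        then have "[:- c, 1:] * w i = [:- c, 1:] * (if i = j then q' else 0)"
          using zout[of i] w[of i] q' by simp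
        then have "w i = (if i = j then q' else 0)"
          by (metis mult_left_cancel pCons_eq_0_iff one_neq_zero)
        then show "(\<chi> i. w i) $ i = (if i = j then q' else 0)" by simp
      qed
      then have "d \<le> degree q'" by (rule least)
      moreover have "degree q = Suc (degree q')"
        using q q' by (subst q', subst degree_mult_eq) auto
      ultimately show False using qz(2) by simp
    next
      case False
      have uout: "u $ i = 0" if "i \<notin> I" for i using zout[OF that] c by (simp add: u_def)
      have Yu: "(mscale c A - B) *v u = 0"
        using Yt[of z c] unfolding Yz by (simp add: u_def Finite_Cartesian_Product.vec_eq_iff)
      have BA: "B *v u = c *s (A *v u)"
      proof -
        have "mscale c A *v u = c *s (A *v u)"
          by (simp add: Finite_Cartesian_Product.vec_eq_iff matrix_vector_mult_def sum_distrib_left mult.assoc)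
        then show ?thesis using Yu by (simp add: matrix_vector_mult_diff_rdistrib)
      qed
      \<comment> \<open>Differentiate \<open>(t A - B) z = 0\<close> at \<open>c\<close> and pair
        with \<open>u\<close>: the term with \<open>z'\<close> drops out because the symmetric
        matrix \<open>c A - B\<close> kills \<open>u\<close>, and
        \<open>u \<odot> (A *v u) = 0\<close> remains.\<close>
      define z' where "z' = (\<chi> i. poly (pderiv (z $ i)) c)"
      have der: "A *v u + (mscale c A - B) *v z' = 0"
      proof -
        have "(\<Sum>k\<in>UNIV. pderiv ([:- B $ i $ k, A $ i $ k:] * z $ k)) = 0" for i
          using arg_cong[OF Yzi[of i], of pderiv]
          using pderiv_sum'[of "\<lambda>k. [:- B $ i $ k, A $ i $ k:] * z $ k" UNIV] by simp
        then have "poly (\<Sum>k\<in>UNIV. pderiv ([:- B $ i $ k, A $ i $ k:] * z $ k)) c = 0" for i by simp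
        then have "(\<Sum>k\<in>UNIV. A $ i $ k * u $ k + (c * A $ i $ k - B $ i $ k) * z' $ k) = 0" for i
          by (simp add: poly_sum pderiv_diff pderiv_smult pderiv_pCons u_def z'_def algebra_simps)
        then show ?thesis
          by (simp add: Finite_Cartesian_Product.vec_eq_iff matrix_vector_mult_def sum.distrib)
      qed
      have symY: "transpose (mscale c A - B) = mscale c A - B"
        using sym by (simp add: Finite_Cartesian_Product.vec_eq_iff Finite_Cartesian_Product.transpose_def)
      have "u \<odot> (A *v u + (mscale c A - B) *v z') = 0" unfolding der by simp
      then have "u \<odot> (A *v u) = 0"
        using dot_symmetric_matrix[OF symY, of u z'] Yu by simp
      then have "[:- c, 1:] ^ 2 dvd p"
        unfolding p_def using uout BA by (intro pencil_poly_double_root[OF sym False]) auto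
      then obtain s where s: "p = [:- c, 1:] ^ 2 * s" by (auto simp: dvd_def)
      have "poly p c = 0" unfolding s by simp
      moreover have "poly (pderiv p) c = 0"
        unfolding s power2_eq_square pderiv_mult by simp
      ultimately show False using assms(5) unfolding p_def by blast
    qed
  qed
  then obtain q0 where q0: "q = [:q0:]" "q0 \<noteq> 0" using q qz(2) degree_eq_zeroE by (metis pCons_0_0)
  define zc where "zc e = (\<chi> i. coeff (z $ i) e)" for e
  have rec: "A *v zc e = B *v zc (Suc e)" for e
  proof -
    have "(\<Sum>k\<in>UNIV. A $ i $ k * coeff (z $ k) e - B $ i $ k * coeff (z $ k) (Suc e)) = 0" for i
      using arg_cong[OF Yzi[of i], of "\<lambda>p. coeff p (Suc e)"] by (simp add: coeff_sum algebra_simps)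
    then show ?thesis
      by (simp add: Finite_Cartesian_Product.vec_eq_iff matrix_vector_mult_def sum_subtractf zc_def)
  qed
  have B0: "B *v zc 0 = 0"
  proof -
    have "(\<Sum>k\<in>UNIV. - (B $ i $ k * coeff (z $ k) 0)) = 0" for i
      using arg_cong[OF Yzi[of i], of "\<lambda>p. coeff p 0"] by (simp add: coeff_sum)
    then show ?thesis
      by (simp add: Finite_Cartesian_Product.vec_eq_iff matrix_vector_mult_def sum_negf zc_def)
  qed
  have z1: "zc (Suc e) = 0" for e
  proof (rule ccontr)
    assume ne: "zc (Suc e) \<noteq> 0"
    define E where "E = {e. zc (Suc e) \<noteq> 0}"
    have "finite E"
    proof (rule finite_subset)
      show "E \<subseteq> {..Max (range (\<lambda>i. degree (z $ i)))}"
      proof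
        fix e assume "e \<in> E"
        then obtain i where "coeff (z $ i) (Suc e) \<noteq> 0"
          by (auto simp: E_def zc_def Finite_Cartesian_Product.vec_eq_iff)
        then have "Suc e \<le> degree (z $ i)" by (rule le_degree)
        also have "\<dots> \<le> Max (range (\<lambda>i. degree (z $ i)))" by (rule Max_ge) auto
        finally show "e \<in> {..Max (range (\<lambda>i. degree (z $ i)))}" by simp
      qed
    qed simp
    \<comment> \<open>The top coefficient vector is killed by \<open>A\<close>, and it vanishes
      outside \<open>I\<close> because \<open>q\<close> is constant; the regular block of
      \<open>A\<close> makes it 0.\<close>
    define m where "m = Max E"
    have mE: "m \<in> E" unfolding m_def using \<open>finite E\<close> ne by (intro Max_in) (auto simp: E_def)
    have "Suc m \<notin> E" using Max_ge[OF \<open>finite E\<close>, of "Suc m"] by (auto simp: m_def)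
    then have "A *v zc (Suc m) = 0" using rec[of "Suc m"] by (simp add: E_def)
    moreover have "zc (Suc m) $ i = 0" if "i \<notin> I" for i
      using zout[OF that] by (simp add: zc_def q0)
    ultimately have "principal_block I A *v zc (Suc m) = 0"
      by (intro principal_block_mult_eq_0) auto
    then show False using A mE unfolding det_nonzero_iff_inj by (simp add: E_def)
  qed
  show thesis
  proof (rule that[of "inverse q0 *s zc 0"])
    show "A *v (inverse q0 *s zc 0) = 0" using rec[of 0] z1 by (simp add: vec.scale)
    show "B *v (inverse q0 *s zc 0) = 0" using B0 by (simp add: vec.scale)
    show "(inverse q0 *s zc 0) $ i = (if i = j then 1 else 0)" if "i \<notin> I" for i
      using zout[OF that] q0 by (simp add: zc_def)
  qed
qed

text \<open>Every index outside \<open>I\<close> has its own vector in both kernels. Subtracting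
  their combination with the same outside coordinates as \<open>v\<close> leaves a vector of the
  kernel of \<open>A\<close> supported on \<open>I\<close>, hence 0.\<close>

lemma pencil_common_kernel:
  fixes A B :: "'a::alg_closed_field^'n^'n"
  assumes sym: "transpose A = A" "transpose B = B"
    and rk: "\<And>t. rank (mscale t A - B) \<le> card I"
    and A: "det (principal_block I A) \<noteq> 0"
    and p: "\<And>c. poly (pencil_poly I A B) c = 0 \<Longrightarrow> poly (pderiv (pencil_poly I A B)) c \<noteq> 0"
    and v: "A *v v = 0"
  shows "B *v v = 0"
proof -
  have "\<exists>z. A *v z = 0 \<and> B *v z = 0 \<and> (\<forall>i. i \<notin> I \<longrightarrow> z $ i = (if i = j then 1 else 0))" if "j \<notin> I" for j
    using pencil_constant_kernel_vector[OF sym rk A p that] by blast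
  then obtain z where z: "\<And>j. j \<notin> I \<Longrightarrow> A *v z j = 0" "\<And>j. j \<notin> I \<Longrightarrow> B *v z j = 0"
    "\<And>j i. j \<notin> I \<Longrightarrow> i \<notin> I \<Longrightarrow> z j $ i = (if i = j then 1 else 0)" by metis
  define w where "w = (\<Sum>j\<in>- I. v $ j *s z j)"
  have Aw: "A *v w = 0" unfolding w_def vec.sum using z by (simp add: vec.scale)
  have Bw: "B *v w = 0" unfolding w_def vec.sum using z by (simp add: vec.scale)
  have "principal_block I A *v (v - w) = 0"
  proof (rule principal_block_mult_eq_0)
    fix i assume i: "i \<notin> I"
    have "w $ i = (\<Sum>j\<in>- I. v $ j * z j $ i)"
      by (simp add: w_def sum_component)
    also have "\<dots> = (\<Sum>j\<in>- I. if i = j then v $ j else 0)"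
      using z(3) i by (intro sum.cong) auto
    finally have "w $ i = (\<Sum>j\<in>- I. if i = j then v $ j else 0)" .
    then show "(v - w) $ i = 0" using i by simp
  next
    fix i show "(A *v (v - w)) $ i = 0" using Aw v by (simp add: matrix_vector_mult_diff_distrib)
  qed
  then have "v - w = 0" using A unfolding det_nonzero_iff_inj by blast
  then show ?thesis using Bw by simp
qed

section \<open>The square-free condition as a polynomial test\<close>

definition layer :: "nat \<Rightarrow> (nat \<times> 'n \<times> 'n \<Rightarrow> 'a) \<Rightarrow> 'a^'n^'n" where
  "layer l x = (\<chi> i j. x (l, i, j))"

lemma layer_nth [simp]: "layer l x $ i $ j = x (l, i, j)"
  by (simp add: layer_def)

lemma layer_entries [simp]: "layer l (entries M) = M l"
  by (simp add: layer_def)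

text \<open>Being nonzero guarantees two things at once: the first matrix has a regular block, and
  the pencil polynomial has no multiple root.\<close>

definition pencil_disc :: "'n::finite set \<Rightarrow> (nat \<times> 'n \<times> 'n \<Rightarrow> 'a) \<Rightarrow> 'a::field" where
  "pencil_disc I x = det (principal_block I (layer 0 x)) *
     Determinant.det (sylvester (card I) (pencil_poly I (layer 0 x) (layer 1 x)))"

lemma poly_fun_coeff_mult:
  assumes "\<And>k. poly_fun (\<lambda>x. coeff (F x) k)" "\<And>k. poly_fun (\<lambda>x. coeff (G x) k)"
  shows "poly_fun (\<lambda>x. coeff (F x * G x) k)"
  unfolding coeff_mult by (intro poly_fun_sum poly_fun.mult assms)

lemma poly_fun_coeff_prod:
  assumes "\<And>i k. i \<in> A \<Longrightarrow> poly_fun (\<lambda>x. coeff (F i x) k)"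
  shows "poly_fun (\<lambda>x. coeff (\<Prod>i\<in>A. F i x) k)"
  using assms
  by (induction A arbitrary: k rule: infinite_finite_induct) (auto intro: poly_fun.const poly_fun_coeff_mult)

lemma poly_fun_coeff_det:
  assumes "\<And>i j k. poly_fun (\<lambda>x. coeff (F x $ i $ j) k)"
  shows "poly_fun (\<lambda>x. coeff (det (F x)) k)"
  unfolding Determinants.det_def coeff_sum
  by (intro poly_fun_sum poly_fun_coeff_mult poly_fun_coeff_prod assms poly_fun.const)

lemma poly_fun_pencil_disc: "poly_fun (pencil_disc I :: (nat \<times> 'n::finite \<times> 'n \<Rightarrow> 'a) \<Rightarrow> 'a::field)"
proof -
  have pp: "poly_fun (\<lambda>x. coeff (pencil_poly I (layer 0 x) (layer 1 x) :: 'a poly) k)" for k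
    unfolding pencil_poly_def
  proof (rule poly_fun_coeff_det)
    fix i j :: 'n and k
    show "poly_fun (\<lambda>x. coeff (principal_block I (pencil (layer 0 x) (layer 1 x)) $ i $ j :: 'a poly) k)"
    proof (cases "i \<in> I \<and> j \<in> I")
      case True
      consider "k = 0" | "k = 1" | k' where "k = Suc (Suc k')" by (metis One_nat_def not0_implies_Suc)
      then show ?thesis using True
        by cases (simp_all add: principal_block_def pencil_def poly_fun.const poly_fun.coord poly_fun_uminus)
    next
      case False
      have "coeff (principal_block I (pencil (layer 0 x) (layer 1 x)) $ i $ j :: 'a poly) k
          = (if i = j then coeff 1 k else 0)" for x
        using False by (auto simp: principal_block_def)
      then show ?thesis by (simp only: poly_fun.const)
    qed
  qed
  have pd: "poly_fun (\<lambda>x. coeff (pderiv (pencil_poly I (layer 0 x) (layer 1 x)) :: 'a poly) k)" for k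
    unfolding coeff_pderiv by (intro poly_fun.mult poly_fun.const pp)
  show ?thesis
    unfolding pencil_disc_def[abs_def] sylvester_def
  proof (intro poly_fun.mult poly_fun_det poly_fun_det_mat)
    show "poly_fun (\<lambda>x. principal_block I (layer 0 x) $ i $ j :: 'a)" for i j
      by (cases "i \<in> I \<and> j \<in> I"; cases "i = j")
        (auto simp: principal_block_def intro: poly_fun.const poly_fun.coord)
    show "poly_fun (\<lambda>x. if i < card I - 1 then coeff (monom 1 i * pencil_poly I (layer 0 x) (layer 1 x)) j
        else coeff (monom 1 (i - (card I - 1)) * pderiv (pencil_poly I (layer 0 x) (layer 1 x))) j :: 'a)" for i j
      by (cases "i < card I - 1"; simp only: if_True if_False; rule poly_fun_coeff_mult[OF poly_fun.const])
        (rule pp, rule pd)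
  qed
qed

text \<open>The pencil argument handles one second matrix at a time. As the test is open, it also
  holds with \<open>M 1 + t N\<close> for some nonzero \<open>t\<close>; both second matrices kill
  \<open>v\<close>, hence so does \<open>N\<close>.\<close>

lemma pencil_disc_common_kernel:
  fixes L :: "('a::alg_closed_field^'n^'n) set"
  assumes L: "mspace.subspace L" "\<And>M. M \<in> L \<Longrightarrow> transpose M = M" "\<And>M. M \<in> L \<Longrightarrow> rank M \<le> card I"
    and I: "I \<noteq> {}"
    and M: "range M \<subseteq> L" "pencil_disc I (entries M) \<noteq> 0"
    and N: "N \<in> L" and v: "M 0 *v v = 0"
  shows "N *v v = 0"
proof -
  have cI: "0 < card I" using I by (simp add: card_gt_0_iff)
  have memL: "M l \<in> L" for l using M(1) by auto
  have A: "det (principal_block I (M 0)) \<noteq> 0" using M(2) by (simp add: pencil_disc_def)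
  have step: "C *v v = 0" if C: "C \<in> L" "pencil_disc I (entries (\<lambda>l. if l = 0 then M 0 else C)) \<noteq> 0" for C
  proof (rule pencil_common_kernel[OF _ _ _ A _ v])
    show "transpose (M 0) = M 0" "transpose C = C" using L(2) memL C by auto
    show "rank (mscale t (M 0) - C) \<le> card I" for t
      using C memL L(1) by (intro L(3) mspace.subspace_diff mspace.subspace_scale) auto
    show "poly (pderiv (pencil_poly I (M 0) C)) c \<noteq> 0" if "poly (pencil_poly I (M 0) C) c = 0" for c
      using det_sylvester_common_root[OF degree_pencil_poly cI that] C(2) by (auto simp: pencil_disc_def)
  qed
  have B: "M 1 *v v = 0"
    using M(2) by (intro step) (auto simp: pencil_disc_def memL)
  define c where "c = (\<lambda>(l :: nat, i, j). if l = 0 then [:M 0 $ i $ j:] else [:M 1 $ i $ j, N $ i $ j:])"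
  obtain q where q: "\<And>t. pencil_disc I (\<lambda>i. poly (c i) t) = poly q t"
    using poly_fun_curve[OF poly_fun_pencil_disc, of I c] by blast
  have ct: "(\<lambda>i. poly (c i) t) = entries (\<lambda>l. if l = 0 then M 0 else M 1 + mscale t N)" for t
    by (auto simp: c_def)
  have "poly q 0 = pencil_disc I (entries M)"
    unfolding q[symmetric] ct by (simp add: pencil_disc_def)
  then have "q \<noteq> 0" using M(2) by auto
  then obtain t where t: "t \<noteq> 0" "poly q t \<noteq> 0"
    using exists_nonzero_point[of q "{0}"] by auto
  have "(M 1 + mscale t N) *v v = 0"
    using t q[of t] unfolding ct
    by (intro step mspace.subspace_add mspace.subspace_scale L(1) memL N) auto
  moreover have "mscale t N *v v = t *s (N *v v)"
    by (simp add: Finite_Cartesian_Product.vec_eq_iff matrix_vector_mult_def sum_distrib_left mult.assoc)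
  ultimately show ?thesis using B t by (simp add: matrix_vector_mult_add_rdistrib)
qed

section \<open>Spaces in which kernel vectors of a generic member have maximal isotropic image\<close>

text \<open>Maximality of \<open>rank x\<close> within all of \<open>L\<close> makes
  \<open>kernel_power_series\<close> available in every direction \<open>Z\<close>. The relations
  below are read off from its coefficients.\<close>

locale max_rank_member =
  fixes L :: "('a::alg_closed_field^'n^'n) set" and x :: "'a^'n^'n"
  assumes L: "mspace.subspace L" and sym: "\<And>M. M \<in> L \<Longrightarrow> transpose M = M"
    and x: "x \<in> L" and rk: "\<And>M. M \<in> L \<Longrightarrow> rank M \<le> rank x" and two: "(2::'a) \<noteq> 0"
begin

lemma dot_swap: "M \<in> L \<Longrightarrow> u \<odot> (M *v v) = v \<odot> (M *v u)"
  using sym dot_symmetric_matrix_swap by blast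

lemma kernel_series:
  assumes Z: "Z \<in> L" and v: "x *v v = 0"
  obtains \<zeta> where "\<zeta> 0 = v" "\<And>i. x *v \<zeta> (Suc i) = - (Z *v \<zeta> i)"
proof -
  have "rank (x + mscale t Z) \<le> rank x" for t
    using Z by (intro rk mspace.subspace_add mspace.subspace_scale L x)
  from kernel_power_series[OF this v] that show thesis by metis
qed

lemma kernel_dot: "x *v v' = 0 \<Longrightarrow> v' \<odot> (x *v y) = 0"
  using dot_swap[OF x, of v' y] by simp

lemma kernel_isotropic:
  assumes "Z \<in> L" "x *v v = 0" "x *v v' = 0"
  shows "v' \<odot> (Z *v v) = 0"
proof -
  obtain \<zeta> where \<zeta>: "\<zeta> 0 = v" "\<And>i. x *v \<zeta> (Suc i) = - (Z *v \<zeta> i)"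
    using kernel_series[OF assms(1,2)] by metis
  have "v' \<odot> (x *v \<zeta> (Suc 0)) = 0" using assms(3) by (rule kernel_dot)
  then show ?thesis unfolding \<zeta> by simp
qed

text \<open>\<open>y\<close> and \<open>- \<zeta> 1\<close> differ by a kernel vector, which
  contributes nothing by \<open>kernel_isotropic\<close>; for \<open>\<zeta> 1\<close> the relation
  is one step of the recursion.\<close>

lemma second_order:
  assumes Z: "Z \<in> L" and v: "x *v v = 0" "x *v v' = 0" and y: "x *v y = Z *v v"
  shows "v' \<odot> (Z *v y) = 0"
proof -
  obtain \<zeta> where \<zeta>: "\<zeta> 0 = v" "\<And>i. x *v \<zeta> (Suc i) = - (Z *v \<zeta> i)"
    using kernel_series[OF Z v(1)] by metis
  have "x *v (y + \<zeta> 1) = 0" using \<zeta>(2)[of 0] \<zeta>(1) y by (simp add: matrix_vector_right_distrib)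
  then have 1: "v' \<odot> (Z *v (y + \<zeta> 1)) = 0" using kernel_isotropic[OF Z _ v(2)] by blast
  have "v' \<odot> (x *v \<zeta> 2) = 0" using v(2) by (rule kernel_dot)
  then have "v' \<odot> (Z *v \<zeta> 1) = 0" using \<zeta>(2)[of 1] by (simp add: numeral_2_eq_2)
  then show ?thesis using 1 by (simp add: matrix_vector_right_distrib)
qed

text \<open>Symmetry lets \<open>x\<close> and \<open>Z\<close> be shifted along the series until
  \<open>x\<close> meets the kernel vector \<open>v\<close>. Passing from \<open>\<zeta> 1\<close>
  to an arbitrary \<open>y\<close> costs only relations of lower order.\<close>

lemma third_order:
  assumes Z: "Z \<in> L" and v: "x *v v = 0" and y: "x *v y = Z *v v"
  shows "y \<odot> (Z *v y) = 0"
proof -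
  obtain \<zeta> where \<zeta>: "\<zeta> 0 = v" "\<And>i. x *v \<zeta> (Suc i) = - (Z *v \<zeta> i)"
    using kernel_series[OF Z v] by metis
  have \<zeta>1: "x *v \<zeta> 1 = - (Z *v v)" and \<zeta>2: "x *v \<zeta> 2 = - (Z *v \<zeta> 1)" and \<zeta>3: "x *v \<zeta> 3 = - (Z *v \<zeta> 2)"
    using \<zeta>(2)[of 0] \<zeta>(2)[of 1] \<zeta>(2)[of 2] \<zeta>(1) by (simp_all add: numeral_2_eq_2 numeral_3_eq_3)
  have "\<zeta> 1 \<odot> (Z *v \<zeta> 1) = - (\<zeta> 1 \<odot> (x *v \<zeta> 2))" unfolding \<zeta>2 by simp
  also have "\<dots> = - (\<zeta> 2 \<odot> (x *v \<zeta> 1))" using dot_swap[OF x] by simp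
  also have "\<dots> = v \<odot> (Z *v \<zeta> 2)" unfolding \<zeta>1 using dot_swap[OF Z] by simp
  also have "\<dots> = - (v \<odot> (x *v \<zeta> 3))" unfolding \<zeta>3 by simp
  also have "\<dots> = 0" using kernel_dot[OF v] by simp
  finally have 0: "\<zeta> 1 \<odot> (Z *v \<zeta> 1) = 0" .
  define k where "k = y + \<zeta> 1"
  have k: "x *v k = 0" using \<zeta>1 y by (simp add: k_def matrix_vector_right_distrib)
  have yk: "y = k - \<zeta> 1" by (simp add: k_def)
  have kk: "k \<odot> (Z *v k) = 0" by (rule kernel_isotropic[OF Z k k])
  have ky: "k \<odot> (Z *v y) = 0" by (rule second_order[OF Z v k y])
  have k1: "k \<odot> (Z *v \<zeta> 1) = 0"
    using ky kk unfolding yk by (simp add: matrix_vector_mult_diff_distrib)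
  then have "\<zeta> 1 \<odot> (Z *v k) = 0" using dot_swap[OF Z] by simp
  then show ?thesis
    unfolding yk using 0 kk k1 by (simp add: matrix_vector_mult_diff_distrib)
qed

text \<open>The same shifting one step further. Here the preimages are not arbitrary but taken from
  the series, namely \<open>- \<zeta> 1\<close> and \<open>\<zeta> 2\<close>.\<close>

lemma fifth_order:
  assumes Z: "Z \<in> L" and v: "x *v v = 0"
  obtains y y2 where "x *v y = Z *v v" "x *v y2 = Z *v y" "y2 \<odot> (Z *v y) = 0"
proof -
  obtain \<zeta> where \<zeta>: "\<zeta> 0 = v" "\<And>i. x *v \<zeta> (Suc i) = - (Z *v \<zeta> i)"
    using kernel_series[OF Z v] by metis
  have \<zeta>1: "x *v \<zeta> 1 = - (Z *v v)" and \<zeta>2: "x *v \<zeta> 2 = - (Z *v \<zeta> 1)" and \<zeta>3: "x *v \<zeta> 3 = - (Z *v \<zeta> 2)"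
    and \<zeta>4: "x *v \<zeta> 4 = - (Z *v \<zeta> 3)"
    using \<zeta>(2)[of 0] \<zeta>(2)[of 1] \<zeta>(2)[of 2] \<zeta>(2)[of 3] \<zeta>(1)
    by (simp_all add: numeral_2_eq_2 numeral_3_eq_3 eval_nat_numeral)
  have neg: "M *v (- w) = - (M *v w)" for M :: "'a^'n^'n" and w
    using matrix_vector_mult_diff_distrib[of M 0 w] by simp
  have "\<zeta> 2 \<odot> (Z *v \<zeta> 1) = \<zeta> 1 \<odot> (Z *v \<zeta> 2)" by (rule dot_swap[OF Z])
  also have "\<dots> = - (\<zeta> 1 \<odot> (x *v \<zeta> 3))" unfolding \<zeta>3 by simp
  also have "\<dots> = - (\<zeta> 3 \<odot> (x *v \<zeta> 1))" using dot_swap[OF x] by simp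
  also have "\<dots> = v \<odot> (Z *v \<zeta> 3)" unfolding \<zeta>1 using dot_swap[OF Z] by simp
  also have "\<dots> = - (v \<odot> (x *v \<zeta> 4))" unfolding \<zeta>4 by simp
  also have "\<dots> = 0" using kernel_dot[OF v] by simp
  finally have 0: "\<zeta> 2 \<odot> (Z *v \<zeta> 1) = 0" .
  show thesis
  proof (rule that[of "- \<zeta> 1" "\<zeta> 2"])
    show "x *v - \<zeta> 1 = Z *v v" unfolding neg \<zeta>1 by simp
    show "x *v \<zeta> 2 = Z *v - \<zeta> 1" unfolding neg \<zeta>2 ..
    show "\<zeta> 2 \<odot> (Z *v - \<zeta> 1) = 0" unfolding neg using 0 by simp
  qed
qed

lemma kernel_image_in_range:
  assumes "Z \<in> L" "x *v v = 0"
  shows "\<exists>y. x *v y = Z *v v"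
  using fifth_order[OF assms] by metis

section \<open>The image of a kernel vector under \<open>L\<close> as an isotropic space\<close>

definition preim :: "('a^'n) set \<Rightarrow> ('a^'n) set" where
  "preim T = {y. x *v y \<in> T}"

lemma subspace_preim: "vec.subspace T \<Longrightarrow> vec.subspace (preim T)"
  by (auto simp: preim_def vec.subspace_def matrix_vector_right_distrib vec.scale)

lemma dim_preim:
  assumes T: "vec.subspace T" "T \<subseteq> range ((*v) x)"
  shows "vec.dim (preim T) + rank x = CARD('n) + vec.dim T"
proof -
  have "(*v) x ` preim T = T" using T(2) by (auto simp: preim_def)
  moreover have "{v \<in> preim T. x *v v = 0} = {v. x *v v = 0}"
    using T(1) by (auto simp: preim_def vec.subspace_0)
  ultimately have "vec.dim (preim T) = vec.dim T + vec.dim {v. x *v v = 0}"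
    using vec.dim_image_kernel[OF matrix_vector_mul_linear_gen subspace_preim[OF T(1)], of x] by simp
  then show ?thesis using dim_kernel[of x] by simp
qed

text \<open>Sending \<open>x y\<close> and \<open>x y'\<close> to \<open>y \<odot> (x *v y')\<close>
  is a nondegenerate symmetric form on the range of \<open>x\<close>, and \<open>T\<close> is
  isotropic for it.\<close>

lemma isotropic_dim_bound:
  assumes T: "vec.subspace T" "T \<subseteq> range ((*v) x)"
    and iso: "\<And>y t. y \<in> preim T \<Longrightarrow> t \<in> T \<Longrightarrow> y \<odot> t = 0"
  shows "2 * vec.dim T \<le> rank x"
proof -
  have "T \<subseteq> perp (preim T)" using iso by (auto simp: perp_def)
  then have "vec.dim T \<le> vec.dim (perp (preim T))" by (rule vec.dim_subset)
  then show ?thesis using dim_perp[of "preim T"] dim_preim[OF T] by linarith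
qed

definition orbit :: "'a^'n \<Rightarrow> ('a^'n) set" where
  "orbit p = (\<lambda>N. N *v p) ` L"

lemma orbitI: "N \<in> L \<Longrightarrow> N *v p \<in> orbit p"
  by (auto simp: orbit_def)

lemma orbitE:
  assumes "t \<in> orbit p"
  obtains N where "N \<in> L" "t = N *v p"
  using assms unfolding orbit_def by (elim imageE)

lemma preim_orbitE:
  assumes "y \<in> preim (orbit p)"
  obtains Z where "Z \<in> L" "x *v y = Z *v p"
proof -
  have "x *v y \<in> orbit p" using assms by (simp add: preim_def)
  then show thesis by (rule orbitE) (rule that)
qed

lemma subspace_orbit: "vec.subspace (orbit p)"
  unfolding vec.subspace_def
proof (intro conjI ballI allI)
  show "0 \<in> orbit p" using orbitI[OF mspace.subspace_0[OF L]] by simp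
  fix a assume "a \<in> orbit p"
  then obtain N where N: "N \<in> L" "a = N *v p" by (rule orbitE)
  show "a + b \<in> orbit p" if b: "b \<in> orbit p" for b
  proof -
    obtain N' where N': "N' \<in> L" "b = N' *v p" using b by (rule orbitE)
    have "(N + N') *v p \<in> orbit p" using N N' by (intro orbitI mspace.subspace_add L)
    then show ?thesis using N N' by (simp add: matrix_vector_mult_add_rdistrib)
  qed
  show "c *s a \<in> orbit p" for c
  proof -
    have "mscale c N *v p = c *s (N *v p)"
      by (simp add: Finite_Cartesian_Product.vec_eq_iff matrix_vector_mult_def sum_distrib_left mult.assoc)
    then show ?thesis using orbitI[OF mspace.subspace_scale[OF L N(1)], of c p] N by simp
  qed
qed

lemma orbit_subset_range: "x *v p = 0 \<Longrightarrow> orbit p \<subseteq> range ((*v) x)"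
proof
  fix t assume p: "x *v p = 0" and "t \<in> orbit p"
  then obtain N where N: "N \<in> L" "t = N *v p" by (elim orbitE)
  obtain y where "x *v y = N *v p" using kernel_image_in_range[OF N(1) p] by blast
  then show "t \<in> range ((*v) x)" using N(2) by (intro range_eqI[of _ _ y]) simp
qed

text \<open>The quadratic case is \<open>second_order\<close>, because
  \<open>y \<odot> (x *v y) = y \<odot> (Z *v p) = p \<odot> (Z *v y)\<close>; polarisation needs
  \<open>2 \<noteq> 0\<close>.\<close>

lemma orbit_isotropic:
  assumes p: "x *v p = 0" and y: "y \<in> preim (orbit p)" "y' \<in> preim (orbit p)"
  shows "y \<odot> (x *v y') = 0"
proof -
  have q: "y \<odot> (x *v y) = 0" if y0: "y \<in> preim (orbit p)" for y
  proof -
    obtain Z where Z: "Z \<in> L" "x *v y = Z *v p" using y0 by (rule preim_orbitE)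
    have "p \<odot> (Z *v y) = 0" using second_order[OF Z(1) p p Z(2)] .
    then show ?thesis unfolding Z(2) using dot_swap[OF Z(1)] by simp
  qed
  have "y + y' \<in> preim (orbit p)" by (intro vec.subspace_add subspace_preim subspace_orbit y)
  from q[OF this] have "y \<odot> (x *v y) + y' \<odot> (x *v y) + (y \<odot> (x *v y') + y' \<odot> (x *v y')) = 0"
    by (simp only: matrix_vector_right_distrib dot_simps(1,2) ac_simps)
  then have "y' \<odot> (x *v y) + y \<odot> (x *v y') = 0"
    unfolding q[OF y(1)] q[OF y(2)] by (simp only: add_0_left add_0_right)
  then have "2 * (y \<odot> (x *v y')) = 0" unfolding dot_swap[OF x, of y' y] by (simp only: mult_2)
  then show ?thesis using two by simp
qed

lemma orbit_isotropic':
  assumes p: "x *v p = 0" and y: "y \<in> preim (orbit p)" and t: "t \<in> orbit p"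
  shows "y \<odot> t = 0"
proof -
  have "t \<in> range ((*v) x)" using orbit_subset_range[OF p] t by (rule subsetD)
  then obtain y' where y': "t = x *v y'" by (elim rangeE)
  then have "y' \<in> preim (orbit p)" using t by (simp add: preim_def)
  then show ?thesis using orbit_isotropic[OF p y] y' by simp
qed

lemma dim_orbit_le: "x *v p = 0 \<Longrightarrow> 2 * vec.dim (orbit p) \<le> rank x"
  by (intro isotropic_dim_bound subspace_orbit orbit_subset_range orbit_isotropic')

text \<open>By the bound on \<open>rank x\<close>, \<open>orbit p\<close> has the maximal dimension
  of an isotropic space. An isotropic \<open>x y\<close> orthogonal to it but outside it would
  enlarge it beyond \<open>isotropic_dim_bound\<close>.\<close>

lemma maximal_isotropic:
  assumes p: "x *v p = 0" and dim: "rank x \<le> 2 * vec.dim (orbit p) + 1"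
    and y: "y \<odot> (x *v y) = 0" "\<And>y'. y' \<in> preim (orbit p) \<Longrightarrow> y' \<odot> (x *v y) = 0"
  shows "x *v y \<in> orbit p"
proof (rule ccontr)
  let ?T = "orbit p" and ?w = "x *v y"
  assume w: "?w \<notin> ?T"
  define T' where "T' = vec.span (insert ?w ?T)"
  have spanT: "vec.span ?T = ?T" using subspace_orbit by (simp add: vec.span_eq_iff)
  have dimT': "vec.dim T' = Suc (vec.dim ?T)"
    unfolding T'_def vec.dim_span vec.dim_insert spanT using w by simp
  have elem: "\<exists>c t1. t1 \<in> ?T \<and> t = t1 + c *s ?w" if "t \<in> T'" for t
  proof -
    have "\<exists>c. t - c *s ?w \<in> vec.span ?T"
      using that by (simp only: T'_def vec.span_breakdown_eq)
    then obtain c where "t - c *s ?w \<in> vec.span ?T" by (rule exE)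
    then show ?thesis unfolding spanT by (intro exI[of _ c] exI[of _ "t - c *s ?w"]) simp
  qed
  have yt: "y \<odot> t = 0" if "t \<in> ?T" for t
  proof -
    have "t \<in> range ((*v) x)" using orbit_subset_range[OF p] that by (rule subsetD)
    then obtain y2 where y2: "t = x *v y2" by (elim rangeE)
    then have "y2 \<in> preim ?T" using that by (simp add: preim_def)
    then have "y2 \<odot> (x *v y) = 0" by (rule y(2))
    then show ?thesis unfolding y2 using dot_swap[OF x] by simp
  qed
  have "2 * vec.dim T' \<le> rank x"
  proof (rule isotropic_dim_bound)
    show "vec.subspace T'" by (simp add: T'_def)
    show "T' \<subseteq> range ((*v) x)"
      unfolding T'_def using orbit_subset_range[OF p]
      by (intro vec.span_minimal) (auto intro!: vec.subspace_image)
    fix y' t assume y': "y' \<in> preim T'" and t: "t \<in> T'"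
    obtain c t1 where t1: "t1 \<in> ?T" "t = t1 + c *s ?w" using elem[OF t] by blast
    have "x *v y' \<in> T'" using y' by (simp add: preim_def)
    then obtain c' t2 where t2: "t2 \<in> ?T" "x *v y' = t2 + c' *s ?w" using elem by blast
    define y1 where "y1 = y' - c' *s y"
    have y1: "y1 \<in> preim ?T"
      using t2 by (simp add: preim_def y1_def matrix_vector_mult_diff_distrib vec.scale)
    have "y' = y1 + c' *s y" by (simp add: y1_def)
    then show "y' \<odot> t = 0"
      using t1 yt[OF t1(1)] orbit_isotropic'[OF p y1 t1(1)] y(1) y(2)[OF y1] by simp
  qed
  then show False using dimT' dim by simp
qed

text \<open>As \<open>M\<close> kills \<open>p\<close>, the members \<open>Z\<close> and
  \<open>M + Z\<close> agree at \<open>p\<close>, so \<open>second_order\<close> holds for both with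
  the same \<open>y'\<close>. The difference says that \<open>M v\<close> is orthogonal to
  \<open>orbit p\<close>, and maximality puts it inside.\<close>

lemma annihilator_maps_kernel_to_orbit:
  assumes p: "x *v p = 0" and dim: "rank x \<le> 2 * vec.dim (orbit p) + 1"
    and M: "M \<in> L" "M *v p = 0" and v: "x *v v = 0"
  shows "M *v v \<in> orbit p"
proof -
  obtain y where y: "x *v y = M *v v" using kernel_image_in_range[OF M(1) v] by blast
  have "x *v y \<in> orbit p"
  proof (rule maximal_isotropic[OF p dim])
    have "v \<odot> (M *v y) = 0" by (rule second_order[OF M(1) v v y])
    then show "y \<odot> (x *v y) = 0" unfolding y using dot_swap[OF M(1)] by simp
    fix y' assume "y' \<in> preim (orbit p)"
    then obtain Z where Z: "Z \<in> L" "x *v y' = Z *v p" by (rule preim_orbitE)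
    have "x *v y' = (M + Z) *v p" using Z M by (simp add: matrix_vector_mult_add_rdistrib)
    then have "v \<odot> ((M + Z) *v y') = 0"
      by (intro second_order[OF _ p v] mspace.subspace_add L M Z)
    moreover have "v \<odot> (Z *v y') = 0" by (rule second_order[OF Z(1) p v Z(2)])
    ultimately have "v \<odot> (M *v y') = 0" by (simp add: matrix_vector_mult_add_rdistrib)
    then show "y' \<odot> (x *v y) = 0" unfolding y using dot_swap[OF M(1)] by simp
  qed
  then show ?thesis by (simp add: y)
qed

text \<open>The same comparison of \<open>Z\<close> with \<open>M + Z\<close>, now in
  \<open>third_order\<close>, followed by polarisation.\<close>

lemma annihilator_isotropic:
  assumes p: "x *v p = 0" and M: "M \<in> L" "M *v p = 0"
    and y: "y \<in> preim (orbit p)" "y' \<in> preim (orbit p)"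
  shows "y \<odot> (M *v y') = 0"
proof -
  have q: "y \<odot> (M *v y) = 0" if y0: "y \<in> preim (orbit p)" for y
  proof -
    obtain Z where Z: "Z \<in> L" "x *v y = Z *v p" using y0 by (rule preim_orbitE)
    have "x *v y = (M + Z) *v p" using Z M by (simp add: matrix_vector_mult_add_rdistrib)
    then have "y \<odot> ((M + Z) *v y) = 0"
      by (intro third_order[OF _ p] mspace.subspace_add L M Z)
    moreover have "y \<odot> (Z *v y) = 0" by (rule third_order[OF Z(1) p Z(2)])
    ultimately show ?thesis by (simp add: matrix_vector_mult_add_rdistrib)
  qed
  have "y + y' \<in> preim (orbit p)" by (intro vec.subspace_add subspace_preim subspace_orbit y)
  from q[OF this] have "y \<odot> (M *v y) + y' \<odot> (M *v y) + (y \<odot> (M *v y') + y' \<odot> (M *v y')) = 0"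
    by (simp only: matrix_vector_right_distrib dot_simps(1,2) ac_simps)
  then have "y' \<odot> (M *v y) + y \<odot> (M *v y') = 0"
    unfolding q[OF y(1)] q[OF y(2)] by (simp only: add_0_left add_0_right)
  then have "2 * (y \<odot> (M *v y')) = 0" unfolding dot_swap[OF M(1), of y' y] by (simp only: mult_2)
  then show ?thesis using two by simp
qed

lemma image_in_orbit:
  assumes p: "x *v p = 0" and dim: "rank x \<le> 2 * vec.dim (orbit p) + 1"
    and iso: "\<And>N y y'. N \<in> L \<Longrightarrow> y \<in> preim (orbit p) \<Longrightarrow> y' \<in> preim (orbit p) \<Longrightarrow> y \<odot> (N *v y') = 0"
    and ker: "\<And>N v. N \<in> L \<Longrightarrow> x *v v = 0 \<Longrightarrow> N *v v \<in> orbit p"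
    and M: "M \<in> L" "M *v p = 0" and y: "y \<in> preim (orbit p)"
  shows "M *v y \<in> orbit p"
proof -
  \<comment> \<open>The special preimages of \<open>fifth_order\<close> give
    \<open>Z y0 = x y2\<close> with \<open>y2\<close> isotropic, so maximality applies to it. The
    vector \<open>y\<close> differs from \<open>y0\<close> by a kernel vector of \<open>x\<close>,
    which \<open>ker\<close> covers.\<close>
  have step: "Z *v y \<in> orbit p" if Z: "Z \<in> L" "x *v y = Z *v p" for Z
  proof -
    obtain y0 y2 where y0: "x *v y0 = Z *v p" "x *v y2 = Z *v y0" "y2 \<odot> (Z *v y0) = 0"
      using fifth_order[OF Z(1) p] by metis
    have y0W: "y0 \<in> preim (orbit p)" using orbitI[OF Z(1)] y0 by (simp add: preim_def)
    have "x *v y2 \<in> orbit p"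
      by (rule maximal_isotropic[OF p dim]) (use y0 iso[OF Z(1) _ y0W] in auto)
    then have 1: "Z *v y0 \<in> orbit p" using y0 by simp
    have "x *v (y - y0) = 0" using Z y0 by (simp add: matrix_vector_mult_diff_distrib)
    then have "Z *v (y - y0) \<in> orbit p" by (rule ker[OF Z(1)])
    then have "Z *v y0 + Z *v (y - y0) \<in> orbit p" using 1 by (intro vec.subspace_add subspace_orbit)
    then show ?thesis by (simp add: matrix_vector_mult_diff_distrib)
  qed
  obtain Z where Z: "Z \<in> L" "x *v y = Z *v p" using y by (rule preim_orbitE)
  have "(M + Z) *v y \<in> orbit p"
    by (intro step mspace.subspace_add L M Z) (use Z M in \<open>simp add: matrix_vector_mult_add_rdistrib\<close>)
  then have "(M + Z) *v y - Z *v y \<in> orbit p"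
    using step[OF Z] by (intro vec.subspace_diff subspace_orbit)
  then show ?thesis by (simp add: matrix_vector_mult_add_rdistrib)
qed

text \<open>Two kernel vectors on which \<open>L\<close> acts independently: their annihilators in \<open>L\<close> span \<open>L\<close>, and each
  annihilator is compressed by the relations above.\<close>

lemma compression_if_independent_kernel_vectors:
  assumes p: "x *v p = 0" and q: "x *v q = 0"
    and S: "rank x \<le> 2 * card S + 1"
    and onto: "\<And>y z. \<exists>N\<in>L. \<forall>i\<in>S. (N *v p) $ i = y i \<and> (N *v q) $ i = z i"
  obtains W U where "vec.subspace W" "vec.subspace U" "W \<subseteq> U"
    "vec.dim W + rank x = CARD('n) + card S" "vec.dim U + card S = CARD('n)"
    "\<And>N w u. N \<in> L \<Longrightarrow> w \<in> W \<Longrightarrow> u \<in> U \<Longrightarrow> w \<odot> (N *v u) = 0"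
proof -
  define R :: "'a^'n^'n" where "R = (\<chi> i j. if i = j \<and> i \<in> S then 1 else 0)"
  have R: "(R *v w) $ i = (if i \<in> S then w $ i else 0)" for w i
    by (simp add: R_def matrix_vector_mult_def if_distrib[of "\<lambda>x. x * _"] cong: if_cong)
  have Rimg: "(*v) R ` T \<subseteq> {x. \<forall>i. i \<notin> S \<longrightarrow> x $ i = 0}" for T
    by (auto simp: R)
  have dim: "vec.dim (orbit p) = card S"
  proof (rule antisym)
    show "vec.dim (orbit p) \<le> card S" using dim_orbit_le[OF p] S by linarith
    have "(*v) R ` orbit p = {x. \<forall>i. i \<notin> S \<longrightarrow> x $ i = 0}"
    proof (rule subset_antisym[OF Rimg] subsetI)+
      fix w :: "'a^'n" assume w: "w \<in> {x. \<forall>i. i \<notin> S \<longrightarrow> x $ i = 0}"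
      obtain N where N: "N \<in> L" "\<And>i. i \<in> S \<Longrightarrow> (N *v p) $ i = w $ i"
        using onto[of "\<lambda>i. w $ i"] by blast
      have "w = R *v (N *v p)" using w N by (auto simp: Finite_Cartesian_Product.vec_eq_iff R)
      then show "w \<in> (*v) R ` orbit p" using orbitI[OF N(1)] by (rule image_eqI)
    qed
    then have "card S = vec.dim ((*v) R ` orbit p)" by (simp only: dim_substandard_cart)
    also have "\<dots> \<le> vec.dim (orbit p)" by (rule vec.dim_image_le[OF matrix_vector_mul_linear_gen])
    finally show "card S \<le> vec.dim (orbit p)" .
  qed
  have inj: "t = 0" if t: "t \<in> orbit p" "\<And>i. i \<in> S \<Longrightarrow> t $ i = 0" for t
  proof -
    have "(*v) R ` orbit p = {x. \<forall>i. i \<notin> S \<longrightarrow> x $ i = 0}"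
    proof (rule subset_antisym[OF Rimg] subsetI)+
      fix w :: "'a^'n" assume w: "w \<in> {x. \<forall>i. i \<notin> S \<longrightarrow> x $ i = 0}"
      obtain N where N: "N \<in> L" "\<And>i. i \<in> S \<Longrightarrow> (N *v p) $ i = w $ i"
        using onto[of "\<lambda>i. w $ i"] by blast
      have "w = R *v (N *v p)" using w N by (auto simp: Finite_Cartesian_Product.vec_eq_iff R)
      then show "w \<in> (*v) R ` orbit p" using orbitI[OF N(1)] by (rule image_eqI)
    qed
    then have "vec.dim ((*v) R ` orbit p) = card S" by (simp only: dim_substandard_cart)
    then have "vec.dim {t \<in> orbit p. R *v t = 0} = 0"
      using vec.dim_image_kernel[OF matrix_vector_mul_linear_gen[of R] subspace_orbit[of p]] dim by simp
    then have "{t \<in> orbit p. R *v t = 0} \<subseteq> {0}" by (simp only: vec.dim_eq_0)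
    moreover have "R *v t = 0" using t by (simp add: Finite_Cartesian_Product.vec_eq_iff R)
    ultimately show ?thesis using t by blast
  qed
  have dimp: "rank x \<le> 2 * vec.dim (orbit p) + 1" using S dim by simp
  \<comment> \<open>Prescribe the coordinates in \<open>S\<close> as 0 at \<open>p\<close> and as
    those of \<open>t\<close> at \<open>q\<close>. Vectors of \<open>orbit p\<close> are determined
    by these coordinates, so \<open>N p\<close> is 0, and \<open>N q\<close>, which then lies in
    \<open>orbit p\<close>, equals \<open>t\<close>.\<close>
  have lift: "\<exists>M\<in>L. M *v p = 0 \<and> M *v q = t" if t: "t \<in> orbit p" for t
  proof -
    obtain N where N: "N \<in> L" "\<And>i. i \<in> S \<Longrightarrow> (N *v p) $ i = 0" "\<And>i. i \<in> S \<Longrightarrow> (N *v q) $ i = t $ i"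
      using onto[of "\<lambda>_. 0" "\<lambda>i. t $ i"] by blast
    have Np: "N *v p = 0" by (rule inj[OF orbitI[OF N(1)]]) (rule N(2))
    have "N *v q \<in> orbit p" by (rule annihilator_maps_kernel_to_orbit[OF p dimp N(1) Np q])
    then have "N *v q - t = 0"
      using t N(3) by (intro inj vec.subspace_diff subspace_orbit) auto
    then show ?thesis using N Np by auto
  qed
  have "orbit p \<subseteq> orbit q"
  proof
    fix t assume "t \<in> orbit p"
    then obtain M where "M \<in> L" "t = M *v q" using lift by blast
    then show "t \<in> orbit q" by (auto simp: orbit_def)
  qed
  then have pq: "orbit p = orbit q"
    using dim_orbit_le[OF q] S dim by (intro vec.subspace_dim_equal subspace_orbit) auto
  have split: "\<exists>M1\<in>L. \<exists>M2\<in>L. N = M1 + M2 \<and> M1 *v p = 0 \<and> M2 *v q = 0" if N: "N \<in> L" for N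
  proof -
    obtain M where M: "M \<in> L" "M *v p = 0" "M *v q = N *v q"
      using lift[of "N *v q"] orbitI[OF N] pq by blast
    have "(N - M) *v q = 0" using M by (simp add: matrix_vector_mult_diff_rdistrib)
    moreover have "N - M \<in> L" using N M L by (intro mspace.subspace_diff)
    ultimately show ?thesis using M by (intro bexI[of _ M] bexI[of _ "N - M"]) auto
  qed
  have dimq: "rank x \<le> 2 * vec.dim (orbit q) + 1" using dimp pq by simp
  have ker: "N *v v \<in> orbit p" if N: "N \<in> L" and v: "x *v v = 0" for N v
  proof -
    obtain M1 M2 where M: "M1 \<in> L" "M2 \<in> L" "N = M1 + M2" "M1 *v p = 0" "M2 *v q = 0"
      using split[OF N] by blast
    have "M1 *v v \<in> orbit p" by (rule annihilator_maps_kernel_to_orbit[OF p dimp M(1,4) v])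
    moreover have "M2 *v v \<in> orbit p" unfolding pq
      by (rule annihilator_maps_kernel_to_orbit[OF q dimq M(2,5) v])
    ultimately have "M1 *v v + M2 *v v \<in> orbit p" by (intro vec.subspace_add subspace_orbit)
    then show ?thesis unfolding M(3) by (simp add: matrix_vector_mult_add_rdistrib)
  qed
  have iso: "y \<odot> (N *v y') = 0"
    if N: "N \<in> L" and y: "y \<in> preim (orbit p)" "y' \<in> preim (orbit p)" for N y y'
  proof -
    obtain M1 M2 where M: "M1 \<in> L" "M2 \<in> L" "N = M1 + M2" "M1 *v p = 0" "M2 *v q = 0"
      using split[OF N] by blast
    have "y \<odot> (M1 *v y') = 0" by (rule annihilator_isotropic[OF p M(1,4) y])
    moreover have "y \<odot> (M2 *v y') = 0"
      by (rule annihilator_isotropic[OF q M(2,5) y[unfolded pq]])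
    ultimately show ?thesis unfolding M(3) by (simp add: matrix_vector_mult_add_rdistrib)
  qed
  have img: "N *v y \<in> orbit p" if N: "N \<in> L" and y: "y \<in> preim (orbit p)" for N y
  proof -
    obtain M1 M2 where M: "M1 \<in> L" "M2 \<in> L" "N = M1 + M2" "M1 *v p = 0" "M2 *v q = 0"
      using split[OF N] by blast
    have "M1 *v y \<in> orbit p" by (rule image_in_orbit[OF p dimp iso ker M(1,4) y])
    moreover have "M2 *v y \<in> orbit p" unfolding pq
      by (rule image_in_orbit[OF q dimq iso[unfolded pq] ker[unfolded pq] M(2,5) y[unfolded pq]])
    ultimately have "M1 *v y + M2 *v y \<in> orbit p" by (intro vec.subspace_add subspace_orbit)
    then show ?thesis unfolding M(3) by (simp add: matrix_vector_mult_add_rdistrib)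
  qed
  show thesis
  \<comment> \<open>All members map the preimage of \<open>orbit p\<close> under \<open>x\<close>
    into \<open>orbit p\<close>, so pairing with the orthogonal space of \<open>orbit p\<close>
    gives 0.\<close>
  proof (rule that[of "preim (orbit p)" "perp (orbit p)"])
    show "vec.subspace (preim (orbit p))" by (intro subspace_preim subspace_orbit)
    show "vec.subspace (perp (orbit p))" by (rule subspace_perp)
    show "preim (orbit p) \<subseteq> perp (orbit p)"
      using orbit_isotropic'[OF p] by (auto simp: perp_def dot_commute)
    show "vec.dim (preim (orbit p)) + rank x = CARD('n) + card S"
      using dim_preim[OF subspace_orbit orbit_subset_range[OF p]] dim by simp
    show "vec.dim (perp (orbit p)) + card S = CARD('n)" using dim_perp[of "orbit p"] dim by simp
    fix N w u assume N: "N \<in> L" and w: "w \<in> preim (orbit p)" and u: "u \<in> perp (orbit p)"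
    have "(N *v w) \<odot> u = 0" using img[OF N w] u by (simp add: perp_def)
    then show "w \<odot> (N *v u) = 0" unfolding dot_swap[OF N, of w u] by (simp add: dot_commute)
  qed
qed

end


section \<open>Independence of the action on kernel vectors as a polynomial test\<close>

lemma principal_block_mult:
  fixes Y :: "'a::field^'n^'n"
  shows "(principal_block I Y *v v) $ i = (if i \<in> I then \<Sum>j\<in>I. Y $ i $ j * v $ j else v $ i)"
proof (cases "i \<in> I")
  case True
  have "(principal_block I Y *v v) $ i = (\<Sum>j\<in>UNIV. if j \<in> I then Y $ i $ j * v $ j else 0)"
    unfolding matrix_vector_mult_def using True by (auto simp: principal_block_def intro!: sum.cong)
  then show ?thesis using True by (simp add: sum.If_cases)
next
  case False
  then show ?thesis
    by (simp add: matrix_vector_mult_def principal_block_def if_distrib[of "\<lambda>x. x * _"] cong: if_cong)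
qed

lemma principal_block_solve:
  fixes Y :: "'a::field^'n^'n"
  assumes "det (principal_block I Y) \<noteq> 0"
  shows "\<exists>v. (\<forall>i\<in>I. (\<Sum>j\<in>I. Y $ i $ j * v $ j) = w i) \<and> (\<forall>i. i \<notin> I \<longrightarrow> v $ i = 0)"
proof -
  obtain v where v: "principal_block I Y *v v = (\<chi> i. if i \<in> I then w i else 0)"
    using det_nonzero_surj[OF assms] by blast
  have vi: "(if i \<in> I then \<Sum>j\<in>I. Y $ i $ j * v $ j else v $ i) = (if i \<in> I then w i else 0)" for i
    using arg_cong[OF v, of "\<lambda>v. v $ i"] unfolding principal_block_mult by simp
  show ?thesis
  proof (intro exI[of _ v] conjI ballI allI impI)
    show "(\<Sum>j\<in>I. Y $ i $ j * v $ j) = w i" if "i \<in> I" for i using vi[of i] that by simp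
    show "v $ i = 0" if "i \<notin> I" for i using vi[of i] that by simp
  qed
qed

lemma mult_supported:
  fixes Y :: "'a::field^'n^'n"
  assumes "\<And>i. i \<notin> I \<Longrightarrow> v $ i = 0"
  shows "(Y *v v) $ i = (\<Sum>j\<in>I. Y $ i $ j * v $ j)"
  unfolding matrix_vector_mult_def using assms
  by (simp, intro sum.mono_neutral_right) auto

text \<open>Because the block is regular, projecting the range to the coordinates in
  \<open>I\<close> is onto; the set in question is the kernel of this projection.\<close>

lemma dim_range_vanishing_on_block:
  fixes Y :: "'a::field^'n^'n"
  assumes nz: "det (principal_block I Y) \<noteq> 0"
  shows "vec.dim {u \<in> range ((*v) Y). \<forall>i\<in>I. u $ i = 0} + card I = rank Y"
proof -
  define R :: "'a^'n^'n" where "R = (\<chi> i j. if i = j \<and> i \<in> I then 1 else 0)"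
  have R: "(R *v w) $ i = (if i \<in> I then w $ i else 0)" for w i
    by (simp add: R_def matrix_vector_mult_def if_distrib[of "\<lambda>x. x * _"] cong: if_cong)
  have sub: "vec.subspace (range ((*v) Y))" by (intro vec.subspace_image) auto
  have img: "(*v) R ` range ((*v) Y) = {x. \<forall>i. i \<notin> I \<longrightarrow> x $ i = 0}"
  proof (rule subset_antisym)
    show "(*v) R ` range ((*v) Y) \<subseteq> {x. \<forall>i. i \<notin> I \<longrightarrow> x $ i = 0}" by (auto simp: R)
    show "{x. \<forall>i. i \<notin> I \<longrightarrow> x $ i = 0} \<subseteq> (*v) R ` range ((*v) Y)"
    proof
      fix w :: "'a^'n" assume w: "w \<in> {x. \<forall>i. i \<notin> I \<longrightarrow> x $ i = 0}"
      obtain v where v: "\<And>i. i \<in> I \<Longrightarrow> (\<Sum>j\<in>I. Y $ i $ j * v $ j) = w $ i"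
        "\<And>i. i \<notin> I \<Longrightarrow> v $ i = 0"
        using principal_block_solve[OF nz, of "\<lambda>i. w $ i"] by blast
      have "w = R *v (Y *v v)"
        using w v mult_supported[of I v Y] by (auto simp: Finite_Cartesian_Product.vec_eq_iff R)
      then show "w \<in> (*v) R ` range ((*v) Y)" by blast
    qed
  qed
  have ker: "{u \<in> range ((*v) Y). R *v u = 0} = {u \<in> range ((*v) Y). \<forall>i\<in>I. u $ i = 0}"
    by (auto simp: Finite_Cartesian_Product.vec_eq_iff R)
  have "vec.dim (range ((*v) Y)) = vec.dim ((*v) R ` range ((*v) Y)) + vec.dim {u \<in> range ((*v) Y). R *v u = 0}"
    by (rule vec.dim_image_kernel[OF matrix_vector_mul_linear_gen[of R] sub])
  then show ?thesis unfolding img ker dim_range dim_substandard_cart by simp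
qed

text \<open>The unit vector at \<open>j\<close>, corrected on \<open>I\<close> by Cramer's rule so
  that the rows of \<open>X\<close> in \<open>I\<close> kill it. Multiplying by the minor clears
  denominators and makes the vector polynomial in \<open>X\<close>.\<close>

definition lift_vec :: "'n set \<Rightarrow> 'a::field^'n^'n \<Rightarrow> 'n \<Rightarrow> 'a^'n" where
  "lift_vec I X j = (\<chi> k. if k = j then det (principal_block I X) else if k \<in> I
     then - det (\<chi> a b. if b = k then (if a \<in> I then X $ a $ j else 0) else principal_block I X $ a $ b)
     else 0)"

lemma lift_vec_kernel_on_block:
  fixes X :: "'a::field^'n^'n"
  assumes nz: "det (principal_block I X) \<noteq> 0" and j: "j \<notin> I" and i: "i \<in> I"
  shows "(X *v lift_vec I X j) $ i = 0"
proof -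
  let ?d = "det (principal_block I X)"
  define b where "b = (\<chi> a. if a \<in> I then X $ a $ j else 0)"
  define y where "y = (\<chi> k. det (\<chi> a c. if c = k then b $ a else principal_block I X $ a $ c) / ?d)"
  have y: "principal_block I X *v y = b" using cramer[OF nz, of y b] by (simp add: y_def)
  have yi: "(if i \<in> I then \<Sum>j\<in>I. X $ i $ j * y $ j else y $ i) = b $ i" for i
    using arg_cong[OF y, of "\<lambda>v. v $ i"] unfolding principal_block_mult .
  have y0: "y $ k = 0" if "k \<notin> I" for k using yi[of k] that by (simp add: b_def)
  have "lift_vec I X j $ k = ?d * ((axis j 1 - y) $ k)" for k
  proof -
    have "k \<in> I \<Longrightarrow> lift_vec I X j $ k = - (?d * y $ k)"
      using j nz by (auto simp: lift_vec_def y_def b_def cong: if_cong)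
    then show ?thesis
      using y0[of k] j by (cases "k \<in> I") (auto simp: lift_vec_def axis_def)
  qed
  then have "lift_vec I X j = ?d *s (axis j 1 - y)"
    by (simp add: Finite_Cartesian_Product.vec_eq_iff right_diff_distrib)
  then have "(X *v lift_vec I X j) $ i = ?d * ((X *v axis j 1) $ i - (X *v y) $ i)"
    by (simp add: vec.scale matrix_vector_mult_diff_distrib right_diff_distrib)
  also have "(X *v axis j 1) $ i = X $ i $ j"
    by (simp add: matrix_vector_mult_def axis_def if_distrib[of "\<lambda>x. _ * x"] cong: if_cong)
  also have "(X *v y) $ i = X $ i $ j"
    using mult_supported[of I y X i] y0 yi[of i] i by (simp add: b_def)
  finally show ?thesis by simp
qed

text \<open>With \<open>v j\<close> the lifted vectors, the second factor evaluates
  \<open>card (S \<times> D)\<close> matrices, numbered through \<open>e\<close>, under the map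
  sending \<open>N\<close> to the coordinates \<open>i \<in> S\<close> of all \<open>N v j\<close>
  with \<open>j \<in> D\<close>. If it is nonzero, a space containing these matrices attains every
  prescribed family of such values.\<close>

definition compression_disc ::
    "('n::finite \<times> 'n \<Rightarrow> nat) \<Rightarrow> 'n set \<Rightarrow> 'n set \<Rightarrow> 'n set \<Rightarrow> (nat \<times> 'n \<times> 'n \<Rightarrow> 'a) \<Rightarrow> 'a::field" where
  "compression_disc e S D I x = det (principal_block I (layer 0 x)) *
     det (principal_block (S \<times> D)
       (\<chi> q p. (layer (Suc (e p)) x *v lift_vec I (layer 0 x) (snd q)) $ fst q))"

lemma poly_fun_if: "(c \<Longrightarrow> poly_fun f) \<Longrightarrow> (\<not> c \<Longrightarrow> poly_fun g) \<Longrightarrow> poly_fun (\<lambda>x. if c then f x else g x)"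
  by (cases c) auto

lemma poly_fun_principal_block:
  assumes "\<And>i j. poly_fun (\<lambda>x. F x $ i $ j)"
  shows "poly_fun (\<lambda>x. principal_block I (F x) $ i $ j)"
  unfolding principal_block_def by (simp, intro conjI impI poly_fun_if poly_fun.const assms)

lemma poly_fun_lift_vec: "poly_fun (\<lambda>x. lift_vec I (layer l x) j $ k :: 'a::field)"
proof -
  have pb: "poly_fun (\<lambda>x. principal_block I (layer l x) $ a $ b :: 'a)" for a b
    by (rule poly_fun_principal_block) (simp add: poly_fun.coord)
  have "poly_fun (\<lambda>x. det (principal_block I (layer l x)) :: 'a)" by (intro poly_fun_det pb)
  moreover have "poly_fun (\<lambda>x. - det (\<chi> a b. if b = k then (if a \<in> I then layer l x $ a $ j else 0)
      else principal_block I (layer l x) $ a $ b) :: 'a)"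
    by (intro poly_fun_uminus poly_fun_det) (simp cong: if_cong, intro conjI impI poly_fun_if poly_fun.const poly_fun.coord pb)
  ultimately show ?thesis
    unfolding lift_vec_def by (simp only: vec_lambda_beta, intro poly_fun_if poly_fun.const)
qed

lemma poly_fun_compression_disc:
  "poly_fun (compression_disc e S D I :: (nat \<times> 'n::finite \<times> 'n \<Rightarrow> 'a) \<Rightarrow> 'a::field)"
  unfolding compression_disc_def[abs_def]
proof (intro poly_fun.mult poly_fun_det poly_fun_principal_block)
  show "poly_fun (\<lambda>x. layer 0 x $ i $ j :: 'a)" for i j :: 'n by (simp add: poly_fun.coord)
  show "poly_fun (\<lambda>x. (\<chi> q p. (layer (Suc (e p)) x *v lift_vec I (layer 0 x) (snd q)) $ fst q) $ q $ p :: 'a)" for q p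
    by (simp add: matrix_vector_mult_def) (intro poly_fun_sum poly_fun.mult poly_fun.coord poly_fun_lift_vec)
qed

text \<open>Applied when all \<open>x v j\<close> are multiples \<open>\<gamma> j\<close> of one
  vector: a third index pays for cancelling the multiples. The zeros at \<open>a\<close> and
  \<open>b\<close> allow values on the two combinations to be prescribed separately.\<close>

lemma exists_two_relations:
  fixes \<gamma> :: "'i \<Rightarrow> 'a::field"
  assumes "finite D" "2 \<le> card D" "(\<exists>c\<in>D. \<gamma> c \<noteq> 0) \<Longrightarrow> 3 \<le> card D"
  obtains a b \<alpha> \<beta> where "a \<in> D" "b \<in> D" "a \<noteq> b" "\<alpha> a \<noteq> 0" "\<alpha> b = 0" "\<beta> a = 0" "\<beta> b \<noteq> 0"
    "(\<Sum>j\<in>D. \<alpha> j * \<gamma> j) = 0" "(\<Sum>j\<in>D. \<beta> j * \<gamma> j) = 0"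
proof (cases "\<exists>c\<in>D. \<gamma> c \<noteq> 0")
  case False
  obtain a b where ab: "a \<in> D" "b \<in> D" "a \<noteq> b"
    using assms(1,2) card_le_Suc0_iff_eq[OF assms(1)] by (metis Suc_n_not_le_n numeral_2_eq_2 order_trans)
  show thesis
    by (rule that[of a b "\<lambda>j. if j = a then 1 else 0" "\<lambda>j. if j = b then 1 else 0"])
      (use ab False in auto)
next
  case True
  then obtain c where c: "c \<in> D" "\<gamma> c \<noteq> 0" by blast
  have "card (D - {c}) \<ge> 2" using assms(3)[OF True] c(1) assms(1) by simp
  then obtain a b where ab: "a \<in> D - {c}" "b \<in> D - {c}" "a \<noteq> b"
    using card_le_Suc0_iff_eq[of "D - {c}"] assms(1) by (metis Suc_n_not_le_n numeral_2_eq_2 order_trans finite_Diff)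
  have rel: "(\<Sum>j\<in>D. (if j = a then \<gamma> c else if j = c then - \<gamma> a else 0) * \<gamma> j) = 0" if "a \<in> D - {c}" for a
  proof -
    have "(\<Sum>j\<in>D. (if j = a then \<gamma> c else if j = c then - \<gamma> a else 0) * \<gamma> j)
        = (\<Sum>j\<in>{a, c}. (if j = a then \<gamma> c else if j = c then - \<gamma> a else 0) * \<gamma> j)"
      using that c assms(1) by (intro sum.mono_neutral_right) auto
    then show ?thesis using that by auto
  qed
  show thesis
    by (rule that[of a b "\<lambda>j. if j = a then \<gamma> c else if j = c then - \<gamma> a else 0"
          "\<lambda>j. if j = b then \<gamma> c else if j = c then - \<gamma> b else 0"])
      (use ab c rel in auto)
qed

lemma compression_disc_compression:
  fixes L :: "('a::alg_closed_field^'n^'n) set"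
  assumes LL: "mspace.subspace L" "\<And>M. M \<in> L \<Longrightarrow> transpose M = M" "\<And>M. M \<in> L \<Longrightarrow> rank M \<le> \<rho>"
    and two: "(2::'a) \<noteq> 0"
    and card: "card I = 2 * card S" "D \<inter> I = {}" "card D = 2 + (\<rho> - 2 * card S)"
      "2 * card S \<le> \<rho>" "\<rho> \<le> 2 * card S + 1"
    and M: "range M \<subseteq> L" "compression_disc e S D I (entries M) \<noteq> 0"
  obtains W U where "vec.subspace W" "vec.subspace U" "W \<subseteq> U"
    "vec.dim W + \<rho> = CARD('n) + card S" "vec.dim U + card S = CARD('n)"
    "\<And>N w u. N \<in> L \<Longrightarrow> w \<in> W \<Longrightarrow> u \<in> U \<Longrightarrow> w \<odot> (N *v u) = 0"
proof -
  have memL: "M l \<in> L" for l using M(1) by auto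
  have "\<exists>x1. x1 \<in> L \<and> (\<forall>N. N \<in> L \<longrightarrow> rank N \<le> rank x1)"
    by (rule ex_has_greatest_nat[of _ "M 0" _ "Suc \<rho>"]) (use memL LL in \<open>auto simp: less_Suc_eq_le\<close>)
  then obtain x1 where x1: "x1 \<in> L" "\<And>N. N \<in> L \<Longrightarrow> rank N \<le> rank x1" by blast
  obtain D0 where D0: "det (x1 + D0) \<noteq> 0" "rank D0 = CARD('n) - rank x1"
    using exists_complementary_matrix by blast
  \<comment> \<open>The first matrix of the tuple need not have maximal rank in \<open>L\<close>. On
    the line towards a member \<open>x1\<close> of maximal rank, a general point keeps the test
    nonzero and reaches that rank.\<close>
  define c where "c = (\<lambda>(l :: nat, i, j). if l = 0 then [:M 0 $ i $ j, x1 $ i $ j - M 0 $ i $ j:] else [:M l $ i $ j:])"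
  define N where "N t = (\<lambda>l :: nat. if l = 0 then M 0 + mscale t (x1 - M 0) else M l)" for t
  have cN: "(\<lambda>i. poly (c i) t) = entries (N t)" for t
    by (auto simp: c_def N_def)
  have NL: "N t l \<in> L" for t l
    using memL x1 by (auto simp: N_def intro!: mspace.subspace_add mspace.subspace_scale mspace.subspace_diff LL(1))
  obtain f where f: "\<And>t. compression_disc e S D I (entries (N t)) = poly f t"
    using poly_fun_curve[OF poly_fun_compression_disc, of e S D I c] unfolding cN by blast
  have "poly_fun (\<lambda>x. det (layer 0 x + D0))"
    by (rule poly_fun_det) (simp add: poly_fun.intros)
  from poly_fun_curve[OF this, of c]
  obtain g where g: "\<And>t. det (N t 0 + D0) = poly g t" unfolding cN layer_entries by blast
  have "f \<noteq> 0"
  proof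
    assume "f = 0"
    moreover have "N 0 = M" by (auto simp: N_def Finite_Cartesian_Product.vec_eq_iff)
    ultimately show False using f[of 0] M(2) by simp
  qed
  moreover have "g \<noteq> 0"
  proof
    assume "g = 0"
    moreover have "N 1 0 = x1" by (auto simp: N_def Finite_Cartesian_Product.vec_eq_iff)
    ultimately show False using g[of 1] D0(1) by simp
  qed
  ultimately obtain t0 where "poly (f * g) t0 \<noteq> 0"
    using exists_nonzero_point[of "f * g" "{}"] by auto
  then have t0: "compression_disc e S D I (entries (N t0)) \<noteq> 0" "det (N t0 0 + D0) \<noteq> 0"
    using f g by auto
  define x where "x = N t0 0"
  have xL: "x \<in> L" using NL by (simp add: x_def)
  have "rank x1 \<le> rank x"
    using t0(2) rank_add_le[of x D0] D0(2) rank_le_card[of x1] unfolding det_nonzero_iff_rank x_def by linarith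
  then have "rank K \<le> rank x" if "K \<in> L" for K using x1(2)[OF that] by simp
  then interpret max_rank_member L x
    by unfold_locales (use LL two xL in auto)
  have nz: "det (principal_block I x) \<noteq> 0" using t0(1) by (simp add: compression_disc_def x_def)
  define v where "v j = lift_vec I x j" for j
  define K where "K = (\<chi> q p. (N t0 (Suc (e p)) *v v (snd q)) $ fst q)"
  have nzK: "det (principal_block (S \<times> D) K) \<noteq> 0"
    using t0(1) by (simp add: compression_disc_def x_def K_def v_def)
  have v: "(x *v v j) $ i = 0" if "j \<in> D" "i \<in> I" for i j
    unfolding v_def using nz that card(2) by (intro lift_vec_kernel_on_block) auto
  \<comment> \<open>All \<open>x v j\<close> lie in this space, whose dimension
    \<open>rank x - 2 * card S\<close> is at most 1, so they are multiples of one vector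
    \<open>t\<close>.\<close>
  let ?T = "{u \<in> range ((*v) x). \<forall>i\<in>I. u $ i = 0}"
  have dimT: "vec.dim ?T + card I = rank x" by (rule dim_range_vanishing_on_block[OF nz])
  have rkx: "rank x \<le> \<rho>" using LL(3) xL by blast
  obtain B where B: "B \<subseteq> ?T" "vec.independent B" "?T \<subseteq> vec.span B" "card B = vec.dim ?T"
    by (rule vec.basis_exists)
  have "\<exists>t. B \<subseteq> {t}"
  proof -
    have "card B \<le> Suc 0" using B(4) dimT rkx card by linarith
    then have eq: "\<forall>a1\<in>B. \<forall>a2\<in>B. a1 = a2"
      by (simp only: card_le_Suc0_iff_eq[OF vec.finiteI_independent[OF B(2)]])
    show ?thesis
    proof (cases "B = {}")
      case False
      then obtain t where "t \<in> B" by blast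
      then have "B \<subseteq> {t}" using eq by blast
      then show ?thesis by blast
    qed simp
  qed
  then obtain t where t: "B \<subseteq> {t}" by blast
  have "\<exists>c. x *v v j = c *s t" if "j \<in> D" for j
  proof -
    have "x *v v j \<in> ?T" using v[OF that] by blast
    then have "x *v v j \<in> vec.span {t}" using B(3) vec.span_mono[OF t] by blast
    then show ?thesis by (simp add: vec.span_singleton image_iff)
  qed
  then obtain \<gamma> where \<gamma>: "\<And>j. j \<in> D \<Longrightarrow> x *v v j = \<gamma> j *s t" by metis
  \<comment> \<open>If \<open>t\<close> is 0 the coefficients are arbitrary, so they are reset where
    \<open>x v j = 0\<close>. A nonzero one then shows that \<open>?T\<close> is nonzero, which
    forces \<open>\<rho> = 2 * card S + 1\<close> and three indices in \<open>D\<close>.\<close>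
  define \<gamma>' where "\<gamma>' j = (if x *v v j = 0 then 0 else \<gamma> j)" for j
  have \<gamma>': "x *v v j = \<gamma>' j *s t" if "j \<in> D" for j using \<gamma>[OF that] by (simp add: \<gamma>'_def)
  have finD: "finite D" by simp
  have c3: "3 \<le> card D" if "\<exists>j\<in>D. \<gamma>' j \<noteq> 0"
  proof -
    from that obtain j where j: "j \<in> D" "x *v v j \<noteq> 0" by (auto simp: \<gamma>'_def split: if_splits)
    have "x *v v j \<in> ?T" using v[OF j(1)] by blast
    then have "\<not> ?T \<subseteq> {0}" using j(2) by blast
    then have "vec.dim ?T \<noteq> 0" by (simp only: vec.dim_eq_0) simp
    then show ?thesis using dimT rkx card by linarith
  qed
  have c2: "2 \<le> card D" using card by simp
  obtain a b \<alpha> \<beta> where ab: "a \<in> D" "b \<in> D" "a \<noteq> b" "\<alpha> a \<noteq> 0" "\<alpha> b = 0" "\<beta> a = 0" "\<beta> b \<noteq> 0"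
    "(\<Sum>j\<in>D. \<alpha> j * \<gamma>' j) = 0" "(\<Sum>j\<in>D. \<beta> j * \<gamma>' j) = 0"
    by (rule exists_two_relations[OF finD c2 c3])
  define p where "p = (\<Sum>j\<in>D. \<alpha> j *s v j)"
  define q where "q = (\<Sum>j\<in>D. \<beta> j *s v j)"
  have comb: "x *v (\<Sum>j\<in>D. \<delta> j *s v j) = (\<Sum>j\<in>D. \<delta> j * \<gamma>' j) *s t" for \<delta>
  proof -
    have "x *v (\<Sum>j\<in>D. \<delta> j *s v j) = (\<Sum>j\<in>D. \<delta> j *s (x *v v j))"
      by (simp add: vec.sum vec.scale)
    also have "\<dots> = (\<Sum>j\<in>D. (\<delta> j * \<gamma>' j) *s t)"
      by (intro sum.cong refl) (simp add: \<gamma>')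
    finally show ?thesis by (simp add: vec.scale_sum_left)
  qed
  have p: "x *v p = 0" unfolding p_def comb ab(8) by simp
  have q: "x *v q = 0" unfolding q_def comb ab(9) by simp
  have onto: "\<exists>N\<in>L. \<forall>i\<in>S. (N *v p) $ i = y i \<and> (N *v q) $ i = z i" for y z
  proof -
    \<comment> \<open>Dividing by \<open>\<alpha> a\<close> and \<open>\<beta> b\<close> gives the
      right values because \<open>\<alpha> b\<close> and \<open>\<beta> a\<close> vanish and all
      other indices of \<open>D\<close> are sent to 0.\<close>
    define Y where "Y = (\<lambda>(i, j). if j = a then y i / \<alpha> a else if j = b then z i / \<beta> b else 0)"
    obtain c where c: "\<And>q. q \<in> S \<times> D \<Longrightarrow> (\<Sum>p\<in>S \<times> D. K $ q $ p * c $ p) = Y q"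
      using principal_block_solve[OF nzK, of Y] by blast
    define N' where "N' = (\<Sum>p\<in>S \<times> D. mscale (c $ p) (N t0 (Suc (e p))))"
    have N'L: "N' \<in> L" unfolding N'_def
      by (intro mspace.subspace_sum mspace.subspace_scale LL(1) NL)
    have N'v: "(N' *v v j) $ i = Y (i, j)" if ij: "i \<in> S" "j \<in> D" for i j
    proof -
      have "(N' *v v j) $ i = (\<Sum>k\<in>UNIV. (\<Sum>p\<in>S \<times> D. c $ p * N t0 (Suc (e p)) $ i $ k) * v j $ k)"
        by (simp add: N'_def matrix_vector_mult_def sum_nth_nth)
      also have "\<dots> = (\<Sum>p\<in>S \<times> D. \<Sum>k\<in>UNIV. c $ p * N t0 (Suc (e p)) $ i $ k * v j $ k)"
        unfolding sum_distrib_right by (rule sum.swap)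
      also have "\<dots> = (\<Sum>p\<in>S \<times> D. K $ (i, j) $ p * c $ p)"
        by (intro sum.cong refl) (simp add: K_def matrix_vector_mult_def sum_distrib_left sum_distrib_right mult_ac)
      finally show ?thesis using c[of "(i, j)"] ij by simp
    qed
    have N'c: "(N' *v (\<Sum>j\<in>D. \<delta> j *s v j)) $ i = (\<Sum>j\<in>D. \<delta> j * Y (i, j))" if "i \<in> S" for \<delta> i
    proof -
      have "(N' *v (\<Sum>j\<in>D. \<delta> j *s v j)) $ i = (\<Sum>j\<in>D. \<delta> j * (N' *v v j) $ i)"
        by (simp add: vec.sum vec.scale sum_component)
      then show ?thesis using N'v[OF that] by simp
    qed
    have Ysum: "(\<Sum>j\<in>D. \<delta> j * Y (i, j)) = \<delta> a * (y i / \<alpha> a) + \<delta> b * (z i / \<beta> b)" for \<delta> i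
    proof -
      have "(\<Sum>j\<in>D. \<delta> j * Y (i, j)) = (\<Sum>j\<in>{a, b}. \<delta> j * Y (i, j))"
        using ab by (intro sum.mono_neutral_right) (auto simp: Y_def)
      then show ?thesis using ab by (simp add: Y_def)
    qed
    show ?thesis
    proof (intro bexI[OF _ N'L] ballI conjI)
      fix i assume i: "i \<in> S"
      show "(N' *v p) $ i = y i" unfolding p_def N'c[OF i] Ysum using ab by simp
      show "(N' *v q) $ i = z i" unfolding q_def N'c[OF i] Ysum using ab by simp
    qed
  qed
  have rkS: "rank x \<le> 2 * card S + 1" using rkx card by linarith
  obtain W U where WU: "vec.subspace W" "vec.subspace U" "W \<subseteq> U"
    "vec.dim W + rank x = CARD('n) + card S" "vec.dim U + card S = CARD('n)"
    "\<And>N w u. N \<in> L \<Longrightarrow> w \<in> W \<Longrightarrow> u \<in> U \<Longrightarrow> w \<odot> (N *v u) = 0"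
    by (rule compression_if_independent_kernel_vectors[OF p q rkS onto]) blast
  have "2 * card S \<le> rank x" using dimT card by linarith
  \<comment> \<open>The rank of \<open>x\<close> may be below \<rho>; then \<open>W\<close> is
    larger than wanted and is cut down.\<close>
  then have "CARD('n) + card S - \<rho> \<le> vec.dim W" using WU(4) rkx by linarith
  then obtain W' where W': "vec.subspace W'" "W' \<subseteq> vec.span W" "vec.dim W' = CARD('n) + card S - \<rho>"
    by (rule vec.choose_subspace_of_subspace)
  have W'W: "W' \<subseteq> W" using W'(2) WU(1) by (simp add: vec.span_eq_iff[THEN iffD2])
  show thesis
  proof (rule that[of W' U])
    have "card S \<le> card I" using card by simp
    have "\<rho> \<le> CARD('n) + card S"
    proof -
      have "card (D \<union> I) \<le> CARD('n)" by (rule card_mono) auto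
      then have "card D + card I \<le> CARD('n)" using card(2) by (simp add: card_Un_disjoint)
      then show ?thesis using card by linarith
    qed
    then show "vec.dim W' + \<rho> = CARD('n) + card S" using W'(3) by simp
  qed (use WU W' W'W in auto)
qed

section \<open>Degeneration to shifted coordinate subspaces\<close>

definition idx :: "'n::finite \<Rightarrow> nat" where
  "idx = (SOME f. bij_betw f UNIV {..<CARD('n)})"

lemma bij_idx: "bij_betw (idx :: 'n::finite \<Rightarrow> nat) UNIV {..<CARD('n)}"
proof -
  have "\<exists>f. bij_betw f (UNIV :: 'n set) {..<CARD('n)}"
    by (rule finite_same_card_bij) auto
  then show ?thesis unfolding idx_def by (rule someI_ex)
qed

lemma idx_eq_iff [simp]: "idx i = idx j \<longleftrightarrow> i = j"
  using bij_idx by (auto simp: bij_betw_def inj_on_def)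

lemma idx_less: "idx (i :: 'n::finite) < CARD('n)"
  using bij_idx[where ?'n = 'n] by (auto simp: bij_betw_def)

text \<open>A sum of two powers of 2 determines the unordered pair of exponents. The torus
  \<open>diag (t ^ 2 ^ idx i)\<close> therefore scales different symmetric positions by different
  powers \<open>t ^ wt i j\<close>, and its limits are coordinate subspaces.\<close>

definition wt :: "'n::finite \<Rightarrow> 'n \<Rightarrow> nat" where
  "wt i j = 2 ^ idx i + 2 ^ idx j"

lemma wt_commute: "wt i j = wt j i"
  by (simp add: wt_def)

lemma two_powers_eq:
  assumes "a \<le> b" "c \<le> d" "(2::nat) ^ a + 2 ^ b = 2 ^ c + 2 ^ d"
  shows "a = c \<and> b = d"
proof -
  have less: "(2::nat) ^ a + 2 ^ b < 2 ^ c + 2 ^ d" if "a \<le> b" "b < d" for a b c d :: nat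
  proof -
    have "(2::nat) ^ a \<le> 2 ^ b" using that by simp
    then have "(2::nat) ^ a + 2 ^ b \<le> 2 ^ Suc b" by simp
    also have "\<dots> \<le> 2 ^ d" using that by (intro power_increasing) auto
    also have "\<dots> < 2 ^ c + 2 ^ d" by simp
    finally show ?thesis .
  qed
  have "b = d" using less[of a b d c] less[of c d b a] assms by (metis linorder_less_linear less_irrefl)
  then show ?thesis using assms by simp
qed

lemma wt_eq_iff: "wt i j = wt a b \<longleftrightarrow> (i = a \<and> j = b) \<or> (i = b \<and> j = a)"
proof
  assume "wt i j = wt a b"
  then have e: "(2::nat) ^ idx i + 2 ^ idx j = 2 ^ idx a + 2 ^ idx b" by (simp add: wt_def)
  show "(i = a \<and> j = b) \<or> (i = b \<and> j = a)"
    using two_powers_eq[of "idx i" "idx j" "idx a" "idx b"] two_powers_eq[of "idx j" "idx i" "idx a" "idx b"]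
      two_powers_eq[of "idx i" "idx j" "idx b" "idx a"] two_powers_eq[of "idx j" "idx i" "idx b" "idx a"] e
    by (cases "idx i \<le> idx j"; cases "idx a \<le> idx b") (auto simp: add.commute)
qed (auto simp: wt_def)

lemma wt_strict_mono: "idx i < idx j \<Longrightarrow> wt i b < wt j b"
  by (simp add: wt_def)

definition weights :: "'n::finite itself \<Rightarrow> nat set" where
  "weights _ = (\<lambda>(i :: 'n, j). wt i j) ` UNIV"

lemma finite_weights: "finite (weights TYPE('n::finite))"
  by (simp add: weights_def)

lemma wt_in_weights [simp]: "wt (i :: 'n::finite) j \<in> weights TYPE('n)"
  unfolding weights_def by (rule image_eqI[of _ _ "(i, j)"]) auto

definition symm_unit :: "nat \<Rightarrow> 'a::field^'n^'n" where
  "symm_unit \<theta> = (\<chi> i j. if wt i j = \<theta> then 1 else 0)"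

definition coord_space :: "nat set \<Rightarrow> ('a::field^'n^'n) set" where
  "coord_space G = {M. transpose M = M \<and> (\<forall>i j. M $ i $ j \<noteq> 0 \<longrightarrow> wt i j \<in> G)}"

lemma transpose_eq_iff: "transpose M = M \<longleftrightarrow> (\<forall>i j. M $ i $ j = M $ j $ i)"
  by (auto simp: Finite_Cartesian_Product.vec_eq_iff Finite_Cartesian_Product.transpose_def)

lemma symmetric_entries_by_weight:
  fixes M :: "'a::field^'n^'n"
  assumes "transpose M = M"
  shows "\<exists>c. \<forall>i j. M $ i $ j = c (wt i j)"
proof -
  define p where "p \<theta> = (SOME p. wt (fst p) (snd p :: 'n) = \<theta>)" for \<theta>
  have "M $ i $ j = M $ fst (p (wt i j)) $ snd (p (wt i j))" for i j
  proof -
    have "wt (fst (p (wt i j))) (snd (p (wt i j))) = wt i j"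
      unfolding p_def by (rule someI[of _ "(i, j)"]) simp
    then show ?thesis using assms by (auto simp: wt_eq_iff transpose_eq_iff)
  qed
  then show ?thesis by (intro exI[of _ "\<lambda>\<theta>. M $ fst (p \<theta>) $ snd (p \<theta>)"]) blast
qed

lemma subspace_coord_space: "mspace.subspace (coord_space G)"
  unfolding mspace.subspace_def coord_space_def transpose_eq_iff
  by (auto, metis add_0)

lemma symm_unit_in_coord_space: "\<theta> \<in> G \<Longrightarrow> symm_unit \<theta> \<in> coord_space G"
  by (auto simp: coord_space_def symm_unit_def transpose_eq_iff wt_commute)

text \<open>The analogue of initial forms. The weight function is a parameter because highest
  weights are treated as lowest weights for the negated function.\<close>

definition leading :: "('n \<Rightarrow> 'n \<Rightarrow> 'w::linorder) \<Rightarrow> ('a::field^'n^'n) set \<Rightarrow> 'w set" where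
  "leading u X = {\<theta>. \<exists>M\<in>X. (\<exists>i j. u i j = \<theta> \<and> M $ i $ j \<noteq> 0) \<and> (\<forall>i j. M $ i $ j \<noteq> 0 \<longrightarrow> \<theta> \<le> u i j)}"

lemma leading_mono: "X \<subseteq> Y \<Longrightarrow> leading u X \<subseteq> leading u Y"
  by (auto simp: leading_def)

lemma exists_leading:
  fixes u :: "'n::finite \<Rightarrow> 'n \<Rightarrow> 'w::linorder"
  assumes "M \<in> X" "M \<noteq> 0"
  shows "leading u X \<noteq> {}"
proof -
  define A where "A = (\<lambda>(i, j). u i j) ` {(i, j). M $ i $ j \<noteq> 0}"
  have A: "finite A" "A \<noteq> {}"
    using assms(2) by (auto simp: A_def Finite_Cartesian_Product.vec_eq_iff)
  have "Min A \<in> A" using A by (rule Min_in)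
  then obtain i j where ij: "u i j = Min A" "M $ i $ j \<noteq> 0" by (auto simp: A_def)
  have "Min A \<le> u a b" if "M $ a $ b \<noteq> 0" for a b
    using A(1) that by (intro Min_le) (auto simp: A_def)
  then have "Min A \<in> leading u X" using assms(1) ij unfolding leading_def by blast
  then show ?thesis by blast
qed

lemma finite_leading: "finite (leading u X)" for u :: "'n::finite \<Rightarrow> 'n \<Rightarrow> 'w::linorder"
  by (rule finite_subset[of _ "(\<lambda>(i, j). u i j) ` UNIV"]) (auto simp: leading_def)

text \<open>Echelon form by induction on the dimension: the members that vanish at a position of
  least leading weight form a hyperplane, which loses exactly this weight.\<close>

lemma card_leading:
  fixes u :: "'n::finite \<Rightarrow> 'n \<Rightarrow> 'w::linorder" and X :: "('a::field^'n^'n) set"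
  assumes u: "\<And>i j a b. u i j = u a b \<Longrightarrow> wt i j = wt a b"
  shows "mspace.subspace X \<Longrightarrow> (\<And>M. M \<in> X \<Longrightarrow> transpose M = M) \<Longrightarrow> card (leading u X) = mspace.dim X"
proof (induction "mspace.dim X" arbitrary: X)
  case 0
  then have "X \<subseteq> {0}" by simp
  then have "leading u X = {}" by (auto simp: leading_def)
  then show ?case using 0 by simp
next
  case (Suc d)
  have "\<not> X \<subseteq> {0}" using Suc(2) by (metis mspace.dim_eq_0 nat.distinct(1))
  then have ne: "leading u X \<noteq> {}" using exists_leading by blast
  define \<theta> where "\<theta> = Min (leading u X)"
  have \<theta>: "\<theta> \<in> leading u X" unfolding \<theta>_def using finite_leading ne by (rule Min_in)
  then obtain M0 i j where M0: "M0 \<in> X" "u i j = \<theta>" "M0 $ i $ j \<noteq> 0" by (auto simp: leading_def)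
  define X' where "X' = {M \<in> X. M $ i $ j = 0}"
  have X': "mspace.subspace X'"
    using Suc(3) by (auto simp: X'_def mspace.subspace_def)
  have span: "mspace.span (insert M0 X') = X"
  proof (rule subset_antisym)
    show "mspace.span (insert M0 X') \<subseteq> X"
      using Suc(3) M0 by (intro mspace.span_minimal) (auto simp: X'_def)
    show "X \<subseteq> mspace.span (insert M0 X')"
    proof
      fix M assume M: "M \<in> X"
      define c where "c = M $ i $ j / M0 $ i $ j"
      have "M - mscale c M0 \<in> X'"
        using M M0 Suc(3) by (auto simp: X'_def c_def intro!: mspace.subspace_diff mspace.subspace_scale)
      then have "\<exists>c. M - mscale c M0 \<in> mspace.span X'" using mspace.span_base by blast
      then show "M \<in> mspace.span (insert M0 X')" by (simp only: mspace.span_breakdown_eq)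
    qed
  qed
  have "M0 \<notin> mspace.span X'" using M0 X' by (auto simp: mspace.span_eq_iff[THEN iffD2] X'_def)
  then have dim: "mspace.dim X = Suc (mspace.dim X')"
    using mspace.dim_span[of "insert M0 X'"] unfolding span by (simp add: mspace.dim_insert)
  have lead: "leading u X = insert \<theta> (leading u X')"
  proof (rule subset_antisym)
    show "insert \<theta> (leading u X') \<subseteq> leading u X"
      using \<theta> leading_mono[of X' X] by (auto simp: X'_def)
    show "leading u X \<subseteq> insert \<theta> (leading u X')"
    proof
      fix \<phi> assume \<phi>: "\<phi> \<in> leading u X"
      have le: "\<theta> \<le> \<phi>" unfolding \<theta>_def using finite_leading \<phi> by (rule Min_le)
      show "\<phi> \<in> insert \<theta> (leading u X')"
      proof (cases "\<phi> = \<theta>")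
        case False
        obtain M where M: "M \<in> X" "\<exists>i j. u i j = \<phi> \<and> M $ i $ j \<noteq> 0" "\<forall>i j. M $ i $ j \<noteq> 0 \<longrightarrow> \<phi> \<le> u i j"
          using \<phi> unfolding leading_def by blast
        have "M $ i $ j = 0" using M(3) M0(2) le False by (metis antisym)
        then have "M \<in> X'" using M(1) by (simp add: X'_def)
        then show ?thesis using M unfolding leading_def by blast
      qed simp
    qed
  qed
  have "\<theta> \<notin> leading u X'"
  proof
    assume "\<theta> \<in> leading u X'"
    then obtain M a b where M: "M \<in> X'" "u a b = \<theta>" "M $ a $ b \<noteq> 0" by (auto simp: leading_def)
    have "wt a b = wt i j" by (rule u) (simp add: M M0)
    moreover have "transpose M = M" using M(1) Suc(4) by (simp add: X'_def)
    ultimately show False using M by (auto simp: wt_eq_iff X'_def transpose_eq_iff)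
  qed
  then have "card (leading u X) = Suc (card (leading u X'))"
    unfolding lead by (simp add: finite_leading)
  also have "card (leading u X') = mspace.dim X'"
    using Suc(1)[of X'] Suc(2,4) X' dim by (simp add: X'_def)
  finally show ?case using dim by simp
qed

lemma dim_coord_space:
  assumes "G \<subseteq> weights TYPE('n::finite)"
  shows "mspace.dim (coord_space G :: ('a::field^'n^'n) set) = card G"
proof -
  have "leading wt (coord_space G :: ('a^'n^'n) set) = G"
  proof (rule subset_antisym)
    show "leading wt (coord_space G :: ('a^'n^'n) set) \<subseteq> G" by (auto simp: leading_def coord_space_def)
    show "G \<subseteq> leading wt (coord_space G :: ('a^'n^'n) set)"
    proof
      fix \<theta> assume \<theta>: "\<theta> \<in> G"
      then obtain i j :: 'n where "\<theta> = wt i j" using assms by (auto simp: weights_def)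
      then show "\<theta> \<in> leading wt (coord_space G :: ('a^'n^'n) set)"
        unfolding leading_def
        by (intro CollectI bexI[of _ "symm_unit \<theta>"] conjI exI[of _ i] exI[of _ j]
            symm_unit_in_coord_space[OF \<theta>]) (auto simp: symm_unit_def split: if_splits)
    qed
  qed
  moreover have "card (leading wt (coord_space G :: ('a^'n^'n) set)) = mspace.dim (coord_space G :: ('a^'n^'n) set)"
    by (rule card_leading[OF _ subspace_coord_space]) (auto simp: coord_space_def)
  ultimately show ?thesis by simp
qed

section \<open>Congruence and orbit closures\<close>

definition congr :: "'a::field^'n^'n \<Rightarrow> ('a^'n^'n) set \<Rightarrow> ('a^'n^'n) set" where
  "congr g L = (\<lambda>M. g ** M ** transpose g) ` L"

text \<open>Membership of \<open>L'\<close> in the closure of the congruence orbit of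
  \<open>L\<close>, phrased contrapositively through tests: an open condition true on
  \<open>L'\<close> is true on some \<open>congr g L\<close>.\<close>

definition degenerates_to :: "('a::field^'n^'n) set \<Rightarrow> ('a^'n^'n) set \<Rightarrow> bool" where
  "degenerates_to L L' \<longleftrightarrow>
     (\<forall>f. poly_fun f \<longrightarrow> (\<forall>g. invertible g \<longrightarrow> vanishes_on f (congr g L)) \<longrightarrow> vanishes_on f L')"

lemma congr_congr: "congr h (congr g L) = congr (h ** g) L"
  by (auto simp: congr_def image_image matrix_mul_assoc matrix_transpose_mul)

lemma congruence_nth:
  "(g ** M ** transpose g) $ i $ j = (\<Sum>a\<in>UNIV. \<Sum>b\<in>UNIV. g $ i $ a * M $ a $ b * g $ j $ b)"
  for g M :: "'a::comm_ring_1^'n^'n"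
proof -
  have "(g ** M ** transpose g) $ i $ j = (\<Sum>b\<in>UNIV. \<Sum>a\<in>UNIV. g $ i $ a * M $ a $ b * g $ j $ b)"
    by (simp add: matrix_matrix_mult_def Finite_Cartesian_Product.transpose_def sum_distrib_right)
  also have "\<dots> = (\<Sum>a\<in>UNIV. \<Sum>b\<in>UNIV. g $ i $ a * M $ a $ b * g $ j $ b)" by (rule sum.swap)
  finally show ?thesis .
qed

lemma mscale_congruence: "g ** mscale c M ** transpose g = mscale c (g ** M ** transpose g)"
  for g M :: "'a::field^'n^'n"
  by (simp add: Finite_Cartesian_Product.vec_eq_iff congruence_nth sum_distrib_left mult_ac)

lemma add_congruence: "g ** (M + N) ** transpose g = g ** M ** transpose g + g ** N ** transpose g"
  for g M N :: "'a::field^'n^'n"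
  by (simp add: Finite_Cartesian_Product.vec_eq_iff congruence_nth sum.distrib algebra_simps)

lemma transpose_congruence: "transpose M = M \<Longrightarrow> transpose (g ** M ** transpose g) = g ** M ** transpose g"
  for g M :: "'a::field^'n^'n"
  by (simp add: matrix_transpose_mul matrix_mul_assoc)

lemma linear_congruence: "Vector_Spaces.linear mscale mscale (\<lambda>M. g ** M ** transpose g)"
  for g :: "'a::field^'n^'n"
  by unfold_locales (auto simp: mscale_congruence add_congruence)

interpretation mspace: finite_dimensional_vector_space_pair
  "mscale :: 'a::field \<Rightarrow> 'a^'n^'m \<Rightarrow> 'a^'n^'m" "range matrix_unit"
  "mscale :: 'a::field \<Rightarrow> 'a^'n^'m \<Rightarrow> 'a^'n^'m" "range matrix_unit" ..

lemma subspace_congr: "mspace.subspace L \<Longrightarrow> mspace.subspace (congr g L)"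
  unfolding congr_def by (rule mspace.linear_subspace_image[OF linear_congruence])

lemma inj_congruence:
  fixes g :: "'a::field^'n^'n"
  assumes "invertible g"
  shows "inj (\<lambda>M. g ** M ** transpose g)"
proof (rule injI)
  obtain h where h: "h ** g = mat 1" using assms unfolding invertible_def by blast
  have inv: "h ** (g ** M ** transpose g) ** transpose h = M" for M
  proof -
    have "h ** (g ** M ** transpose g) ** transpose h = (h ** g) ** M ** transpose (h ** g)"
      by (simp add: matrix_mul_assoc matrix_transpose_mul)
    then show ?thesis by (simp add: h transpose_mat)
  qed
  fix M N assume "g ** M ** transpose g = g ** N ** transpose g"
  then have "h ** (g ** M ** transpose g) ** transpose h = h ** (g ** N ** transpose g) ** transpose h"
    by simp
  then show "M = N" unfolding inv .
qed

lemma dim_congr: "invertible g \<Longrightarrow> mspace.dim (congr g L) = mspace.dim L"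
  unfolding congr_def
  by (rule mspace.dim_image_eq[OF linear_congruence]) (auto intro: inj_on_subset[OF inj_congruence])

text \<open>Substituting a congruence into a test gives another test, so an orbit closure is stable
  under congruence.\<close>

lemma degenerates_to_trans:
  fixes L :: "('a::field^'n^'n) set"
  assumes "degenerates_to L L'" "degenerates_to L' L''"
  shows "degenerates_to L L''"
  unfolding degenerates_to_def
proof (intro allI impI)
  fix f :: "(nat \<times> 'n \<times> 'n \<Rightarrow> 'a) \<Rightarrow> 'a"
  assume f: "poly_fun f" "\<forall>g. invertible g \<longrightarrow> vanishes_on f (congr g L)"
  have "vanishes_on f (congr h L')" if h: "invertible h" for h
  proof -
    define F where "F x = f (\<lambda>(l, i, j). \<Sum>a\<in>UNIV. \<Sum>b\<in>UNIV. h $ i $ a * x (l, a, b) * h $ j $ b)" for x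
    have F: "F (entries M) = f (entries (\<lambda>l. h ** M l ** transpose h))" for M
      unfolding F_def entries_def congruence_nth by simp
    have pF: "poly_fun F"
    proof -
      have "poly_fun (\<lambda>x. (case i of (l, i, j) \<Rightarrow> \<lambda>x. \<Sum>a\<in>UNIV. \<Sum>b\<in>UNIV. h $ i $ a * x (l, a, b) * h $ j $ b) x)" for i
        by (cases i) (auto intro!: poly_fun_sum poly_fun.mult poly_fun.const poly_fun.coord)
      from poly_fun_subst[OF f(1) this] show ?thesis unfolding F_def[abs_def]
        by (simp add: case_prod_unfold)
    qed
    have "vanishes_on F (congr g L)" if g: "invertible g" for g
      unfolding vanishes_on_def
    proof (intro allI impI)
      fix M :: "nat \<Rightarrow> 'a^'n^'n" assume M: "range M \<subseteq> congr g L"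
      have "range (\<lambda>l. h ** M l ** transpose h) \<subseteq> congr (h ** g) L"
        using M unfolding congr_congr[symmetric] congr_def[of h] by blast
      moreover have "vanishes_on f (congr (h ** g) L)" using f(2) g h invertible_mult by blast
      ultimately show "F (entries M) = 0" unfolding F vanishes_on_def by blast
    qed
    then have "vanishes_on F L'" using assms(1) pF unfolding degenerates_to_def by blast
    show ?thesis
      unfolding vanishes_on_def
    proof (intro allI impI)
      fix M :: "nat \<Rightarrow> 'a^'n^'n" assume M: "range M \<subseteq> congr h L'"
      have "\<forall>l. \<exists>N\<in>L'. M l = h ** N ** transpose h" using M unfolding congr_def by blast
      then obtain N where N: "\<And>l. N l \<in> L'" "\<And>l. M l = h ** N l ** transpose h" by metis
      have "M = (\<lambda>l. h ** N l ** transpose h)" using N(2) by (rule ext)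
      moreover have "F (entries N) = 0" using \<open>vanishes_on F L'\<close> N(1) unfolding vanishes_on_def by blast
      ultimately show "f (entries M) = 0" unfolding F by simp
    qed
  qed
  then show "vanishes_on f L''" using assms(2) f(1) unfolding degenerates_to_def by blast
qed

lemma degenerates_to_congr: "invertible h \<Longrightarrow> degenerates_to L (congr h L)"
  unfolding degenerates_to_def by blast

text \<open>The limit of \<open>L\<close> under a one-parameter torus with generic weights.\<close>

lemma degenerates_to_leading:
  fixes L :: "('a::alg_closed_field^'n^'n) set"
  assumes L: "mspace.subspace L" "\<And>M. M \<in> L \<Longrightarrow> transpose M = M"
  shows "degenerates_to L (coord_space (leading wt L))"
  unfolding degenerates_to_def
proof (intro allI impI)
  fix f :: "(nat \<times> 'n \<times> 'n \<Rightarrow> 'a) \<Rightarrow> 'a"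
  assume f: "poly_fun f" "\<forall>g. invertible g \<longrightarrow> vanishes_on f (congr g L)"
  let ?G = "leading wt L"
  have "\<exists>M\<in>L. (\<forall>i j. wt i j = \<theta> \<longrightarrow> M $ i $ j = 1) \<and> (\<forall>i j. M $ i $ j \<noteq> 0 \<longrightarrow> \<theta> \<le> wt i j)" if \<theta>: "\<theta> \<in> ?G" for \<theta>
  proof -
    obtain M i j where M: "M \<in> L" "wt i j = \<theta>" "M $ i $ j \<noteq> 0" "\<forall>i j. M $ i $ j \<noteq> 0 \<longrightarrow> \<theta> \<le> wt i j"
      using \<theta> unfolding leading_def by blast
    show ?thesis
    proof (intro bexI[of _ "mscale (1 / M $ i $ j) M"] conjI allI impI)
      show "mscale (1 / M $ i $ j) M \<in> L" using M L by (intro mspace.subspace_scale)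
      show "mscale (1 / M $ i $ j) M $ a $ b = 1" if "wt a b = \<theta>" for a b
        using that M(2,3) L(2)[OF M(1)] unfolding M(2)[symmetric] wt_eq_iff transpose_eq_iff by auto
      show "\<theta> \<le> wt a b" if "mscale (1 / M $ i $ j) M $ a $ b \<noteq> 0" for a b
        using that M(4) by auto
    qed
  qed
  then obtain E where E: "\<And>\<theta>. \<theta> \<in> ?G \<Longrightarrow> E \<theta> \<in> L" "\<And>\<theta> i j. \<theta> \<in> ?G \<Longrightarrow> wt i j = \<theta> \<Longrightarrow> E \<theta> $ i $ j = 1"
    "\<And>\<theta> i j. \<theta> \<in> ?G \<Longrightarrow> E \<theta> $ i $ j \<noteq> 0 \<Longrightarrow> \<theta> \<le> wt i j" by metis
  show "vanishes_on f (coord_space ?G)"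
    unfolding vanishes_on_def
  proof (intro allI impI)
    fix M :: "nat \<Rightarrow> 'a^'n^'n" assume "range M \<subseteq> coord_space ?G"
    then have M: "transpose (M l) = M l" "\<And>i j. M l $ i $ j \<noteq> 0 \<Longrightarrow> wt i j \<in> ?G" for l
      unfolding coord_space_def by auto
    have "\<exists>c. \<forall>i j. M l $ i $ j = c (wt i j)" for l
      using M(1) by (rule symmetric_entries_by_weight)
    then obtain c where c: "\<And>l i j. M l $ i $ j = c l (wt i j)" by metis
    \<comment> \<open>The torus at \<open>t\<close> applied to the sum of the
      \<open>E \<theta>\<close> with coefficients \<open>c l \<theta>\<close> divided by
      \<open>t ^ \<theta>\<close>. Entries of \<open>E \<theta>\<close> of weight below
      \<open>\<theta>\<close> vanish, so truncated subtraction does no harm, and at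
      \<open>t = 0\<close> exactly \<open>M l\<close> remains.\<close>
    define C where "C = (\<lambda>(l, i, j). \<Sum>\<theta>\<in>?G. monom (c l \<theta> * E \<theta> $ i $ j) (wt i j - \<theta>))"
    obtain q where q: "\<And>t. f (\<lambda>i. poly (C i) t) = poly q t"
      using poly_fun_curve[OF f(1), of C] by blast
    have "poly q t = 0" if t: "t \<noteq> 0" for t
    proof -
      define h :: "'a^'n^'n" where "h = (\<chi> i j. if i = j then t ^ (2 ^ idx i) else 0)"
      have "det h = (\<Prod>i\<in>UNIV. h $ i $ i)" by (rule det_diagonal) (simp add: h_def)
      then have inv: "invertible h" using t by (simp add: invertible_det_nz h_def)
      define N where "N l = (\<Sum>\<theta>\<in>?G. mscale (c l \<theta> * inverse (t ^ \<theta>)) (E \<theta>))" for l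
      have NL: "N l \<in> L" for l
        unfolding N_def using E(1) by (intro mspace.subspace_sum mspace.subspace_scale L(1))
      have hN: "(h ** N l ** transpose h) $ i $ j = poly (C (l, i, j)) t" for l i j
      proof -
        have "(h ** N l ** transpose h) $ i $ j = t ^ (2 ^ idx i) * N l $ i $ j * t ^ (2 ^ idx j)"
          by (simp add: congruence_nth h_def if_distrib[of "\<lambda>x. x * _"] if_distrib[of "\<lambda>x. _ * x"] cong: if_cong)
        also have "\<dots> = t ^ wt i j * N l $ i $ j" by (simp add: wt_def power_add)
        also have "\<dots> = (\<Sum>\<theta>\<in>?G. t ^ wt i j * (c l \<theta> * inverse (t ^ \<theta>) * E \<theta> $ i $ j))"
          by (simp add: N_def sum_nth_nth sum_distrib_left)
        also have "\<dots> = (\<Sum>\<theta>\<in>?G. c l \<theta> * E \<theta> $ i $ j * t ^ (wt i j - \<theta>))"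
        proof (intro sum.cong refl)
          fix \<theta> assume \<theta>: "\<theta> \<in> ?G"
          show "t ^ wt i j * (c l \<theta> * inverse (t ^ \<theta>) * E \<theta> $ i $ j) = c l \<theta> * E \<theta> $ i $ j * t ^ (wt i j - \<theta>)"
          proof (cases "E \<theta> $ i $ j = 0")
            case False
            then have "\<theta> \<le> wt i j" using E(3)[OF \<theta>] by blast
            then have "t ^ wt i j = t ^ (wt i j - \<theta>) * t ^ \<theta>" by (simp flip: power_add)
            then show ?thesis using t by simp
          qed simp
        qed
        finally show ?thesis by (simp add: C_def poly_sum poly_monom)
      qed
      have "(\<lambda>i. poly (C i) t) = entries (\<lambda>l. h ** N l ** transpose h)"
        using hN by (auto simp: entries_def)
      moreover have "range (\<lambda>l. h ** N l ** transpose h) \<subseteq> congr h L"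
        using NL by (auto simp: congr_def)
      moreover have "vanishes_on f (congr h L)" using f(2) inv by blast
      ultimately show ?thesis unfolding q[symmetric] vanishes_on_def by metis
    qed
    then have "poly q t = poly 0 t" if "poly [:0, 1:] t \<noteq> 0" for t using that by simp
    then have "q = 0" by (intro poly_eq_if_eq_generically[of "[:0, 1:]" q 0]) auto
    have "poly (C (l, i, j)) 0 = M l $ i $ j" for l i j
    proof -
      have "poly (C (l, i, j)) 0 = (\<Sum>\<theta>\<in>?G. if wt i j = \<theta> then c l \<theta> else 0)"
        unfolding C_def prod.case poly_sum
      proof (intro sum.cong refl)
        fix \<theta> assume \<theta>: "\<theta> \<in> ?G"
        show "poly (monom (c l \<theta> * E \<theta> $ i $ j) (wt i j - \<theta>)) 0 = (if wt i j = \<theta> then c l \<theta> else 0)"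
        proof (cases "E \<theta> $ i $ j = 0")
          case True
          then have "wt i j \<noteq> \<theta>" using E(2)[OF \<theta>] by force
          then show ?thesis using True by simp
        next
          case False
          then have "\<theta> \<le> wt i j" using E(3)[OF \<theta>] by blast
          then show ?thesis using E(2)[OF \<theta>, of i j] by (auto simp: poly_monom power_0_left)
        qed
      qed
      also have "\<dots> = M l $ i $ j"
        using M(2)[of l i j] c[of l i j] finite_leading[of wt L] by (cases "wt i j \<in> ?G") auto
      finally show ?thesis .
    qed
    then have "(\<lambda>i. poly (C i) 0) = entries M" by (auto simp: entries_def)
    then show "f (entries M) = 0" using q[of 0] \<open>q = 0\<close> by simp
  qed
qed

text \<open>The trace on weights of invariance under triangular congruences; for coordinate
  subspaces this is the Borel-fixed condition.\<close>

definition shifted :: "'n::finite itself \<Rightarrow> nat set \<Rightarrow> bool" where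
  "shifted _ G \<longleftrightarrow> (\<forall>i j b :: 'n. idx i < idx j \<longrightarrow> wt j b \<in> G \<longrightarrow> wt i b \<in> G)"

lemma sum_eq_tail_sum:
  assumes "finite G" "\<And>x. x \<in> G \<Longrightarrow> x \<le> B"
  shows "\<Sum>G = (\<Sum>\<theta>\<in>{1..B}. card {x \<in> G. \<theta> \<le> x})"
proof -
  have "(\<Sum>\<theta>\<in>{1..B}. card {x \<in> G. \<theta> \<le> x}) = (\<Sum>\<theta>\<in>{1..B}. \<Sum>x\<in>G. if \<theta> \<le> x then 1 else 0)"
    using assms(1) by (intro sum.cong refl) (simp add: sum.If_cases Int_def)
  also have "\<dots> = (\<Sum>x\<in>G. \<Sum>\<theta>\<in>{1..B}. if \<theta> \<le> x then 1 else 0)" by (rule sum.swap)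
  also have "\<dots> = (\<Sum>x\<in>G. x)"
  proof (intro sum.cong refl)
    fix x assume "x \<in> G"
    then have "x \<le> B" by (rule assms(2))
    then have "{1..B} \<inter> {\<theta>. \<theta> \<le> x} = {1..x}" by auto
    then show "(\<Sum>\<theta>\<in>{1..B}. if \<theta> \<le> x then 1 else 0) = x" by (simp add: sum.If_cases)
  qed
  finally show ?thesis by simp
qed

text \<open>The total weight is the sum of the tail counts, so tails that are termwise at most those
  of \<open>G\<close> with a total not below that of \<open>G\<close> must agree with them.\<close>

lemma equal_tails:
  assumes fin: "finite G" "finite H" and card: "card G = card H"
    and tail: "\<And>\<theta>. card {x \<in> H. \<theta> \<le> x} \<le> card {x \<in> G. \<theta> \<le> x}"
    and sum: "\<Sum>G \<le> \<Sum>H"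
  shows "card {x \<in> H. \<theta> \<le> x} = card {x \<in> G. \<theta> \<le> (x::nat)}"
proof -
  define B where "B = Max (insert 0 (G \<union> H)) + \<theta>"
  have B: "x \<le> B" if "x \<in> G \<union> H" for x
    using Max_ge[of "insert 0 (G \<union> H)" x] that fin unfolding B_def by (intro trans_le_add1) auto
  have "\<Sum>H = \<Sum>G"
    using sum sum_mono[of "{1..B}" "\<lambda>\<theta>. card {x \<in> H. \<theta> \<le> x}" "\<lambda>\<theta>. card {x \<in> G. \<theta> \<le> x}"] tail
      sum_eq_tail_sum[of G B] sum_eq_tail_sum[of H B] B fin by simp
  then have eq: "(\<Sum>\<theta>\<in>{1..B}. card {x \<in> H. \<theta> \<le> x}) = (\<Sum>\<theta>\<in>{1..B}. card {x \<in> G. \<theta> \<le> x})"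
    using sum_eq_tail_sum[of G B] sum_eq_tail_sum[of H B] B fin by simp
  show ?thesis
  proof (cases "\<theta> = 0")
    case False
    then have "\<theta> \<in> {1..B}" by (simp add: B_def)
    then show ?thesis using sum_mono_inv[OF eq tail] by blast
  qed (use card in simp)
qed

text \<open>Minimise the total weight over all coordinate subspaces in the orbit closure. A transvection moves
  entries to lower weight only, so neither its lowest nor its highest leading weights can change at the
  minimum; hence the minimum is invariant under the transvection.\<close>

lemma exists_shifted_degeneration:
  fixes L :: "('a::alg_closed_field^'n^'n) set"
  assumes L: "mspace.subspace L" "\<And>M. M \<in> L \<Longrightarrow> transpose M = M" and two: "(2::'a) \<noteq> 0"
  obtains G where "G \<subseteq> weights TYPE('n)" "card G = mspace.dim L" "degenerates_to L (coord_space G)"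
    "shifted TYPE('n) G"
proof -
  define P where "P G \<longleftrightarrow> G \<subseteq> weights TYPE('n) \<and> card G = mspace.dim L \<and> degenerates_to L (coord_space G)" for G
  have leadW: "leading wt X \<subseteq> weights TYPE('n)" for X :: "('a^'n^'n) set"
    by (auto simp: leading_def)
  have "P (leading wt L)"
    unfolding P_def using leadW card_leading[OF _ L] degenerates_to_leading[OF L] by blast
  then obtain G where G: "P G" "\<And>H. P H \<Longrightarrow> \<Sum>G \<le> \<Sum>H"
    using ex_has_least_nat[of P "leading wt L" "\<lambda>G. \<Sum>G"] by blast
  have GW: "G \<subseteq> weights TYPE('n)" and cardG: "card G = mspace.dim L" and degG: "degenerates_to L (coord_space G)"
    using G(1) by (auto simp: P_def)
  have finG: "finite G" using GW finite_weights finite_subset by blast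
  have "shifted TYPE('n) G"
    unfolding shifted_def
  proof (intro allI impI)
    fix i j b :: 'n
    assume ij: "idx i < idx j" and jb: "wt j b \<in> G"
    have inj: "i \<noteq> j" using ij by auto
    \<comment> \<open>The transvection adding row and column \<open>j\<close> to row and column
      \<open>i\<close>; entries move to lower weights.\<close>
    define g :: "'a^'n^'n" where "g = (\<chi> p q. if p = q then 1 else if p = i \<and> q = j then 1 else 0)"
    have gM: "(g ** M ** transpose g) $ p $ q = M $ p $ q + (if p = i then M $ j $ q else 0)
        + (if q = i then M $ p $ j else 0) + (if p = i \<and> q = i then M $ j $ j else 0)" for M p q
    proof -
      have row: "(\<Sum>a\<in>UNIV. g $ p $ a * F a) = F p + (if p = i then F j else 0)" for p and F :: "'n \<Rightarrow> 'a"
      proof -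
        have "g $ p $ a * F a = (if p = a then F a else 0) + (if j = a then (if p = i then F j else 0) else 0)" for a
          using inj by (auto simp: g_def)
        then have "(\<Sum>a\<in>UNIV. g $ p $ a * F a)
            = (\<Sum>a\<in>UNIV. (if p = a then F a else 0) + (if j = a then (if p = i then F j else 0) else 0))"
          by (intro sum.cong) auto
        then show ?thesis by (simp add: sum.distrib)
      qed
      have "(g ** M ** transpose g) $ p $ q = (\<Sum>a\<in>UNIV. g $ p $ a * (\<Sum>b\<in>UNIV. g $ q $ b * M $ a $ b))"
        unfolding congruence_nth by (simp add: sum_distrib_left mult_ac)
      then show ?thesis unfolding row by (auto simp: add_ac)
    qed
    have g_top: "(g ** M ** transpose g) $ p $ q = M $ p $ q"
      if top: "\<And>c d. wt p q < wt c d \<Longrightarrow> M $ c $ d = 0" for M p q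
    proof -
      have "M $ j $ q = 0" if "p = i" using top[of j q] wt_strict_mono[OF ij, of q] that by simp
      moreover have "M $ p $ j = 0" if "q = i"
        using top[of p j] wt_strict_mono[OF ij, of p] that wt_commute by metis
      moreover have "M $ j $ j = 0" if "p = i" "q = i"
      proof -
        have "wt i i < wt j i" "wt i j < wt j j" using wt_strict_mono[OF ij] by auto
        then have "wt p q < wt j j" using that wt_commute[of i j] by simp
        then show ?thesis by (rule top)
      qed
      ultimately show ?thesis unfolding gM by auto
    qed
    have inv: "invertible g"
    proof -
      have "\<forall>v. g *v v = 0 \<longrightarrow> v = 0"
      proof (intro allI impI)
        fix v assume v: "g *v v = 0"
        have gv: "(g *v v) $ p = v $ p + (if p = i then v $ j else 0)" for p
        proof -
          have "g $ p $ a * v $ a = (if p = a then v $ a else 0) + (if j = a then (if p = i then v $ j else 0) else 0)" for a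
            using inj by (auto simp: g_def)
          then have "(\<Sum>a\<in>UNIV. g $ p $ a * v $ a)
              = (\<Sum>a\<in>UNIV. (if p = a then v $ a else 0) + (if j = a then (if p = i then v $ j else 0) else 0))"
            by (intro sum.cong) auto
          then show ?thesis by (simp add: sum.distrib matrix_vector_mult_def)
        qed
        have z: "v $ p + (if p = i then v $ j else 0) = 0" for p
          using gv[of p] v by simp
        have "v $ j = 0" using z[of j] inj by simp
        then have "v $ p = 0" for p using z[of p] by (cases "p = i") auto
        then show "v = 0" by (simp add: Finite_Cartesian_Product.vec_eq_iff)
      qed
      then show ?thesis unfolding invertible_det_nz det_nonzero_iff_inj .
    qed
    define X where "X = congr g (coord_space G)"
    have Xsub: "mspace.subspace X" unfolding X_def by (rule subspace_congr[OF subspace_coord_space])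
    have Xsym: "transpose M = M" if "M \<in> X" for M
      using that transpose_congruence unfolding X_def congr_def coord_space_def by auto
    have dimX: "mspace.dim X = card G" unfolding X_def dim_congr[OF inv] dim_coord_space[OF GW] ..
    define hi where "hi p q = - int (wt p q)" for p q :: 'n
    have hi: "hi p q = hi p' q' \<Longrightarrow> wt p q = wt p' q'" for p q p' q' by (simp add: hi_def)
    \<comment> \<open>At the highest weight of a matrix the transvection changes nothing, so the
      highest weights of members of \<open>X\<close> lie in \<open>G\<close>; by dimension they fill
      \<open>G\<close>.\<close>
    have hisub: "leading hi X \<subseteq> (\<lambda>\<theta>. - int \<theta>) ` G"
    proof
      fix \<theta> assume "\<theta> \<in> leading hi X"
      then obtain M' p q where M': "M' \<in> X" "hi p q = \<theta>" "M' $ p $ q \<noteq> 0" "\<And>a b. M' $ a $ b \<noteq> 0 \<Longrightarrow> \<theta> \<le> hi a b"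
        unfolding leading_def by blast
      obtain M where M: "M \<in> coord_space G" "M' = g ** M ** transpose g" using M'(1) by (auto simp: X_def congr_def)
      have top: "M $ a $ b = 0" if "wt p q < wt a b" for a b
      proof (rule ccontr)
        assume ne: "M $ a $ b \<noteq> 0"
        define A where "A = (\<lambda>(a, b). wt a b) ` {(a, b). M $ a $ b \<noteq> 0}"
        have A: "finite A" "wt a b \<in> A" using ne by (auto simp: A_def)
        then have "Max A \<in> A" by (intro Max_in) auto
        then obtain a' b' where ab': "wt a' b' = Max A" "M $ a' $ b' \<noteq> 0" by (auto simp: A_def)
        have zero: "M $ c $ d = 0" if "wt a' b' < wt c d" for c d
        proof (rule ccontr)
          assume "M $ c $ d \<noteq> 0"
          then have "wt c d \<in> A" by (auto simp: A_def)
          then show False using Max_ge[OF A(1)] ab'(1) that by fastforce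
        qed
        have "M' $ a' $ b' = M $ a' $ b'"
          unfolding M(2) using zero by (rule g_top)
        then have "\<theta> \<le> hi a' b'" using M'(4) ab'(2) by simp
        moreover have "wt a b \<le> wt a' b'" using Max_ge[OF A] ab'(1) by simp
        ultimately show False using that M'(2) by (simp add: hi_def)
      qed
      have "M' $ p $ q = M $ p $ q"
        unfolding M(2) using top by (rule g_top)
      then have "wt p q \<in> G" using M'(3) M(1) by (auto simp: coord_space_def)
      then show "\<theta> \<in> (\<lambda>\<theta>. - int \<theta>) ` G" using M'(2) by (auto simp: hi_def)
    qed
    have hieq: "leading hi X = (\<lambda>\<theta>. - int \<theta>) ` G"
    proof (rule card_subset_eq[OF _ hisub])
      have "card ((\<lambda>\<theta>. - int \<theta>) ` G) = card G" by (rule card_image) (auto simp: inj_on_def)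
      then show "card (leading hi X) = card ((\<lambda>\<theta>. - int \<theta>) ` G)"
        using card_leading[OF hi Xsub Xsym] dimX by simp
    qed (use finG in simp)
    define H where "H = leading wt X"
    define Xge where "Xge \<theta> = {M \<in> X. \<forall>a b. M $ a $ b \<noteq> 0 \<longrightarrow> \<theta> \<le> wt a b}" for \<theta>
    define Xle where "Xle \<theta> = {M \<in> X. \<forall>a b. M $ a $ b \<noteq> 0 \<longrightarrow> wt a b \<le> \<theta>}" for \<theta>
    have Xge: "mspace.subspace (Xge \<theta>)" and Xle: "mspace.subspace (Xle \<theta>)" for \<theta>
      using Xsub unfolding Xge_def Xle_def mspace.subspace_def by (auto, metis add_0, metis add_0)
    have symge: "transpose M = M" if "M \<in> Xge \<theta>" for M \<theta> using that Xsym by (simp add: Xge_def)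
    have symle: "transpose M = M" if "M \<in> Xle \<theta>" for M \<theta> using that Xsym by (simp add: Xle_def)
    have dimge: "mspace.dim (Xge \<theta>) = card {x \<in> H. \<theta> \<le> x}" for \<theta>
    proof -
      have "leading wt (Xge \<theta>) = {x \<in> H. \<theta> \<le> x}"
      proof (intro subset_antisym subsetI)
        fix \<phi> assume "\<phi> \<in> leading wt (Xge \<theta>)"
        then show "\<phi> \<in> {x \<in> H. \<theta> \<le> x}" unfolding leading_def Xge_def H_def by auto
      next
        fix \<phi> assume "\<phi> \<in> {x \<in> H. \<theta> \<le> x}"
        then have \<phi>: "\<phi> \<in> leading wt X" "\<theta> \<le> \<phi>" by (auto simp: H_def)
        then obtain M where M: "M \<in> X" "\<exists>i j. wt i j = \<phi> \<and> M $ i $ j \<noteq> 0" "\<forall>i j. M $ i $ j \<noteq> 0 \<longrightarrow> \<phi> \<le> wt i j"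
          unfolding leading_def by blast
        then have "M \<in> Xge \<theta>" using \<phi>(2) by (auto simp: Xge_def intro: order_trans)
        then show "\<phi> \<in> leading wt (Xge \<theta>)" using M unfolding leading_def by blast
      qed
      then show ?thesis using card_leading[of wt "Xge \<theta>", OF _ Xge symge] by simp
    qed
    \<comment> \<open>Both sides come from \<open>Xge \<theta>\<close>: its lowest leading weights
      count the left side, while its highest ones lie in \<open>G\<close> and are at least
      \<open>\<theta>\<close>.\<close>
    have tail: "card {x \<in> H. \<theta> \<le> x} \<le> card {x \<in> G. \<theta> \<le> x}" for \<theta>
    proof -
      have "leading hi (Xge \<theta>) \<subseteq> (\<lambda>\<theta>. - int \<theta>) ` {x \<in> G. \<theta> \<le> x}"
      proof
        fix \<phi> assume \<phi>: "\<phi> \<in> leading hi (Xge \<theta>)"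
        then have "\<phi> \<in> leading hi X" using leading_mono[of "Xge \<theta>" X hi] by (auto simp: Xge_def)
        then obtain x where x: "x \<in> G" "\<phi> = - int x" unfolding hieq by blast
        obtain p q M where "M \<in> Xge \<theta>" "hi p q = \<phi>" "M $ p $ q \<noteq> 0" using \<phi> unfolding leading_def by blast
        then have "\<theta> \<le> x" using x(2) by (auto simp: Xge_def hi_def)
        then show "\<phi> \<in> (\<lambda>\<theta>. - int \<theta>) ` {x \<in> G. \<theta> \<le> x}" using x by blast
      qed
      then have "card (leading hi (Xge \<theta>)) \<le> card ((\<lambda>\<theta>. - int \<theta>) ` {x \<in> G. \<theta> \<le> x})"
        using finG by (intro card_mono) auto
      also have "\<dots> \<le> card {x \<in> G. \<theta> \<le> x}" using finG by (intro card_image_le) auto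
      finally show ?thesis
        using card_leading[of hi "Xge \<theta>", OF hi Xge symge] dimge[of \<theta>] by simp
    qed
    have "P H"
      unfolding P_def
    proof (intro conjI)
      show "H \<subseteq> weights TYPE('n)" unfolding H_def by (rule leadW)
      have "card H = card G" unfolding H_def using card_leading[of wt X, OF _ Xsub Xsym] dimX by simp
      then show "card H = mspace.dim L" using cardG by simp
      have "degenerates_to (coord_space G) X" unfolding X_def using inv by (rule degenerates_to_congr)
      moreover have "degenerates_to X (coord_space H)" unfolding H_def by (rule degenerates_to_leading[OF Xsub Xsym])
      ultimately show "degenerates_to L (coord_space H)" using degG degenerates_to_trans by blast
    qed
    then have tails: "card {x \<in> H. \<theta> \<le> x} = card {x \<in> G. \<theta> \<le> x}" for \<theta>
      using G(2)[of H] tail finG cardG finite_leading[of wt X]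
      by (intro equal_tails) (auto simp: P_def H_def)
    \<comment> \<open>With equal tails, the dimensions of \<open>Xge \<theta>\<close> and
      \<open>Xle \<theta>\<close> add up to \<open>card G + 1\<close>, one more than the dimension
      of \<open>X\<close>; so some nonzero member is concentrated in weight
      \<open>\<theta>\<close>.\<close>
    have unit: "symm_unit \<theta> \<in> X" if \<theta>: "\<theta> \<in> G" for \<theta>
    proof -
      have "leading hi (Xle \<theta>) = (\<lambda>\<theta>. - int \<theta>) ` {x \<in> G. x \<le> \<theta>}"
      proof (intro subset_antisym subsetI)
        fix \<phi> assume \<phi>: "\<phi> \<in> leading hi (Xle \<theta>)"
        then have "\<phi> \<in> leading hi X" using leading_mono[of "Xle \<theta>" X hi] by (auto simp: Xle_def)
        then obtain x where x: "x \<in> G" "\<phi> = - int x" unfolding hieq by blast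
        obtain p q M where "M \<in> Xle \<theta>" "hi p q = \<phi>" "M $ p $ q \<noteq> 0" using \<phi> unfolding leading_def by blast
        then have "x \<le> \<theta>" using x(2) by (auto simp: Xle_def hi_def)
        then show "\<phi> \<in> (\<lambda>\<theta>. - int \<theta>) ` {x \<in> G. x \<le> \<theta>}" using x by blast
      next
        fix \<phi> assume "\<phi> \<in> (\<lambda>\<theta>. - int \<theta>) ` {x \<in> G. x \<le> \<theta>}"
        then obtain x where x: "x \<in> G" "x \<le> \<theta>" "\<phi> = - int x" by blast
        then have "\<phi> \<in> leading hi X" unfolding hieq by blast
        then obtain M where M: "M \<in> X" "\<exists>i j. hi i j = \<phi> \<and> M $ i $ j \<noteq> 0" "\<forall>i j. M $ i $ j \<noteq> 0 \<longrightarrow> \<phi> \<le> hi i j"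
          unfolding leading_def by blast
        have "M \<in> Xle \<theta>" using M(1,3) x unfolding Xle_def hi_def by fastforce
        then show "\<phi> \<in> leading hi (Xle \<theta>)" using M unfolding leading_def by blast
      qed
      then have dimle: "mspace.dim (Xle \<theta>) = card {x \<in> G. x \<le> \<theta>}"
        using card_leading[of hi "Xle \<theta>", OF hi Xle symle] card_image[of "\<lambda>\<theta>. - int \<theta>" "{x \<in> G. x \<le> \<theta>}"]
        by (auto simp: inj_on_def)
      let ?S = "{A + B |A B. A \<in> Xge \<theta> \<and> B \<in> Xle \<theta>}"
      have "?S \<subseteq> X" using Xsub by (auto simp: Xge_def Xle_def intro: mspace.subspace_add)
      then have "mspace.dim ?S \<le> card G" using mspace.dim_subset[of ?S X] dimX by simp
      moreover have "card {x \<in> G. \<theta> \<le> x} + card {x \<in> G. x \<le> \<theta>} = Suc (card G)"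
      proof -
        have "{x \<in> G. \<theta> \<le> x} \<union> {x \<in> G. x \<le> \<theta>} = G" "{x \<in> G. \<theta> \<le> x} \<inter> {x \<in> G. x \<le> \<theta>} = {\<theta>}" using \<theta> by auto
        then show ?thesis using card_Un_Int[of "{x \<in> G. \<theta> \<le> x}" "{x \<in> G. x \<le> \<theta>}"] finG by simp
      qed
      ultimately have "mspace.dim (Xge \<theta> \<inter> Xle \<theta>) \<noteq> 0"
        using mspace.dim_sums_Int[OF Xge Xle, of \<theta> \<theta>] dimge[of \<theta>] tails[of \<theta>] dimle by linarith
      then obtain M where M: "M \<in> Xge \<theta>" "M \<in> Xle \<theta>" "M \<noteq> 0" by auto
      obtain a b where ab: "M $ a $ b \<noteq> 0" using M(3) by (auto simp: Finite_Cartesian_Product.vec_eq_iff)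
      have only: "wt p q = \<theta>" if "M $ p $ q \<noteq> 0" for p q
        using that M(1,2) by (auto simp: Xge_def Xle_def intro: antisym)
      have eq: "symm_unit \<theta> = mscale (1 / M $ a $ b) M"
      proof -
        have entry: "M $ p $ q = (if wt p q = \<theta> then M $ a $ b else 0)" for p q
        proof (cases "wt p q = \<theta>")
          case True
          then have "wt p q = wt a b" using only[OF ab] by simp
          then show ?thesis using True symge[OF M(1)] by (auto simp: wt_eq_iff transpose_eq_iff)
        qed (use only[of p q] in auto)
        have "symm_unit \<theta> $ p $ q = mscale (1 / M $ a $ b) M $ p $ q" for p q
          unfolding mscale_nth entry[of p q] using ab by (simp add: symm_unit_def)
        then show ?thesis by (simp only: Finite_Cartesian_Product.vec_eq_iff) blast
      qed
      show ?thesis unfolding eq using M(1) Xsub by (auto simp: Xge_def intro: mspace.subspace_scale)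
    qed
    have "coord_space G \<subseteq> X"
    proof
      fix M :: "'a^'n^'n" assume M: "M \<in> coord_space G"
      then have "\<exists>c. \<forall>i j. M $ i $ j = c (wt i j)"
        by (intro symmetric_entries_by_weight) (simp add: coord_space_def)
      then obtain c where c: "\<And>i j. M $ i $ j = c (wt i j)" by blast
      have "M = (\<Sum>\<theta>\<in>G. mscale (c \<theta>) (symm_unit \<theta>))"
      proof -
        have "(\<Sum>\<theta>\<in>G. mscale (c \<theta>) (symm_unit \<theta>)) $ p $ q = M $ p $ q" for p q
        proof -
          have "(\<Sum>\<theta>\<in>G. mscale (c \<theta>) (symm_unit \<theta>)) $ p $ q = (\<Sum>\<theta>\<in>G. if wt p q = \<theta> then c \<theta> else 0)"
            by (auto simp: sum_nth_nth symm_unit_def intro!: sum.cong)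
          also have "\<dots> = M $ p $ q"
          proof (cases "wt p q \<in> G")
            case False
            then have "M $ p $ q = 0" using M unfolding coord_space_def by blast
            then show ?thesis using False finG by simp
          qed (use c[of p q] finG in simp)
          finally show ?thesis .
        qed
        then show ?thesis by (simp add: Finite_Cartesian_Product.vec_eq_iff)
      qed
      then show "M \<in> X" using unit Xsub by (simp add: mspace.subspace_sum mspace.subspace_scale)
    qed
    then have XG: "X = coord_space G"
      using mspace.subspace_dim_equal[OF subspace_coord_space Xsub, of G] dimX
        dim_coord_space[OF GW, where ?'a = 'a] by simp
    define E :: "'a^'n^'n" where "E = symm_unit (wt j b)"
    have "E \<in> coord_space G" unfolding E_def using jb by (rule symm_unit_in_coord_space)
    then have "g ** E ** transpose g \<in> X" unfolding X_def congr_def by (rule imageI)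
    then have "g ** E ** transpose g \<in> coord_space G" by (simp only: XG)
    \<comment> \<open>The entry is 1, except for \<open>b = i\<close>, where two terms contribute
      and it is 2.\<close>
    moreover have "(g ** E ** transpose g) $ i $ b \<noteq> 0"
      unfolding gM using inj two by (auto simp: E_def symm_unit_def wt_eq_iff)
    ultimately show "wt i b \<in> G" by (auto simp: coord_space_def)
  qed
  then show thesis using that GW cardG degG by blast
qed

section \<open>Compression spaces\<close>

definition elt :: "nat \<Rightarrow> 'n::finite" where
  "elt = the_inv idx"

lemma elt_idx [simp]: "elt (idx i) = i"
  unfolding elt_def by (rule the_inv_f_f) (simp add: inj_def)

lemma idx_elt [simp]: "k < CARD('n) \<Longrightarrow> idx (elt k :: 'n::finite) = k"
proof -
  assume "k < CARD('n)"
  then have "k \<in> idx ` (UNIV :: 'n set)" using bij_idx[where ?'n = 'n] by (simp add: bij_betw_def)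
  then obtain i :: 'n where "k = idx i" by blast
  then show ?thesis by simp
qed

lemma eq_elt_iff: "k < CARD('n) \<Longrightarrow> (j :: 'n::finite) = elt k \<longleftrightarrow> idx j = k"
  by auto

lemma card_idx_vimage:
  assumes "A \<subseteq> {..<CARD('n)}"
  shows "card {i :: 'n::finite. idx i \<in> A} = card A"
proof -
  have "bij_betw idx {i :: 'n. idx i \<in> A} A"
    unfolding bij_betw_def
  proof
    show "idx ` {i :: 'n. idx i \<in> A} = A"
    proof (intro subset_antisym subsetI)
      fix k assume "k \<in> A"
      then have "k = idx (elt k :: 'n)" "idx (elt k :: 'n) \<in> A" using assms by auto
      then show "k \<in> idx ` {i :: 'n. idx i \<in> A}" by blast
    qed auto
  qed (simp add: inj_on_def)
  then show ?thesis by (rule bij_betw_same_card)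
qed

lemma card_idx_less: "m \<le> CARD('n) \<Longrightarrow> card {i :: 'n::finite. idx i < m} = m"
  using card_idx_vimage[of "{..<m}"] by auto

text \<open>The coordinate space of these weights is the standard \<open>s\<close>-compression space, whose projective
  dimension is the number \<open>\<kappa>(s)\<close> for \<open>r = \<rho> + 1\<close>.\<close>

definition cweights :: "'n::finite itself \<Rightarrow> nat \<Rightarrow> nat \<Rightarrow> nat set" where
  "cweights _ \<rho> s = {wt i j |i j :: 'n. idx i < s \<or> idx j < s \<or> (idx i < \<rho> - s \<and> idx j < \<rho> - s)}"

lemma wt_in_cweights:
  "wt (i :: 'n::finite) j \<in> cweights TYPE('n) \<rho> s \<longleftrightarrow>
     idx i < s \<or> idx j < s \<or> (idx i < \<rho> - s \<and> idx j < \<rho> - s)"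
  unfolding cweights_def by (auto simp: wt_eq_iff)

lemma cweights_subset: "cweights TYPE('n::finite) \<rho> s \<subseteq> weights TYPE('n)"
  unfolding cweights_def by auto

lemma finite_cweights: "finite (cweights TYPE('n::finite) \<rho> s)"
  using finite_subset[OF cweights_subset finite_weights] .

lemma sum_first_rows: "s \<le> n \<Longrightarrow> 2 * (\<Sum>a<s. int n - int a) = int s * (2 * int n - int s + 1)"
  by (induction s) (auto simp: algebra_simps)

lemma sum_triangle: "2 * (\<Sum>b<m. int b + 1) = int m * (int m + 1)"
  by (induction m) (auto simp: algebra_simps)

text \<open>\<open>A1\<close> counts pairs whose smaller index is below \<open>s\<close>,
  \<open>A2\<close> those with both indices from \<open>s\<close> up to but excluding
  \<open>\<rho> - s\<close>. Everything is doubled to avoid dividing triangular numbers.\<close>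

lemma card_cweights:
  assumes s: "2 * s \<le> \<rho>" and \<rho>: "\<rho> < CARD('n::finite)"
  shows "int (card (cweights TYPE('n) \<rho> s)) = kappa CARD('n) (\<rho> + 1) s + 1"
proof -
  let ?n = "CARD('n)"
  define A1 where "A1 = Sigma {..<s} (\<lambda>a. {a..<?n})"
  define A2 where "A2 = Sigma {s..<\<rho> - s} (\<lambda>b. {s..b})"
  define w where "w = (\<lambda>(a, b). wt (elt a :: 'n) (elt b))"
  have eltinj: "elt a = (elt b :: 'n) \<longleftrightarrow> a = b" if "a < ?n" "b < ?n" for a b
    using that idx_elt[where ?'n = 'n] by metis
  have eq: "cweights TYPE('n) \<rho> s = w ` A1 \<union> w ` A2"
  proof (intro subset_antisym subsetI)
    fix \<theta> assume "\<theta> \<in> cweights TYPE('n) \<rho> s"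
    then obtain i j :: 'n where ij: "\<theta> = wt i j" "idx i \<le> idx j" "idx i < s \<or> idx j < \<rho> - s"
    proof -
      from \<open>\<theta> \<in> _\<close> obtain i j :: 'n where ij: "\<theta> = wt i j"
        "idx i < s \<or> idx j < s \<or> (idx i < \<rho> - s \<and> idx j < \<rho> - s)"
        unfolding cweights_def by blast
      show thesis
        using that[of i j] that[of j i] ij wt_commute[of i j] s by (cases "idx i \<le> idx j") auto
    qed
    have \<theta>: "\<theta> = w (idx i, idx j)" "\<theta> = w (idx j, idx i)" using ij(1) wt_commute[of i j] by (auto simp: w_def)
    show "\<theta> \<in> w ` A1 \<union> w ` A2"
    proof (cases "idx i < s")
      case True
      then have "(idx i, idx j) \<in> A1" using ij idx_less[of j] by (auto simp: A1_def)
      then show ?thesis using \<theta>(1) by blast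
    next
      case False
      then have "(idx j, idx i) \<in> A2" using ij by (auto simp: A2_def)
      then show ?thesis using \<theta>(2) by blast
    qed
  next
    fix \<theta> assume "\<theta> \<in> w ` A1 \<union> w ` A2"
    then obtain a b where ab: "(a, b) \<in> A1 \<or> (a, b) \<in> A2" "\<theta> = w (a, b)" by auto
    have "a < ?n" "b < ?n" using ab(1) s \<rho> by (auto simp: A1_def A2_def)
    then show "\<theta> \<in> cweights TYPE('n) \<rho> s"
      unfolding ab(2) w_def prod.case wt_in_cweights using ab(1) by (auto simp: A1_def A2_def)
  qed
  have fin: "finite A1" "finite A2" by (auto simp: A1_def A2_def)
  have weq: "w (a, b) = w (c, d) \<longleftrightarrow> (a = c \<and> b = d) \<or> (a = d \<and> b = c)"
    if "a < ?n" "b < ?n" "c < ?n" "d < ?n" for a b c d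
    unfolding w_def prod.case wt_eq_iff using that eltinj by simp
  have inj1: "inj_on w A1"
  proof (rule inj_onI)
    fix x y assume xy: "x \<in> A1" "y \<in> A1" "w x = w y"
    obtain a b c d where abcd: "x = (a, b)" "y = (c, d)" by fastforce
    have lt: "a < ?n" "b < ?n" "c < ?n" "d < ?n" using xy abcd s \<rho> by (auto simp: A1_def)
    have "(a = c \<and> b = d) \<or> (a = d \<and> b = c)" using xy(3) weq[OF lt] abcd by simp
    then show "x = y" using xy(1,2) abcd by (auto simp: A1_def)
  qed
  have inj2: "inj_on w A2"
  proof (rule inj_onI)
    fix x y assume xy: "x \<in> A2" "y \<in> A2" "w x = w y"
    obtain a b c d where abcd: "x = (a, b)" "y = (c, d)" by fastforce
    have lt: "a < ?n" "b < ?n" "c < ?n" "d < ?n" using xy abcd s \<rho> by (auto simp: A2_def)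
    have "(a = c \<and> b = d) \<or> (a = d \<and> b = c)" using xy(3) weq[OF lt] abcd by simp
    then show "x = y" using xy(1,2) abcd by (auto simp: A2_def)
  qed
  have disj: "w ` A1 \<inter> w ` A2 = {}"
  proof -
    have "w x \<noteq> w y" if "x \<in> A1" "y \<in> A2" for x y
    proof -
      obtain a b c d where abcd: "x = (a, b)" "y = (c, d)" by fastforce
      have lt: "a < ?n" "b < ?n" "c < ?n" "d < ?n" using that abcd s \<rho> by (auto simp: A1_def A2_def)
      have "\<not> ((a = c \<and> b = d) \<or> (a = d \<and> b = c))" using that abcd by (auto simp: A1_def A2_def)
      then show ?thesis using weq[OF lt] abcd by simp
    qed
    then show ?thesis by blast
  qed
  have "int (card (cweights TYPE('n) \<rho> s)) = int (card A1) + int (card A2)"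
    unfolding eq using disj fin inj1 inj2 by (simp add: card_Un_disjoint card_image)
  also have "int (card A1) = (\<Sum>a<s. int ?n - int a)"
    unfolding A1_def using s \<rho> by (simp add: of_nat_diff)
  also have "int (card A2) = (\<Sum>b<\<rho> - 2 * s. int b + 1)"
  proof -
    have "int (card A2) = (\<Sum>b\<in>{s..<\<rho> - s}. int (Suc b - s))"
      unfolding A2_def by simp
    also have "\<dots> = (\<Sum>b<\<rho> - 2 * s. int b + 1)"
      by (rule sum.reindex_bij_witness[of _ "\<lambda>b. b + s" "\<lambda>b. b - s"]) (use s in auto)
    finally show ?thesis .
  qed
  finally have "2 * int (card (cweights TYPE('n) \<rho> s))
      = int s * (2 * int ?n - int s + 1) + int (\<rho> - 2 * s) * (int (\<rho> - 2 * s) + 1)"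
    using sum_first_rows[of s ?n] sum_triangle[of "\<rho> - 2 * s"] s \<rho> by simp
  moreover have "2 * int ((\<rho> + 1 - s) choose 2) = (int \<rho> + 1 - int s) * (int \<rho> - int s)"
  proof -
    have "even (m * (m - 1))" for m :: nat by (cases m) auto
    then have "2 * ((\<rho> + 1 - s) choose 2) = (\<rho> + 1 - s) * (\<rho> + 1 - s - 1)"
      unfolding choose_two by (rule dvd_mult_div_cancel)
    then have "2 * int ((\<rho> + 1 - s) choose 2) = int ((\<rho> + 1 - s) * (\<rho> + 1 - s - 1))" by linarith
    then show ?thesis using s by (simp add: of_nat_diff)
  qed
  moreover have "int (\<rho> - 2 * s) = int \<rho> - 2 * int s" using s by (simp add: of_nat_diff)
  ultimately have "2 * int (card (cweights TYPE('n) \<rho> s)) = 2 * (kappa ?n (\<rho> + 1) s + 1)"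
    unfolding kappa_def by (simp add: algebra_simps)
  then show ?thesis by simp
qed

text \<open>The last \<open>n - (\<rho> - s)\<close> unit vectors are mapped into the first
  \<open>s\<close> coordinates, so the kernel has dimension at least
  \<open>n - \<rho>\<close>.\<close>

lemma rank_coord_space_cweights:
  fixes M :: "'a::field^'n^'n"
  assumes M: "M \<in> coord_space (cweights TYPE('n) \<rho> s)" and s: "2 * s \<le> \<rho>" and \<rho>: "\<rho> \<le> CARD('n)"
  shows "rank M \<le> \<rho>"
proof -
  define W :: "('a^'n) set" where "W = {v. \<forall>i. i \<notin> {i. \<rho> - s \<le> idx i} \<longrightarrow> v $ i = 0}"
  define V :: "('a^'n) set" where "V = {v. \<forall>i. i \<notin> {i. idx i < s} \<longrightarrow> v $ i = 0}"
  have subW: "vec.subspace W" by (auto simp: W_def vec.subspace_def)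
  have "{\<rho> - s..<CARD('n)} \<subseteq> {..<CARD('n)}" by auto
  from card_idx_vimage[OF this]
  have "card {i :: 'n. \<rho> - s \<le> idx i} = CARD('n) - (\<rho> - s)" by (simp add: idx_less)
  then have dimW: "vec.dim W = CARD('n) - (\<rho> - s)" unfolding W_def by (simp only: dim_substandard_cart)
  have dimV: "vec.dim V = s"
    unfolding V_def dim_substandard_cart using card_idx_less[of s, where ?'n = 'n] s \<rho> by simp
  have "(*v) M ` W \<subseteq> V"
  proof
    fix w assume "w \<in> (*v) M ` W"
    then obtain v where v: "v \<in> W" "w = M *v v" by (elim imageE)
    have "(M *v v) $ i = 0" if i: "\<not> idx i < s" for i
    proof -
      have "M $ i $ j * v $ j = 0" for j
      proof (cases "idx j < \<rho> - s")
        case True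
        then show ?thesis using v(1) by (simp add: W_def)
      next
        case False
        then have "wt i j \<notin> cweights TYPE('n) \<rho> s" unfolding wt_in_cweights using i s by auto
        then have "M $ i $ j = 0" using M unfolding coord_space_def by blast
        then show ?thesis by simp
      qed
      then have "(\<Sum>j\<in>UNIV. M $ i $ j * v $ j) = 0" by (intro sum.neutral) blast
      then show ?thesis by (simp only: matrix_vector_mult_def vec_lambda_beta)
    qed
    then show "w \<in> V" using v(2) by (simp add: V_def)
  qed
  then have "vec.dim ((*v) M ` W) \<le> s" using vec.dim_subset[of "(*v) M ` W" V] dimV by simp
  moreover have "vec.dim W = vec.dim ((*v) M ` W) + vec.dim {v \<in> W. M *v v = 0}"
    by (rule vec.dim_image_kernel[OF matrix_vector_mul_linear_gen[of M] subW])
  moreover have "vec.dim {v \<in> W. M *v v = 0} \<le> vec.dim {v. M *v v = 0}"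
    by (rule vec.dim_subset) auto
  ultimately show ?thesis using dimW dim_kernel[of M] s \<rho> by linarith
qed

definition compressible :: "nat \<Rightarrow> nat \<Rightarrow> ('a::field^'n^'n) set \<Rightarrow> bool" where
  "compressible \<rho> s L \<longleftrightarrow> (\<exists>g. invertible g \<and> L \<subseteq> congr g (coord_space (cweights TYPE('n) \<rho> s)))"

lemma compressible_congr:
  fixes L :: "('a::field^'n^'n) set"
  assumes "invertible h" "compressible \<rho> s (congr h L)"
  shows "compressible \<rho> s L"
proof -
  obtain g where g: "invertible g" "congr h L \<subseteq> congr g (coord_space (cweights TYPE('n) \<rho> s))"
    using assms(2) unfolding compressible_def by blast
  obtain h' where h': "h ** h' = mat 1" "h' ** h = mat 1" using assms(1) unfolding invertible_def by blast
  have "congr (mat 1) L = L" by (simp add: congr_def transpose_mat)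
  then have "L = congr h' (congr h L)" by (simp add: congr_congr h')
  also have "\<dots> \<subseteq> congr h' (congr g (coord_space (cweights TYPE('n) \<rho> s)))"
    unfolding congr_def[of h'] using g(2) by (rule image_mono)
  finally have "L \<subseteq> congr (h' ** g) (coord_space (cweights TYPE('n) \<rho> s))" by (simp add: congr_congr)
  moreover have "invertible h'" using h' unfolding invertible_def by blast
  ultimately show ?thesis unfolding compressible_def using invertible_mult g(1) by blast
qed

text \<open>Take a basis adapted to \<open>W \<subseteq> U\<close>, with the vectors of
  \<open>W\<close> at the highest indices and those outside \<open>U\<close> at the lowest
  \<open>s\<close>. The vanishing pairing becomes the vanishing of entries.\<close>

lemma compressibleI:
  fixes L :: "('a::field^'n^'n) set"
  assumes sym: "\<And>M. M \<in> L \<Longrightarrow> transpose M = M"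
    and W: "vec.subspace W" "vec.subspace U" "W \<subseteq> U"
    and dim: "vec.dim W + \<rho> = CARD('n) + s" "vec.dim U + s = CARD('n)" "2 * s \<le> \<rho>"
    and zero: "\<And>M w u. M \<in> L \<Longrightarrow> w \<in> W \<Longrightarrow> u \<in> U \<Longrightarrow> w \<odot> (M *v u) = 0"
  shows "compressible \<rho> s L"
proof -
  obtain B1 where B1: "B1 \<subseteq> W" "vec.independent B1" "W \<subseteq> vec.span B1" "card B1 = vec.dim W"
    by (rule vec.basis_exists)
  obtain B2 where B2: "B1 \<subseteq> B2" "B2 \<subseteq> U" "vec.independent B2" "U \<subseteq> vec.span B2"
    using vec.maximal_independent_subset_extend[of B1 U] B1 W(3) by blast
  obtain B3 where B3: "B2 \<subseteq> B3" "B3 \<subseteq> UNIV" "vec.independent B3" "UNIV \<subseteq> vec.span B3"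
    using vec.maximal_independent_subset_extend[of B2 UNIV] B2 by blast
  have fin: "finite B3" using B3(3) by (rule vec.finiteI_independent)
  have finB: "finite B2" "finite B1" using finite_subset[OF B3(1) fin] finite_subset[OF B2(1)] by auto
  have c2: "card B2 = vec.dim U" by (rule vec.basis_card_eq_dim[OF B2(2,4,3)])
  have c3: "card B3 = CARD('n)" using vec.basis_card_eq_dim[OF B3(2,4,3)] by (simp only: vec_dim_card)
  have \<rho>n: "\<rho> - s \<le> CARD('n)" using dim by linarith
  have cI1: "card {i :: 'n. \<rho> - s \<le> idx i} = card B1"
  proof -
    have "{\<rho> - s..<CARD('n)} \<subseteq> {..<CARD('n)}" by auto
    from card_idx_vimage[OF this]
    have "card {i :: 'n. \<rho> - s \<le> idx i} = CARD('n) - (\<rho> - s)" by (simp add: idx_less)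
    then show ?thesis using B1(4) dim by linarith
  qed
  have cI2: "card {i :: 'n. s \<le> idx i \<and> idx i < \<rho> - s} = card (B2 - B1)"
  proof -
    have "{i :: 'n. s \<le> idx i \<and> idx i < \<rho> - s} = {i. idx i \<in> {s..<\<rho> - s}}" by auto
    then have "card {i :: 'n. s \<le> idx i \<and> idx i < \<rho> - s} = \<rho> - s - s"
      using card_idx_vimage[of "{s..<\<rho> - s}", where ?'n = 'n] \<rho>n by (simp add: subset_iff)
    then show ?thesis using card_Diff_subset[OF finB(2) B2(1)] c2 B1(4) dim by linarith
  qed
  have cI3: "card {i :: 'n. idx i < s} = card (B3 - B2)"
    using card_idx_less[of s, where ?'n = 'n] card_Diff_subset[OF finB(1) B3(1)] c2 c3 dim by linarith
  obtain e1 where e1: "bij_betw e1 {i :: 'n. \<rho> - s \<le> idx i} B1"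
    using finite_same_card_bij[OF _ finB(2) cI1] by auto
  obtain e2 where e2: "bij_betw e2 {i :: 'n. s \<le> idx i \<and> idx i < \<rho> - s} (B2 - B1)"
    using finite_same_card_bij[OF _ _ cI2] finB by auto
  obtain e3 where e3: "bij_betw e3 {i :: 'n. idx i < s} (B3 - B2)"
    using finite_same_card_bij[OF _ _ cI3] fin by auto
  define e where "e i = (if \<rho> - s \<le> idx i then e1 i else if s \<le> idx i then e2 i else e3 i)" for i :: 'n
  have eW: "e i \<in> B1" if "\<rho> - s \<le> idx i" for i
    using bij_betwE[OF e1] that by (auto simp: e_def)
  have eU: "e i \<in> B2" if "s \<le> idx i" for i
  proof (cases "\<rho> - s \<le> idx i")
    case True then show ?thesis using eW B2(1) by blast
  next
    case False
    then show ?thesis using bij_betwE[OF e2] that by (auto simp: e_def)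
  qed
  have "B3 \<subseteq> range e"
  proof
    fix b assume b: "b \<in> B3"
    consider "b \<in> B1" | "b \<in> B2 - B1" | "b \<in> B3 - B2" using b by blast
    then show "b \<in> range e"
    proof cases
      case 1
      then have "b \<in> e1 ` {i. \<rho> - s \<le> idx i}" using e1 by (simp only: bij_betw_def)
      then obtain i where "b = e1 i" "\<rho> - s \<le> idx i" by blast
      then have "b = e i" by (simp add: e_def)
      then show ?thesis by blast
    next
      case 2
      then have "b \<in> e2 ` {i. s \<le> idx i \<and> idx i < \<rho> - s}" using e2 by (simp only: bij_betw_def)
      then obtain i where "b = e2 i" "s \<le> idx i" "idx i < \<rho> - s" by blast
      then have "b = e i" by (simp add: e_def)
      then show ?thesis by blast
    next
      case 3
      then have "b \<in> e3 ` {i. idx i < s}" using e3 by (simp only: bij_betw_def)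
      then obtain i where "b = e3 i" "idx i < s" by blast
      moreover from this have "\<not> \<rho> - s \<le> idx i" "\<not> s \<le> idx i" using dim(3) by linarith+
      ultimately have "b = e i" by (simp add: e_def)
      then show ?thesis by blast
    qed
  qed
  define P where "P = (\<chi> i j. e i $ j)"
  have P: "(P *v y) $ i = e i \<odot> y" for y i
    by (simp add: P_def matrix_vector_mult_def scalar_product_def)
  have inv: "invertible P"
    unfolding invertible_det_nz det_nonzero_iff_inj
  proof (intro allI impI)
    fix v assume v: "P *v v = 0"
    have ev: "e i \<odot> v = 0" for i using P[of v i] v by simp
    have "v \<in> perp B3"
    proof -
      have "b \<odot> v = 0" if "b \<in> B3" for b
      proof -
        have "b \<in> range e" using \<open>B3 \<subseteq> range e\<close> that by (rule subsetD)
        then show ?thesis using ev by (elim rangeE) simp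
      qed
      then show ?thesis by (simp add: perp_def)
    qed
    then have vU: "v \<in> perp UNIV" using perp_span[of B3] B3(4) by (simp add: top.extremum_unique)
    have "v $ i = 0" for i
    proof -
      have "axis i 1 \<odot> v = 0" using vU by (simp add: perp_def del: dot_simps)
      then show ?thesis by simp
    qed
    then show "v = 0" by (simp add: Finite_Cartesian_Product.vec_eq_iff)
  qed
  have PMP: "(P ** M ** transpose P) $ i $ j = e i \<odot> (M *v e j)" for M i j
    unfolding congruence_nth
    by (simp add: P_def scalar_product_def matrix_vector_mult_def sum_distrib_left mult.assoc)
  have "congr P L \<subseteq> coord_space (cweights TYPE('n) \<rho> s)"
  proof
    fix N assume "N \<in> congr P L"
    then obtain M where M: "M \<in> L" "N = P ** M ** transpose P" unfolding congr_def by blast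
    have symN: "transpose N = N" unfolding M(2) by (rule transpose_congruence[OF sym[OF M(1)]])
    have z: "N $ i $ j = 0" if "\<rho> - s \<le> idx i" "s \<le> idx j" for i j
      unfolding M(2) PMP using eW[OF that(1)] eU[OF that(2)] B1(1) B2(2) by (intro zero[OF M(1)]) auto
    have "wt i j \<in> cweights TYPE('n) \<rho> s" if ne: "N $ i $ j \<noteq> 0" for i j
    proof -
      have "N $ j $ i \<noteq> 0" using ne symN by (simp add: transpose_eq_iff)
      then show ?thesis unfolding wt_in_cweights using z[of i j] z[of j i] ne by force
    qed
    then show "N \<in> coord_space (cweights TYPE('n) \<rho> s)" using symN by (simp add: coord_space_def)
  qed
  moreover have "congr (mat 1) (coord_space (cweights TYPE('n) \<rho> s))
      = (coord_space (cweights TYPE('n) \<rho> s) :: ('a^'n^'n) set)"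
    by (simp add: congr_def transpose_mat)
  ultimately have "compressible \<rho> s (congr P L)"
    unfolding compressible_def
    by (intro exI[of _ "mat 1"]) (simp add: invertible_det_nz)
  then show ?thesis by (rule compressible_congr[OF inv])
qed

lemma shifted_le:
  fixes i j i' j' :: "'n::finite"
  assumes G: "shifted TYPE('n) G" and ij: "wt i j \<in> G" and le: "idx i' \<le> idx i" "idx j' \<le> idx j"
  shows "wt i' j' \<in> G"
proof -
  have step: "wt a' b \<in> G" if "wt a b \<in> G" "idx a' \<le> idx a" for a a' b :: 'n
    using G that unfolding shifted_def by (cases "a = a'") (auto simp: le_less)
  have "wt i' j \<in> G" by (rule step[OF ij le(1)])
  then have "wt j i' \<in> G" by (simp only: wt_commute)
  then have "wt j' i' \<in> G" by (rule step[OF _ le(2)])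
  then show ?thesis by (simp only: wt_commute)
qed

text \<open>A missing weight at the corner \<open>(s, \<rho> - s)\<close> excludes all positions
  above it, and these form the complement of the compression pattern.\<close>

lemma shifted_subset_cweights:
  assumes G: "shifted TYPE('n::finite) G" "G \<subseteq> weights TYPE('n)"
    and s: "2 * s \<le> \<rho>" "\<rho> < CARD('n)" and notin: "wt (elt s :: 'n) (elt (\<rho> - s)) \<notin> G"
  shows "G \<subseteq> cweights TYPE('n) \<rho> s"
proof
  fix \<theta> assume \<theta>: "\<theta> \<in> G"
  then obtain i j :: 'n where ij: "\<theta> = wt i j" using G(2) unfolding weights_def by auto
  have no: "\<not> (s \<le> idx a \<and> \<rho> - s \<le> idx b)" if "wt a b \<in> G" for a b :: 'n
    using shifted_le[OF G(1) that, of "elt s" "elt (\<rho> - s)"] notin s by auto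
  have "wt j i \<in> G" "wt i j \<in> G" using \<theta> ij wt_commute[of i j] by auto
  then show "\<theta> \<in> cweights TYPE('n) \<rho> s"
    unfolding ij wt_in_cweights using no[of i j] no[of j i] by auto
qed

text \<open>Up to nonzero factors the block is the permutation matrix of an involution; this covers
  antidiagonal and diagonal test blocks alike.\<close>

lemma det_principal_block_involution:
  fixes M :: "'a::field^'n^'n"
  assumes \<sigma>: "\<And>i. i \<in> I \<Longrightarrow> \<sigma> i \<in> I" "\<And>i. i \<in> I \<Longrightarrow> \<sigma> (\<sigma> i) = i"
    and M: "\<And>i j. i \<in> I \<Longrightarrow> j \<in> I \<Longrightarrow> M $ i $ j = (if j = \<sigma> i then c i else 0)" "\<And>i. i \<in> I \<Longrightarrow> c i \<noteq> 0"
  shows "det (principal_block I M) \<noteq> 0"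
  unfolding det_nonzero_iff_inj
proof (intro allI impI)
  fix v assume v: "principal_block I M *v v = 0"
  have vi: "(if i \<in> I then \<Sum>j\<in>I. M $ i $ j * v $ j else v $ i) = 0" for i
    using arg_cong[OF v, of "\<lambda>v. v $ i"] unfolding principal_block_mult by simp
  have "v $ i = 0" for i
  proof (cases "i \<in> I")
    case True
    have k: "\<sigma> i \<in> I" "\<sigma> (\<sigma> i) = i" using \<sigma> True by auto
    have "(\<Sum>j\<in>I. M $ \<sigma> i $ j * v $ j) = (\<Sum>j\<in>I. if j = i then c (\<sigma> i) * v $ j else 0)"
      using M(1)[OF k(1)] k(2) by (intro sum.cong) auto
    also have "\<dots> = c (\<sigma> i) * v $ i" using True by simp
    finally show ?thesis using vi[of "\<sigma> i"] k M(2) by simp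
  qed (use vi[of i] in simp)
  then show "v = 0" by (simp add: Finite_Cartesian_Product.vec_eq_iff)
qed

lemma rank_ge_card_if_block_regular:
  fixes Y :: "'a::field^'n^'n"
  assumes "det (principal_block I Y) \<noteq> 0"
  shows "card I \<le> rank Y"
  using dim_range_vanishing_on_block[OF assms] by simp

text \<open>If all antidiagonal weights were present, the antidiagonal matrix of size
  \<open>\<rho> + 1\<close> would belong to the space and have rank
  \<open>\<rho> + 1\<close>.\<close>

lemma shifted_bounded_rank:
  fixes G :: "nat set"
  assumes G: "shifted TYPE('n::finite) G" and \<rho>: "\<rho> < CARD('n)"
    and rk: "\<And>M :: 'a::field^'n^'n. M \<in> coord_space G \<Longrightarrow> rank M \<le> \<rho>"
  shows "\<exists>s. 2 * s \<le> \<rho> \<and> wt (elt s :: 'n) (elt (\<rho> - s)) \<notin> G"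
proof (rule ccontr)
  assume none: "\<not> ?thesis"
  have half: "wt (elt s :: 'n) (elt (\<rho> - s)) \<in> G" if s: "2 * s \<le> \<rho>" for s
    using none s by blast
  have inG: "wt (elt s :: 'n) (elt (\<rho> - s)) \<in> G" if "s \<le> \<rho>" for s
  proof (cases "2 * s \<le> \<rho>")
    case False
    then have "2 * (\<rho> - s) \<le> \<rho>" "\<rho> - (\<rho> - s) = s" using that by auto
    then have "wt (elt (\<rho> - s) :: 'n) (elt s) \<in> G" using half[of "\<rho> - s"] by simp
    then show ?thesis by (simp only: wt_commute)
  qed (rule half)
  define M :: "'a^'n^'n" where "M = (\<chi> i j. if idx i + idx j = \<rho> then 1 else 0)"
  have "M \<in> coord_space G"
    unfolding coord_space_def mem_Collect_eq transpose_eq_iff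
  proof (intro conjI allI impI)
    fix i j assume "M $ i $ j \<noteq> 0"
    then have "idx i + idx j = \<rho>" by (simp add: M_def split: if_splits)
    then have ij: "idx i \<le> \<rho>" "\<rho> - idx i = idx j" by auto
    from inG[OF ij(1)] show "wt i j \<in> G" unfolding ij(2) elt_idx .
  qed (simp add: M_def add.commute)
  then have "rank M \<le> \<rho>" by (rule rk)
  moreover have "det (principal_block {i. idx i < \<rho> + 1} M) \<noteq> 0"
  proof (rule det_principal_block_involution[where \<sigma> = "\<lambda>i. elt (\<rho> - idx i)" and c = "\<lambda>_. 1"])
    fix i j :: 'n assume ij: "i \<in> {i. idx i < \<rho> + 1}" "j \<in> {i. idx i < \<rho> + 1}"
    have "j = elt (\<rho> - idx i) \<longleftrightarrow> idx j = \<rho> - idx i"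
      using \<rho> by (intro eq_elt_iff) simp
    then show "M $ i $ j = (if j = elt (\<rho> - idx i) then 1 else 0)" using ij by (auto simp: M_def)
  qed (use \<rho> in auto)
  then have "card {i :: 'n. idx i < \<rho> + 1} \<le> rank M" by (rule rank_ge_card_if_block_regular)
  ultimately show False using card_idx_less[of "\<rho> + 1", where ?'n = 'n] \<rho> by simp
qed

section \<open>Test matrices\<close>

definition pencil_A :: "nat \<Rightarrow> 'a::field^'n^'n" where
  "pencil_A \<rho> = (\<chi> i j. if idx i + idx j + 1 = \<rho> then 1 else 0)"

text \<open>With the first two summands, \<open>t A - B\<close> is a companion pencil of
  \<open>t ^ \<rho> - 1\<close> with its rows reversed: row \<open>i > 0\<close> says that
  consecutive coordinates have ratio \<open>t\<close>. If the characteristic divides \<rho>, that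
  polynomial is not square-free, and the third summand adds a linear term to it.\<close>

definition pencil_B :: "nat \<Rightarrow> 'a::field^'n^'n" where
  "pencil_B \<rho> = (\<chi> i j. (if idx i < \<rho> \<and> idx j < \<rho> \<and> idx i + idx j = \<rho> then 1 else 0)
     + (if idx i = 0 \<and> idx j = 0 then 1 else 0)
     + (if idx i + idx j = 1 \<and> of_nat \<rho> = (0::'a) then 1 else 0))"

text \<open>With \<open>a = 1\<close> if the characteristic divides \<open>\<rho>\<close> and \<open>a = 0\<close> otherwise, the determinant of the
  test pencil is a multiple of \<open>t\<^sup>\<rho> - 2 a t - 1\<close>, whose derivative is \<open>- 2\<close> or \<open>\<rho> t\<^sup>\<rho>\<^sup>-\<^sup>1\<close>.\<close>

definition test_poly :: "nat \<Rightarrow> 'a::field poly" where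
  "test_poly \<rho> = monom 1 \<rho> - [:1, if of_nat \<rho> = (0::'a) then 2 else 0:]"

lemma sum_over_idx:
  assumes "m \<le> CARD('n::finite)"
  shows "(\<Sum>j\<in>{j :: 'n. idx j < m}. f (idx j)) = (\<Sum>k<m. f k)"
  by (rule sum.reindex_bij_witness[of _ elt idx]) (use assms in auto)

lemma pencil_poly_test:
  assumes \<rho>: "2 \<le> \<rho>" "\<rho> \<le> CARD('n::finite)" and two: "(2::'a) \<noteq> 0"
  shows "\<exists>c. c \<noteq> 0 \<and> pencil_poly {i :: 'n. idx i < \<rho>} (pencil_A \<rho>) (pencil_B \<rho>)
    = Polynomial.smult c (test_poly \<rho> :: 'a::alg_closed_field poly)"
proof -
  let ?I = "{i :: 'n. idx i < \<rho>}"
  define a :: 'a where "a = (if of_nat \<rho> = (0::'a) then 1 else 0)"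
  \<comment> \<open>For \<open>\<rho> = 2\<close> a nonzero \<open>a\<close> would mean
    characteristic 2. Hence the correction in the last coordinate of \<open>y t\<close> below never
    falls on coordinate 1.\<close>
  have a2: "a = 0 \<or> 3 \<le> \<rho>" using two \<rho>(1) by (cases "\<rho> = 2") (auto simp: a_def)
  define z :: 'n where "z = elt 0"
  have z: "idx z = 0" using \<rho> by (simp add: z_def)
  have zI: "z \<in> ?I" using z \<rho> by simp
  define P :: "'a \<Rightarrow> 'a^'n^'n" where "P t = principal_block ?I (mscale t (pencil_A \<rho>) - pencil_B \<rho>)" for t
  have ent: "(mscale t (pencil_A \<rho>) - pencil_B \<rho>) $ i $ j =
      (if idx i + idx j + 1 = \<rho> then t else 0) - (if idx i + idx j = \<rho> then 1 else 0)
       - (if idx i = 0 \<and> idx j = 0 then 1 else 0) - (if idx i + idx j = 1 then a else 0)"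
    if "i \<in> ?I" "j \<in> ?I" for t and i j :: 'n
    using that by (auto simp: pencil_A_def pencil_B_def a_def)
  \<comment> \<open>The vector of powers of \<open>t\<close>, corrected in its last coordinate for
    the extra entries. All rows of \<open>P t\<close> kill it except row 0, where the test
    polynomial appears.\<close>
  define y where "y t = (\<chi> j :: 'n. if idx j < \<rho> then t ^ idx j - (if idx j = \<rho> - 1 then a else 0) else 0)" for t
  have rowsum: "(\<Sum>j\<in>?I. (mscale t (pencil_A \<rho>) - pencil_B \<rho>) $ i $ j * F (idx j)) =
      t * F (\<rho> - 1 - idx i) - (if 0 < idx i then F (\<rho> - idx i) else 0)
      - (if idx i = 0 then F 0 else 0) - (if idx i = 0 then a * F 1 else if idx i = 1 then a * F 0 else 0)"
    if i: "i \<in> ?I" for t and i :: 'n and F :: "nat \<Rightarrow> 'a"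
  proof -
    have i_lt: "idx i < \<rho>" using i by simp
    have "(\<Sum>j\<in>?I. (mscale t (pencil_A \<rho>) - pencil_B \<rho>) $ i $ j * F (idx j)) =
      (\<Sum>j\<in>?I. ((if idx i + idx j + 1 = \<rho> then t else 0) - (if idx i + idx j = \<rho> then 1 else 0)
       - (if idx i = 0 \<and> idx j = 0 then 1 else 0) - (if idx i + idx j = 1 then a else 0)) * F (idx j))"
      using i by (intro sum.cong refl arg_cong2[where f = "(*)"] ent) auto
    also have "\<dots> = (\<Sum>k<\<rho>. ((if idx i + k + 1 = \<rho> then t else 0) - (if idx i + k = \<rho> then 1 else 0)
       - (if idx i = 0 \<and> k = 0 then 1 else 0) - (if idx i + k = 1 then a else 0)) * F k)"
      using sum_over_idx[OF \<rho>(2), of "\<lambda>k. ((if idx i + k + 1 = \<rho> then t else 0) - (if idx i + k = \<rho> then 1 else 0)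
       - (if idx i = 0 \<and> k = 0 then 1 else 0) - (if idx i + k = 1 then a else 0)) * F k"] .
    also have "\<dots> = (\<Sum>k<\<rho>. (if k = \<rho> - 1 - idx i then t * F k else 0)) - (\<Sum>k<\<rho>. if k = \<rho> - idx i then F k else 0)
       - (\<Sum>k<\<rho>. if k = 0 then (if idx i = 0 then F k else 0) else 0)
       - (\<Sum>k<\<rho>. if k = 1 - idx i then (if idx i \<le> 1 then a * F k else 0) else 0)"
      unfolding sum_subtractf[symmetric]
    proof (intro sum.cong refl)
      fix k assume "k \<in> {..<\<rho>}"
      then have k: "idx i + k + 1 = \<rho> \<longleftrightarrow> k = \<rho> - 1 - idx i" "idx i + k = \<rho> \<longleftrightarrow> k = \<rho> - idx i"
        "idx i + k = 1 \<longleftrightarrow> k = 1 - idx i \<and> idx i \<le> 1" using i_lt by auto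
      show "((if idx i + k + 1 = \<rho> then t else 0) - (if idx i + k = \<rho> then 1 else 0)
         - (if idx i = 0 \<and> k = 0 then 1 else 0) - (if idx i + k = 1 then a else 0)) * F k
        = (if k = \<rho> - 1 - idx i then t * F k else 0) - (if k = \<rho> - idx i then F k else 0)
         - (if k = 0 then (if idx i = 0 then F k else 0) else 0)
         - (if k = 1 - idx i then (if idx i \<le> 1 then a * F k else 0) else 0)"
      proof -
        have c1: "(if idx i + k + 1 = \<rho> then t else 0) * F k = (if k = \<rho> - 1 - idx i then t * F k else 0)"
          using k(1) by simp
        have c2: "(if idx i + k = \<rho> then 1 else 0) * F k = (if k = \<rho> - idx i then F k else 0)"
          using k(2) by simp
        have c3: "(if idx i = 0 \<and> k = 0 then 1 else 0) * F k = (if k = 0 then (if idx i = 0 then F k else 0) else 0)"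
          by simp
        have c4: "(if idx i + k = 1 then a else 0) * F k
            = (if k = 1 - idx i then (if idx i \<le> 1 then a * F k else 0) else 0)"
          using k(3) by simp
        show ?thesis unfolding left_diff_distrib c1 c2 c3 c4 ..
      qed
    qed
    also have "\<dots> = t * F (\<rho> - 1 - idx i) - (if 0 < idx i then F (\<rho> - idx i) else 0)
      - (if idx i = 0 then F 0 else 0) - (if idx i = 0 then a * F 1 else if idx i = 1 then a * F 0 else 0)"
      using i_lt \<rho>(1) by auto
    finally show ?thesis .
  qed
  have Py: "P t *v y t = (\<chi> i. if i = z then poly (test_poly \<rho>) t else 0)" for t
  proof -
    have "(P t *v y t) $ i = (if i = z then poly (test_poly \<rho>) t else 0)" for i
    proof (cases "i \<in> ?I")
      case False
      then show ?thesis using zI unfolding P_def principal_block_mult by (auto simp: y_def)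
    next
      case True
      define F where "F k = t ^ k - (if k = \<rho> - 1 then a else 0)" for k
      have "(P t *v y t) $ i = (\<Sum>j\<in>?I. (mscale t (pencil_A \<rho>) - pencil_B \<rho>) $ i $ j * F (idx j))"
        unfolding P_def principal_block_mult using True by (auto simp: y_def F_def intro!: sum.cong)
      also note rowsum[OF True]
      also have "t * F (\<rho> - 1 - idx i) - (if 0 < idx i then F (\<rho> - idx i) else 0)
          - (if idx i = 0 then F 0 else 0) - (if idx i = 0 then a * F 1 else if idx i = 1 then a * F 0 else 0)
          = (if idx i = 0 then poly (test_poly \<rho>) t else 0)"
      proof -
        consider "idx i = 0" | "idx i = 1" | "2 \<le> idx i" by linarith
        then show ?thesis
        proof cases
          case 1
          have "t * t ^ (\<rho> - 1) = t ^ \<rho>" using \<rho> by (cases \<rho>) auto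
          moreover have "poly (test_poly \<rho>) t = t ^ \<rho> - 1 - 2 * a * t"
            by (simp add: test_poly_def poly_monom a_def)
          moreover have "a * F 1 = a * t" using a2 by (auto simp: F_def)
          moreover have "F 0 = 1" using \<rho> by (simp add: F_def)
          ultimately show ?thesis using 1 by (simp add: F_def algebra_simps)
        next
          case 2
          have "t * t ^ (\<rho> - 2) = t ^ (\<rho> - 1)" using \<rho> by (metis Suc_diff_Suc Suc_1 less_eq_Suc_le power_Suc diff_Suc_1 numeral_2_eq_2)
          then show ?thesis using 2 \<rho> by (auto simp: F_def numeral_2_eq_2)
        next
          case 3
          then have "\<rho> - idx i = Suc (\<rho> - 1 - idx i)" "\<rho> - idx i \<noteq> \<rho> - 1" "\<rho> - 1 - idx i \<noteq> \<rho> - 1"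
            using True by auto
          then show ?thesis using 3 by (simp add: F_def)
        qed
      qed
      finally show ?thesis using z by (metis idx_eq_iff)
    qed
    then show ?thesis by (simp add: Finite_Cartesian_Product.vec_eq_iff)
  qed
  \<comment> \<open>Replacing column \<open>z\<close> of \<open>P t\<close> by
    \<open>P t *v y t\<close> keeps the determinant, as \<open>y t\<close> is 1 at \<open>z\<close>,
    and the test polynomial factors out. The cofactor matrix \<open>Q t\<close> is regular for every
    \<open>t\<close>, so its determinant is a polynomial without roots, a constant.\<close>
  define Q where "Q t = (\<chi> i j. if j = z then (if i = z then 1 else 0) else P t $ i $ j)" for t
  have detQ: "det (Q t) \<noteq> 0" for t
    unfolding det_nonzero_iff_inj
  proof (intro allI impI)
    fix v assume v: "Q t *v v = 0"
    have Qv: "(Q t *v v) $ i = (P t *v (\<chi> j. if j = z then 0 else v $ j)) $ i + (if i = z then v $ z else 0)" for i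
    proof -
      have "(Q t *v v) $ i = (\<Sum>j\<in>UNIV. P t $ i $ j * (if j = z then 0 else v $ j) + (if j = z then (if i = z then v $ j else 0) else 0))"
        unfolding matrix_vector_mult_def Q_def by (auto intro!: sum.cong)
      then show ?thesis by (simp add: sum.distrib matrix_vector_mult_def)
    qed
    define F where "F k = (if k = 0 then 0 else v $ elt k)" for k
    have F: "(if j = z then 0 else v $ j) = F (idx j)" for j
      using z by (auto simp: F_def) (metis elt_idx)
    have out: "v $ i = 0" if "i \<notin> ?I" for i
    proof -
      have "i \<noteq> z" using that zI by auto
      then show ?thesis using Qv[of i] v that unfolding P_def principal_block_mult by simp
    qed
    have row: "(\<Sum>j\<in>?I. (mscale t (pencil_A \<rho>) - pencil_B \<rho>) $ i $ j * F (idx j)) + (if i = z then v $ z else 0) = 0"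
      if "i \<in> ?I" for i
      using Qv[of i] v that unfolding P_def principal_block_mult F by simp
    have Fz: "F k = 0" if "k < \<rho>" for k
      using that
    proof (induction k)
      case (Suc k)
      define i :: 'n where "i = elt (\<rho> - 1 - k)"
      have i: "idx i = \<rho> - 1 - k" using \<rho> Suc(2) by (simp add: i_def)
      have iI: "i \<in> ?I" "i \<noteq> z" using i Suc(2) z by auto
      have "\<rho> - 1 - idx i = k" "\<rho> - idx i = Suc k" "0 < idx i" using i Suc(2) by auto
      then have "t * F k - F (Suc k) - (if idx i = 1 then a * F 0 else 0) = 0"
        using row[OF iI(1)] iI(2) unfolding rowsum[OF iI(1)] by simp
      moreover have "F k = 0" "F 0 = 0" using Suc by (auto simp: F_def)
      ultimately show ?case by (auto split: if_splits)
    qed (simp add: F_def)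
    have "v $ z = 0"
      using row[OF zI] Fz \<rho> unfolding rowsum[OF zI] by (auto simp: z)
    moreover have "v $ j = 0" if "j \<noteq> z" for j
      using F[of j] Fz[of "idx j"] out[of j] that by (cases "j \<in> ?I") auto
    ultimately show "v = 0" by (metis (mono_tags, lifting) Finite_Cartesian_Product.vec_eq_iff zero_index)
  qed
  have detP: "det (P t) = poly (test_poly \<rho>) t * det (Q t)" for t
  proof -
    have "y t $ z = 1" using z \<rho> by (simp add: y_def)
    then have "det (P t) = det (\<chi> i j. if j = z then (P t *v y t) $ i else P t $ i $ j)"
      using cramer_lemma[where k = z and A = "P t" and x = "y t"] by simp
    also have "\<dots> = det (transpose (\<chi> i j. if j = z then (P t *v y t) $ i else P t $ i $ j))" by simp
    also have "transpose (\<chi> i j. if j = z then (P t *v y t) $ i else P t $ i $ j)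
      = (\<chi> i. if i = z then poly (test_poly \<rho>) t *s axis z 1 else row i (transpose (Q t)))"
      unfolding Py
      by (auto simp: Finite_Cartesian_Product.vec_eq_iff Finite_Cartesian_Product.transpose_def
          Finite_Cartesian_Product.row_def Q_def axis_def)
    also have "det \<dots> = poly (test_poly \<rho>) t * det (\<chi> i. if i = z then axis z 1 else row i (transpose (Q t)))"
      by (rule det_row_mul)
    also have "(\<chi> i. if i = z then axis z 1 else row i (transpose (Q t))) = transpose (Q t)"
      by (auto simp: Finite_Cartesian_Product.vec_eq_iff Finite_Cartesian_Product.transpose_def
          Finite_Cartesian_Product.row_def Q_def axis_def)
    finally show ?thesis by simp
  qed
  define Qp where "Qp = (\<chi> i j. if j = z then (if i = z then 1 else 0)
     else principal_block ?I (pencil (pencil_A \<rho>) (pencil_B \<rho> :: 'a^'n^'n)) $ i $ j)"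
  have ev: "(\<chi> i j. poly (principal_block ?I (pencil (pencil_A \<rho>) (pencil_B \<rho>)) $ i $ j) t) = P t" for t
    by (simp add: P_def Finite_Cartesian_Product.vec_eq_iff principal_block_def pencil_def)
  have evQ: "poly (det Qp) t = det (Q t)" for t
    unfolding poly_det
    by (intro arg_cong[where f = det])
      (use ev[of t] in \<open>auto simp: Finite_Cartesian_Product.vec_eq_iff Qp_def Q_def\<close>)
  have "degree (det Qp) = 0"
    using alg_closed_imp_poly_has_root[of "det Qp"] detQ unfolding evQ by blast
  then obtain c where c: "det Qp = [:c:]" by (metis degree_eq_zeroE)
  have "c \<noteq> 0" using detQ[of 0] unfolding evQ[symmetric] c by simp
  moreover have "pencil_poly ?I (pencil_A \<rho>) (pencil_B \<rho>) = Polynomial.smult c (test_poly \<rho>)"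
  proof (rule poly_eq_if_eq_generically[of 1])
    fix t
    have "poly (pencil_poly ?I (pencil_A \<rho>) (pencil_B \<rho>)) t = det (P t)"
      unfolding pencil_poly_def poly_det ev ..
    also have "\<dots> = poly (test_poly \<rho>) t * c" unfolding detP evQ[symmetric] c by simp
    finally show "poly (pencil_poly ?I (pencil_A \<rho>) (pencil_B \<rho>)) t = poly (Polynomial.smult c (test_poly \<rho>)) t"
      by simp
  qed simp
  ultimately show ?thesis by blast
qed

lemma pencil_disc_test:
  assumes \<rho>: "2 \<le> \<rho>" "\<rho> \<le> CARD('n::finite)" and two: "(2::'a::alg_closed_field) \<noteq> 0"
  shows "pencil_disc {i :: 'n. idx i < \<rho>}
    (entries (\<lambda>l. if l = 0 then pencil_A \<rho> else if l = 1 then pencil_B \<rho> else (0 :: 'a^'n^'n))) \<noteq> 0"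
proof -
  let ?I = "{i :: 'n. idx i < \<rho>}"
  let ?q = "test_poly \<rho> :: 'a poly"
  obtain c where c: "c \<noteq> 0" "pencil_poly ?I (pencil_A \<rho>) (pencil_B \<rho>) = Polynomial.smult c ?q"
    using pencil_poly_test[OF \<rho> two] by blast
  have cardI: "card ?I = \<rho>" using card_idx_less[OF \<rho>(2)] .
  have dq: "degree ?q = \<rho>"
  proof -
    have "degree [:1 :: 'a, if of_nat \<rho> = (0::'a) then 2 else 0:] < \<rho>" using \<rho>(1) by (auto simp: le_less_trans)
    then have "degree (monom 1 \<rho> + - [:1 :: 'a, if of_nat \<rho> = (0::'a) then 2 else 0:]) = degree (monom (1::'a) \<rho>)"
      by (intro degree_add_eq_left) (simp only: degree_minus degree_monom_eq[OF one_neq_zero])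
    then show ?thesis
      unfolding test_poly_def diff_conv_add_uminus by (simp only: degree_monom_eq[OF one_neq_zero])
  qed
  have "\<exists>\<alpha> \<beta>. \<alpha> * ?q + \<beta> * pderiv ?q = 1"
  proof (cases "of_nat \<rho> = (0::'a)")
    case True
    have "pderiv ?q = [:- 2:]"
      using True by (simp add: test_poly_def pderiv_diff pderiv_monom pderiv_pCons)
    then have "0 * ?q + [:- (1 / 2):] * pderiv ?q = 1" using two by (simp add: one_pCons)
    then show ?thesis by blast
  next
    case False
    have d: "pderiv ?q = monom (of_nat \<rho>) (\<rho> - 1)"
      using False by (simp add: test_poly_def pderiv_diff pderiv_monom pderiv_pCons)
    have "[:0, 1 / of_nat \<rho>:] * pderiv ?q = monom 1 \<rho>"
    proof -
      have "[:0, 1 / of_nat \<rho>:] = monom (1 / of_nat \<rho> :: 'a) 1" by (simp add: monom_Suc monom_0)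
      then show ?thesis unfolding d using False \<rho> by (simp add: mult_monom)
    qed
    then have "[:- 1:] * ?q + [:0, 1 / of_nat \<rho>:] * pderiv ?q = 1"
      using False by (simp add: test_poly_def one_pCons)
    then show ?thesis by blast
  qed
  then obtain \<alpha> \<beta> where ab: "\<alpha> * ?q + \<beta> * pderiv ?q = 1" by blast
  have "Determinant.det (sylvester \<rho> (Polynomial.smult c ?q)) \<noteq> 0"
  proof (rule det_sylvester_nonzero)
    show "degree (Polynomial.smult c ?q) = \<rho>" using c(1) dq by simp
    show "0 < \<rho>" using \<rho> by simp
    show "Polynomial.smult (inverse c) \<alpha> * Polynomial.smult c ?q
        + Polynomial.smult (inverse c) \<beta> * pderiv (Polynomial.smult c ?q) = 1"
      using ab c(1) by (simp add: pderiv_smult)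
  qed
  moreover have "det (principal_block ?I (pencil_A \<rho> :: 'a^'n^'n)) \<noteq> 0"
  proof (rule det_principal_block_involution[where \<sigma> = "\<lambda>i. elt (\<rho> - 1 - idx i)" and c = "\<lambda>_. 1"])
    fix i j :: 'n assume ij: "i \<in> ?I" "j \<in> ?I"
    have "j = elt (\<rho> - 1 - idx i) \<longleftrightarrow> idx j = \<rho> - 1 - idx i"
      using \<rho> by (intro eq_elt_iff) simp
    then show "(pencil_A \<rho> :: 'a^'n^'n) $ i $ j = (if j = elt (\<rho> - 1 - idx i) then 1 else 0)"
      using ij by (auto simp: pencil_A_def)
  qed (use \<rho> in auto)
  ultimately show ?thesis
    by (simp add: pencil_disc_def cardI c(2))
qed

text \<open>The first matrix has no nonzero entry in a row of \<open>I\<close> and a column of the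
  middle range \<open>D\<close>, so each lifted vector is a multiple of a unit vector. The symmetric
  units of the pairs in \<open>S \<times> D\<close> then make the second block diagonal.\<close>

lemma compression_disc_test:
  fixes s d :: nat
  assumes n: "2 * s + d \<le> CARD('n::finite)"
  defines "S \<equiv> {i :: 'n. idx i < s}" and "D \<equiv> {i :: 'n. s \<le> idx i \<and> idx i < s + d}"
    and "I \<equiv> {i :: 'n. idx i < s \<or> (s + d \<le> idx i \<and> idx i < 2 * s + d)}"
  shows "compression_disc (\<lambda>p. prod_encode (idx (fst p), idx (snd p))) S D I
    (entries (\<lambda>l. case l of 0 \<Rightarrow> (\<chi> i j. if idx i + idx j + 1 = 2 * s + d \<and> (idx i < s \<or> idx j < s) then 1 else 0)
       | Suc m \<Rightarrow> (case prod_decode m of (a, b) \<Rightarrow>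
           if a < s \<and> s \<le> b \<and> b < s + d then symm_unit (wt (elt a :: 'n) (elt b)) else (0 :: 'a::field^'n^'n)))) \<noteq> 0"
proof -
  define X :: "'a^'n^'n" where "X = (\<chi> i j. if idx i + idx j + 1 = 2 * s + d \<and> (idx i < s \<or> idx j < s) then 1 else 0)"
  have detX: "det (principal_block I X) \<noteq> 0"
  proof (rule det_principal_block_involution[where \<sigma> = "\<lambda>i. elt (2 * s + d - 1 - idx i)" and c = "\<lambda>_. 1"])
    have e: "idx (elt (2 * s + d - 1 - idx i) :: 'n) = 2 * s + d - 1 - idx i" if "i \<in> I" for i :: 'n
      using that n by (intro idx_elt) (auto simp: I_def)
    show "elt (2 * s + d - 1 - idx i) \<in> I" if "i \<in> I" for i
      using e[OF that] that by (auto simp: I_def)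
    show "elt (2 * s + d - 1 - idx (elt (2 * s + d - 1 - idx i) :: 'n)) = i" if "i \<in> I" for i
    proof -
      have "2 * s + d - 1 - (2 * s + d - 1 - idx i) = idx i" using that by (auto simp: I_def)
      then show ?thesis unfolding e[OF that] by simp
    qed
    show "X $ i $ j = (if j = elt (2 * s + d - 1 - idx i) then 1 else 0)" if "i \<in> I" "j \<in> I" for i j
    proof -
      have "j = elt (2 * s + d - 1 - idx i) \<longleftrightarrow> idx j = 2 * s + d - 1 - idx i"
        using that(1) n by (intro eq_elt_iff) (auto simp: I_def)
      moreover have "idx i + idx j + 1 = 2 * s + d \<and> (idx i < s \<or> idx j < s) \<longleftrightarrow> idx j = 2 * s + d - 1 - idx i"
        using that unfolding I_def mem_Collect_eq by linarith
      ultimately show ?thesis by (simp add: X_def)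
    qed
  qed auto
  define \<delta> where "\<delta> = det (principal_block I X)"
  have lift: "lift_vec I X j = \<delta> *s axis j 1" if j: "j \<in> D" for j
  proof -
    have "lift_vec I X j $ k = (\<delta> *s axis j 1) $ k" for k
    proof (cases "k = j")
      case True
      then show ?thesis by (simp add: lift_vec_def \<delta>_def)
    next
      case False
      have "det (\<chi> a b. if b = k then (if a \<in> I then X $ a $ j else 0) else principal_block I X $ a $ b) = 0"
      proof (rule det_zero_column)
        have "X $ a $ j = 0" if "a \<in> I" for a
          using that j by (auto simp: X_def D_def I_def)
        then show "column k (\<chi> a b. if b = k then (if a \<in> I then X $ a $ j else 0) else principal_block I X $ a $ b) = 0"
          by (auto simp: column_def Finite_Cartesian_Product.vec_eq_iff)
      qed
      then show ?thesis using False by (simp add: lift_vec_def axis_def)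
    qed
    then show ?thesis by (simp only: Finite_Cartesian_Product.vec_eq_iff) blast
  qed
  define M :: "nat \<Rightarrow> 'a^'n^'n" where "M = (\<lambda>l. case l of 0 \<Rightarrow> X
       | Suc m \<Rightarrow> (case prod_decode m of (a, b) \<Rightarrow>
           if a < s \<and> s \<le> b \<and> b < s + d then symm_unit (wt (elt a :: 'n) (elt b)) else 0))"
  define e where "e = (\<lambda>p :: 'n \<times> 'n. prod_encode (idx (fst p), idx (snd p)))"
  have "det (principal_block (S \<times> D) (\<chi> q p. (M (Suc (e p)) *v lift_vec I X (snd q)) $ fst q)) \<noteq> 0"
  proof (rule det_principal_block_involution[where \<sigma> = "\<lambda>i. i" and c = "\<lambda>_. \<delta>"])
    fix q p assume q: "q \<in> S \<times> D" and p: "p \<in> S \<times> D"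
    obtain i j i' j' where ij: "q = (i, j)" "p = (i', j')" by fastforce
    have "M (Suc (e p)) = symm_unit (wt i' j')"
      using p by (simp add: M_def e_def ij S_def D_def)
    moreover have "(symm_unit (wt i' j') *v (\<delta> *s axis j 1)) $ i = \<delta> * symm_unit (wt i' j') $ i $ j"
      by (simp add: vec.scale matrix_vector_mult_def axis_def if_distrib[of "\<lambda>x. _ * x"] cong: if_cong)
    moreover have "wt i j = wt i' j' \<longleftrightarrow> p = q"
      using p q unfolding wt_eq_iff by (auto simp: ij S_def D_def)
    ultimately show "(\<chi> q p. (M (Suc (e p)) *v lift_vec I X (snd q)) $ fst q) $ q $ p = (if p = q then \<delta> else 0)"
      using lift[of j] q by (simp add: ij symm_unit_def)
  qed (use detX in \<open>auto simp: \<delta>_def\<close>)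
  then have "compression_disc e S D I (entries M) \<noteq> 0"
    using detX by (simp add: compression_disc_def M_def)
  then show ?thesis unfolding M_def X_def e_def .
qed

section \<open>Arithmetic of the dimensions\<close>

lemma kappa_form:
  assumes "2 * s \<le> \<rho>"
  shows "2 * kappa n (\<rho> + 1) s
    = 3 * (int s * int s) + (2 * int n - 1 - 4 * int \<rho>) * int s + int \<rho> * int \<rho> + int \<rho> - 2"
proof -
  have "even (m * (m - 1))" for m :: nat by (cases m) auto
  then have "2 * ((\<rho> + 1 - s) choose 2) = (\<rho> + 1 - s) * (\<rho> + 1 - s - 1)"
    unfolding choose_two by (rule dvd_mult_div_cancel)
  then have "2 * int ((\<rho> + 1 - s) choose 2) = int ((\<rho> + 1 - s) * (\<rho> + 1 - s - 1))" by linarith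
  also have "\<dots> = (int \<rho> + 1 - int s) * (int \<rho> - int s)" using assms by (simp add: of_nat_diff)
  finally show ?thesis unfolding kappa_def by (simp add: algebra_simps)
qed

text \<open>Twice \<open>kappa\<close> is a quadratic polynomial in \<open>s\<close> with leading
  coefficient 3, so once it increases it goes on increasing.\<close>

lemma kappa_convex:
  assumes "a \<le> s" "s \<le> b" "2 * b \<le> \<rho>"
  shows "kappa n (\<rho> + 1) s \<le> max (kappa n (\<rho> + 1) a) (kappa n (\<rho> + 1) b)"
proof (rule ccontr)
  assume "\<not> ?thesis"
  then have gt: "2 * kappa n (\<rho> + 1) s > 2 * kappa n (\<rho> + 1) a" "2 * kappa n (\<rho> + 1) s > 2 * kappa n (\<rho> + 1) b"
    by auto
  define \<beta> where "\<beta> = 2 * int n - 1 - 4 * int \<rho>"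
  have 1: "2 * kappa n (\<rho> + 1) s - 2 * kappa n (\<rho> + 1) a = (int s - int a) * (3 * (int s + int a) + \<beta>)"
    using kappa_form[of s \<rho> n] kappa_form[of a \<rho> n] assms by (simp add: algebra_simps \<beta>_def)
  have 2: "2 * kappa n (\<rho> + 1) b - 2 * kappa n (\<rho> + 1) s = (int b - int s) * (3 * (int b + int s) + \<beta>)"
    using kappa_form[of s \<rho> n] kappa_form[of b \<rho> n] assms by (simp add: algebra_simps \<beta>_def)
  have "0 < (int s - int a) * (3 * (int s + int a) + \<beta>)" using gt 1 by linarith
  then have "0 < 3 * (int s + int a) + \<beta>" using assms by (simp add: zero_less_mult_iff)
  moreover have "int a \<le> int b" using assms by simp
  ultimately have "0 \<le> 3 * (int b + int s) + \<beta>" by (simp add: algebra_simps)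
  then have "0 \<le> (int b - int s) * (3 * (int b + int s) + \<beta>)" using assms by (intro mult_nonneg_nonneg) auto
  then show False using gt 2 by linarith
qed

text \<open>Since \<open>2 * s + d = \<rho> + 2\<close>, the conclusion gives matrices of rank at
  most \<rho> two independent kernel vectors. So the certificate for the last stratum has room
  whenever that stratum beats \<open>s = 0\<close>.\<close>

lemma size_bound_if_kappa_larger:
  assumes d: "\<rho> = 2 * s + (d - 2)" "d = 2 \<or> d = 3" and s: "0 < s"
    and gt: "kappa n (\<rho> + 1) 0 < kappa n (\<rho> + 1) s"
  shows "2 * s + d \<le> n"
proof -
  have \<rho>: "int \<rho> = 2 * int s + (int d - 2)" using d by auto
  have "0 < 3 * (int s * int s) + (2 * int n - 1 - 4 * int \<rho>) * int s"
    using gt kappa_form[of s \<rho> n] kappa_form[of 0 \<rho> n] d by auto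
  then have "0 < int s * (3 * int s + 2 * int n - 1 - 4 * int \<rho>)" by (simp add: algebra_simps)
  then have "0 < 3 * int s + 2 * int n - 1 - 4 * int \<rho>" using s by (simp add: zero_less_mult_iff)
  then show ?thesis using \<rho> d s by auto
qed

text \<open>This gap is later compared with the number of weights that a limit loses when one corner
  weight is missing.\<close>

lemma kappa_step:
  assumes d: "\<rho> = 2 * s + (d - 2)" "d = 2 \<or> d = 3" and s: "0 < s"
  shows "kappa n (\<rho> + 1) s - kappa n (\<rho> + 1) (s - 1) = int n - int s + 2 - 2 * int d"
proof -
  obtain t where t: "s = Suc t" using s gr0_implies_Suc by blast
  define u where "u = int d - 2"
  have u: "int d = u + 2" "u * u = u" using d(2) by (auto simp: u_def)
  have \<rho>: "int \<rho> = 2 * int t + 2 + u" using d t by (auto simp: u_def)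
  have st: "2 * s \<le> \<rho>" "2 * t \<le> \<rho>" using d t by auto
  have "2 * kappa n (\<rho> + 1) s - 2 * kappa n (\<rho> + 1) t = 2 * (int n - int s + 2 - 2 * int d)"
    using kappa_form[OF st(1), of n] kappa_form[OF st(2), of n] u(2) unfolding \<rho> u(1) t of_nat_Suc
    by (simp add: algebra_simps)
  then show ?thesis by (simp add: t)
qed

section \<open>Members of the Fano variety\<close>

lemma fano_memberD:
  fixes L :: "('a::alg_closed_field^'n^'n) set"
  assumes "L \<in> topspace (fano_space k (\<rho> + 1))"
  shows "mspace.subspace L" "mspace.dim L = k + 1" "\<And>M. M \<in> L \<Longrightarrow> transpose M = M"
    "\<And>M. M \<in> L \<Longrightarrow> rank M \<le> \<rho>"
  using assms unfolding topspace_fano_space grassmannian_def sym_det_cone_def symmetric_matrices_def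
  by auto

lemma fano_memberI:
  fixes L :: "('a::alg_closed_field^'n^'n) set"
  assumes L: "mspace.subspace L" "mspace.dim L = k + 1" "L \<subseteq> coord_space (cweights TYPE('n) \<rho> s)"
    and s: "2 * s \<le> \<rho>" "\<rho> < CARD('n)"
  shows "L \<in> topspace (fano_space k (\<rho> + 1))"
proof -
  have "rank M < \<rho> + 1" if "M \<in> L" for M
    using rank_coord_space_cweights[of M \<rho> s] L(3) s that by auto
  moreover have "transpose M = M" if "M \<in> L" for M using L(3) that by (auto simp: coord_space_def)
  ultimately show ?thesis
    using L(1,2) unfolding topspace_fano_space grassmannian_def sym_det_cone_def symmetric_matrices_def by auto
qed

lemma (in finite_dimensional_vector_space) exists_subspace_between:
  assumes V: "subspace V" "T \<subseteq> V" and d: "dim T \<le> d" "d \<le> dim V"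
  shows "\<exists>L. subspace L \<and> T \<subseteq> L \<and> L \<subseteq> V \<and> dim L = d"
proof -
  obtain B where B: "B \<subseteq> T" "independent B" "T \<subseteq> span B" "card B = dim T"
    by (rule basis_exists)
  obtain C where C: "B \<subseteq> C" "C \<subseteq> V" "independent C" "V \<subseteq> span C"
    using maximal_independent_subset_extend[of B V] B V(2) by blast
  have fin: "finite C" using C(3) by (rule finiteI_independent)
  have cC: "card C = dim V" by (rule basis_card_eq_dim[OF C(2,4,3)])
  have finB: "finite B" using finite_subset[OF C(1) fin] .
  have "d - card B \<le> card (C - B)" using card_Diff_subset[OF finB C(1)] cC d B(4) by simp
  then obtain E where E: "E \<subseteq> C - B" "card E = d - card B" "finite E"
    by (rule obtain_subset_with_card_n)
  have ind: "independent (B \<union> E)" using C(1,3) E(1) independent_mono[of C "B \<union> E"] by blast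
  have "dim (span (B \<union> E)) = card (B \<union> E)" by (rule dim_span_eq_card_independent[OF ind])
  also have "\<dots> = d" using E finB d B(4) by (subst card_Un_disjoint) auto
  finally have "dim (span (B \<union> E)) = d" .
  moreover have "T \<subseteq> span (B \<union> E)" using B(3) span_mono[of B "B \<union> E"] by blast
  moreover have "span (B \<union> E) \<subseteq> V" using C(1,2) E(1) V(1) by (intro span_minimal) auto
  ultimately show ?thesis using subspace_span by blast
qed

text \<open>Turns a witness tuple for a test into a point of the Fano variety: enlarging the space
  around the tuple keeps the test nonzero.\<close>

lemma exists_fano_member:
  fixes T :: "('a::alg_closed_field^'n^'n) set"
  assumes T: "T \<subseteq> coord_space (cweights TYPE('n) \<rho> s)" "mspace.dim T \<le> k + 1"
    and s: "2 * s \<le> \<rho>" "\<rho> < CARD('n)" and k: "int k \<le> kappa CARD('n) (\<rho> + 1) s"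
  obtains L where "L \<in> topspace (fano_space k (\<rho> + 1))" "T \<subseteq> L" "L \<subseteq> coord_space (cweights TYPE('n) \<rho> s)"
proof -
  have "mspace.dim (coord_space (cweights TYPE('n) \<rho> s) :: ('a^'n^'n) set) = card (cweights TYPE('n) \<rho> s)"
    by (rule dim_coord_space[OF cweights_subset])
  then have "k + 1 \<le> mspace.dim (coord_space (cweights TYPE('n) \<rho> s) :: ('a^'n^'n) set)"
    using card_cweights[OF s] k by linarith
  then obtain L where "mspace.subspace L" "T \<subseteq> L" "L \<subseteq> coord_space (cweights TYPE('n) \<rho> s)" "mspace.dim L = k + 1"
    using mspace.exists_subspace_between[OF subspace_coord_space T] by blast
  then show thesis using that fano_memberI[OF _ _ _ s] by blast
qed

lemma not_vanishes_onI: "range M \<subseteq> L \<Longrightarrow> f (entries M) \<noteq> 0 \<Longrightarrow> \<not> vanishes_on f L"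
  by (auto simp: vanishes_on_def)

lemma not_vanishes_onE:
  assumes "\<not> vanishes_on f L"
  obtains M where "range M \<subseteq> L" "f (entries M) \<noteq> 0"
  using assms unfolding vanishes_on_def by blast

section \<open>Large spaces of bounded rank are compression spaces\<close>

lemma compressible_0_if_pencil_disc:
  fixes L :: "('a::alg_closed_field^'n^'n) set"
  assumes L: "mspace.subspace L" "\<And>M. M \<in> L \<Longrightarrow> transpose M = M" "\<And>M. M \<in> L \<Longrightarrow> rank M \<le> \<rho>"
    and \<rho>: "0 < \<rho>" "\<rho> \<le> CARD('n)" and disc: "\<not> vanishes_on (pencil_disc {i. idx i < \<rho>}) L"
  obtains A :: "'a^'n^'n" where "rank A = \<rho>" "\<forall>N\<in>L. \<forall>v. A *v v = 0 \<longrightarrow> N *v v = 0"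
proof -
  let ?I = "{i :: 'n. idx i < \<rho>}"
  have cI: "card ?I = \<rho>" by (rule card_idx_less[OF \<rho>(2)])
  obtain M where M: "range M \<subseteq> L" "pencil_disc ?I (entries M) \<noteq> 0"
    using disc by (rule not_vanishes_onE)
  have ne: "?I \<noteq> {}" using cI \<rho>(1) by (metis card.empty less_irrefl)
  have M0: "M 0 \<in> L" using M(1) by blast
  have "det (principal_block ?I (M 0)) \<noteq> 0" using M(2) by (simp add: pencil_disc_def)
  then have "\<rho> \<le> rank (M 0)" using rank_ge_card_if_block_regular cI by metis
  then have "rank (M 0) = \<rho>" using L(3)[OF M0] by simp
  then show thesis
  proof (rule that, intro ballI allI impI)
    have rk: "\<And>M. M \<in> L \<Longrightarrow> rank M \<le> card ?I" using L(3) cI by simp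
    fix N v assume Nv: "N \<in> L" "M 0 *v v = 0"
    show "N *v v = 0" using pencil_disc_common_kernel[OF L(1,2) rk ne M(1) M(2) Nv(1) Nv(2)] .
  qed
qed

text \<open>Below \<open>2 * s + d\<close> the first and the last \<open>s\<close> indices make up
  \<open>I\<close>, paired with each other by the antidiagonal, and the \<open>d\<close> indices
  between them are left for the kernel vectors.\<close>

definition comp_crit :: "'n::finite itself \<Rightarrow> nat \<Rightarrow> nat \<Rightarrow> (nat \<times> 'n \<times> 'n \<Rightarrow> 'a) \<Rightarrow> 'a::field" where
  "comp_crit _ s d = compression_disc (\<lambda>p. prod_encode (idx (fst p), idx (snd p)))
     {i. idx i < s} {i. s \<le> idx i \<and> idx i < s + d}
     {i. idx i < s \<or> (s + d \<le> idx i \<and> idx i < 2 * s + d)}"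

lemma compression_if_comp_crit:
  fixes L :: "('a::alg_closed_field^'n^'n) set"
  assumes L: "mspace.subspace L" "\<And>M. M \<in> L \<Longrightarrow> transpose M = M" "\<And>M. M \<in> L \<Longrightarrow> rank M \<le> \<rho>"
    and two: "(2::'a) \<noteq> 0" and d: "\<rho> = 2 * s + (d - 2)" "d = 2 \<or> d = 3" and n: "2 * s + d \<le> CARD('n)"
    and disc: "\<not> vanishes_on (comp_crit TYPE('n) s d) L"
  obtains W U where "vec.subspace W" "vec.subspace U" "W \<subseteq> U"
    "vec.dim W + \<rho> = CARD('n) + s" "vec.dim U + s = CARD('n)"
    "\<And>N w u. N \<in> L \<Longrightarrow> w \<in> W \<Longrightarrow> u \<in> U \<Longrightarrow> w \<odot> (N *v u) = 0"
proof -
  let ?S = "{i :: 'n. idx i < s}" and ?D = "{i :: 'n. s \<le> idx i \<and> idx i < s + d}"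
    and ?I = "{i :: 'n. idx i < s \<or> (s + d \<le> idx i \<and> idx i < 2 * s + d)}"
  obtain M where M: "range M \<subseteq> L"
    "compression_disc (\<lambda>p. prod_encode (idx (fst p), idx (snd p))) ?S ?D ?I (entries M) \<noteq> 0"
    using disc unfolding comp_crit_def by (rule not_vanishes_onE)
  have S: "card ?S = s" using n by (intro card_idx_less) simp
  have D: "card ?D = d"
    using card_idx_vimage[of "{s..<s + d}", where ?'n = 'n] n by (simp add: subset_iff)
  have I: "card ?I = 2 * s"
  proof -
    have "{..<s} \<union> {s + d..<2 * s + d} \<subseteq> {..<CARD('n)}" using n by auto
    from card_idx_vimage[OF this]
    have "card ?I = card ({..<s} \<union> {s + d..<2 * s + d})" by simp
    also have "\<dots> = 2 * s" by (subst card_Un_disjoint) auto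
    finally show ?thesis .
  qed
  show thesis
    by (rule compression_disc_compression[OF L two _ _ _ _ _ M]) (use S D I d that in auto)
qed

text \<open>The rank bound passes to the limit through the test \<open>det (layer 0 x + D)\<close>,
  with \<open>D\<close> complementary to a supposed member of larger rank.\<close>

lemma exists_bounded_shifted_degeneration:
  fixes L :: "('a::alg_closed_field^'n^'n) set"
  assumes L: "L \<in> topspace (fano_space k (\<rho> + 1))" and two: "(2::'a) \<noteq> 0" and \<rho>: "\<rho> < CARD('n)"
  obtains G where "G \<subseteq> weights TYPE('n)" "card G = k + 1" "degenerates_to L (coord_space G)"
    "shifted TYPE('n) G" "\<exists>s. 2 * s \<le> \<rho> \<and> wt (elt s :: 'n) (elt (\<rho> - s)) \<notin> G"
proof -
  note LD = fano_memberD[OF L]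
  obtain G where G: "G \<subseteq> weights TYPE('n)" "card G = mspace.dim L" "degenerates_to L (coord_space G)"
    "shifted TYPE('n) G"
    using exists_shifted_degeneration[OF LD(1,3) two] by blast
  have "rank M \<le> \<rho>" if M: "M \<in> coord_space G" for M :: "'a^'n^'n"
  proof (rule ccontr)
    assume gt: "\<not> rank M \<le> \<rho>"
    obtain D where D: "det (M + D) \<noteq> 0" "rank D = CARD('n) - rank M"
      by (rule exists_complementary_matrix)
    define f where "f x = det (layer 0 x + D)" for x :: "nat \<times> 'n \<times> 'n \<Rightarrow> 'a"
    have "poly_fun f"
      unfolding f_def[abs_def] by (rule poly_fun_det) (simp add: poly_fun.intros)
    moreover have "vanishes_on f (congr g L)" if g: "invertible g" for g
      unfolding vanishes_on_def
    proof (intro allI impI)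
      fix N :: "nat \<Rightarrow> 'a^'n^'n" assume "range N \<subseteq> congr g L"
      then obtain N0 where N0: "N0 \<in> L" "N 0 = g ** N0 ** transpose g" unfolding congr_def by blast
      have "rank (N 0) \<le> \<rho>" unfolding N0(2) rank_congruence[OF g] by (rule LD(4)[OF N0(1)])
      then have "rank (N 0) + rank D < CARD('n)" using gt D(2) rank_le_card[of M] by linarith
      then show "f (entries N) = 0" unfolding f_def layer_entries by (rule det_add_eq_0)
    qed
    ultimately have "vanishes_on f (coord_space G)" using G(3) unfolding degenerates_to_def by blast
    moreover have "f (entries (\<lambda>_. M)) \<noteq> 0" using D(1) by (simp add: f_def)
    moreover have "range (\<lambda>_::nat. M) \<subseteq> coord_space G" using M by auto
    ultimately show False using not_vanishes_onI by blast
  qed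
  then have "\<exists>s. 2 * s \<le> \<rho> \<and> wt (elt s :: 'n) (elt (\<rho> - s)) \<notin> G"
    by (rule shifted_bounded_rank[OF G(4) \<rho>])
  then show thesis using that[OF G(1) _ G(3,4)] G(2) LD(2) by simp
qed

lemma degenerates_to_not_vanishes_on:
  assumes "degenerates_to L L'" "poly_fun f" "\<not> vanishes_on f L'"
  obtains g where "invertible g" "\<not> vanishes_on f (congr g L)"
  using assms unfolding degenerates_to_def by blast

lemma fano_member_congr:
  fixes L :: "('a::alg_closed_field^'n^'n) set"
  assumes L: "L \<in> topspace (fano_space k (\<rho> + 1))" and g: "invertible g"
  shows "mspace.subspace (congr g L)" "\<And>M. M \<in> congr g L \<Longrightarrow> transpose M = M"
    "\<And>M. M \<in> congr g L \<Longrightarrow> rank M \<le> \<rho>"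
proof -
  note LD = fano_memberD[OF L]
  show "mspace.subspace (congr g L)" by (rule subspace_congr[OF LD(1)])
  fix M assume "M \<in> congr g L"
  then obtain N where N: "N \<in> L" "M = g ** N ** transpose g" unfolding congr_def by blast
  show "transpose M = M" unfolding N(2) by (rule transpose_congruence[OF LD(3)[OF N(1)]])
  show "rank M \<le> \<rho>" unfolding N(2) rank_congruence[OF g] by (rule LD(4)[OF N(1)])
qed

lemma dim_fano_bound:
  fixes L :: "('a::alg_closed_field^'n^'n) set"
  assumes L: "L \<in> topspace (fano_space k (\<rho> + 1))" and two: "(2::'a) \<noteq> 0" and \<rho>: "\<rho> < CARD('n)"
  shows "\<exists>s. 2 * s \<le> \<rho> \<and> int k \<le> kappa CARD('n) (\<rho> + 1) s"
proof -
  obtain G s where G: "G \<subseteq> weights TYPE('n)" "card G = k + 1" "shifted TYPE('n) G"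
    and s: "2 * s \<le> \<rho>" "wt (elt s :: 'n) (elt (\<rho> - s)) \<notin> G"
    by (rule exists_bounded_shifted_degeneration[OF L two \<rho>]) blast
  have "G \<subseteq> cweights TYPE('n) \<rho> s" by (rule shifted_subset_cweights[OF G(3,1) s(1) \<rho> s(2)])
  then have "card G \<le> card (cweights TYPE('n) \<rho> s)" by (rule card_mono[OF finite_cweights])
  then show ?thesis using card_cweights[OF s(1) \<rho>] G(2) s(1) by (intro exI[of _ s]) linarith
qed

text \<open>A missing corner at \<open>t\<close> puts the limit inside the
  \<open>t\<close>-compression space, which is too small unless \<open>t = s\<close>; hence all
  corners not belonging to \<open>s\<close> are present.\<close>

lemma fano_shifted_cases:
  fixes L :: "('a::alg_closed_field^'n^'n) set"
  assumes L: "L \<in> topspace (fano_space k (\<rho> + 1))" and two: "(2::'a) \<noteq> 0" and \<rho>: "\<rho> < CARD('n)"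
    and large: "\<And>t. 2 * t \<le> \<rho> \<Longrightarrow> t \<noteq> s \<Longrightarrow> kappa CARD('n) (\<rho> + 1) t < int k"
  obtains G where "G \<subseteq> weights TYPE('n)" "card G = k + 1" "degenerates_to L (coord_space G)"
    "shifted TYPE('n) G" "2 * s \<le> \<rho>" "G \<subseteq> cweights TYPE('n) \<rho> s"
    "\<forall>t\<le>\<rho>. t \<noteq> s \<longrightarrow> t \<noteq> \<rho> - s \<longrightarrow> wt (elt t :: 'n) (elt (\<rho> - t)) \<in> G"
proof -
  obtain G s' where G: "G \<subseteq> weights TYPE('n)" "card G = k + 1" "degenerates_to L (coord_space G)"
    "shifted TYPE('n) G" and s': "2 * s' \<le> \<rho>" "wt (elt s' :: 'n) (elt (\<rho> - s')) \<notin> G"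
    by (rule exists_bounded_shifted_degeneration[OF L two \<rho>]) blast
  have sub: "t = s \<and> G \<subseteq> cweights TYPE('n) \<rho> s" if t: "2 * t \<le> \<rho>" "wt (elt t :: 'n) (elt (\<rho> - t)) \<notin> G" for t
  proof -
    have sub: "G \<subseteq> cweights TYPE('n) \<rho> t" by (rule shifted_subset_cweights[OF G(4,1) t(1) \<rho> t(2)])
    then have "card G \<le> card (cweights TYPE('n) \<rho> t)" by (rule card_mono[OF finite_cweights])
    then have "int k \<le> kappa CARD('n) (\<rho> + 1) t" using card_cweights[OF t(1) \<rho>] G(2) by linarith
    then have "t = s" using large[OF t(1)] by force
    then show ?thesis using sub by simp
  qed
  have inG: "wt (elt t :: 'n) (elt (\<rho> - t)) \<in> G" if t: "t \<le> \<rho>" "t \<noteq> s" "t \<noteq> \<rho> - s" for t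
  proof (cases "2 * t \<le> \<rho>")
    case True
    then show ?thesis using sub[of t] t by blast
  next
    case False
    then have 1: "2 * (\<rho> - t) \<le> \<rho>" "\<rho> - (\<rho> - t) = t" "\<rho> - t \<noteq> s" using t by auto
    then have "wt (elt (\<rho> - t) :: 'n) (elt t) \<in> G" using sub[of "\<rho> - t"] by auto
    then show ?thesis by (simp only: wt_commute)
  qed
  show thesis using that[OF G] inG sub[OF s'] s'(1) by blast
qed

text \<open>Each nonzero position of the test pencil lies below an interior corner
  \<open>(a, \<rho> - a)\<close> with \<open>0 < a < \<rho>\<close>, so shiftedness supplies its
  weight.\<close>

lemma pencil_in_coord_space:
  fixes G :: "nat set"
  assumes \<rho>: "2 \<le> \<rho>" "\<rho> < CARD('n::finite)" and G: "shifted TYPE('n) G"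
    and anti: "\<And>t. 0 < t \<Longrightarrow> t < \<rho> \<Longrightarrow> wt (elt t :: 'n) (elt (\<rho> - t)) \<in> G"
  shows "(pencil_A \<rho> :: 'a::field^'n^'n) \<in> coord_space G" "(pencil_B \<rho> :: 'a^'n^'n) \<in> coord_space G"
proof -
  have anti': "wt i j \<in> G" if "idx i \<le> a" "idx j \<le> \<rho> - a" "0 < a" "a < \<rho>" for i j :: 'n and a
    by (rule shifted_le[OF G anti[OF that(3,4)]]) (use that \<rho> in auto)
  have small: "wt i j \<in> G" if "idx i + idx j + 1 = \<rho>" for i j :: 'n
  proof (cases "idx i + 1 < \<rho>")
    case True
    then show ?thesis using that by (intro anti'[of i "idx i + 1" j]) auto
  next
    case False
    then show ?thesis using that \<rho> by (intro anti'[of i "idx i" j]) auto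
  qed
  show "(pencil_A \<rho> :: 'a^'n^'n) \<in> coord_space G"
    unfolding coord_space_def mem_Collect_eq transpose_eq_iff
    using small by (auto simp: pencil_A_def add.commute split: if_splits)
  show "(pencil_B \<rho> :: 'a^'n^'n) \<in> coord_space G"
    unfolding coord_space_def mem_Collect_eq transpose_eq_iff
  proof (intro conjI allI impI)
    fix i j :: 'n
    show "(pencil_B \<rho> :: 'a^'n^'n) $ i $ j = pencil_B \<rho> $ j $ i"
      by (simp add: pencil_B_def add.commute conj_commute)
    assume "(pencil_B \<rho> :: 'a^'n^'n) $ i $ j \<noteq> 0"
    then have "(idx i < \<rho> \<and> idx j < \<rho> \<and> idx i + idx j = \<rho>) \<or> idx i + idx j \<le> 1"
      by (auto simp: pencil_B_def split: if_splits)
    then show "wt i j \<in> G"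
    proof
      assume "idx i < \<rho> \<and> idx j < \<rho> \<and> idx i + idx j = \<rho>"
      then show ?thesis by (intro anti'[of i "idx i" j]) auto
    next
      assume "idx i + idx j \<le> 1"
      then show ?thesis using \<rho> by (intro anti'[of i 1 j]) auto
    qed
  qed
qed

lemma fano_compressible_0:
  fixes L :: "('a::alg_closed_field^'n^'n) set"
  assumes L: "L \<in> topspace (fano_space k (\<rho> + 1))" and two: "(2::'a) \<noteq> 0"
    and \<rho>: "2 \<le> \<rho>" "\<rho> < CARD('n)"
    and large: "\<And>t. 2 * t \<le> \<rho> \<Longrightarrow> 0 < t \<Longrightarrow> kappa CARD('n) (\<rho> + 1) t < int k"
  shows "compressible \<rho> 0 L"
proof -
  have large': "2 * t \<le> \<rho> \<Longrightarrow> t \<noteq> 0 \<Longrightarrow> kappa CARD('n) (\<rho> + 1) t < int k" for t using large by simp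
  obtain G where G: "degenerates_to L (coord_space G)" "shifted TYPE('n) G"
    and anti: "\<forall>t\<le>\<rho>. t \<noteq> 0 \<longrightarrow> t \<noteq> \<rho> - 0 \<longrightarrow> wt (elt t :: 'n) (elt (\<rho> - t)) \<in> G"
    by (rule fano_shifted_cases[OF L two \<rho>(2) large']) blast
  have AB: "(pencil_A \<rho> :: 'a^'n^'n) \<in> coord_space G" "(pencil_B \<rho> :: 'a^'n^'n) \<in> coord_space G"
    using anti by (auto intro!: pencil_in_coord_space[OF \<rho> G(2)])
  have "\<not> vanishes_on (pencil_disc {i. idx i < \<rho>}) (coord_space G :: ('a^'n^'n) set)"
  proof (rule not_vanishes_onI)
    show "range (\<lambda>l::nat. if l = 0 then pencil_A \<rho> else if l = 1 then pencil_B \<rho> else (0 :: 'a^'n^'n)) \<subseteq> coord_space G"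
      using AB mspace.subspace_0[OF subspace_coord_space] by auto
  qed (rule pencil_disc_test[OF \<rho>(1) less_imp_le[OF \<rho>(2)] two])
  then obtain g where g: "invertible g" "\<not> vanishes_on (pencil_disc {i. idx i < \<rho>}) (congr g L)"
    using degenerates_to_not_vanishes_on[OF G(1) poly_fun_pencil_disc] by blast
  note gL = fano_member_congr[OF L g(1)]
  have \<rho>': "0 < \<rho>" "\<rho> \<le> CARD('n)" using \<rho> by auto
  obtain A :: "'a^'n^'n" where A: "rank A = \<rho>" "\<forall>N\<in>congr g L. \<forall>v. A *v v = 0 \<longrightarrow> N *v v = 0"
    by (rule compressible_0_if_pencil_disc[OF gL \<rho>' g(2)])
  have "compressible \<rho> 0 (congr g L)"
  proof (rule compressibleI[OF gL(2) subspace_kernel[of A] vec.subspace_UNIV])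
    show "vec.dim {v. A *v v = 0} + \<rho> = CARD('n) + 0" using dim_kernel[of A] A(1) by simp
    show "vec.dim (UNIV :: ('a^'n) set) + 0 = CARD('n)" by (simp only: vec_dim_card)
    fix N w and u :: "'a^'n" assume N: "N \<in> congr g L" and w: "w \<in> {v. A *v v = 0}"
    have "N *v w = 0" using A(2) N w by blast
    then show "w \<odot> (N *v u) = 0" using dot_symmetric_matrix[OF gL(2)[OF N], of w u] by simp
  qed auto
  then show ?thesis by (rule compressible_congr[OF g(1)])
qed

lemma comp_crit_tuple:
  assumes n: "2 * s + d \<le> CARD('n::finite)" and G: "shifted TYPE('n) G"
    and d: "0 < d"
    and anti: "\<And>i. i < s \<Longrightarrow> wt (elt i :: 'n) (elt (2 * s + d - 1 - i)) \<in> G"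
  obtains M :: "nat \<Rightarrow> 'a::field^'n::finite^'n" where "range M \<subseteq> coord_space G" "finite (range M)" "card (range M) \<le> s * d + 2"
    "comp_crit TYPE('n) s d (entries M) \<noteq> 0"
proof -
  have 1: "wt i j \<in> G" if ij: "idx i + idx j + 1 = 2 * s + d" "idx i < s" for i j :: 'n
  proof -
    have "2 * s + d - 1 - idx i = idx j" using ij by simp
    then show ?thesis using anti[OF ij(2)] by simp
  qed
  have X: "(\<chi> i j. if idx i + idx j + 1 = 2 * s + d \<and> (idx i < s \<or> idx j < s) then 1 else 0)
      \<in> (coord_space G :: ('a^'n^'n) set)"
    unfolding coord_space_def mem_Collect_eq transpose_eq_iff
  proof (intro conjI allI impI)
    fix i j :: 'n
    assume "(\<chi> i j. if idx i + idx j + 1 = 2 * s + d \<and> (idx i < s \<or> idx j < s) then 1 else (0 :: 'a)) $ i $ j \<noteq> 0"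
    then have "idx i + idx j + 1 = 2 * s + d" "idx i < s \<or> idx j < s" by (auto split: if_splits)
    then show "wt i j \<in> G" using 1[of i j] 1[of j i] wt_commute[of i j] by (auto simp: add.commute)
  qed (simp add: add.commute disj_commute)
  have E: "symm_unit (wt (elt a :: 'n) (elt b)) \<in> (coord_space G :: ('a^'n^'n) set)"
    if ab: "a < s" "s \<le> b" "b < s + d" for a b
  proof (rule symm_unit_in_coord_space)
    have "wt (elt (s - 1) :: 'n) (elt (2 * s + d - 1 - (s - 1))) \<in> G" using ab by (intro anti) auto
    then show "wt (elt a :: 'n) (elt b) \<in> G"
      by (rule shifted_le[OF G]) (use ab n in auto)
  qed
  have zero: "(0 :: 'a^'n^'n) \<in> coord_space G" by (rule mspace.subspace_0[OF subspace_coord_space])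
  let ?M = "\<lambda>l. case l of 0 \<Rightarrow> (\<chi> i j. if idx i + idx j + 1 = 2 * s + d \<and> (idx i < s \<or> idx j < s) then 1 else 0)
       | Suc m \<Rightarrow> (case prod_decode m of (a, b) \<Rightarrow>
           if a < s \<and> s \<le> b \<and> b < s + d then symm_unit (wt (elt a :: 'n) (elt b)) else (0 :: 'a^'n^'n))"
  have sub: "range ?M \<subseteq> coord_space G"
  proof (rule image_subsetI)
    fix l :: nat
    show "(case l of 0 \<Rightarrow> (\<chi> i j. if idx i + idx j + 1 = 2 * s + d \<and> (idx i < s \<or> idx j < s) then 1 else 0)
       | Suc m \<Rightarrow> (case prod_decode m of (a, b) \<Rightarrow>
           if a < s \<and> s \<le> b \<and> b < s + d then symm_unit (wt (elt a :: 'n) (elt b)) else (0 :: 'a^'n^'n)))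
      \<in> coord_space G"
    proof (cases l)
      case (Suc m)
      obtain a b where ab: "prod_decode m = (a, b)" by fastforce
      show ?thesis using E[of a b] zero by (simp add: Suc ab)
    qed (use X in simp)
  qed
  define E where "E = insert (\<chi> i j. if idx i + idx j + 1 = 2 * s + d \<and> (idx i < s \<or> idx j < s) then 1 else 0)
    (insert 0 ((\<lambda>(a, b). symm_unit (wt (elt a :: 'n) (elt b)) :: 'a^'n^'n) ` ({..<s} \<times> {s..<s + d})))"
  have "?M l \<in> E" for l
  proof (cases l)
    case (Suc m)
    obtain a b where ab: "prod_decode m = (a, b)" by fastforce
    show ?thesis unfolding E_def by (auto simp: Suc ab)
  qed (simp add: E_def)
  then have E: "range ?M \<subseteq> E" by (rule image_subsetI)
  have fin: "finite E" by (simp add: E_def)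
  have "card E \<le> s * d + 2"
  proof -
    have "card ((\<lambda>(a, b). symm_unit (wt (elt a :: 'n) (elt b)) :: 'a^'n^'n) ` ({..<s} \<times> {s..<s + d})) \<le> s * d"
      using card_image_le[of "{..<s} \<times> {s..<s + d}" "\<lambda>(a, b). symm_unit (wt (elt a :: 'n) (elt b)) :: 'a^'n^'n"] by simp
    then show ?thesis unfolding E_def by (intro order_trans[OF card_insert_le_m1]) (auto intro!: order_trans[OF card_insert_le_m1])
  qed
  then have "card (range ?M) \<le> s * d + 2" using card_mono[OF fin E] by simp
  then show thesis
    using sub finite_subset[OF E fin] compression_disc_test[OF n] by (intro that[of ?M]) (simp_all add: comp_crit_def)
qed

lemma fano_compressible_max:
  fixes L :: "('a::alg_closed_field^'n^'n) set"
  assumes L: "L \<in> topspace (fano_space k (\<rho> + 1))" and two: "(2::'a) \<noteq> 0" and \<rho>: "\<rho> < CARD('n)"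
    and d: "\<rho> = 2 * s + (d - 2)" "d = 2 \<or> d = 3" and s: "0 < s"
    and large: "\<And>t. t < s \<Longrightarrow> kappa CARD('n) (\<rho> + 1) t < int k"
    and k: "int k \<le> kappa CARD('n) (\<rho> + 1) s"
  shows "compressible \<rho> s L"
proof -
  have large': "2 * t \<le> \<rho> \<Longrightarrow> t \<noteq> s \<Longrightarrow> kappa CARD('n) (\<rho> + 1) t < int k" for t
    using large[of t] d by (cases "t < s") auto
  obtain G where G: "G \<subseteq> weights TYPE('n)" "card G = k + 1" "degenerates_to L (coord_space G)"
    "shifted TYPE('n) G" "G \<subseteq> cweights TYPE('n) \<rho> s"
    by (rule fano_shifted_cases[OF L two \<rho> large']) blast
  have n: "2 * s + d \<le> CARD('n)"
    using size_bound_if_kappa_larger[OF d s] large[OF s] k by simp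
  have anti: "wt (elt i :: 'n) (elt (2 * s + d - 1 - i)) \<in> G" if i: "i < s" for i
  proof (rule ccontr)
    assume no: "wt (elt i :: 'n) (elt (2 * s + d - 1 - i)) \<notin> G"
    define b0 where "b0 = 2 * s + d - 1 - i"
    \<comment> \<open>By shiftedness, a missing weight at \<open>(i, b0)\<close> removes this whole
      rectangle from the compression pattern.\<close>
    define Z where "Z = (\<lambda>(a, b). wt (elt a :: 'n) (elt b)) ` ({i..<s} \<times> {b0..<CARD('n)})"
    have b0: "s \<le> b0" "b0 < CARD('n)" using i n d by (auto simp: b0_def)
    have inj: "inj_on (\<lambda>(a, b). wt (elt a :: 'n) (elt b)) ({i..<s} \<times> {b0..<CARD('n)})"
    proof (rule inj_onI, clarify)
      fix a b a' b'
      assume h: "a \<in> {i..<s}" "b \<in> {b0..<CARD('n)}" "a' \<in> {i..<s}" "b' \<in> {b0..<CARD('n)}"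
        "wt (elt a :: 'n) (elt b) = wt (elt a' :: 'n) (elt b')"
      have lt: "a < CARD('n)" "b < CARD('n)" "a' < CARD('n)" "b' < CARD('n)" using h b0 by auto
      have e: "(elt x :: 'n) = elt y \<longleftrightarrow> x = y" if "x < CARD('n)" "y < CARD('n)" for x y
        using eq_elt_iff[OF that(2), of "elt x"] that(1) by simp
      have "a = a' \<and> b = b' \<or> a = b' \<and> b = a'" using h(5)[unfolded wt_eq_iff] e lt by metis
      then show "a = a' \<and> b = b'" using h b0 by auto
    qed
    have cZ: "card Z = (s - i) * (CARD('n) - b0)" unfolding Z_def card_image[OF inj] by simp
    have disj: "G \<inter> Z = {}"
    proof -
      have "wt (elt a :: 'n) (elt b) \<notin> G" if ab: "a \<in> {i..<s}" "b \<in> {b0..<CARD('n)}" for a b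
      proof
        assume "wt (elt a :: 'n) (elt b) \<in> G"
        then have "wt (elt i :: 'n) (elt b0) \<in> G"
          by (rule shifted_le[OF G(4)]) (use ab b0 i in auto)
        then show False using no by (simp add: b0_def)
      qed
      then show ?thesis unfolding Z_def by auto
    qed
    have "Z \<subseteq> cweights TYPE('n) \<rho> s"
    proof
      fix \<theta> assume "\<theta> \<in> Z"
      then obtain a b where ab: "\<theta> = wt (elt a :: 'n) (elt b)" "a < s" by (auto simp: Z_def)
      then show "\<theta> \<in> cweights TYPE('n) \<rho> s" using b0 unfolding ab(1) wt_in_cweights by simp
    qed
    then have "card (G \<union> Z) \<le> card (cweights TYPE('n) \<rho> s)"
      using G(5) by (intro card_mono finite_cweights) auto
    moreover have "card (G \<union> Z) = card G + card Z"
      using disj finite_subset[OF G(1) finite_weights] by (intro card_Un_disjoint) (auto simp: Z_def)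
    ultimately have "int k + 1 + int (card Z) \<le> kappa CARD('n) (\<rho> + 1) s + 1"
      using card_cweights[OF _ \<rho>, of s] d(1) G(2) by simp
    moreover have "kappa CARD('n) (\<rho> + 1) (s - 1) < int k" using s by (intro large) simp
    ultimately have small: "int (card Z) < int CARD('n) - int s + 2 - 2 * int d"
      using kappa_step[OF d s, of "CARD('n)"] by linarith
    \<comment> \<open>The rectangle has \<open>m * (q - d + 1 - m)\<close> weights. This is concave
      in \<open>m\<close> and so at least \<open>q - d\<close>, its value at \<open>m = 1\<close>;
      as \<open>d \<ge> 2\<close>, that is not below the available gap
      \<open>q + 2 - 2 * d\<close>.\<close>
    define m where "m = int s - int i"
    define q where "q = int CARD('n) - int s"
    have "int (s - i) = m" "int (CARD('n) - b0) = q - int d + 1 - m"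
      using i b0 n by (auto simp: b0_def m_def q_def)
    then have "int (card Z) = m * (q - int d + 1 - m)" unfolding cZ by simp
    moreover have "0 \<le> (m - 1) * (q - int d - m)"
      using i n by (intro mult_nonneg_nonneg) (auto simp: m_def q_def)
    moreover have "m * (q - int d + 1 - m) = (m - 1) * (q - int d - m) + (q - int d)"
      by (simp add: algebra_simps)
    ultimately show False using d(2) q_def small by auto
  qed
  have "\<not> vanishes_on (comp_crit TYPE('n) s d) (coord_space G :: ('a^'n^'n) set)"
  proof -
    have "0 < d" using d(2) by auto
    then obtain M :: "nat \<Rightarrow> 'a^'n^'n" where "range M \<subseteq> coord_space G" "comp_crit TYPE('n) s d (entries M) \<noteq> 0"
      by (rule comp_crit_tuple[OF n G(4) _ anti]) blast
    then show ?thesis by (rule not_vanishes_onI)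
  qed
  then obtain g where g: "invertible g" "\<not> vanishes_on (comp_crit TYPE('n) s d) (congr g L)"
    using degenerates_to_not_vanishes_on[OF G(3) poly_fun_compression_disc] unfolding comp_crit_def by blast
  note gL = fano_member_congr[OF L g(1)]
  obtain W U where WU: "vec.subspace W" "vec.subspace U" "W \<subseteq> U"
    "vec.dim W + \<rho> = CARD('n) + s" "vec.dim U + s = CARD('n)"
    "\<And>N w u. N \<in> congr g L \<Longrightarrow> w \<in> W \<Longrightarrow> u \<in> U \<Longrightarrow> w \<odot> (N *v u) = 0"
    using compression_if_comp_crit[OF gL two d n g(2)] by blast
  have "compressible \<rho> s (congr g L)"
    using d(1) WU(6) by (intro compressibleI[OF gL(2) WU(1-5)]) auto
  then show ?thesis by (rule compressible_congr[OF g(1)])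
qed

section \<open>Irreducibility of a single compression stratum\<close>

text \<open>Members are parametrised by a congruence matrix and \<open>k + 1\<close> matrices of the
  standard compression space, so by part of a vector space; a line there is the required rational
  curve.\<close>

lemma irreducible_if_compressible:
  fixes k \<rho> s :: nat
  defines "F \<equiv> topspace (fano_space k (\<rho> + 1) :: ('a::alg_closed_field^'n^'n) set topology)"
  assumes s: "2 * s \<le> \<rho>" "\<rho> < CARD('n)" and ne: "F \<noteq> {}"
    and comp: "\<And>L. L \<in> F \<Longrightarrow> compressible \<rho> s L"
  shows "irreducible_space (fano_space k (\<rho> + 1) :: ('a^'n^'n) set topology)"
proof (rule irreducible_fano_spaceI)
  let ?E = "coord_space (cweights TYPE('n) \<rho> s) :: ('a^'n^'n) set"
  show "topspace (fano_space k (\<rho> + 1) :: ('a^'n^'n) set topology) \<noteq> {}" using ne by (simp add: F_def)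
  have par: "\<exists>g b vs. invertible g \<and> ordered_basis L vs \<and> length vs = k + 1 \<and>
      (\<forall>a<k + 1. b a \<in> ?E \<and> vs ! a = g ** b a ** transpose g)" if L: "L \<in> F" for L
  proof -
    note LD = fano_memberD[OF L[unfolded F_def]]
    obtain g where g: "invertible g" "L \<subseteq> congr g ?E" using comp[OF L] unfolding compressible_def by blast
    obtain vs where vs: "ordered_basis L vs" using ordered_basis_exists[OF LD(1)] by blast
    have len: "length vs = k + 1"
      using vs LD(2) distinct_card[of vs] mspace.dim_span_eq_card_independent[of "set vs"]
      by (simp add: ordered_basis_def)
    have "\<forall>a. a < k + 1 \<longrightarrow> (\<exists>b. b \<in> ?E \<and> vs ! a = g ** b ** transpose g)"
    proof (intro allI impI)
      fix a assume "a < k + 1"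
      then have "vs ! a \<in> L" using vs len unfolding ordered_basis_def by (metis mspace.span_base nth_mem)
      then have "vs ! a \<in> congr g ?E" using g(2) by blast
      then show "\<exists>b. b \<in> ?E \<and> vs ! a = g ** b ** transpose g" unfolding congr_def by blast
    qed
    then obtain b where "\<forall>a. a < k + 1 \<longrightarrow> b a \<in> ?E \<and> vs ! a = g ** b a ** transpose g" by metis
    then show ?thesis using g(1) vs len by blast
  qed
  fix L1 L2 :: "('a^'n^'n) set"
  assume "L1 \<in> topspace (fano_space k (\<rho> + 1))" "L2 \<in> topspace (fano_space k (\<rho> + 1))"
  then have L: "L1 \<in> F" "L2 \<in> F" by (auto simp: F_def)
  obtain g1 b1 vs1 where 1: "invertible g1" "ordered_basis L1 vs1" "length vs1 = k + 1"
    "\<forall>a<k + 1. b1 a \<in> ?E \<and> vs1 ! a = g1 ** b1 a ** transpose g1" using par[OF L(1)] by blast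
  obtain g2 b2 vs2 where 2: "invertible g2" "ordered_basis L2 vs2" "length vs2 = k + 1"
    "\<forall>a<k + 1. b2 a \<in> ?E \<and> vs2 ! a = g2 ** b2 a ** transpose g2" using par[OF L(2)] by blast
  define gt where "gt t = g1 + mscale t (g2 - g1)" for t
  define bt where "bt t a = b1 a + mscale t (b2 a - b1 a)" for t a
  define gp where "gp i p = [:g1 $ i $ p, g2 $ i $ p - g1 $ i $ p:]" for i p
  define bp where "bp a p q = [:b1 a $ p $ q, b2 a $ p $ q - b1 a $ p $ q:]" for a p q
  define c where "c = (\<lambda>(a, i, j). \<Sum>p\<in>UNIV. \<Sum>q\<in>UNIV. gp i p * bp a p q * gp j q)"
  \<comment> \<open>The interpolated congruence matrix may be singular at some parameters;
    \<open>D\<close> excludes them.\<close>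
  define D where "D = det (\<chi> i p. gp i p)"
  have ct: "(\<chi> i j. poly (c (a, i, j)) t) = gt t ** bt t a ** transpose (gt t)" for a t
    unfolding Finite_Cartesian_Product.vec_eq_iff congruence_nth c_def gp_def bp_def gt_def bt_def
    by (simp add: poly_sum poly_mult del: mult_pCons_left mult_pCons_right)
  have Dt: "poly D t = det (gt t)" for t
    unfolding D_def poly_det
    by (intro arg_cong[where f = det]) (simp add: Finite_Cartesian_Product.vec_eq_iff gp_def gt_def)
  have g0: "gt 0 = g1" "gt 1 = g2" "bt 0 = b1" "bt 1 = b2"
    by (auto simp: gt_def bt_def Finite_Cartesian_Product.vec_eq_iff fun_eq_iff)
  have basis1: "map (\<lambda>a. \<chi> i j. poly (c (a, i, j)) 0) [0..<k + 1] = vs1"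
    using 1(3,4) by (intro nth_equalityI) (simp_all add: ct g0 del: upt_Suc)
  have basis2: "map (\<lambda>a. \<chi> i j. poly (c (a, i, j)) 1) [0..<k + 1] = vs2"
    using 2(3,4) by (intro nth_equalityI) (simp_all add: ct g0 del: upt_Suc)
  have "D \<noteq> 0" using Dt[of 0] 1(1) unfolding g0 invertible_det_nz by auto
  moreover have "mspace.span (set (map (\<lambda>a. \<chi> i j. poly (c (a, i, j)) t) [0..<k + 1])) \<subseteq> sym_det_cone (\<rho> + 1)"
    if t: "poly D t \<noteq> 0" for t
  proof -
    have inv: "invertible (gt t)" using t by (simp add: Dt invertible_det_nz)
    have "bt t a \<in> ?E" if "a < k + 1" for a
      unfolding bt_def using 1(4) 2(4) that
      by (intro mspace.subspace_add mspace.subspace_scale mspace.subspace_diff subspace_coord_space) auto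
    then have "set (map (\<lambda>a. \<chi> i j. poly (c (a, i, j)) t) [0..<k + 1]) \<subseteq> congr (gt t) ?E"
      unfolding ct congr_def by auto
    then have "mspace.span (set (map (\<lambda>a. \<chi> i j. poly (c (a, i, j)) t) [0..<k + 1])) \<subseteq> congr (gt t) ?E"
      by (rule mspace.span_minimal[OF _ subspace_congr[OF subspace_coord_space]])
    also have "\<dots> \<subseteq> sym_det_cone (\<rho> + 1)"
    proof
      fix N assume "N \<in> congr (gt t) ?E"
      then obtain M where M: "M \<in> ?E" "N = gt t ** M ** transpose (gt t)" unfolding congr_def by blast
      have "transpose M = M" using M(1) by (simp add: coord_space_def)
      then have "transpose N = N" unfolding M(2) by (rule transpose_congruence)
      moreover have "rank N \<le> \<rho>" unfolding M(2) rank_congruence[OF inv]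
        using rank_coord_space_cweights[OF M(1) s(1)] s(2) by simp
      ultimately show "N \<in> sym_det_cone (\<rho> + 1)" by (simp add: sym_det_cone_def symmetric_matrices_def)
    qed
    finally show ?thesis .
  qed
  ultimately show "\<exists>c D. ordered_basis L1 (map (\<lambda>a. \<chi> i j. poly (c (a, i, j)) 0) [0..<k + 1]) \<and>
        ordered_basis L2 (map (\<lambda>a. \<chi> i j. poly (c (a, i, j)) 1) [0..<k + 1]) \<and> D \<noteq> 0 \<and>
        (\<forall>t. poly D t \<noteq> 0 \<longrightarrow>
          mspace.span (set (map (\<lambda>a. \<chi> i j. poly (c (a, i, j)) t) [0..<k + 1])) \<subseteq> sym_det_cone (\<rho> + 1))"
    using 1(2) 2(2) by (intro exI[of _ c] exI[of _ D]) (simp only: basis1 basis2, blast)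
qed

section \<open>Excluding compression strata\<close>

text \<open>Vanishes on all spaces with a common kernel of codimension \<open>\<rho>\<close>.\<close>

definition bordered_det :: "nat \<Rightarrow> (nat \<times> 'n::finite \<times> 'n \<Rightarrow> 'a) \<Rightarrow> 'a::field" where
  "bordered_det \<rho> x = det ((layer 0 x + matrix_unit (elt \<rho>, elt 0) ** layer 1 x)
     + (\<chi> i j. if i = j \<and> \<rho> < idx i then 1 else 0))"

lemma poly_fun_bordered_det: "poly_fun (bordered_det \<rho> :: (nat \<times> 'n::finite \<times> 'n \<Rightarrow> 'a) \<Rightarrow> 'a::field)"
  unfolding bordered_det_def[abs_def]
proof (rule poly_fun_det)
  fix i j :: 'n
  show "poly_fun (\<lambda>x. ((layer 0 x + matrix_unit (elt \<rho>, elt 0) ** layer 1 x)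
     + (\<chi> i j. if i = j \<and> \<rho> < idx i then 1 else 0)) $ i $ j :: 'a)"
    unfolding vector_add_component matrix_matrix_mult_def vec_lambda_beta layer_nth
    by (intro poly_fun.add poly_fun_sum poly_fun.mult poly_fun.const poly_fun.coord)
qed

text \<open>Multiplying a member from the left keeps the common kernel, so the first summand has
  rank at most \<rho>, while the diagonal one has rank at most
  \<open>n - \<rho> - 1\<close>.\<close>

lemma bordered_det_eq_0:
  fixes A :: "'a::field^'n^'n"
  assumes M: "range M \<subseteq> L" and \<rho>: "\<rho> < CARD('n)"
    and A: "rank A = \<rho>" "\<forall>N\<in>L. \<forall>v. A *v v = 0 \<longrightarrow> N *v v = 0"
  shows "bordered_det \<rho> (entries M) = 0"
  unfolding bordered_det_def layer_entries
proof (rule det_add_eq_0)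
  let ?B = "M 0 + matrix_unit (elt \<rho>, elt 0) ** M 1"
  let ?X = "(\<chi> i j. if i = j \<and> \<rho> < idx i then 1 else 0) :: 'a^'n^'n"
  have memL: "M l \<in> L" for l using M by auto
  have "{v. A *v v = 0} \<subseteq> {v. ?B *v v = 0}"
  proof (rule subsetI, unfold mem_Collect_eq)
    fix v assume "A *v v = 0"
    then have "M 0 *v v = 0" "M 1 *v v = 0" using A(2) memL by auto
    then show "?B *v v = 0"
      by (simp add: matrix_vector_mult_add_rdistrib matrix_vector_mul_assoc[symmetric])
  qed
  then have "vec.dim {v. A *v v = 0} \<le> vec.dim {v. ?B *v v = 0}" by (rule vec.dim_subset)
  then have "rank ?B \<le> \<rho>" using dim_kernel[of A] dim_kernel[of ?B] A(1) by linarith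
  moreover have "{v. \<forall>i. i \<notin> {i :: 'n. idx i < \<rho> + 1} \<longrightarrow> v $ i = 0} \<subseteq> {v. ?X *v v = 0}"
  proof (rule subsetI, unfold mem_Collect_eq)
    fix v :: "'a^'n" assume v: "\<forall>i. \<not> idx i < \<rho> + 1 \<longrightarrow> v $ i = 0"
    have "(?X *v v) $ i = 0" for i
      unfolding matrix_vector_mult_def vec_lambda_beta using v
      by (intro sum.neutral) auto
    then show "?X *v v = 0" by (simp add: Finite_Cartesian_Product.vec_eq_iff)
  qed
  then have "vec.dim {v :: 'a^'n. \<forall>i. i \<notin> {i :: 'n. idx i < \<rho> + 1} \<longrightarrow> v $ i = 0} \<le> vec.dim {v. ?X *v v = 0}"
    by (rule vec.dim_subset)
  then have "\<rho> + 1 \<le> vec.dim {v. ?X *v v = 0}"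
    unfolding dim_substandard_cart using card_idx_less[of "\<rho> + 1", where ?'n = 'n] \<rho> by simp
  ultimately show "rank ?B + rank ?X < CARD('n)" using dim_kernel[of ?X] by linarith
qed

text \<open>Row 0 of the second matrix, moved to row \<rho>, supplies the diagonal entry at \<rho>
  that the antidiagonal of size \<rho> lacks; the sum is a permutation matrix.\<close>

lemma bordered_det_test:
  assumes \<rho>: "0 < \<rho>" "\<rho> < CARD('n::finite)"
    and M: "M 0 = pencil_A \<rho>" "M 1 = (symm_unit (wt (elt 0 :: 'n) (elt \<rho>)) :: 'a::field^'n^'n)"
  shows "bordered_det \<rho> (entries M) \<noteq> 0"
proof -
  define Y :: "'a^'n^'n" where "Y = (M 0 + matrix_unit (elt \<rho>, elt 0) ** M 1)
     + (\<chi> i j. if i = j \<and> \<rho> < idx i then 1 else 0)"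
  define \<sigma> :: "'n \<Rightarrow> 'n" where "\<sigma> i = (if idx i < \<rho> then elt (\<rho> - Suc (idx i)) else i)" for i
  have \<sigma>: "\<sigma> (\<sigma> i) = i" for i using \<rho> by (auto simp: \<sigma>_def)
  have Q: "(matrix_unit (elt \<rho>, elt 0) ** M 1) $ i $ j = (if idx i = \<rho> \<and> j = i then 1 else 0)" for i j
  proof -
    have "(matrix_unit (elt \<rho>, elt 0) ** M 1) $ i $ j
        = (\<Sum>k\<in>UNIV. (if (elt \<rho>, elt 0) = (i, k) then 1 else 0) * (if wt k j = wt (elt 0 :: 'n) (elt \<rho>) then 1 else 0))"
      unfolding matrix_matrix_mult_def M(2) symm_unit_def by simp
    also have "\<dots> = (\<Sum>k\<in>UNIV. if k = (elt 0 :: 'n) then (if elt \<rho> = i \<and> wt (elt 0) j = wt (elt 0 :: 'n) (elt \<rho>) then 1 else 0) else 0)"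
      by (intro sum.cong) auto
    also have "\<dots> = (if elt \<rho> = i \<and> wt (elt 0) j = wt (elt 0 :: 'n) (elt \<rho>) then 1 else 0)" by simp
    also have "\<dots> = (if idx i = \<rho> \<and> j = i then 1 else 0)"
      using \<rho>(2) eq_elt_iff[OF \<rho>(2), of i] by (auto simp: wt_eq_iff)
    finally show ?thesis .
  qed
  have Y: "Y $ i $ j = (if j = \<sigma> i then 1 else 0)" for i j
  proof -
    have e: "j = elt (\<rho> - Suc (idx i)) \<longleftrightarrow> idx j = \<rho> - Suc (idx i)" using \<rho> by (intro eq_elt_iff) simp
    have Yij: "Y $ i $ j = (if idx i + idx j + 1 = \<rho> then 1 else 0) + (if idx i = \<rho> \<and> j = i then 1 else 0)
        + (if i = j \<and> \<rho> < idx i then 1 else 0)"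
      unfolding Y_def vector_add_component Q M(1) pencil_A_def by simp
    show ?thesis
    proof (cases "idx i < \<rho>")
      case True
      then have "\<sigma> i = elt (\<rho> - Suc (idx i))" by (simp add: \<sigma>_def)
      then have "j = \<sigma> i \<longleftrightarrow> idx j = \<rho> - Suc (idx i)" using e by (simp only:)
      then have "j = \<sigma> i \<longleftrightarrow> idx i + idx j + 1 = \<rho>" using True by linarith
      moreover have "idx i \<noteq> \<rho>" "\<not> \<rho> < idx i" using True by auto
      ultimately show ?thesis unfolding Yij by (simp only: simp_thms if_True if_False add_0_right)
    next
      case False
      then have "\<sigma> i = i" "idx i + idx j + 1 \<noteq> \<rho>" by (auto simp: \<sigma>_def)
      then show ?thesis unfolding Yij using False by (cases "idx i = \<rho>") auto
    qed
  qed
  have "det (principal_block UNIV Y) \<noteq> 0"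
    by (rule det_principal_block_involution[where \<sigma> = \<sigma> and c = "\<lambda>_. 1"]) (simp_all add: \<sigma> Y)
  moreover have "principal_block UNIV Y = Y" by (simp add: principal_block_def Finite_Cartesian_Product.vec_eq_iff)
  ultimately show ?thesis by (simp add: bordered_det_def Y_def)
qed

text \<open>Nonzero only if the restriction to symmetric matrices on the index set \<open>{i. idx i < m}\<close>
  is surjective.\<close>

definition restriction_det :: "nat \<Rightarrow> (nat \<times> 'n::finite \<times> 'n \<Rightarrow> 'a) \<Rightarrow> 'a::field" where
  "restriction_det m x = det (principal_block {p. idx (fst p) \<le> idx (snd p) \<and> idx (snd p) < m}
     ((\<chi> q p. layer (prod_encode (idx (fst p), idx (snd p))) x $ fst q $ snd q) :: 'a^('n \<times> 'n)^('n \<times> 'n)))"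

lemma poly_fun_restriction_det: "poly_fun (restriction_det m :: (nat \<times> 'n::finite \<times> 'n \<Rightarrow> 'a) \<Rightarrow> 'a::field)"
  unfolding restriction_det_def[abs_def]
  by (intro poly_fun_det poly_fun_principal_block) (simp add: poly_fun.coord)

text \<open>Choose a member that restricts to the diagonal matrix unit at an index \<open>i0\<close>
  with \<open>c $ i0 \<noteq> 0\<close>; its value at \<open>c\<close> is the square of that
  coordinate.\<close>

lemma exists_nonisotropic_if_restriction_det:
  fixes L :: "('a::field^'n^'n) set"
  assumes L: "mspace.subspace L" "\<And>M. M \<in> L \<Longrightarrow> transpose M = M"
    and M: "range M \<subseteq> L" "restriction_det m (entries M) \<noteq> 0"
    and c: "c \<noteq> 0" "\<And>i. m \<le> idx i \<Longrightarrow> c $ i = 0"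
  shows "\<exists>N\<in>L. c \<odot> (N *v c) \<noteq> 0"
proof -
  define Q where "Q = {p :: 'n \<times> 'n. idx (fst p) \<le> idx (snd p) \<and> idx (snd p) < m}"
  define e where "e = (\<lambda>p :: 'n \<times> 'n. prod_encode (idx (fst p), idx (snd p)))"
  obtain i0 where i0: "c $ i0 \<noteq> 0" using c(1) by (auto simp: Finite_Cartesian_Product.vec_eq_iff)
  have "det (principal_block Q ((\<chi> q p. M (e p) $ fst q $ snd q) :: 'a^('n \<times> 'n)^('n \<times> 'n))) \<noteq> 0"
    using M(2) by (simp add: restriction_det_def Q_def e_def)
  from principal_block_solve[OF this, of "\<lambda>q. if q = (i0, i0) then 1 else 0"]
  obtain v where v: "\<forall>q\<in>Q. (\<Sum>p\<in>Q. M (e p) $ fst q $ snd q * v $ p) = (if q = (i0, i0) then 1 else 0)"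
    by auto
  define N where "N = (\<Sum>p\<in>Q. mscale (v $ p) (M (e p)))"
  have memL: "M l \<in> L" for l using M(1) by auto
  have N: "N \<in> L" unfolding N_def by (intro mspace.subspace_sum mspace.subspace_scale L(1) memL)
  have NQ: "N $ i $ j = (if i = i0 \<and> j = i0 then 1 else 0)" if "idx i \<le> idx j" "idx j < m" for i j
    using v[rule_format, of "(i, j)"] that by (simp add: N_def Q_def sum_nth_nth mult.commute)
  have Nij: "N $ i $ j = (if i = i0 \<and> j = i0 then 1 else 0)" if ij: "idx i < m" "idx j < m" for i j
  proof (cases "idx i \<le> idx j")
    case False
    have "N $ i $ j = N $ j $ i" using L(2)[OF N] unfolding transpose_eq_iff by blast
    then show ?thesis using NQ[of j i] False ij by auto
  qed (use NQ ij in auto)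
  have "c $ i * (N $ i $ j * c $ j) = (if j = i0 then if i = i0 then c $ i0 * c $ i0 else 0 else 0)" for i j
    using Nij[of i j] c(2)[of i] c(2)[of j] by (cases "idx i < m"; cases "idx j < m") auto
  then have "c \<odot> (N *v c) = (\<Sum>i\<in>UNIV. \<Sum>j\<in>UNIV. if j = i0 then if i = i0 then c $ i0 * c $ i0 else 0 else 0)"
    by (simp add: scalar_product_def matrix_vector_mult_def sum_distrib_left)
  also have "\<dots> = c $ i0 * c $ i0" by simp
  finally have "c \<odot> (N *v c) \<noteq> 0" using i0 by simp
  then show ?thesis using N by (rule bexI)
qed

text \<open>By dimension, \<open>W\<close> contains a nonzero vector supported on the first
  \<open>m\<close> indices, and all members vanish quadratically on it.\<close>

lemma restriction_det_compression:
  fixes L :: "('a::field^'n^'n) set"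
  assumes L: "mspace.subspace L" "\<And>M. M \<in> L \<Longrightarrow> transpose M = M"
    and W: "vec.subspace W" "CARD('n) < vec.dim W + m" "\<And>N w. N \<in> L \<Longrightarrow> w \<in> W \<Longrightarrow> w \<odot> (N *v w) = 0"
    and m: "m \<le> CARD('n)"
  shows "vanishes_on (restriction_det m) L"
proof (rule ccontr)
  assume "\<not> ?thesis"
  then obtain M where M: "range M \<subseteq> L" "restriction_det m (entries M) \<noteq> 0" by (rule not_vanishes_onE)
  define K where "K = {v :: 'a^'n. \<forall>i. i \<notin> {i. idx i < m} \<longrightarrow> v $ i = 0}"
  have K: "vec.subspace K" unfolding vec.subspace_def K_def by auto
  have dK: "vec.dim K = m" unfolding K_def dim_substandard_cart by (rule card_idx_less[OF m])
  have "vec.dim {x + y |x y. x \<in> W \<and> y \<in> K} \<le> vec.dim (UNIV :: ('a^'n) set)"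
    by (rule vec.dim_subset) simp
  then have "vec.dim {x + y |x y. x \<in> W \<and> y \<in> K} \<le> CARD('n)" by (simp only: vec_dim_card)
  then have "vec.dim (W \<inter> K) \<noteq> 0" using vec.dim_sums_Int[OF W(1) K] dK W(2) by linarith
  then obtain c where c: "c \<in> W" "c \<in> K" "c \<noteq> 0" by auto
  have "\<exists>N\<in>L. c \<odot> (N *v c) \<noteq> 0"
    by (rule exists_nonisotropic_if_restriction_det[OF L M c(3)]) (use c(2) in \<open>auto simp: K_def\<close>)
  then show False using W(3) c(1) by blast
qed

lemma restriction_det_test:
  assumes m: "m \<le> CARD('n::finite)"
    and L: "coord_space (cweights TYPE('n) m 0) \<subseteq> (L :: ('a::field^'n^'n) set)"
  shows "\<not> vanishes_on (restriction_det m) L"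
proof (rule not_vanishes_onI)
  let ?M = "\<lambda>l. case prod_decode l of (a, b) \<Rightarrow>
     if a < m \<and> b < m then symm_unit (wt (elt a :: 'n) (elt b)) else (0 :: 'a^'n^'n)"
  have zero: "(0 :: 'a^'n^'n) \<in> coord_space (cweights TYPE('n) m 0)" by (rule mspace.subspace_0[OF subspace_coord_space])
  have "?M l \<in> coord_space (cweights TYPE('n) m 0)" for l
  proof -
    obtain a b where ab: "prod_decode l = (a, b)" by fastforce
    have "wt (elt a :: 'n) (elt b) \<in> cweights TYPE('n) m 0" if "a < m" "b < m"
      unfolding wt_in_cweights using that m by simp
    then show ?thesis using zero symm_unit_in_coord_space by (auto simp: ab)
  qed
  then show "range ?M \<subseteq> L" using L by blast
  show "restriction_det m (entries ?M) \<noteq> 0"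
    unfolding restriction_det_def
  proof (rule det_principal_block_involution[where \<sigma> = "\<lambda>q. q" and c = "\<lambda>_. 1"])
    fix q p :: "'n \<times> 'n"
    assume "q \<in> {p. idx (fst p) \<le> idx (snd p) \<and> idx (snd p) < m}" "p \<in> {p. idx (fst p) \<le> idx (snd p) \<and> idx (snd p) < m}"
    moreover obtain a b c d where [simp]: "q = (a, b)" "p = (c, d)" by fastforce
    ultimately have "idx a \<le> idx b" "idx b < m" "idx c \<le> idx d" "idx d < m" by auto
    then show "(\<chi> q p. layer (prod_encode (idx (fst p), idx (snd p))) (entries ?M) $ fst q $ snd q) $ q $ p
        = (if p = q then 1 else 0)"
      unfolding layer_entries by (auto simp: symm_unit_def wt_eq_iff)
  qed auto
qed

section \<open>Reducibility\<close>

lemma poly_fun_comp_crit: "poly_fun (comp_crit TYPE('n::finite) s d :: (nat \<times> 'n \<times> 'n \<Rightarrow> 'a) \<Rightarrow> 'a::field)"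
  unfolding comp_crit_def by (rule poly_fun_compression_disc)

lemma pencil_in_coord_space_cweights:
  "(pencil_A \<rho> :: 'a::field^'n::finite^'n) \<in> coord_space (cweights TYPE('n) \<rho> s)"
  "2 \<le> \<rho> \<Longrightarrow> (pencil_B \<rho> :: 'a^'n^'n) \<in> coord_space (cweights TYPE('n) \<rho> 0)"
proof -
  show "(pencil_A \<rho> :: 'a^'n^'n) \<in> coord_space (cweights TYPE('n) \<rho> s)"
    unfolding coord_space_def mem_Collect_eq transpose_eq_iff wt_in_cweights
    by (auto simp: pencil_A_def add.commute split: if_splits)
  assume \<rho>: "2 \<le> \<rho>"
  show "(pencil_B \<rho> :: 'a^'n^'n) \<in> coord_space (cweights TYPE('n) \<rho> 0)"
    unfolding coord_space_def mem_Collect_eq transpose_eq_iff wt_in_cweights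
  proof (intro conjI allI impI)
    fix i j :: 'n
    show "(pencil_B \<rho> :: 'a^'n^'n) $ i $ j = pencil_B \<rho> $ j $ i"
      by (simp add: pencil_B_def add.commute conj_commute)
    assume "(pencil_B \<rho> :: 'a^'n^'n) $ i $ j \<noteq> 0"
    then have "(idx i < \<rho> \<and> idx j < \<rho>) \<or> idx i + idx j \<le> 1"
      by (auto simp: pencil_B_def split: if_splits)
    then show "idx i < 0 \<or> idx j < 0 \<or> idx i < \<rho> - 0 \<and> idx j < \<rho> - 0" using \<rho> by auto
  qed
qed

lemma dim_le_card_mspace: "finite T \<Longrightarrow> mspace.dim T \<le> card T"
  using mspace.dim_le_card[of T T] mspace.span_superset[of T] by blast

text \<open>The two tests exclude each other: \<open>pencil_disc\<close> forces a common kernel of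
  codimension \<rho>, on which \<open>bordered_det\<close> vanishes.\<close>

lemma fano_space_not_irreducible_low:
  assumes irr: "irreducible_space (fano_space k (\<rho> + 1) :: ('a::alg_closed_field^'n^'n) set topology)"
    and two: "(2::'a) \<noteq> 0" and \<rho>: "2 \<le> \<rho>" "\<rho> < CARD('n)" and s: "0 < s" "2 * s \<le> \<rho>" and k: "1 \<le> k"
  shows "\<not> (int k \<le> kappa CARD('n) (\<rho> + 1) 0 \<and> int k \<le> kappa CARD('n) (\<rho> + 1) s)"
proof
  assume le: "int k \<le> kappa CARD('n) (\<rho> + 1) 0 \<and> int k \<le> kappa CARD('n) (\<rho> + 1) s"
  have \<rho>': "0 < \<rho>" "\<rho> \<le> CARD('n)" and s0: "2 * 0 \<le> \<rho>" using \<rho> by auto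
  \<comment> \<open>Each witness consists of two matrices, for which \<open>k \<ge> 1\<close> leaves
    room.\<close>
  have dim2: "mspace.dim {A, B :: 'a^'n^'n} \<le> k + 1" for A B
  proof -
    have "card {A, B} \<le> k + 1" using k card_insert_le_m1[of 2 "{B}" A] by (auto simp: card_insert_if)
    then show ?thesis using dim_le_card_mspace[of "{A, B}"] by simp
  qed
  have "{pencil_A \<rho>, pencil_B \<rho> :: 'a^'n^'n} \<subseteq> coord_space (cweights TYPE('n) \<rho> 0)"
    using pencil_in_coord_space_cweights(1) pencil_in_coord_space_cweights(2)[OF \<rho>(1)] by auto
  from exists_fano_member[OF this dim2 s0 \<rho>(2) conjunct1[OF le]]
  obtain L1 :: "('a^'n^'n) set" where L1: "L1 \<in> topspace (fano_space k (\<rho> + 1))" "{pencil_A \<rho>, pencil_B \<rho>} \<subseteq> L1"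
    "L1 \<subseteq> coord_space (cweights TYPE('n) \<rho> 0)" .
  have zero: "0 \<in> L1" using fano_memberD(1)[OF L1(1)] by (rule mspace.subspace_0)
  have n1: "\<not> vanishes_on (pencil_disc {i. idx i < \<rho>}) L1"
  proof (rule not_vanishes_onI)
    show "range (\<lambda>l::nat. if l = 0 then pencil_A \<rho> else if l = 1 then pencil_B \<rho> else (0 :: 'a^'n^'n)) \<subseteq> L1"
      using L1(2) zero by auto
  qed (rule pencil_disc_test[OF \<rho>(1) \<rho>'(2) two])
  have "wt (elt 0 :: 'n) (elt \<rho>) \<in> cweights TYPE('n) \<rho> s" unfolding wt_in_cweights using s(1) by simp
  then have "{pencil_A \<rho>, symm_unit (wt (elt 0 :: 'n) (elt \<rho>)) :: 'a^'n^'n} \<subseteq> coord_space (cweights TYPE('n) \<rho> s)"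
    using pencil_in_coord_space_cweights(1) symm_unit_in_coord_space by auto
  from exists_fano_member[OF this dim2 s(2) \<rho>(2) conjunct2[OF le]]
  obtain L2 :: "('a^'n^'n) set" where L2: "L2 \<in> topspace (fano_space k (\<rho> + 1))"
      "{pencil_A \<rho>, symm_unit (wt (elt 0 :: 'n) (elt \<rho>))} \<subseteq> L2"
      "L2 \<subseteq> coord_space (cweights TYPE('n) \<rho> s)" .
  have n2: "\<not> vanishes_on (bordered_det \<rho>) L2"
  proof (rule not_vanishes_onI)
    show "range (\<lambda>l::nat. if l = 0 then pencil_A \<rho> else symm_unit (wt (elt 0 :: 'n) (elt \<rho>)) :: 'a^'n^'n) \<subseteq> L2"
      using L2(2) by auto
  qed (rule bordered_det_test[OF \<rho>'(1) \<rho>(2)], simp_all)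
  obtain L :: "('a^'n^'n) set" where L: "L \<in> topspace (fano_space k (\<rho> + 1))"
      "\<not> vanishes_on (pencil_disc {i. idx i < \<rho>}) L" "\<not> vanishes_on (bordered_det \<rho>) L"
    by (rule irreducible_fano_space_meet[OF irr poly_fun_pencil_disc poly_fun_bordered_det L1(1) n1 L2(1) n2])
  note LD = fano_memberD[OF L(1)]
  obtain A :: "'a^'n^'n" where A: "rank A = \<rho>" "\<forall>N\<in>L. \<forall>v. A *v v = 0 \<longrightarrow> N *v v = 0"
    by (rule compressible_0_if_pencil_disc[OF LD(1,3,4) \<rho>' L(2)])
  then show False using L(3) bordered_det_eq_0[OF _ \<rho>(2) A] unfolding vanishes_on_def by blast
qed

lemma shifted_cweights:
  assumes "2 * s \<le> \<rho>"
  shows "shifted TYPE('n::finite) (cweights TYPE('n) \<rho> s)"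
  unfolding shifted_def wt_in_cweights by auto

lemma fano_space_not_irreducible_high:
  assumes irr: "irreducible_space (fano_space k (\<rho> + 1) :: ('a::alg_closed_field^'n^'n) set topology)"
    and two: "(2::'a) \<noteq> 0" and \<rho>: "\<rho> < CARD('n)"
    and d: "\<rho> = 2 * s + (d - 2)" "d = 2 \<or> d = 3" and s: "0 < s"
    and k: "kappa CARD('n) (\<rho> + 1) 0 < int k"
  shows "\<not> (int k \<le> kappa CARD('n) (\<rho> + 1) s \<and> int k \<le> kappa CARD('n) (\<rho> + 1) (s - 1))"
proof
  assume le: "int k \<le> kappa CARD('n) (\<rho> + 1) s \<and> int k \<le> kappa CARD('n) (\<rho> + 1) (s - 1)"
  have s2: "2 * s \<le> \<rho>" "2 * (s - 1) \<le> \<rho>" using d(1) by auto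
  have n: "2 * s + d \<le> CARD('n)" using size_bound_if_kappa_larger[OF d s] k le by simp
  \<comment> \<open>Since \<open>\<kappa>(0) < k\<close>, the number \<open>k + 1\<close> exceeds
    the number of symmetric positions in a block of size \<rho>; this gives room for both witnesses
    below.\<close>
  have tri: "\<rho> * (\<rho> + 1) div 2 \<le> k"
  proof -
    have "int \<rho> * int \<rho> + int \<rho> - 2 < 2 * int k" using kappa_form[of 0 \<rho> "CARD('n)"] k by simp
    then have "int (\<rho> * (\<rho> + 1)) < 2 * int k + 2" by (simp add: algebra_simps)
    then show ?thesis by linarith
  qed
  have d0: "0 < d" using d(2) by auto
  have "wt (elt i :: 'n) (elt (2 * s + d - 1 - i)) \<in> cweights TYPE('n) \<rho> s" if "i < s" for i
    unfolding wt_in_cweights using that n by simp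
  from comp_crit_tuple[OF n shifted_cweights[OF s2(1)] d0 this, where ?'a = 'a]
  obtain M :: "nat \<Rightarrow> 'a^'n^'n" where M: "range M \<subseteq> coord_space (cweights TYPE('n) \<rho> s)" "finite (range M)"
      "card (range M) \<le> s * d + 2" "comp_crit TYPE('n) s d (entries M) \<noteq> 0" .
  have "s * d + 1 \<le> \<rho> * (\<rho> + 1) div 2"
  proof -
    have "2 * (s * d + 1) \<le> \<rho> * (\<rho> + 1)"
    proof -
      obtain t where t: "s = Suc t" using s gr0_implies_Suc by blast
      from d(2) show ?thesis using d(1) unfolding t by (auto simp: algebra_simps)
    qed
    then have "2 * (s * d + 1) div 2 \<le> \<rho> * (\<rho> + 1) div 2" by (rule div_le_mono)
    then show ?thesis by simp
  qed
  then have "mspace.dim (range M) \<le> k + 1" using dim_le_card_mspace[OF M(2)] M(3) tri by linarith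
  from exists_fano_member[OF M(1) this s2(1) \<rho> conjunct1[OF le]]
  obtain L1 :: "('a^'n^'n) set" where L1: "L1 \<in> topspace (fano_space k (\<rho> + 1))" "range M \<subseteq> L1"
    "L1 \<subseteq> coord_space (cweights TYPE('n) \<rho> s)" .
  have n1: "\<not> vanishes_on (comp_crit TYPE('n) s d) L1" using L1(2) M(4) by (rule not_vanishes_onI)
  \<comment> \<open>The size of the largest leading block that the
    \<open>(s - 1)\<close>-compression space fills completely. For the \<open>W\<close> of the
    \<open>s\<close>-compression, \<open>dim W + m = n + 1\<close>, just enough to meet the vectors
    supported on the block.\<close>
  define m where "m = \<rho> - (s - 1)"
  have m: "m \<le> \<rho>" "m \<le> CARD('n)" using \<rho> by (auto simp: m_def)
  have sub: "cweights TYPE('n) m 0 \<subseteq> cweights TYPE('n) \<rho> (s - 1)"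
    unfolding cweights_def m_def by auto
  then have sub': "coord_space (cweights TYPE('n) m 0) \<subseteq> (coord_space (cweights TYPE('n) \<rho> (s - 1)) :: ('a^'n^'n) set)"
    unfolding coord_space_def by auto
  have "mspace.dim (coord_space (cweights TYPE('n) m 0) :: ('a^'n^'n) set) = card (cweights TYPE('n) m 0)"
    by (rule dim_coord_space[OF cweights_subset])
  also have "\<dots> \<le> k + 1"
  proof -
    have "int (card (cweights TYPE('n) m 0)) = kappa CARD('n) (m + 1) 0 + 1"
      using m(1) \<rho> by (intro card_cweights) auto
    moreover have "int m * int m \<le> int \<rho> * int \<rho>" using m(1) by (intro mult_mono) auto
    ultimately show ?thesis
      using kappa_form[of 0 m "CARD('n)"] kappa_form[of 0 \<rho> "CARD('n)"] k m(1) by simp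
  qed
  finally have "mspace.dim (coord_space (cweights TYPE('n) m 0) :: ('a^'n^'n) set) \<le> k + 1" .
  from exists_fano_member[OF sub' this s2(2) \<rho> conjunct2[OF le]]
  obtain L2 :: "('a^'n^'n) set" where L2: "L2 \<in> topspace (fano_space k (\<rho> + 1))"
    "coord_space (cweights TYPE('n) m 0) \<subseteq> L2" "L2 \<subseteq> coord_space (cweights TYPE('n) \<rho> (s - 1))" .
  have n2: "\<not> vanishes_on (restriction_det m) L2" by (rule restriction_det_test[OF m(2) L2(2)])
  obtain L :: "('a^'n^'n) set" where L: "L \<in> topspace (fano_space k (\<rho> + 1))"
      "\<not> vanishes_on (comp_crit TYPE('n) s d) L" "\<not> vanishes_on (restriction_det m) L"
    by (rule irreducible_fano_space_meet[OF irr poly_fun_comp_crit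
          poly_fun_restriction_det L1(1) n1 L2(1) n2])
  note LD = fano_memberD[OF L(1)]
  obtain W U where WU: "vec.subspace W" "vec.subspace U" "W \<subseteq> U"
    "vec.dim W + \<rho> = CARD('n) + s" "vec.dim U + s = CARD('n)"
    "\<And>N w u. N \<in> L \<Longrightarrow> w \<in> W \<Longrightarrow> u \<in> U \<Longrightarrow> w \<odot> (N *v u) = 0"
    using compression_if_comp_crit[OF LD(1,3,4) two d n L(2)] by blast
  have dimW: "CARD('n) < vec.dim W + m" using WU(4) s d(1) by (simp add: m_def)
  have "vanishes_on (restriction_det m) L"
    by (rule restriction_det_compression[OF LD(1,3) WU(1) dimW _ m(2)]) (use WU(3,6) in blast)+
  then show False using L(3) by blast
qed

theorem theorem1p10:
  fixes r k :: nat
  assumes "CHAR('a::alg_closed_field) \<noteq> 2"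
    and "3 \<le> r" and "r \<le> CARD('n::finite)" and "1 \<le> k"
  shows "irreducible_space (fano_space k r :: ('a^'n^'n) set topology) \<longleftrightarrow>
    (let \<kappa> = kappa CARD('n) r; s_max = (r - 1) div 2 in
       max (\<kappa> 1) (\<kappa> s_max) < int k \<and> int k \<le> \<kappa> 0 \<or>
       max (\<kappa> 0) (\<kappa> (s_max - 1)) < int k \<and> int k \<le> \<kappa> s_max)"
proof -
  define \<rho> where "\<rho> = r - 1"
  define S where "S = \<rho> div 2"
  \<comment> \<open>\<open>d - 2\<close> is the parity of \<rho>: one more lifted vector is needed
    in the odd case to obtain two kernel vectors.\<close>
  define d where "d = 2 + \<rho> mod 2"
  define \<kappa> where "\<kappa> = kappa CARD('n) (\<rho> + 1)"
  let ?F = "fano_space k (\<rho> + 1) :: ('a^'n^'n) set topology"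
  have r: "r = \<rho> + 1" and \<rho>: "2 \<le> \<rho>" "\<rho> < CARD('n)" using assms by (auto simp: \<rho>_def)
  have S: "0 < S" "2 * S \<le> \<rho>" using \<rho> by (auto simp: S_def)
  have d: "\<rho> = 2 * S + (d - 2)" "d = 2 \<or> d = 3" by (auto simp: S_def d_def)
  have two: "(2::'a) \<noteq> 0"
  proof
    assume "(2::'a) = 0"
    then have "of_nat 2 = (0::'a)" by simp
    then have "CHAR('a) dvd 2" by (simp only: of_nat_eq_0_iff_char_dvd)
    then have "CHAR('a) = 1 \<or> CHAR('a) = 2" using two_is_prime_nat prime_nat_iff by metis
    then show False using assms(1) CHAR_not_1[where ?'a = 'a] by auto
  qed
  have leS: "t \<le> S" if "2 * t \<le> \<rho>" for t using that by (simp add: S_def)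
  have below: "\<kappa> t \<le> max (\<kappa> a) (\<kappa> b)" if "a \<le> t" "t \<le> b" "b \<le> S" for a b t
    unfolding \<kappa>_def by (rule kappa_convex) (use that S in auto)
  have nonempty: "topspace ?F \<noteq> {}" if s: "2 * s \<le> \<rho>" "int k \<le> \<kappa> s" for s
  proof -
    obtain L :: "('a^'n^'n) set" where "L \<in> topspace ?F"
      by (rule exists_fano_member[of "{}", OF _ _ s(1) \<rho>(2) s(2)[unfolded \<kappa>_def]]) auto
    then show ?thesis by blast
  qed
  have low: "irreducible_space ?F" if "max (\<kappa> 1) (\<kappa> S) < int k" "int k \<le> \<kappa> 0"
  proof (rule irreducible_if_compressible[where s = 0])
    have "\<kappa> t < int k" if "2 * t \<le> \<rho>" "0 < t" for t
      using below[of 1 t S] leS[OF that(1)] that(2) \<open>max (\<kappa> 1) (\<kappa> S) < int k\<close> by linarith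
    then show "compressible \<rho> 0 L" if "L \<in> topspace ?F" for L
      using fano_compressible_0[OF that two \<rho>] unfolding \<kappa>_def by blast
  qed (use \<rho> nonempty[of 0] that in auto)
  have high: "irreducible_space ?F" if h: "max (\<kappa> 0) (\<kappa> (S - 1)) < int k" "int k \<le> \<kappa> S"
  proof (rule irreducible_if_compressible[where s = S])
    have "\<kappa> t < int k" if "t < S" for t using below[of 0 t "S - 1"] that h(1) by linarith
    then show "compressible \<rho> S L" if "L \<in> topspace ?F" for L
      using fano_compressible_max[OF that two \<rho>(2) d S(1)] h(2) unfolding \<kappa>_def by blast
  qed (use \<rho> S nonempty[of S] that in auto)
  have "max (\<kappa> 1) (\<kappa> S) < int k \<and> int k \<le> \<kappa> 0 \<or> max (\<kappa> 0) (\<kappa> (S - 1)) < int k \<and> int k \<le> \<kappa> S"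
    if irr: "irreducible_space ?F"
  proof -
    obtain L :: "('a^'n^'n) set" where "L \<in> topspace ?F" using irr unfolding irreducible_space_def by blast
    then obtain s where s: "2 * s \<le> \<rho>" "int k \<le> \<kappa> s" using dim_fano_bound[OF _ two \<rho>(2)] unfolding \<kappa>_def by blast
    have max: "int k \<le> max (\<kappa> 0) (\<kappa> S)" using below[of 0 s S] leS[OF s(1)] s(2) by linarith
    show ?thesis
    proof (cases "int k \<le> \<kappa> 0")
      case True
      \<comment> \<open>The same pair of tests is used for \<open>s = 1\<close> and for
        \<open>s = S\<close>.\<close>
      have "\<not> int k \<le> \<kappa> 1" "\<not> int k \<le> \<kappa> S"
        using fano_space_not_irreducible_low[OF irr two \<rho> _ _ assms(4)] True S \<rho>(1) unfolding \<kappa>_def by auto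
      then show ?thesis using True by auto
    next
      case False
      then have "\<not> int k \<le> \<kappa> (S - 1)"
        using fano_space_not_irreducible_high[OF irr two \<rho>(2) d S(1)] max unfolding \<kappa>_def by auto
      then show ?thesis using False max by auto
    qed
  qed
  then have "irreducible_space ?F \<longleftrightarrow>
      max (\<kappa> 1) (\<kappa> S) < int k \<and> int k \<le> \<kappa> 0 \<or> max (\<kappa> 0) (\<kappa> (S - 1)) < int k \<and> int k \<le> \<kappa> S"
    using low high by blast
  then show ?thesis unfolding Let_def r \<kappa>_def S_def by simp
qed

end
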